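(* For positive integers $n,d$, the cone $P_{n,2d}$ is a spectrahedral shadow only in the cases where $P_{n,2d}=\Sigma_{n,2d}$, i.e. only for $2d=2$ or $n\le2$ or $(n,2d)=(3,4)$.
   Context: For positive integers $n,d$, $P_{n,2d}$ denotes the cone of all forms (homogeneous polynomials) of degree $2d$ in $\mathbb{R}[x_1,\dots,x_n]$ that are positive semidefinite, i.e. take non-negative values on $\mathbb{R}^n$; $\Sigma_{n,2d}$ denotes the cone of all forms of degree $2d$ in $\mathbb{R}[x_1,\dots,x_n]$ that are sums of squares of forms. Both are subsets of the finite-dimensional real vector space of forms of degree $2d$ in $n$ variables. A spectrahedron in $\mathbb{R}^N$ is a set of the form $\{\xi\in\mathbb{R}^N : M_0+\sum_{i=1}^N\xi_iM_i\succeq 0\}$ with $M_0,\dots,M_N$ real symmetric $e\times e$ matrices for some $e\ge1$ ($\succeq0$ means positive semidefinite). A subset $K$ of a finite-dimensional real vector space $E$ is a spectrahedral shadow if $K=f(T)$ for some spectrahedron $T\subseteq\mathbb{R}^N$, some $N$, and some linear map $f\colon\mathbb{R}^N\to E$. *)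

theory Defs
  imports "HOL-Analysis.Finite_Function_Topology" "Jordan_Normal_Form.Matrix"
begin

text \<open>
  A real polynomial is a finitely supported map from monomials to coefficients, and a monomial is a
  finitely supported map from variable indices to exponents.  The ring in \<open>n\<close> variables consists of
  the polynomials that involve only the variables with indices \<open>0, \<dots>, n - 1\<close>.  Multiplication is the
  convolution product of \<^theory>\<open>HOL-Library.Poly_Mapping\<close>, and the real vector space structure is
  the one of \<^theory>\<open>HOL-Analysis.Finite_Function_Topology\<close>.  The space of \<open>n\<close>-vectors is
  \<^term>\<open>carrier_vec n\<close>.
\<close>

type_synonym monomial = "nat \<Rightarrow>\<^sub>0 nat"
type_synonym rpoly = "monomial \<Rightarrow>\<^sub>0 real"

definition monomial_degree :: "monomial \<Rightarrow> nat" where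
  "monomial_degree m = (\<Sum>i \<in> Poly_Mapping.keys m. Poly_Mapping.lookup m i)"

definition eval_poly :: "rpoly \<Rightarrow> real vec \<Rightarrow> real" where
  "eval_poly p x = (\<Sum>m \<in> Poly_Mapping.keys p.
     Poly_Mapping.lookup p m *
       (\<Prod>i \<in> Poly_Mapping.keys m. vec_index x i ^ Poly_Mapping.lookup m i))"

text \<open>As usual, the zero polynomial counts as a form of every degree.\<close>

definition forms :: "nat \<Rightarrow> nat \<Rightarrow> rpoly set" where
  "forms n k = {p. \<forall>m \<in> Poly_Mapping.keys p.
     Poly_Mapping.keys m \<subseteq> {..<n} \<and> monomial_degree m = k}"

definition psd_forms :: "nat \<Rightarrow> nat \<Rightarrow> rpoly set" where
  "psd_forms n k = {p \<in> forms n k. \<forall>x \<in> carrier_vec n. 0 \<le> eval_poly p x}"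

definition sos_forms :: "nat \<Rightarrow> nat \<Rightarrow> rpoly set" where
  "sos_forms n k = {p \<in> forms n k.
     \<exists>qs. (\<forall>q \<in> set qs. \<exists>j. q \<in> forms n j) \<and> p = (\<Sum>q\<leftarrow>qs. q ^ 2)}"

definition symmetric_mat :: "nat \<Rightarrow> real mat \<Rightarrow> bool" where
  "symmetric_mat e A \<longleftrightarrow> A \<in> carrier_mat e e \<and> transpose_mat A = A"

definition psd_mat :: "nat \<Rightarrow> real mat \<Rightarrow> bool" where
  "psd_mat e A \<longleftrightarrow> symmetric_mat e A \<and>
     (\<forall>v \<in> carrier_vec e. 0 \<le> scalar_prod v (A *\<^sub>v v))"

text \<open>The pencil \<open>M 0 + \<xi>\<^sub>1 M 1 + \<dots> + \<xi>\<^sub>N M N\<close>; vector entries are indexed from 0.\<close>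

definition matrix_pencil :: "nat \<Rightarrow> nat \<Rightarrow> (nat \<Rightarrow> real mat) \<Rightarrow> real vec \<Rightarrow> real mat" where
  "matrix_pencil N e M \<xi> =
     mat e e (\<lambda>(r, c). M 0 $$ (r, c) + (\<Sum>i<N. vec_index \<xi> i * M (Suc i) $$ (r, c)))"

definition spectrahedron :: "nat \<Rightarrow> real vec set \<Rightarrow> bool" where
  "spectrahedron N T \<longleftrightarrow>
     (\<exists>e M. e \<ge> 1 \<and> (\<forall>i\<le>N. symmetric_mat e (M i)) \<and>
        T = {\<xi> \<in> carrier_vec N. psd_mat e (matrix_pencil N e M \<xi>)})"

definition linear_from_vec :: "nat \<Rightarrow> 'a::real_vector set \<Rightarrow> (real vec \<Rightarrow> 'a) \<Rightarrow> bool" where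
  "linear_from_vec N E f \<longleftrightarrow>
     f \<in> carrier_vec N \<rightarrow> E \<and>
     (\<forall>x \<in> carrier_vec N. \<forall>y \<in> carrier_vec N. f (x + y) = f x + f y) \<and>
     (\<forall>c. \<forall>x \<in> carrier_vec N. f (c \<cdot>\<^sub>v x) = c *\<^sub>R f x)"

text \<open>Here \<open>E\<close> is meant to be a finite-dimensional linear subspace containing \<open>K\<close>.\<close>

definition spectrahedral_shadow :: "'a::real_vector set \<Rightarrow> 'a set \<Rightarrow> bool" where
  "spectrahedral_shadow E K \<longleftrightarrow>
     (\<exists>N T f. spectrahedron N T \<and> linear_from_vec N E f \<and> K = f ` T)"

end

theory Submission
  imports Defs "HOL-Analysis.Analysis" "HOL-Real_Asymp.Real_Asymp" "HOL-Computational_Algebra.Polynomial"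
begin

text \<open>
  The equality cases are Hilbert's. Quadratic forms have Gram matrices, and a nonnegative binary form becomes divisible
  by the square of a linear form once its minimum on the circle is subtracted. For ternary quartics, following Choi and
  Lam, every nonzero nonnegative \<open>F\<close> dominates the square of a nonzero quadratic form: if \<open>F\<close> has a zero, then
  \<open>F = x\<^sup>2 f + x g + h\<close> with binary \<open>f\<close>, \<open>g\<close>, \<open>h\<close>, and one looks at the zeros of \<open>f\<close> and of \<open>4 f h - g\<^sup>2\<close>.
  Hence a sum of squares below \<open>F\<close> whose values at six suitable points have the largest sum is equal to \<open>F\<close>.

  In the other cases let \<open>f\<close> be the dehomogenised Motzkin or Choi-Lam form, which is not a sum of squares of
  polynomials. Suppose that the cone is a spectrahedral shadow. After a reduction to a pencil with a definite member,
  conic duality turns the representation into a polynomial system: there are finitely many functions of a point and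
  of auxiliary unknowns solving the system such that every form of the cone becomes, on the solutions, a sum of a fixed
  number of squares of linear combinations of these functions. The unknowns can be chosen, over some box, as functions
  \<open>y\<close> whose partial derivatives are polynomials in \<open>y\<close>. The cone contains all the forms that restrict to
  \<open>t\<^sup>2\<^sup>D f((s - c) / t)\<close> in the affine chart, and letting \<open>t\<close> tend to 0 in their representations exhibits \<open>f\<close> as a
  sum of squares of polynomials.
\<close>

section \<open>Polynomials along solutions of polynomial differential equations\<close>

text \<open>For each form of the cone there is a representation as a sum of squares on the solutions
  of the system, but its coefficients may blow up as \<open>t\<close> tends to 0. Three features
  rescue the limit. The functions entering the squares and the number of squares come from the
  pencil and are the same for all forms. The family of forms contains every centre, because the box
  on which the unknowns become functions is found by a category argument and its centre cannot be
  prescribed. Finally, every nonzero combination of these functions must vanish to finite order at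
  the centre along some ray; continuous or merely smooth selections would not do. Polynomial partial
  derivatives give factorial bounds for all derivatives and hence this quasi-analyticity. They also
  survive the elimination of variables, because the reciprocal of the derivative in the implicit
  function theorem can be adjoined as one more function. The definite member of the pencil is needed
  since positive functionals are extended with the help of an order unit.\<close>

text \<open>The list of the pairs \<open>(c, a)\<close> stands for the sum of the monomials \<open>c\<close> times the product of the
  variables with indices in \<open>a\<close>. Neither order nor cancellation is normalised: only the value \<open>lev\<close> matters.\<close>

type_synonym lpoly = "(real \<times> nat list) list"

definition lev :: "lpoly \<Rightarrow> (nat \<Rightarrow> real) \<Rightarrow> real" where
  "lev q y = (\<Sum>(c, a)\<leftarrow>q. c * (\<Prod>i\<leftarrow>a. y i))"

definition lvar :: "nat \<Rightarrow> lpoly \<Rightarrow> bool" where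
  "lvar p q \<longleftrightarrow> (\<forall>(c, a) \<in> set q. set a \<subseteq> {..<p})"

definition lscale :: "real \<Rightarrow> lpoly \<Rightarrow> lpoly" where
  "lscale r q = map (\<lambda>(c, a). (r * c, a)) q"

definition lmul :: "lpoly \<Rightarrow> lpoly \<Rightarrow> lpoly" where
  "lmul q r = concat (map (\<lambda>(c, a). map (\<lambda>(d, b). (c * d, a @ b)) r) q)"

text \<open>Formal differentiation along the vector field \<open>y\<^sub>i' = P i\<close>.\<close>

primrec tder :: "(nat \<Rightarrow> lpoly) \<Rightarrow> nat list \<Rightarrow> lpoly" where
  "tder P [] = []"
| "tder P (i # a) = lmul (P i) [(1, a)] @ lmul [(1, [i])] (tder P a)"

definition lder :: "(nat \<Rightarrow> lpoly) \<Rightarrow> lpoly \<Rightarrow> lpoly" where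
  "lder P q = concat (map (\<lambda>(c, a). lscale c (tder P a)) q)"

lemma lev_Nil [simp]: "lev [] y = 0"
  by (simp add: lev_def)

lemma lev_Cons: "lev ((c, a) # q) y = c * (\<Prod>i\<leftarrow>a. y i) + lev q y"
  by (simp add: lev_def)

lemma lev_append [simp]: "lev (q @ r) y = lev q y + lev r y"
  by (simp add: lev_def)

lemma lev_scale [simp]: "lev (lscale r q) y = r * lev q y"
  by (induction q) (auto simp: lscale_def lev_def algebra_simps)

lemma lev_monomial_mul:
  "lev (map (\<lambda>(d, b). (c * d, a @ b)) r) y = c * (\<Prod>i\<leftarrow>a. y i) * lev r y"
  by (induction r) (auto simp: lev_def algebra_simps)

lemma lev_mul [simp]: "lev (lmul q r) y = lev q y * lev r y"
  by (induction q) (auto simp: lmul_def lev_Cons lev_monomial_mul algebra_simps)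

lemma lvar_Nil [simp]: "lvar p []"
  by (simp add: lvar_def)

lemma lvar_append [simp]: "lvar p (q @ r) \<longleftrightarrow> lvar p q \<and> lvar p r"
  by (auto simp: lvar_def)

lemma lvar_Cons [simp]: "lvar p ((c, a) # q) \<longleftrightarrow> set a \<subseteq> {..<p} \<and> lvar p q"
  by (auto simp: lvar_def)

lemma lvar_scale [simp]: "lvar p q \<Longrightarrow> lvar p (lscale r q)"
  by (auto simp: lvar_def lscale_def)

lemma lvar_mul [simp]: "lvar p q \<Longrightarrow> lvar p r \<Longrightarrow> lvar p (lmul q r)"
  unfolding lvar_def lmul_def by fastforce

lemma lvar_concat: "(\<And>q. q \<in> set qs \<Longrightarrow> lvar p q) \<Longrightarrow> lvar p (concat qs)"
  by (induction qs) auto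

lemma lvar_mono: "lvar p q \<Longrightarrow> p \<le> p' \<Longrightarrow> lvar p' q"
  unfolding lvar_def by fastforce

lemma lvar_tder:
  "set a \<subseteq> {..<p} \<Longrightarrow> p \<le> p' \<Longrightarrow> (\<And>i. i < p \<Longrightarrow> lvar p' (P i)) \<Longrightarrow> lvar p' (tder P a)"
proof (induction a)
  case (Cons i a)
  hence "set a \<subseteq> {..<p'}" "i < p'" by force+
  thus ?case using Cons by auto
qed auto

lemma lvar_lder':
  assumes "lvar p q" "p \<le> p'" "\<And>i. i < p \<Longrightarrow> lvar p' (P i)"
  shows "lvar p' (lder P q)"
  unfolding lder_def using assms
  by (intro lvar_concat) (auto simp: lvar_def[of p q] intro!: lvar_scale lvar_tder[of _ p])

lemma lvar_lder:
  assumes "lvar p q" "\<And>i. i < p \<Longrightarrow> lvar p (P i)"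
  shows "lvar p (lder P q)"
  using lvar_lder'[OF assms(1) order_refl assms(2)] .

lemma lev_cong:
  assumes "lvar p q" "\<And>i. i < p \<Longrightarrow> y i = y' i"
  shows "lev q y = lev q y'"
proof -
  have "(\<Prod>i\<leftarrow>a. y i) = (\<Prod>i\<leftarrow>a. y' i)" if "set a \<subseteq> {..<p}" for a
    using that assms(2) by (induction a) auto
  thus ?thesis using assms(1) by (induction q) (auto simp: lev_Cons)
qed

text \<open>The velocity is prescribed at \<open>t0\<close> only, so the curve may be an integral
  curve or just a straight line with the right tangent.\<close>

lemma lev_lder_has_derivative:
  assumes "lvar p q"
    and "\<And>i. i < p \<Longrightarrow> ((\<lambda>t. Y t i) has_real_derivative lev (P i) (Y t0)) (at t0)"
  shows "((\<lambda>t. lev q (Y t)) has_real_derivative lev (lder P q) (Y t0)) (at t0)"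
proof -
  have *: "((\<lambda>t. \<Prod>i\<leftarrow>a. Y t i) has_real_derivative lev (tder P a) (Y t0)) (at t0)"
    if "set a \<subseteq> {..<p}" for a
    using that
  proof (induction a)
    case (Cons i a)
    hence "((\<lambda>t. Y t i * (\<Prod>i\<leftarrow>a. Y t i)) has_real_derivative
        lev (P i) (Y t0) * (\<Prod>i\<leftarrow>a. Y t0 i) + lev (tder P a) (Y t0) * Y t0 i) (at t0)"
      by (intro DERIV_mult assms(2)) auto
    thus ?case by (simp add: lev_Cons algebra_simps)
  qed auto
  show ?thesis using assms(1)
  proof (induction q)
    case (Cons ca q)
    obtain c a where [simp]: "ca = (c, a)" by force
    have "((\<lambda>t. c * (\<Prod>i\<leftarrow>a. Y t i) + lev q (Y t)) has_real_derivative
        c * lev (tder P a) (Y t0) + lev (lder P q) (Y t0)) (at t0)"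
      using Cons by (intro DERIV_add DERIV_cmult *) auto
    thus ?case by (simp add: lev_Cons lder_def)
  qed (auto simp: lder_def)
qed

section \<open>Sizes of formal derivatives\<close>

definition lnorm :: "lpoly \<Rightarrow> real" where
  "lnorm q = (\<Sum>(c, a)\<leftarrow>q. \<bar>c\<bar>)"

definition ldeg_le :: "nat \<Rightarrow> lpoly \<Rightarrow> bool" where
  "ldeg_le L q \<longleftrightarrow> (\<forall>(c, a) \<in> set q. length a \<le> L)"

lemma lnorm_simps [simp]: "lnorm [] = 0" "lnorm ((c, a) # q) = \<bar>c\<bar> + lnorm q"
  "lnorm (q @ r) = lnorm q + lnorm r"
  by (auto simp: lnorm_def)

lemma lnorm_nonneg [simp]: "lnorm q \<ge> 0"
  by (induction q) auto

lemma lnorm_scale [simp]: "lnorm (lscale r q) = \<bar>r\<bar> * lnorm q"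
  by (induction q) (auto simp: lscale_def abs_mult algebra_simps)

text \<open>An equality, because the terms of a list never cancel.\<close>

lemma lnorm_mul [simp]: "lnorm (lmul q r) = lnorm q * lnorm r"
proof -
  have "lnorm (map (\<lambda>(d, b). (c * d, a @ b)) r) = \<bar>c\<bar> * lnorm r" for c a
    by (induction r) (auto simp: abs_mult algebra_simps)
  thus ?thesis by (induction q) (auto simp: lmul_def algebra_simps)
qed

lemma ldeg_le_simps [simp]: "ldeg_le L []" "ldeg_le L ((c, a) # q) \<longleftrightarrow> length a \<le> L \<and> ldeg_le L q"
  "ldeg_le L (q @ r) \<longleftrightarrow> ldeg_le L q \<and> ldeg_le L r"
  by (auto simp: ldeg_le_def)

lemma ldeg_le_mono: "ldeg_le L q \<Longrightarrow> L \<le> L' \<Longrightarrow> ldeg_le L' q"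
  unfolding ldeg_le_def by fastforce

lemma ldeg_le_scale: "ldeg_le L q \<Longrightarrow> ldeg_le L (lscale r q)"
  unfolding ldeg_le_def lscale_def by auto

lemma ldeg_le_mul: "ldeg_le L q \<Longrightarrow> ldeg_le L' r \<Longrightarrow> ldeg_le (L + L') (lmul q r)"
  unfolding ldeg_le_def lmul_def by (fastforce intro: add_mono)

lemma ldeg_le_exists: "\<exists>L. ldeg_le L q"
proof (induction q)
  case (Cons ca q)
  then obtain L where "ldeg_le L q" by blast
  moreover obtain c a where "ca = (c, a)" by force
  ultimately have "ldeg_le (max L (length a)) (ca # q)" by (auto intro: ldeg_le_mono)
  thus ?case by blast
qed auto

lemma tder_bounds:
  fixes C :: real
  assumes "set a \<subseteq> {..<p}" "\<And>i. i < p \<Longrightarrow> lnorm (P i) \<le> C" "\<And>i. i < p \<Longrightarrow> ldeg_le D (P i)"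
  shows "lnorm (tder P a) \<le> length a * C \<and> ldeg_le (length a + D) (tder P a)"
  using assms(1)
proof (induction a)
  case (Cons i a)
  hence i: "i < p" and IH: "lnorm (tder P a) \<le> length a * C" "ldeg_le (length a + D) (tder P a)"
    by auto
  have "ldeg_le (D + length a) (lmul (P i) [(1, a)])" "ldeg_le (1 + (length a + D)) (lmul [(1, [i])] (tder P a))"
    using i assms(3) IH by (intro ldeg_le_mul; auto)+
  thus ?case using IH assms(2)[OF i] by (auto simp: algebra_simps intro: ldeg_le_mono)
qed auto

text \<open>By the product rule a term has at most \<open>L\<close> factors to differentiate. The
  degree grows linearly under iteration, so the factors \<open>L\<close> accumulate to a
  factorial.\<close>

lemma lder_bounds:
  fixes C :: real
  assumes "lvar p q" "ldeg_le L q" "\<And>i. i < p \<Longrightarrow> lnorm (P i) \<le> C" "\<And>i. i < p \<Longrightarrow> ldeg_le D (P i)"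
    and "C \<ge> 0"
  shows "lnorm (lder P q) \<le> L * C * lnorm q \<and> ldeg_le (L + D) (lder P q)"
  using assms(1,2)
proof (induction q)
  case (Cons ca q)
  obtain c a where ca [simp]: "ca = (c, a)" by force
  from Cons have a: "set a \<subseteq> {..<p}" "length a \<le> L" by auto
  have IH: "lnorm (lder P q) \<le> L * C * lnorm q" "ldeg_le (L + D) (lder P q)" using Cons by auto
  have t: "lnorm (tder P a) \<le> length a * C" "ldeg_le (length a + D) (tder P a)"
    using tder_bounds[OF a(1) assms(3,4)] by auto
  have "\<bar>c\<bar> * lnorm (tder P a) \<le> \<bar>c\<bar> * (L * C)"
    using t(1) order_trans[OF t(1) mult_right_mono[of "real (length a)" "real L" C]] a(2) assms(5)
    by (intro mult_left_mono) auto
  moreover have "ldeg_le (L + D) (lscale c (tder P a))"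
    using t(2) a(2) by (auto intro!: ldeg_le_scale ldeg_le_mono[OF t(2)])
  ultimately show ?case using IH by (auto simp: lder_def algebra_simps)
qed (auto simp: lder_def)

lemma abs_lev_le:
  assumes "lvar p q" "ldeg_le L q" "\<And>i. i < p \<Longrightarrow> \<bar>y i\<bar> \<le> R" "R \<ge> 1"
  shows "\<bar>lev q y\<bar> \<le> lnorm q * R ^ L"
proof -
  have *: "\<bar>\<Prod>i\<leftarrow>a. y i\<bar> \<le> R ^ length a" if "set a \<subseteq> {..<p}" for a
    using that
  proof (induction a)
    case (Cons i a)
    thus ?case using assms(3,4) by (auto simp: abs_mult intro!: mult_mono)
  qed auto
  show ?thesis using assms(1,2)
  proof (induction q)
    case (Cons ca q)
    obtain c a where ca [simp]: "ca = (c, a)" by force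
    have "\<bar>\<Prod>i\<leftarrow>a. y i\<bar> \<le> R ^ length a" using Cons * by auto
    also have "\<dots> \<le> R ^ L" using Cons assms(4) by (auto intro: power_increasing)
    finally have "\<bar>c * (\<Prod>i\<leftarrow>a. y i)\<bar> \<le> \<bar>c\<bar> * R ^ L" by (auto simp: abs_mult intro: mult_left_mono)
    moreover have "\<bar>lev q y\<bar> \<le> lnorm q * R ^ L" using Cons by auto
    ultimately show ?case by (simp add: lev_Cons algebra_simps)
  qed auto
qed

text \<open>The growth \<open>B ^ m * m!\<close> is that of an analytic function. It makes solutions of polynomial
  differential equations quasi-analytic, so that no power series are needed.\<close>

lemma iterated_lder_bound:
  assumes "lvar p q" "\<And>i. i < p \<Longrightarrow> lvar p (P i)" "R \<ge> 1"
  shows "\<exists>A B. A \<ge> 0 \<and> B > 0 \<and>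
    (\<forall>m y. (\<forall>i<p. \<bar>y i\<bar> \<le> R) \<longrightarrow> \<bar>lev ((lder P ^^ m) q) y\<bar> \<le> A * B ^ m * fact m)"
proof -
  obtain L where L: "ldeg_le L q" using ldeg_le_exists by blast
  have "\<forall>i. \<exists>L. ldeg_le L (P i)" using ldeg_le_exists by blast
  then obtain DD where DD: "\<And>i. ldeg_le (DD i) (P i)" by metis
  \<comment> \<open>\<open>Suc\<close> keeps \<open>D\<close>, and with it the growth rate
    \<open>E\<close> below, positive.\<close>
  define D where "D = Suc (\<Sum>i<p. DD i)"
  define C where "C = 1 + (\<Sum>i<p. lnorm (P i))"
  have D: "ldeg_le D (P i)" if "i < p" for i
  proof -
    have "DD i \<le> (\<Sum>i<p. DD i)" using that by (intro member_le_sum) auto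
    thus ?thesis by (intro ldeg_le_mono[OF DD[of i]]) (auto simp: D_def)
  qed
  have C: "lnorm (P i) \<le> C" if "i < p" for i
  proof -
    have "lnorm (P i) \<le> (\<Sum>i<p. lnorm (P i))" using that by (intro member_le_sum) auto
    thus ?thesis by (auto simp: C_def)
  qed
  have C1: "C \<ge> 1" unfolding C_def by (auto intro: sum_nonneg)
  \<comment> \<open>The \<open>m\<close>-th derivative has degree at most \<open>L + m * D\<close>,
    which is at most \<open>(L + D) * Suc m\<close>; one more derivative therefore costs a factor
    \<open>E * Suc m\<close>.\<close>
  define E where "E = real (L + D) * C"
  have E0: "E > 0" unfolding E_def using C1 by (intro mult_pos_pos) (auto simp: D_def add_pos_nonneg sum_nonneg)
  have it: "lvar p ((lder P ^^ m) q) \<and> ldeg_le (L + m * D) ((lder P ^^ m) q) \<and>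
      lnorm ((lder P ^^ m) q) \<le> lnorm q * E ^ m * fact m" for m
  proof (induction m)
    case (Suc m)
    let ?q = "(lder P ^^ m) q"
    have b: "lnorm (lder P ?q) \<le> real (L + m * D) * C * lnorm ?q" "ldeg_le (L + m * D + D) (lder P ?q)"
      using lder_bounds[of p ?q "L + m * D" P C D] Suc C D C1 by auto
    have "real (L + m * D) \<le> real (L + D) * real (Suc m)"
      by (simp add: algebra_simps)
    hence "real (L + m * D) * C * lnorm ?q \<le> (real (L + D) * real (Suc m)) * C * lnorm ?q"
      using C1 by (intro mult_right_mono) auto
    also have "\<dots> = E * Suc m * lnorm ?q" by (simp add: E_def)
    also have "\<dots> \<le> E * Suc m * (lnorm q * E ^ m * fact m)"
      using Suc E0 by (intro mult_left_mono) auto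
    finally have "lnorm (lder P ?q) \<le> lnorm q * E ^ Suc m * fact (Suc m)" using b by (simp add: algebra_simps)
    thus ?case using Suc b lvar_lder[OF _ assms(2), of ?q] by (auto simp: algebra_simps)
  qed (use assms L in auto)
  show ?thesis
  proof (intro exI conjI allI impI)
    show "lnorm q * R ^ L \<ge> 0" using assms by auto
    show "E * R ^ D > 0" using E0 assms by auto
    fix m y assume y: "\<forall>i<p. \<bar>y i\<bar> \<le> R"
    have "\<bar>lev ((lder P ^^ m) q) y\<bar> \<le> lnorm ((lder P ^^ m) q) * R ^ (L + m * D)"
      using it[of m] y assms by (intro abs_lev_le[of p]) auto
    also have "\<dots> \<le> (lnorm q * E ^ m * fact m) * R ^ (L + m * D)"
      using it[of m] assms by (intro mult_right_mono) auto
    finally show "\<bar>lev ((lder P ^^ m) q) y\<bar> \<le> lnorm q * R ^ L * (E * R ^ D) ^ m * fact m"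
      by (simp add: power_add power_mult_distrib power_mult[symmetric] algebra_simps)
  qed
qed

section \<open>Quasi-analyticity\<close>

text \<open>In the Taylor expansion at \<open>s1\<close> only the remainder survives. One factor 2
  in \<open>4 * B\<close> pays for \<open>fact (k + m) \<le> 2 ^ (k + m) * fact k * fact m\<close>,
  the other makes the remainder decay like powers of 1/2. All orders \<open>k\<close> are treated at
  once so that the argument can start again from the point reached.\<close>

lemma flat_vanishes_near:
  fixes G :: "nat \<Rightarrow> real \<Rightarrow> real"
  assumes der: "\<And>m s. s \<in> {a<..<b} \<Longrightarrow> (G m has_real_derivative G (Suc m) s) (at s)"
    and bnd: "\<And>m s. s \<in> {a<..<b} \<Longrightarrow> \<bar>G m s\<bar> \<le> A * B ^ m * fact m" and B: "B > 0"
    and s1: "s1 \<in> {a<..<b}" "\<And>m. G m s1 = 0" and s: "s \<in> {a<..<b}" "\<bar>s - s1\<bar> \<le> 1 / (4 * B)"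
  shows "G k s = 0"
proof (cases "s = s1")
  case False
  have bnd2: "\<bar>G (k + m) t\<bar> \<le> A * (2 * B) ^ k * fact k * ((2 * B) ^ m * fact m)" if "t \<in> {a<..<b}" for m t
  proof -
    have A: "A \<ge> 0" using bnd[OF s1(1), of 0] by auto
    have "(fact (k + m) :: real) = real ((k + m) choose k) * (fact k * fact m)"
      by (simp add: binomial_fact)
    also have "\<dots> \<le> 2 ^ (k + m) * (fact k * fact m)"
    proof -
      have "real ((k + m) choose k) \<le> real (2 ^ (k + m))"
        by (intro of_nat_mono binomial_le_pow2)
      thus ?thesis by (intro mult_right_mono) auto
    qed
    finally have "A * B ^ (k + m) * fact (k + m) \<le> A * B ^ (k + m) * (2 ^ (k + m) * (fact k * fact m))"
      using A B by (intro mult_left_mono) auto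
    thus ?thesis using bnd[OF that, of "k + m"] by (simp add: power_add power_mult_distrib algebra_simps)
  qed
  have A: "A \<ge> 0" using bnd[OF s1(1), of 0] by auto
  have sub: "{min s s1..max s s1} \<subseteq> {a<..<b}" using s1 s by auto
  have le: "\<bar>G k s\<bar> \<le> A * (2 * B) ^ k * fact k * (1 / 2) ^ m" if "m > 0" for m
  proof -
    have "\<exists>t. (if s < s1 then s < t \<and> t < s1 else s1 < t \<and> t < s) \<and>
        G k s = (\<Sum>i<m. (G (k + i) s1 / fact i) * (s - s1) ^ i) + (G (k + m) t / fact m) * (s - s1) ^ m"
      using that sub False
      by (intro Taylor[where a="min s s1" and b="max s s1" and diff="\<lambda>i. G (k + i)"]) (auto intro!: der)
    then obtain t where t': "if s < s1 then s < t \<and> t < s1 else s1 < t \<and> t < s"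
      and eq: "G k s = (G (k + m) t / fact m) * (s - s1) ^ m"
      using s1(2) by auto
    have t: "t \<in> {a<..<b}" using t' s1(1) s(1) by (auto split: if_splits)
    have "\<bar>G k s\<bar> = \<bar>G (k + m) t\<bar> / fact m * \<bar>s - s1\<bar> ^ m"
      unfolding eq by (simp add: abs_mult power_abs)
    also have "\<dots> \<le> (A * (2 * B) ^ k * fact k * ((2 * B) ^ m * fact m)) / fact m * (1 / (4 * B)) ^ m"
      using bnd2[OF t, of m] s A B by (intro mult_mono divide_right_mono power_mono) auto
    also have "\<dots> = A * (2 * B) ^ k * fact k * ((2 * B) * (1 / (4 * B))) ^ m"
      by (simp only: power_mult_distrib) simp
    also have "(2 * B) * (1 / (4 * B)) = 1 / 2" using B by simp
    finally show ?thesis .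
  qed
  have "(\<lambda>m. A * (2 * B) ^ k * fact k * (1 / 2) ^ m) \<longlonglongrightarrow> A * (2 * B) ^ k * fact k * 0"
    by (intro tendsto_intros LIMSEQ_power_zero) auto
  hence "\<bar>G k s\<bar> \<le> A * (2 * B) ^ k * fact k * 0"
    by (rule LIMSEQ_le_const) (use le in \<open>auto intro!: exI[of _ 1]\<close>)
  thus ?thesis by simp
qed (use s1 in auto)

text \<open>The radius \<open>1 / (4 * B)\<close> within which flatness spreads is the same at every
  point, because the bounds are uniform on the interval; finitely many steps reach
  \<open>s\<close>.\<close>

lemma flat_vanishes:
  fixes G :: "nat \<Rightarrow> real \<Rightarrow> real"
  assumes der: "\<And>m s. s \<in> {a<..<b} \<Longrightarrow> (G m has_real_derivative G (Suc m) s) (at s)"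
    and bnd: "\<And>m s. s \<in> {a<..<b} \<Longrightarrow> \<bar>G m s\<bar> \<le> A * B ^ m * fact m" and B: "B > 0"
    and s0: "s0 \<in> {a<..<b}" "\<And>m. G m s0 = 0" and s: "s \<in> {a<..<b}"
  shows "G k s = 0"
proof -
  define r where "r = 1 / (4 * B)"
  have r: "r > 0" using B by (simp add: r_def)
  have *: "\<forall>s k. s \<in> {a<..<b} \<longrightarrow> \<bar>s - s0\<bar> \<le> real n * r \<longrightarrow> G k s = 0" for n
  proof (induction n)
    case 0
    thus ?case using s0 by auto
  next
    case (Suc n)
    show ?case
    proof (intro allI impI)
      fix s k assume s: "s \<in> {a<..<b}" "\<bar>s - s0\<bar> \<le> real (Suc n) * r"
      \<comment> \<open>Dividing the segment in the ratio \<open>n : 1\<close> leaves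
        \<open>s1\<close> within \<open>n\<close> steps of \<open>s0\<close> and within one step of
        \<open>s\<close>.\<close>
      define l where "l = real n / real (Suc n)"
      have l: "0 \<le> l" "l \<le> 1" by (auto simp: l_def)
      define s1 where "s1 = (1 - l) * s0 + l * s"
      have "s1 \<in> {a<..<b}"
        using convexD_alt[of "{a<..<b}" s0 s l] s s0(1) l by (simp add: s1_def convex_real_interval)
      moreover have "\<bar>s1 - s0\<bar> = l * \<bar>s - s0\<bar>"
      proof -
        have "s1 - s0 = l * (s - s0)" by (simp add: s1_def algebra_simps)
        thus ?thesis using l by (simp add: abs_mult)
      qed
      moreover have "l * \<bar>s - s0\<bar> \<le> l * (real (Suc n) * r)" using s l by (intro mult_left_mono) auto
      moreover have "l * (real (Suc n) * r) = n * r" by (simp add: l_def)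
      moreover have "\<bar>s - s1\<bar> \<le> r"
      proof -
        have "s - s1 = (1 - l) * (s - s0)" by (simp add: s1_def algebra_simps)
        hence "\<bar>s - s1\<bar> = (1 - l) * \<bar>s - s0\<bar>" using l by (simp add: abs_mult)
        also have "\<dots> \<le> (1 - l) * (real (Suc n) * r)" using s l by (intro mult_left_mono) auto
        also have "1 - l = 1 / real (Suc n)" by (simp add: l_def divide_simps)
        finally show ?thesis by simp
      qed
      ultimately have *: "s1 \<in> {a<..<b}" "\<bar>s1 - s0\<bar> \<le> n * r" "\<bar>s - s1\<bar> \<le> 1 / (4 * B)"
        by (auto simp: r_def)
      have "G m s1 = 0" for m using Suc *(1,2) by blast
      thus "G k s = 0"
        using der bnd B *(1,3) s(1) flat_vanishes_near[where G=G and a=a and b=b and A=A and B=B and ?s1.0=s1 and s=s]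
        by blast
    qed
  qed
  obtain n where "\<bar>s - s0\<bar> / r \<le> real n" using real_arch_simple by blast
  hence "\<bar>s - s0\<bar> \<le> real n * r" using r by (simp add: field_simps)
  thus ?thesis using * s by blast
qed

text \<open>The derivatives of \<open>lev q\<close> along the curve are values of iterated formal
  derivatives, and on a bounded curve these obey a common bound
  \<open>A * B ^ m * fact m\<close>.\<close>

lemma flat_lev_vanishes:
  assumes "lvar p q" "\<And>i. i < p \<Longrightarrow> lvar p (P i)"
    and der: "\<And>s i. s \<in> {a<..<b} \<Longrightarrow> i < p \<Longrightarrow> ((\<lambda>t. Y t i) has_real_derivative lev (P i) (Y s)) (at s)"
    and R: "\<And>s i. s \<in> {a<..<b} \<Longrightarrow> i < p \<Longrightarrow> \<bar>Y s i\<bar> \<le> R"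
    and s0: "s0 \<in> {a<..<b}" "\<And>m. lev ((lder P ^^ m) q) (Y s0) = 0" and s: "s \<in> {a<..<b}"
  shows "lev q (Y s) = 0"
proof -
  have it: "lvar p ((lder P ^^ m) q)" for m
    by (induction m) (auto intro!: lvar_lder assms)
  obtain A B where AB: "B > 0"
    "\<And>m y. (\<forall>i<p. \<bar>y i\<bar> \<le> max R 1) \<Longrightarrow> \<bar>lev ((lder P ^^ m) q) y\<bar> \<le> A * B ^ m * fact m"
    using iterated_lder_bound[of p q P "max R 1"] assms(1,2) by auto
  show ?thesis
  proof (rule flat_vanishes[where G="\<lambda>m s. lev ((lder P ^^ m) q) (Y s)" and k=0, simplified])
    show "((\<lambda>s. lev ((lder P ^^ m) q) (Y s)) has_real_derivative lev (lder P ((lder P ^^ m) q)) (Y s)) (at s)"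
      if "a < s \<and> s < b" for m s
      using that der by (intro lev_lder_has_derivative[OF it]) auto
    show "\<bar>lev ((lder P ^^ m) q) (Y s)\<bar> \<le> A * B ^ m * fact m" if "a < s \<and> s < b" for m s
      using R[of s] that by (intro AB(2)) force
  qed (use AB s0 s in auto)
qed

section \<open>Functions with polynomial partial derivatives\<close>

text \<open>The coordinates outside \<open>J\<close> are unconstrained: points remain total
  functions while coordinates are eliminated, and nothing has to be restricted or padded.\<close>

definition cube :: "nat set \<Rightarrow> (nat \<Rightarrow> real) \<Rightarrow> real \<Rightarrow> (nat \<Rightarrow> real) set" where
  "cube J c \<delta> = {z. \<forall>i\<in>J. \<bar>z i - c i\<bar> < \<delta>}"

lemma cube_updI: "z \<in> cube J c \<delta> \<Longrightarrow> (j \<in> J \<Longrightarrow> \<bar>s - c j\<bar> < \<delta>) \<Longrightarrow> z(j := s) \<in> cube J c \<delta>"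
  by (auto simp: cube_def)

lemma cube_mono: "\<delta>' \<le> \<delta> \<Longrightarrow> cube J c \<delta>' \<subseteq> cube J c \<delta>"
  by (auto simp: cube_def)

lemma cube_center: "\<delta> > 0 \<Longrightarrow> c \<in> cube J c \<delta>"
  by (auto simp: cube_def)

lemma cube_shrink:
  assumes "finite J" "z \<in> cube J c \<delta>"
  shows "\<exists>\<epsilon>>0. cube J z \<epsilon> \<subseteq> cube J c \<delta>"
proof -
  define \<epsilon> where "\<epsilon> = Min (insert 1 ((\<lambda>j. \<delta> - \<bar>z j - c j\<bar>) ` J))"
  have "\<epsilon> > 0" unfolding \<epsilon>_def using assms by (subst Min_gr_iff) (auto simp: cube_def)
  moreover have "\<bar>w j - c j\<bar> < \<delta>" if "w \<in> cube J z \<epsilon>" "j \<in> J" for w j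
  proof -
    have "\<epsilon> \<le> \<delta> - \<bar>z j - c j\<bar>" unfolding \<epsilon>_def using assms that by (intro Min_le) auto
    moreover have "\<bar>w j - z j\<bar> < \<epsilon>" using that by (auto simp: cube_def)
    ultimately show ?thesis by linarith
  qed
  ultimately show ?thesis by (auto simp: cube_def)
qed

text \<open>Finitely many functions of \<open>z\<close>, on the box \<open>cube J c \<delta>\<close>, whose partial derivatives are polynomials
  in the functions themselves (a Noetherian chain). Such functions play the role that Nash functions play in
  real algebraic geometry: they obey an identity theorem and are preserved by the implicit function theorem.\<close>

locale chain =
  fixes J :: "nat set" and c :: "nat \<Rightarrow> real" and \<delta> :: real and p :: nat
    and y :: "(nat \<Rightarrow> real) \<Rightarrow> nat \<Rightarrow> real" and P :: "nat \<Rightarrow> nat \<Rightarrow> lpoly"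
  assumes finite_J: "finite J" and \<delta>_pos: "\<delta> > 0"
    and dep: "i < p \<Longrightarrow> (\<And>j. j \<in> J \<Longrightarrow> z j = z' j) \<Longrightarrow> y z i = y z' i"
    and bounded: "\<exists>R. \<forall>z\<in>cube J c \<delta>. \<forall>i<p. \<bar>y z i\<bar> \<le> R"
    and vars: "j \<in> J \<Longrightarrow> i < p \<Longrightarrow> lvar p (P j i)"
    and part: "z \<in> cube J c \<delta> \<Longrightarrow> j \<in> J \<Longrightarrow> i < p \<Longrightarrow>
      ((\<lambda>s. y (z(j := s)) i) has_real_derivative lev (P j i) (y z)) (at (z j))"
begin

lemma lev_dep: "lvar p q \<Longrightarrow> (\<And>j. j \<in> J \<Longrightarrow> z j = z' j) \<Longrightarrow> lev q (y z) = lev q (y z')"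
  by (intro lev_cong[of p] dep)

lemma lvar_lder_P: "lvar p q \<Longrightarrow> j \<in> J \<Longrightarrow> lvar p (lder (P j) q)"
  by (intro lvar_lder vars)

lemma lev_partial:
  assumes "z(j := s) \<in> cube J c \<delta>" "j \<in> J" "lvar p q"
  shows "((\<lambda>s. lev q (y (z(j := s)))) has_real_derivative lev (lder (P j) q) (y (z(j := s)))) (at s)"
  using part[OF assms(1,2)] by (intro lev_lder_has_derivative[OF assms(3)]) simp

text \<open>Only partial derivatives are available, so continuity and the chain rule are derived
  from the mean value theorem in one coordinate. The point \<open>s\<close> may lie on either side
  of \<open>z j\<close>.\<close>

lemma lev_mvt:
  assumes z: "z \<in> cube J c \<delta>" and s: "z(j := s) \<in> cube J c \<delta>" and j: "j \<in> J" and q: "lvar p q"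
  shows "\<exists>\<xi>. \<bar>\<xi> - z j\<bar> \<le> \<bar>s - z j\<bar> \<and> \<bar>\<xi> - s\<bar> \<le> \<bar>s - z j\<bar> \<and> z(j := \<xi>) \<in> cube J c \<delta> \<and>
    lev q (y (z(j := s))) - lev q (y z) = (s - z j) * lev (lder (P j) q) (y (z(j := \<xi>)))"
proof -
  have cube: "z(j := \<xi>) \<in> cube J c \<delta>" if "min s (z j) \<le> \<xi>" "\<xi> \<le> max s (z j)" for \<xi>
  proof (rule cube_updI[OF z])
    have "\<bar>z j - c j\<bar> < \<delta>" "\<bar>s - c j\<bar> < \<delta>" using z s j by (auto simp: cube_def)
    thus "\<bar>\<xi> - c j\<bar> < \<delta>" using that by linarith
  qed
  let ?f = "\<lambda>s. lev q (y (z(j := s)))" and ?f' = "\<lambda>s. lev (lder (P j) q) (y (z(j := s)))"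
  consider "s = z j" | "s < z j" | "s > z j" by linarith
  thus ?thesis
  proof cases
    case 1 thus ?thesis using z by (intro exI[of _ s]) auto
  next
    case 2
    obtain \<xi> where "s < \<xi>" "\<xi> < z j" "?f (z j) - ?f s = (z j - s) * ?f' \<xi>"
      using MVT2[of s "z j" ?f ?f'] 2 cube lev_partial[OF _ j q] by auto
    thus ?thesis using cube[of \<xi>] 2 by (intro exI[of _ \<xi>]) (auto simp: algebra_simps)
  next
    case 3
    obtain \<xi> where "z j < \<xi>" "\<xi> < s" "?f s - ?f (z j) = (s - z j) * ?f' \<xi>"
      using MVT2[of "z j" s ?f ?f'] 3 cube lev_partial[OF _ j q] by auto
    thus ?thesis using cube[of \<xi>] 3 by (intro exI[of _ \<xi>]) (auto simp: algebra_simps)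
  qed
qed

lemma lev_bounded:
  assumes "lvar p q"
  shows "\<exists>B\<ge>0. \<forall>z\<in>cube J c \<delta>. \<bar>lev q (y z)\<bar> \<le> B"
proof -
  obtain R where R: "\<forall>z\<in>cube J c \<delta>. \<forall>i<p. \<bar>y z i\<bar> \<le> R" using bounded by blast
  obtain L where L: "ldeg_le L q" using ldeg_le_exists by blast
  have "\<bar>lev q (y z)\<bar> \<le> lnorm q * (max R 1) ^ L" if "z \<in> cube J c \<delta>" for z
    using R that by (intro abs_lev_le[OF assms L]) force+
  thus ?thesis by (intro exI[of _ "lnorm q * (max R 1) ^ L"]) auto
qed

lemma lev_lipschitz:
  assumes q: "lvar p q"
  shows "\<exists>B\<ge>0. \<forall>z\<in>cube J c \<delta>. \<forall>z'\<in>cube J c \<delta>. \<bar>lev q (y z) - lev q (y z')\<bar> \<le> B * (\<Sum>j\<in>J. \<bar>z j - z' j\<bar>)"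
proof -
  have "\<forall>j. \<exists>B\<ge>0. j \<in> J \<longrightarrow> (\<forall>z\<in>cube J c \<delta>. \<bar>lev (lder (P j) q) (y z)\<bar> \<le> B)"
    using lev_bounded[OF lvar_lder_P[OF q]] by (metis order_refl)
  then obtain BB where BB: "\<And>j. BB j \<ge> 0"
    "\<And>j z. j \<in> J \<Longrightarrow> z \<in> cube J c \<delta> \<Longrightarrow> \<bar>lev (lder (P j) q) (y z)\<bar> \<le> BB j" by metis
  define B where "B = sum BB J"
  have B: "B \<ge> 0" "\<And>j z. j \<in> J \<Longrightarrow> z \<in> cube J c \<delta> \<Longrightarrow> \<bar>lev (lder (P j) q) (y z)\<bar> \<le> B"
  proof -
    show "B \<ge> 0" using BB by (auto simp: B_def intro: sum_nonneg)
    show "\<bar>lev (lder (P j) q) (y z)\<bar> \<le> B" if "j \<in> J" "z \<in> cube J c \<delta>" for j z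
      using BB(2)[OF that] member_le_sum[OF that(1), of BB] BB(1) finite_J by (auto simp: B_def)
  qed
  have "\<bar>lev q (y z) - lev q (y z')\<bar> \<le> B * (\<Sum>j\<in>J. \<bar>z j - z' j\<bar>)"
    if z: "z \<in> cube J c \<delta>" and z': "z' \<in> cube J c \<delta>" for z z'
  proof -
    \<comment> \<open>Passes from \<open>z'\<close> to \<open>z\<close> one coordinate at a time;
      the intermediate points stay in the box.\<close>
    define W where "W = (\<lambda>K j. if j \<in> K then z j else z' j)"
    have Wbox: "W K \<in> cube J c \<delta>" for K using z z' by (auto simp: W_def cube_def)
    have "\<bar>lev q (y (W K)) - lev q (y z')\<bar> \<le> B * (\<Sum>j\<in>K. \<bar>z j - z' j\<bar>)" if "K \<subseteq> J" for K
      using finite_subset[OF that finite_J] that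
    proof (induction K rule: finite_induct)
      case empty
      have "W {} = z'" by (auto simp: W_def)
      thus ?case by simp
    next
      case (insert k K)
      have eq: "W (insert k K) = (W K)(k := z k)" by (auto simp: W_def)
      obtain \<xi> where \<xi>: "(W K)(k := \<xi>) \<in> cube J c \<delta>"
        "lev q (y (W (insert k K))) - lev q (y (W K)) = (z k - W K k) * lev (lder (P k) q) (y ((W K)(k := \<xi>)))"
        using lev_mvt[of "W K" k "z k" q] Wbox[of "insert k K"] Wbox[of K] insert q unfolding eq by auto
      have Wk: "W K k = z' k" using insert by (auto simp: W_def)
      have "\<bar>lev q (y (W (insert k K))) - lev q (y (W K))\<bar> \<le> \<bar>z k - z' k\<bar> * B"
        unfolding \<xi>(2) abs_mult Wk using B(2)[OF _ \<xi>(1)] insert by (intro mult_left_mono) auto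
      thus ?case using insert by (simp add: algebra_simps)
    qed
    from this[of J] show ?thesis using lev_dep[OF q, of "W J" z] by (auto simp: W_def)
  qed
  thus ?thesis using B by blast
qed

lemma lev_tendsto:
  assumes "lvar p q" "z \<in> cube J c \<delta>" "\<And>j. j \<in> J \<Longrightarrow> ((\<lambda>t. w t j) \<longlongrightarrow> z j) F"
  shows "((\<lambda>t. lev q (y (w t))) \<longlongrightarrow> lev q (y z)) F"
proof -
  obtain B where B: "\<forall>z\<in>cube J c \<delta>. \<forall>z'\<in>cube J c \<delta>. \<bar>lev q (y z) - lev q (y z')\<bar> \<le> B * (\<Sum>j\<in>J. \<bar>z j - z' j\<bar>)"
    using lev_lipschitz[OF assms(1)] by blast
  have "\<forall>\<^sub>F t in F. \<forall>j\<in>J. \<bar>w t j - c j\<bar> < \<delta>"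
  proof (intro eventually_ball_finite[OF finite_J] ballI)
    fix j assume "j \<in> J"
    hence "((\<lambda>t. \<bar>w t j - c j\<bar>) \<longlongrightarrow> \<bar>z j - c j\<bar>) F" by (intro tendsto_intros assms)
    moreover have "\<bar>z j - c j\<bar> < \<delta>" using assms \<open>j \<in> J\<close> by (auto simp: cube_def)
    ultimately show "\<forall>\<^sub>F t in F. \<bar>w t j - c j\<bar> < \<delta>" by (rule order_tendstoD(2))
  qed
  hence ev: "\<forall>\<^sub>F t in F. norm (lev q (y (w t)) - lev q (y z)) \<le> B * (\<Sum>j\<in>J. \<bar>w t j - z j\<bar>)"
    by eventually_elim (use B assms in \<open>auto simp: cube_def\<close>)
  have "((\<lambda>t. B * (\<Sum>j\<in>J. \<bar>w t j - z j\<bar>)) \<longlongrightarrow> B * (\<Sum>j\<in>J. \<bar>z j - z j\<bar>)) F"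
    by (intro tendsto_intros assms)
  hence "((\<lambda>t. lev q (y (w t)) - lev q (y z)) \<longlongrightarrow> 0) F"
    using ev by (intro Lim_null_comparison[OF ev]) simp
  thus ?thesis by (simp add: LIM_zero_iff)
qed

lemma lder_single: "lev (lder D [(1, [i])]) v = lev (D i) v"
  by (simp add: lder_def lev_Cons)

text \<open>The chain rule without a total derivative: the coordinates of the curve are set in
  motion one at a time, and each contributes a mean value quotient that converges because partial
  derivatives are continuous.\<close>

lemma curve_derivative:
  assumes cube: "w t0 \<in> cube J c \<delta>" and i: "i < p"
    and d: "\<And>j. j \<in> J \<Longrightarrow> ((\<lambda>t. w t j) has_real_derivative d j) (at t0)"
  shows "((\<lambda>t. y (w t) i) has_real_derivative (\<Sum>j\<in>J. d j * lev (P j i) (y (w t0)))) (at t0)"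
proof -
  let ?q = "[(1, [i])] :: lpoly"
  have q: "lvar p ?q" using i by auto
  define W where "W = (\<lambda>K t j. if j \<in> K then w t j else w t0 j)"
  have lim: "((\<lambda>t. w t j) \<longlongrightarrow> w t0 j) (at t0)" if "j \<in> J" for j
    using d[OF that] by (intro DERIV_isCont isContD) auto
  have limW: "((\<lambda>t. W K t j) \<longlongrightarrow> w t0 j) (at t0)" if "j \<in> J" for j K
    using lim[OF that] by (cases "j \<in> K") (simp_all add: W_def)
  have W0: "W K t0 = w t0" for K by (auto simp: W_def)
  have evbox: "\<forall>\<^sub>F t in at t0. W K t \<in> cube J c \<delta>" for K
  proof -
    have "\<forall>\<^sub>F t in at t0. \<forall>j\<in>J. \<bar>W K t j - c j\<bar> < \<delta>"
    proof (intro eventually_ball_finite[OF finite_J] ballI)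
      fix j assume j: "j \<in> J"
      have "((\<lambda>t. \<bar>W K t j - c j\<bar>) \<longlongrightarrow> \<bar>w t0 j - c j\<bar>) (at t0)" by (intro tendsto_intros limW j)
      moreover have "\<bar>w t0 j - c j\<bar> < \<delta>" using cube j by (auto simp: cube_def)
      ultimately show "\<forall>\<^sub>F t in at t0. \<bar>W K t j - c j\<bar> < \<delta>" by (rule order_tendstoD(2))
    qed
    thus ?thesis by eventually_elim (auto simp: cube_def)
  qed
  have *: "((\<lambda>t. lev ?q (y (W K t))) has_real_derivative (\<Sum>j\<in>K. d j * lev (P j i) (y (w t0)))) (at t0)" if "K \<subseteq> J" for K
    using finite_subset[OF that finite_J] that
  proof (induction K rule: finite_induct)
    case empty
    have "W {} t = w t0" for t by (auto simp: W_def)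
    thus ?case by simp
  next
    case (insert k K)
    hence kJ: "k \<in> J" by auto
    have eq: "W (insert k K) t = (W K t)(k := w t k)" for t by (auto simp: W_def)
    have Wk: "W K t k = w t0 k" for t using insert by (auto simp: W_def)
    define G where "G t \<xi> \<longleftrightarrow> \<bar>\<xi> - w t0 k\<bar> \<le> \<bar>w t k - w t0 k\<bar> \<and>
      lev ?q (y (W (insert k K) t)) - lev ?q (y (W K t)) = (w t k - w t0 k) * lev (P k i) (y ((W K t)(k := \<xi>)))"
      for t \<xi>
    \<comment> \<open>A mean value point for each \<open>t\<close>; it is no farther from
      \<open>w t0 k\<close> than \<open>w t k\<close> is, and so tends to
      \<open>w t0 k\<close>.\<close>
    define \<xi> where "\<xi> = (\<lambda>t. SOME x. G t x)"
    have G: "\<forall>\<^sub>F t in at t0. G t (\<xi> t)"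
      using evbox[of K] evbox[of "insert k K"]
    proof eventually_elim
      case (elim t)
      hence b: "W K t \<in> cube J c \<delta>" "(W K t)(k := w t k) \<in> cube J c \<delta>" by (simp_all only: eq)
      obtain x where "\<bar>x - W K t k\<bar> \<le> \<bar>w t k - W K t k\<bar>"
        "lev ?q (y ((W K t)(k := w t k))) - lev ?q (y (W K t)) =
          (w t k - W K t k) * lev (lder (P k) ?q) (y ((W K t)(k := x)))"
        using lev_mvt[OF b kJ q] by blast
      hence "G t x" unfolding G_def eq Wk lder_single by (rule conjI)
      hence "\<exists>x. G t x" ..
      thus ?case unfolding \<xi>_def by (rule someI_ex)
    qed
    have lim\<xi>: "(\<xi> \<longlongrightarrow> w t0 k) (at t0)"
    proof -
      have "((\<lambda>t. \<bar>w t k - w t0 k\<bar>) \<longlongrightarrow> \<bar>w t0 k - w t0 k\<bar>) (at t0)"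
        by (intro tendsto_rabs tendsto_diff tendsto_const lim[OF kJ])
      hence l: "((\<lambda>t. \<bar>w t k - w t0 k\<bar>) \<longlongrightarrow> 0) (at t0)" by simp
      have "((\<lambda>t. \<xi> t - w t0 k) \<longlongrightarrow> 0) (at t0)"
      proof (rule Lim_null_comparison[rotated])
        show "\<forall>\<^sub>F t in at t0. norm (\<xi> t - w t0 k) \<le> \<bar>w t k - w t0 k\<bar>"
          using G unfolding G_def real_norm_def by (rule eventually_mono) (rule conjunct1)
      qed (rule l)
      thus ?thesis by (simp add: LIM_zero_iff)
    qed
    have "((\<lambda>t. (w t k - w t0 k) / (t - t0) * lev (P k i) (y ((W K t)(k := \<xi> t)))) \<longlongrightarrow>
        d k * lev (P k i) (y (w t0))) (at t0)"
    proof (intro tendsto_mult)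
      show "((\<lambda>t. (w t k - w t0 k) / (t - t0)) \<longlongrightarrow> d k) (at t0)"
        using d[OF kJ] by (simp add: has_field_derivative_iff)
      show "((\<lambda>t. lev (P k i) (y ((W K t)(k := \<xi> t)))) \<longlongrightarrow> lev (P k i) (y (w t0))) (at t0)"
      proof (rule lev_tendsto[OF vars[OF kJ i] cube])
        fix j assume "j \<in> J"
        thus "((\<lambda>t. ((W K t)(k := \<xi> t)) j) \<longlongrightarrow> w t0 j) (at t0)"
          using limW[of j K] lim\<xi> by (cases "j = k") simp_all
      qed
    qed
    moreover have "\<forall>\<^sub>F t in at t0. (w t k - w t0 k) / (t - t0) * lev (P k i) (y ((W K t)(k := \<xi> t))) =
        ((lev ?q (y (W (insert k K) t)) - lev ?q (y (W K t))) -
         (lev ?q (y (W (insert k K) t0)) - lev ?q (y (W K t0)))) / (t - t0)"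
      using G
    proof eventually_elim
      case (elim t)
      hence "lev ?q (y (W (insert k K) t)) - lev ?q (y (W K t)) =
          (w t k - w t0 k) * lev (P k i) (y ((W K t)(k := \<xi> t)))"
        unfolding G_def by (rule conjunct2)
      thus ?case by (simp only: W0 diff_self diff_zero times_divide_eq_left)
    qed
    ultimately have "((\<lambda>t. lev ?q (y (W (insert k K) t)) - lev ?q (y (W K t))) has_real_derivative
        d k * lev (P k i) (y (w t0))) (at t0)"
      unfolding has_field_derivative_iff by (rule Lim_transform_eventually)
    from DERIV_add[OF this, of "\<lambda>t. lev ?q (y (W K t))"] insert show ?case by simp
  qed
  have "lev ?q (y (W J t)) = y (w t) i" for t
    using dep[OF i, of "W J t" "w t"] by (auto simp: W_def lev_Cons)
  thus ?thesis using *[of J] by simp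
qed

lemma lev_near:
  assumes "lvar p q" "z \<in> cube J c \<delta>" "\<epsilon> > 0"
  shows "\<exists>r>0. cube J z r \<subseteq> cube J c \<delta> \<and> (\<forall>w\<in>cube J z r. \<bar>lev q (y w) - lev q (y z)\<bar> < \<epsilon>)"
proof -
  obtain B where B: "B \<ge> 0" "\<forall>z\<in>cube J c \<delta>. \<forall>z'\<in>cube J c \<delta>. \<bar>lev q (y z) - lev q (y z')\<bar> \<le> B * (\<Sum>j\<in>J. \<bar>z j - z' j\<bar>)"
    using lev_lipschitz[OF assms(1)] by blast
  obtain r0 where r0: "r0 > 0" "cube J z r0 \<subseteq> cube J c \<delta>" using cube_shrink[OF finite_J assms(2)] by blast
  define N where "N = B * real (card J) + 1"
  have N: "N > 0" using B by (auto simp: N_def add_nonneg_pos)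
  define r where "r = min r0 (\<epsilon> / N)"
  have r: "r > 0" "r \<le> r0" using r0 N assms by (auto simp: r_def)
  have "\<bar>lev q (y w) - lev q (y z)\<bar> < \<epsilon>" if w: "w \<in> cube J z r" for w
  proof -
    have "w \<in> cube J c \<delta>" using w r r0 cube_mono by blast
    hence "\<bar>lev q (y w) - lev q (y z)\<bar> \<le> B * (\<Sum>j\<in>J. \<bar>w j - z j\<bar>)" using B assms by blast
    also have "\<dots> \<le> B * (\<Sum>j\<in>J. r)" using w B by (intro mult_left_mono sum_mono) (auto simp: cube_def less_imp_le)
    also have "\<dots> < N * r" using r by (simp add: N_def algebra_simps)
    also have "\<dots> \<le> \<epsilon>" using N by (simp add: r_def min_def field_simps)
    finally show ?thesis .
  qed
  thus ?thesis using r r0 cube_mono by blast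
qed

end

section \<open>Implicit functions\<close>

lemma lev_strict_unique:
  fixes f f' :: "real \<Rightarrow> real"
  assumes "\<And>s. \<bar>s - a\<bar> < r \<Longrightarrow> (f has_real_derivative f' s) (at s)"
    and "\<And>s. \<bar>s - a\<bar> < r \<Longrightarrow> f' s \<noteq> 0"
    and "\<bar>s - a\<bar> < r" "\<bar>t - a\<bar> < r" "f s = f t"
  shows "s = t"
proof -
  have *: False if "\<bar>s - a\<bar> < r" "\<bar>t - a\<bar> < r" "f s = f t" "s < t" for s t
  proof -
    obtain \<xi> where "s < \<xi>" "\<xi> < t" "f t - f s = (t - s) * f' \<xi>"
    proof -
      have "(f has_real_derivative f' x) (at x)" if "s \<le> x" "x \<le> t" for x
        using that \<open>\<bar>s - a\<bar> < r\<close> \<open>\<bar>t - a\<bar> < r\<close> by (intro assms(1)) linarith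
      from MVT2[OF \<open>s < t\<close> this] show ?thesis using that by blast
    qed
    thus False using assms(2)[of \<xi>] that by auto
  qed
  show ?thesis using *[of s t] *[of t s] assms(3-5) by (cases s t rule: linorder_cases) auto
qed

context chain begin

text \<open>The partial derivatives of \<open>\<psi>\<close> are quotients of partial derivatives of
  \<open>q\<close>. They become polynomial once the reciprocal of the denominator joins the chain as
  function number \<open>p\<close>. Uniqueness of the zero puts all zeros of \<open>q\<close> in the
  small box on the graph of \<open>\<psi>\<close>, which is needed to cover a solution set by
  charts.\<close>

lemma implicit_function:
  assumes z0: "z0 \<in> cube J c \<delta>" and i: "i \<in> J" and q: "lvar p q"
    and q0: "lev q (y z0) = 0" and qi: "lev (lder (P i) q) (y z0) \<noteq> 0"
  obtains \<psi> \<epsilon> P' where "\<epsilon> > 0" "cube J z0 \<epsilon> \<subseteq> cube J c \<delta>"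
    "\<And>z. z \<in> cube (J - {i}) z0 \<epsilon> \<Longrightarrow> z(i := \<psi> z) \<in> cube J c \<delta>"
    "\<And>z. z \<in> cube J z0 \<epsilon> \<Longrightarrow> lev q (y z) = 0 \<Longrightarrow> z i = \<psi> z"
    "chain (J - {i}) z0 \<epsilon> (Suc p)
       (\<lambda>z l. if l < p then y (z(i := \<psi> z)) l else 1 / lev (lder (P i) q) (y (z(i := \<psi> z)))) P'"
proof -
  define fi where "fi = lder (P i) q"
  have fi: "lvar p fi" unfolding fi_def by (rule lvar_lder_P[OF q i])
  define m where "m = lev fi (y z0)"
  have m: "\<bar>m\<bar> > 0" using qi by (simp add: m_def fi_def)
  obtain r1 where r1: "r1 > 0" "cube J z0 r1 \<subseteq> cube J c \<delta>"
    "\<And>w. w \<in> cube J z0 r1 \<Longrightarrow> \<bar>lev fi (y w) - m\<bar> < \<bar>m\<bar> / 2"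
    using lev_near[OF fi z0, of "\<bar>m\<bar> / 2"] m unfolding m_def by auto
  \<comment> \<open>The factor \<open>sgn m\<close> treats increasing and decreasing functions
    alike.\<close>
  have fi_big: "sgn m * lev fi (y w) \<ge> \<bar>m\<bar> / 2" if "w \<in> cube J z0 r1" for w
    using r1(3)[OF that] m by (cases "m > 0") (auto simp: abs_if sgn_if split: if_splits)
  have fi_nz: "lev fi (y w) \<noteq> 0" if "w \<in> cube J z0 r1" for w
    using fi_big[OF that] m by auto
  \<comment> \<open>On this box \<open>q\<close> is so small that moving coordinate \<open>i\<close>
    by \<open>r1 / 2\<close> in both directions, with slope at least
    \<open>\<bar>m\<bar> / 2\<close>, meets both signs.\<close>
  obtain r2 where r2: "r2 > 0" "\<And>w. w \<in> cube J z0 r2 \<Longrightarrow> \<bar>lev q (y w)\<bar> < \<bar>m\<bar> / 2 * (r1 / 2)"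
    using lev_near[OF q z0, of "\<bar>m\<bar> / 2 * (r1 / 2)"] m r1(1) q0 by auto
  define \<epsilon> where "\<epsilon> = min r2 (r1 / 2)"
  have \<epsilon>: "\<epsilon> > 0" "\<epsilon> < r1" "\<epsilon> \<le> r2" using r1 r2 by (auto simp: \<epsilon>_def)
  define f where "f = (\<lambda>z. lev q (y z))"
  let ?J = "J - {i}"
  have upd: "z(i := s) \<in> cube J z0 r1" if "z \<in> cube ?J z0 \<epsilon>" "\<bar>s - z0 i\<bar> < r1" for z s
    using that \<epsilon> by (force simp: cube_def)
  have upd2: "z(i := s) \<in> cube J c \<delta>" if "z \<in> cube ?J z0 \<epsilon>" "\<bar>s - z0 i\<bar> < r1" for z s
    using upd[OF that] r1(2) by blast
  have der_i: "((\<lambda>s. f (z(i := s))) has_real_derivative lev fi (y (z(i := s)))) (at s)"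
    if "z \<in> cube ?J z0 \<epsilon>" "\<bar>s - z0 i\<bar> < r1" for z s
    unfolding f_def fi_def by (rule lev_partial[OF upd2[OF that] i q])
  have ex: "\<exists>s. \<bar>s - z0 i\<bar> < r1 \<and> f (z(i := s)) = 0" if z: "z \<in> cube ?J z0 \<epsilon>" for z
  proof -
    let ?u = "z(i := z0 i)"
    let ?g = "\<lambda>s. f (z(i := s))"
    have ub: "?u \<in> cube J z0 r2" using z \<epsilon> i r2 by (force simp: cube_def)
    have ub1: "?u \<in> cube J c \<delta>" using upd2[OF z, of "z0 i"] r1 by auto
    have step: "\<exists>\<xi>. \<bar>\<xi> - z0 i\<bar> < r1 \<and> f (z(i := s)) - f ?u = (s - z0 i) * lev fi (y (z(i := \<xi>)))"
      if s: "\<bar>s - z0 i\<bar> < r1" for s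
    proof -
      have "?u(i := s) \<in> cube J c \<delta>" using upd2[OF z s] by simp
      from lev_mvt[OF ub1 this i q] obtain \<xi> where "\<bar>\<xi> - z0 i\<bar> \<le> \<bar>s - z0 i\<bar>"
        "f (z(i := s)) - f ?u = (s - z0 i) * lev fi (y (z(i := \<xi>)))"
        unfolding f_def fi_def by auto
      thus ?thesis using s by (intro exI[of _ \<xi>]) auto
    qed
    have small: "\<bar>f ?u\<bar> < \<bar>m\<bar> / 2 * (r1 / 2)" using r2(2)[OF ub] by (simp add: f_def)
    have sm: "\<bar>sgn m * f ?u\<bar> < \<bar>m\<bar> / 2 * (r1 / 2)" using small m by (simp add: abs_mult)
    obtain x1 where x1: "\<bar>x1 - z0 i\<bar> < r1" "?g (z0 i + r1 / 2) - f ?u = r1 / 2 * lev fi (y (z(i := x1)))"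
      using step[of "z0 i + r1 / 2"] r1 by auto
    obtain x2 where x2: "\<bar>x2 - z0 i\<bar> < r1" "?g (z0 i - r1 / 2) - f ?u = - (r1 / 2) * lev fi (y (z(i := x2)))"
      using step[of "z0 i - r1 / 2"] r1 by auto
    have "\<bar>m\<bar> / 2 * (r1 / 2) \<le> (sgn m * lev fi (y (z(i := x1)))) * (r1 / 2)"
      "\<bar>m\<bar> / 2 * (r1 / 2) \<le> (sgn m * lev fi (y (z(i := x2)))) * (r1 / 2)"
      using fi_big[OF upd[OF z x1(1)]] fi_big[OF upd[OF z x2(1)]] r1 by (intro mult_right_mono; simp)+
    moreover have "sgn m * ?g (z0 i + r1 / 2) = sgn m * f ?u + (sgn m * lev fi (y (z(i := x1)))) * (r1 / 2)"
      "sgn m * ?g (z0 i - r1 / 2) = sgn m * f ?u - (sgn m * lev fi (y (z(i := x2)))) * (r1 / 2)"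
    proof -
      have a: "?g (z0 i + r1 / 2) = f ?u + r1 / 2 * lev fi (y (z(i := x1)))"
        "?g (z0 i - r1 / 2) = f ?u - (r1 / 2) * lev fi (y (z(i := x2)))" using x1 x2 by linarith+
      show "sgn m * ?g (z0 i + r1 / 2) = sgn m * f ?u + (sgn m * lev fi (y (z(i := x1)))) * (r1 / 2)"
        "sgn m * ?g (z0 i - r1 / 2) = sgn m * f ?u - (sgn m * lev fi (y (z(i := x2)))) * (r1 / 2)"
        unfolding a by (simp_all add: algebra_simps)
    qed
    ultimately have pos: "sgn m * ?g (z0 i + r1 / 2) \<ge> 0" "sgn m * ?g (z0 i - r1 / 2) \<le> 0"
      using sm by linarith+
    have "\<exists>s. z0 i - r1 / 2 \<le> s \<and> s \<le> z0 i + r1 / 2 \<and> sgn m * ?g s = 0"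
      using pos r1(1) by (intro IVT allI impI isCont_mult DERIV_isCont[OF der_i[OF z]]) (auto simp: abs_if)
    then obtain s where "z0 i - r1 / 2 \<le> s" "s \<le> z0 i + r1 / 2" "sgn m * ?g s = 0" by blast
    thus ?thesis using r1 m by (intro exI[of _ s]) (auto simp: sgn_if abs_if split: if_splits)
  qed
  have uniq: "s = t" if "z \<in> cube ?J z0 \<epsilon>" "\<bar>s - z0 i\<bar> < r1" "\<bar>t - z0 i\<bar> < r1" "f (z(i := s)) = f (z(i := t))" for z s t
    by (rule lev_strict_unique[of "z0 i" r1 "\<lambda>s. f (z(i := s))" "\<lambda>s. lev fi (y (z(i := s)))"])
      (use der_i[OF that(1)] fi_nz[OF upd[OF that(1)]] that in auto)
  \<comment> \<open>The predicate under \<open>SOME\<close> does not see \<open>z i\<close>, so the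
    value depends only on the coordinates in \<open>J - {i}\<close>.\<close>
  define \<psi> where "\<psi> = (\<lambda>z. SOME s. \<bar>s - z0 i\<bar> < r1 \<and> f (z(i := s)) = 0)"
  have \<psi>: "\<bar>\<psi> z - z0 i\<bar> < r1" "f (z(i := \<psi> z)) = 0" if "z \<in> cube ?J z0 \<epsilon>" for z
    using someI_ex[OF ex[OF that]] unfolding \<psi>_def by auto
  define \<Phi> where "\<Phi> = (\<lambda>z. z(i := \<psi> z))"
  have \<Phi>: "\<Phi> z \<in> cube J z0 r1" "\<Phi> z \<in> cube J c \<delta>" if "z \<in> cube ?J z0 \<epsilon>" for z
    unfolding \<Phi>_def using upd[OF that \<psi>(1)[OF that]] r1(2) by auto
  have \<psi>_dep: "\<psi> z = \<psi> z'" if "\<And>j. j \<in> ?J \<Longrightarrow> z j = z' j" for z z'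
  proof -
    have "f (z(i := s)) = f (z'(i := s))" for s
      unfolding f_def using that by (intro lev_dep[OF q]) auto
    thus ?thesis by (simp add: \<psi>_def)
  qed
  have \<psi>_der: "((\<lambda>t. \<psi> (z(j := t))) has_real_derivative
      - lev (lder (P j) q) (y (\<Phi> z)) / lev fi (y (\<Phi> z))) (at (z j))"
    if z: "z \<in> cube ?J z0 \<epsilon>" and j: "j \<in> ?J" for z j
  proof -
    define t0 where "t0 = z j"
    define fj where "fj = lder (P j) q"
    have fj: "lvar p fj" unfolding fj_def using j by (intro lvar_lder_P[OF q]) auto
    have ji: "j \<noteq> i" "j \<in> J" using j by auto
    let ?z = "\<lambda>t. z(j := t)"
    have z_t0: "?z t0 = z" by (simp add: t0_def)
    have evz: "\<forall>\<^sub>F t in at t0. ?z t \<in> cube ?J z0 \<epsilon>"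
    proof -
      have "((\<lambda>t. \<bar>t - z0 j\<bar>) \<longlongrightarrow> \<bar>t0 - z0 j\<bar>) (at t0)" by (intro tendsto_intros)
      moreover have "\<bar>t0 - z0 j\<bar> < \<epsilon>" using z j by (auto simp: cube_def t0_def)
      ultimately have "\<forall>\<^sub>F t in at t0. \<bar>t - z0 j\<bar> < \<epsilon>" by (rule order_tendstoD(2))
      thus ?thesis by eventually_elim (use z in \<open>auto simp: cube_def\<close>)
    qed
    \<comment> \<open>\<open>q\<close> vanishes at both ends of the path that first moves coordinate
      \<open>j\<close> from \<open>t0\<close> to \<open>t\<close> and then coordinate
      \<open>i\<close> to the new zero; \<open>w\<close> and \<open>x\<close> are mean value points
      of the two legs.\<close>
    define G where "G t x w \<longleftrightarrow> \<bar>x - \<psi> z\<bar> \<le> \<bar>\<psi> (?z t) - \<psi> z\<bar> \<and> \<bar>w - t0\<bar> \<le> \<bar>t - t0\<bar> \<and>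
        \<bar>lev fi (y ((?z t)(i := x)))\<bar> \<ge> \<bar>m\<bar> / 2 \<and> (\<Phi> z)(j := w) \<in> cube J c \<delta> \<and>
        (\<psi> (?z t) - \<psi> z) * lev fi (y ((?z t)(i := x))) = - (t - t0) * lev fj (y ((\<Phi> z)(j := w)))"
      for t x w
    have "\<forall>\<^sub>F t in at t0. \<exists>x w. G t x w"
      using evz
    proof eventually_elim
      case (elim t)
      let ?a = "(?z t)(i := \<psi> z)"
      have a1: "?a \<in> cube J c \<delta>" using upd2[OF elim \<psi>(1)[OF z]] .
      have a2: "?a(i := \<psi> (?z t)) \<in> cube J c \<delta>" using upd2[OF elim \<psi>(1)[OF elim]] by simp
      from lev_mvt[OF a1 a2 i q] obtain x where x: "\<bar>x - \<psi> z\<bar> \<le> \<bar>\<psi> (?z t) - \<psi> z\<bar>" "\<bar>x - \<psi> (?z t)\<bar> \<le> \<bar>\<psi> (?z t) - \<psi> z\<bar>"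
        "f (\<Phi> (?z t)) - f ?a = (\<psi> (?z t) - \<psi> z) * lev fi (y ((?z t)(i := x)))"
        unfolding f_def fi_def \<Phi>_def by auto
      have "\<bar>x - z0 i\<bar> < r1" using x(1,2) \<psi>(1)[OF z] \<psi>(1)[OF elim] by linarith
      from fi_big[OF upd[OF elim this]] have big: "\<bar>lev fi (y ((?z t)(i := x)))\<bar> \<ge> \<bar>m\<bar> / 2"
        by (simp add: sgn_if split: if_splits)
      have eqa: "(\<Phi> z)(j := t) = ?a" using ji by (auto simp: \<Phi>_def)
      have b: "(\<Phi> z)(j := t) \<in> cube J c \<delta>" unfolding eqa by (rule a1)
      have "(\<Phi> z) j = t0" using ji by (simp add: \<Phi>_def t0_def)
      with lev_mvt[OF \<Phi>(2)[OF z] b ji(2) q] obtain w where w: "\<bar>w - t0\<bar> \<le> \<bar>t - t0\<bar>"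
        "(\<Phi> z)(j := w) \<in> cube J c \<delta>"
        "f ?a - f (\<Phi> z) = (t - t0) * lev fj (y ((\<Phi> z)(j := w)))"
        unfolding f_def fj_def eqa by auto
      have "f (\<Phi> (?z t)) = 0" "f (\<Phi> z) = 0" using \<psi>(2)[OF elim] \<psi>(2)[OF z] by (auto simp: \<Phi>_def)
      with x(3) w(3) have "(\<psi> (?z t) - \<psi> z) * lev fi (y ((?z t)(i := x))) = - (t - t0) * lev fj (y ((\<Phi> z)(j := w)))"
        by linarith
      with x(1) w(1,2) big have "G t x w" unfolding G_def by blast
      thus ?case by blast
    qed
    hence "\<forall>\<^sub>F t in at t0. \<exists>xw. G t (fst xw) (snd xw)" by (rule eventually_mono) auto
    hence G: "\<forall>\<^sub>F t in at t0. G t (fst (SOME xw. G t (fst xw) (snd xw))) (snd (SOME xw. G t (fst xw) (snd xw)))"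
      by (rule eventually_mono) (rule someI_ex)
    define X where "X = (\<lambda>t. fst (SOME xw. G t (fst xw) (snd xw)))"
    define V where "V = (\<lambda>t. snd (SOME xw. G t (fst xw) (snd xw)))"
    have G: "\<forall>\<^sub>F t in at t0. G t (X t) (V t)" using G unfolding X_def V_def .
    have limV: "(V \<longlongrightarrow> t0) (at t0)"
    proof -
      have l: "((\<lambda>t. \<bar>t - t0\<bar>) \<longlongrightarrow> 0) (at t0)" by (rule tendsto_eq_intros refl)+ simp
      have "\<forall>\<^sub>F t in at t0. norm (V t - t0) \<le> \<bar>t - t0\<bar>"
        using G by (rule eventually_mono) (simp add: G_def)
      from Lim_null_comparison[OF this l] show ?thesis by (simp add: LIM_zero_iff)
    qed
    have coordV: "((\<lambda>t. ((\<Phi> z)(j := V t)) k) \<longlongrightarrow> \<Phi> z k) (at t0)" for k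
    proof (cases "k = j")
      case True
      thus ?thesis using limV ji by (simp add: \<Phi>_def t0_def)
    qed simp
    have limfj: "((\<lambda>t. lev fj (y ((\<Phi> z)(j := V t)))) \<longlongrightarrow> lev fj (y (\<Phi> z))) (at t0)"
      by (rule lev_tendsto[OF fj \<Phi>(2)[OF z] coordV])
    obtain B where B: "B \<ge> 0" "\<forall>z\<in>cube J c \<delta>. \<bar>lev fj (y z)\<bar> \<le> B" using lev_bounded[OF fj] by blast
    \<comment> \<open>Continuity of \<open>\<psi>\<close> precedes differentiability: the slope in
      direction \<open>i\<close> is bounded from below and the slope in direction \<open>j\<close>
      from above.\<close>
    have lim\<psi>: "((\<lambda>t. \<bar>\<psi> (?z t) - \<psi> z\<bar>) \<longlongrightarrow> 0) (at t0)"
    proof (rule Lim_null_comparison)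
      show "\<forall>\<^sub>F t in at t0. norm \<bar>\<psi> (?z t) - \<psi> z\<bar> \<le> \<bar>t - t0\<bar> * (B / (\<bar>m\<bar> / 2))"
        using G
      proof eventually_elim
        case (elim t)
        have "\<bar>\<psi> (?z t) - \<psi> z\<bar> * (\<bar>m\<bar> / 2) \<le> \<bar>\<psi> (?z t) - \<psi> z\<bar> * \<bar>lev fi (y ((?z t)(i := X t)))\<bar>"
          using elim by (intro mult_left_mono) (auto simp: G_def)
        also have "\<dots> = \<bar>t - t0\<bar> * \<bar>lev fj (y ((\<Phi> z)(j := V t)))\<bar>"
          using elim unfolding G_def by (metis abs_minus_cancel abs_mult)
        also have "\<dots> \<le> \<bar>t - t0\<bar> * B" using elim B(2) by (intro mult_left_mono) (auto simp: G_def)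
        finally show ?case using m by (simp add: field_simps)
      qed
      show "((\<lambda>t. \<bar>t - t0\<bar> * (B / (\<bar>m\<bar> / 2))) \<longlongrightarrow> 0) (at t0)" by (rule tendsto_eq_intros refl)+ simp
    qed
    have limX: "(X \<longlongrightarrow> \<psi> z) (at t0)"
    proof -
      have "\<forall>\<^sub>F t in at t0. norm (X t - \<psi> z) \<le> \<bar>\<psi> (?z t) - \<psi> z\<bar>"
        using G by (rule eventually_mono) (simp add: G_def)
      from Lim_null_comparison[OF this lim\<psi>] show ?thesis by (simp add: LIM_zero_iff)
    qed
    have coordX: "((\<lambda>t. ((?z t)(i := X t)) k) \<longlongrightarrow> \<Phi> z k) (at t0)" for k
    proof -
      have "((\<lambda>t. t) \<longlongrightarrow> t0) (at t0)" by (rule tendsto_ident_at)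
      thus ?thesis using limX ji by (cases "k = i"; cases "k = j") (simp_all add: \<Phi>_def t0_def)
    qed
    have limfi: "((\<lambda>t. lev fi (y ((?z t)(i := X t)))) \<longlongrightarrow> lev fi (y (\<Phi> z))) (at t0)"
      by (rule lev_tendsto[OF fi \<Phi>(2)[OF z] coordX])
    have "((\<lambda>t. - lev fj (y ((\<Phi> z)(j := V t))) / lev fi (y ((?z t)(i := X t)))) \<longlongrightarrow>
        - lev fj (y (\<Phi> z)) / lev fi (y (\<Phi> z))) (at t0)"
      by (intro tendsto_divide tendsto_minus limfj limfi fi_nz \<Phi>(1)[OF z])
    moreover have "\<forall>\<^sub>F t in at t0. - lev fj (y ((\<Phi> z)(j := V t))) / lev fi (y ((?z t)(i := X t))) =
        (\<psi> (?z t) - \<psi> (?z t0)) / (t - t0)"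
      using G eventually_at_ball'[of 1 t0 UNIV, simplified]
    proof eventually_elim
      case (elim t)
      have "t \<noteq> t0" using elim by simp
      moreover have "lev fi (y ((?z t)(i := X t))) \<noteq> 0" using elim m by (auto simp: G_def)
      moreover have "(\<psi> (?z t) - \<psi> z) * lev fi (y ((?z t)(i := X t))) = - (t - t0) * lev fj (y ((\<Phi> z)(j := V t)))"
        using elim by (simp add: G_def)
      ultimately show ?case unfolding z_t0 by (simp add: field_simps)
    qed
    ultimately have "((\<lambda>t. \<psi> (?z t)) has_real_derivative - lev fj (y (\<Phi> z)) / lev fi (y (\<Phi> z))) (at t0)"
      unfolding has_field_derivative_iff by (rule Lim_transform_eventually)
    thus ?thesis by (simp add: fj_def t0_def)
  qed
  define y' where "y' = (\<lambda>z l. if l < p then y (\<Phi> z) l else 1 / lev fi (y (\<Phi> z)))"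
  have y'_less: "l < p \<Longrightarrow> y' z l = y (\<Phi> z) l" for z l by (simp add: y'_def)
  \<comment> \<open>Variable \<open>p\<close> stands for the reciprocal of
    \<open>lder (P i) q\<close>, so the second summand is the derivative of \<open>\<psi>\<close>
    times \<open>P i l\<close>. The reciprocal itself has as derivative minus its square times that
    of \<open>fi\<close>, hence \<open>[p, p]\<close> below.\<close>
  define Q where "Q = (\<lambda>j l. P j l @ lmul [(-1, [p])] (lmul (lder (P j) q) (P i l)))"
  define P' where "P' = (\<lambda>j l. if l < p then Q j l else lmul [(-1, [p, p])] (lder (Q j) fi))"
  have Q: "lvar (Suc p) (Q j l)" if "j \<in> J" "l < p" for j l
  proof -
    have "lvar p (P j l)" "lvar p (P i l)" "lvar p (lder (P j) q)"
      using that i vars lvar_lder_P[OF q] by auto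
    thus ?thesis unfolding Q_def by (auto intro!: lvar_mul intro: lvar_mono)
  qed
  have lev_y': "lev s (y' z) = lev s (y (\<Phi> z))" if "lvar p s" for s z
    by (rule lev_cong[OF that]) (simp add: y'_def)
  have derQ: "((\<lambda>t. y (\<Phi> (z(j := t))) l) has_real_derivative lev (Q j l) (y' z)) (at (z j))"
    if z: "z \<in> cube ?J z0 \<epsilon>" and j: "j \<in> ?J" and l: "l < p" for z j l
  proof -
    let ?\<psi>' = "- lev (lder (P j) q) (y (\<Phi> z)) / lev fi (y (\<Phi> z))"
    define d where "d = (\<lambda>k. if k = i then ?\<psi>' else if k = j then 1 else 0)"
    have z_id: "z(j := z j) = z" by simp
    have jJ: "j \<in> J" "j \<noteq> i" using j by auto
    have "((\<lambda>t. y (\<Phi> (z(j := t))) l) has_real_derivative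
        (\<Sum>k\<in>J. d k * lev (P k l) (y (\<Phi> (z(j := z j)))))) (at (z j))"
    proof (rule curve_derivative)
      show "\<Phi> (z(j := z j)) \<in> cube J c \<delta>" using \<Phi>(2)[OF z] by simp
      fix k assume "k \<in> J"
      show "((\<lambda>t. \<Phi> (z(j := t)) k) has_real_derivative d k) (at (z j))"
      proof (cases "k = i")
        case True
        thus ?thesis using \<psi>_der[OF z j] by (simp add: \<Phi>_def d_def)
      next
        case False
        thus ?thesis by (cases "k = j") (auto simp: \<Phi>_def d_def)
      qed
    qed (rule l)
    also have "(\<Sum>k\<in>J. d k * lev (P k l) (y (\<Phi> (z(j := z j))))) =
        (\<Sum>k\<in>{i, j}. d k * lev (P k l) (y (\<Phi> z)))"
      unfolding z_id using finite_J i jJ by (intro sum.mono_neutral_right) (auto simp: d_def)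
    also have "\<dots> = lev (Q j l) (y' z)"
    proof -
      have "lev (P j l) (y' z) = lev (P j l) (y (\<Phi> z))" "lev (P i l) (y' z) = lev (P i l) (y (\<Phi> z))"
        "lev (lder (P j) q) (y' z) = lev (lder (P j) q) (y (\<Phi> z))"
        using jJ i l vars lvar_lder_P[OF q] by (auto intro!: lev_y')
      moreover have "y' z p = 1 / lev fi (y (\<Phi> z))" by (simp add: y'_def)
      ultimately show ?thesis using jJ by (simp add: Q_def d_def lev_Cons)
    qed
    finally show ?thesis .
  qed
  have chain': "chain ?J z0 \<epsilon> (Suc p) y' P'"
  proof
    show "finite ?J" using finite_J by simp
    show "\<epsilon> > 0" by (rule \<epsilon>)
    show "y' z l = y' z' l" if "l < Suc p" "\<And>j. j \<in> ?J \<Longrightarrow> z j = z' j" for l z z'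
    proof -
      have "\<Phi> z k = \<Phi> z' k" if "k \<in> J" for k
        using that \<psi>_dep[of z z'] \<open>\<And>j. j \<in> ?J \<Longrightarrow> z j = z' j\<close> by (auto simp: \<Phi>_def)
      hence "l < p \<Longrightarrow> y (\<Phi> z) l = y (\<Phi> z') l" "lev fi (y (\<Phi> z)) = lev fi (y (\<Phi> z'))"
        using dep lev_dep[OF fi] by blast+
      thus ?thesis by (simp add: y'_def)
    qed
    obtain R where R: "\<forall>z\<in>cube J c \<delta>. \<forall>i<p. \<bar>y z i\<bar> \<le> R" using bounded by blast
    show "\<exists>R. \<forall>z\<in>cube ?J z0 \<epsilon>. \<forall>i<Suc p. \<bar>y' z i\<bar> \<le> R"
    proof (intro exI ballI allI impI)
      fix z l assume z: "z \<in> cube ?J z0 \<epsilon>" and l: "l < Suc p"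
      show "\<bar>y' z l\<bar> \<le> max R (2 / \<bar>m\<bar>)"
      proof (cases "l < p")
        case True
        thus ?thesis using R \<Phi>(2)[OF z] by (auto simp: y'_def le_max_iff_disj)
      next
        case False
        have "\<bar>lev fi (y (\<Phi> z))\<bar> \<ge> \<bar>m\<bar> / 2"
          using fi_big[OF \<Phi>(1)[OF z]] by (simp add: sgn_if split: if_splits)
        hence "1 / \<bar>lev fi (y (\<Phi> z))\<bar> \<le> 1 / (\<bar>m\<bar> / 2)" using m by (intro divide_left_mono) auto
        thus ?thesis using False by (simp add: y'_def le_max_iff_disj)
      qed
    qed
    show "lvar (Suc p) (P' j l)" if "j \<in> ?J" "l < Suc p" for j l
    proof (cases "l < p")
      case True
      thus ?thesis using that Q by (auto simp: P'_def)
    next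
      case False
      have "lvar (Suc p) (lder (Q j) fi)"
        using that by (intro lvar_lder'[OF fi] Q) auto
      thus ?thesis using False by (simp add: P'_def)
    qed
    fix z j l assume z: "z \<in> cube ?J z0 \<epsilon>" and j: "j \<in> ?J" and l: "l < Suc p"
    have z_id: "z(j := z j) = z" by simp
    have inv: "((\<lambda>t. lev fi (y (\<Phi> (z(j := t))))) has_real_derivative lev (lder (Q j) fi) (y' z)) (at (z j))"
    proof -
      have "((\<lambda>t. lev fi (y' (z(j := t)))) has_real_derivative lev (lder (Q j) fi) (y' (z(j := z j)))) (at (z j))"
        by (rule lev_lder_has_derivative[OF fi]) (simp add: y'_less derQ[OF z j] del: fun_upd_apply)
      thus ?thesis using lev_y'[OF fi] by simp
    qed
    show "((\<lambda>s. y' (z(j := s)) l) has_real_derivative lev (P' j l) (y' z)) (at (z j))"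
    proof (cases "l < p")
      case True
      thus ?thesis using derQ[OF z j True] by (simp add: P'_def) (simp add: y'_def)
    next
      case False
      hence [simp]: "l = p" using l by simp
      have nz: "lev fi (y (\<Phi> (z(j := z j)))) \<noteq> 0" using fi_nz[OF \<Phi>(1)[OF z]] by simp
      have "((\<lambda>t. inverse (lev fi (y (\<Phi> (z(j := t)))))) has_real_derivative
          - (inverse (lev fi (y (\<Phi> (z(j := z j))))) * lev (lder (Q j) fi) (y' z) * inverse (lev fi (y (\<Phi> (z(j := z j))))))) (at (z j))"
        by (rule DERIV_inverse'[OF inv nz])
      moreover have "y' z p = inverse (lev fi (y (\<Phi> z)))" by (simp add: y'_def inverse_eq_divide)
      ultimately show ?thesis
        by (simp add: P'_def lev_Cons algebra_simps) (simp add: y'_def inverse_eq_divide)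
    qed
  qed
  show ?thesis
  proof (rule that)
    show "\<epsilon> > 0" by (rule \<epsilon>)
    show "cube J z0 \<epsilon> \<subseteq> cube J c \<delta>" using r1(2) \<epsilon> cube_mono[of \<epsilon> r1 J z0] by auto
    show "z(i := \<psi> z) \<in> cube J c \<delta>" if "z \<in> cube ?J z0 \<epsilon>" for z
      using \<Phi>(2)[OF that] by (simp add: \<Phi>_def)
    show "z i = \<psi> z" if z: "z \<in> cube J z0 \<epsilon>" and 0: "lev q (y z) = 0" for z
    proof -
      have zz: "z \<in> cube ?J z0 \<epsilon>" using z by (auto simp: cube_def)
      have "\<bar>z i - z0 i\<bar> < r1" using z i \<epsilon> by (force simp: cube_def)
      thus ?thesis using uniq[OF zz _ \<psi>(1)[OF zz], of "z i"] \<psi>(2)[OF zz] 0 by (simp add: f_def)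
    qed
    show "chain ?J z0 \<epsilon> (Suc p) (\<lambda>z l. if l < p then y (z(i := \<psi> z)) l else
        1 / lev (lder (P i) q) (y (z(i := \<psi> z)))) P'"
      using chain' unfolding y'_def \<Phi>_def fi_def .
  qed
qed

end

section \<open>Selection of solutions of polynomial systems\<close>

text \<open>The boxes constrain only the coordinates in \<open>X\<close>, so \<open>nowhere\<close> and \<open>thin\<close> say that the projection of
  the set to these coordinates is nowhere dense or meagre.\<close>

definition nowhere :: "nat set \<Rightarrow> (nat \<Rightarrow> real) set \<Rightarrow> bool" where
  "nowhere X F \<longleftrightarrow> (\<forall>c \<delta>. \<delta> > 0 \<longrightarrow>
     (\<exists>c' \<delta>'. \<delta>' > 0 \<and> cube X c' \<delta>' \<subseteq> cube X c \<delta> \<and> F \<inter> cube X c' \<delta>' = {}))"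

definition thin :: "nat set \<Rightarrow> (nat \<Rightarrow> real) set \<Rightarrow> bool" where
  "thin X E \<longleftrightarrow> (\<exists>F :: nat \<Rightarrow> (nat \<Rightarrow> real) set. E \<subseteq> (\<Union>k. F k) \<and> (\<forall>k. nowhere X (F k)))"

lemma thin_subset: "thin X E \<Longrightarrow> D \<subseteq> E \<Longrightarrow> thin X D"
  unfolding thin_def by (meson order_trans)

lemma nowhere_thin: "nowhere X E \<Longrightarrow> thin X E"
  unfolding thin_def by (rule exI[of _ "\<lambda>_. E"]) auto

lemma thin_empty: "thin X {}"
  by (rule nowhere_thin) (auto simp: nowhere_def)

lemma thin_UN_nat:
  assumes "\<And>n. thin X (E n)"
  shows "thin X (\<Union>n::nat. E n)"
proof -
  obtain F where F: "\<And>n. E n \<subseteq> (\<Union>k::nat. F n k)" "\<And>n k. nowhere X (F n k)"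
  proof -
    have "\<forall>n. \<exists>G. E n \<subseteq> (\<Union>k::nat. G k) \<and> (\<forall>k. nowhere X (G k))"
      using assms unfolding thin_def by simp
    from choice[OF this] show ?thesis using that by auto
  qed
  have "(\<Union>n. E n) \<subseteq> (\<Union>m. case_prod F (prod_decode m))"
  proof
    fix x assume "x \<in> (\<Union>n. E n)"
    then obtain n where "x \<in> E n" by (rule UN_E)
    with F(1)[of n] have "x \<in> (\<Union>k. F n k)" by (rule subsetD)
    then obtain k where "x \<in> F n k" by (rule UN_E)
    hence "x \<in> case_prod F (prod_decode (prod_encode (n, k)))" by simp
    thus "x \<in> (\<Union>m. case_prod F (prod_decode m))" by (rule UN_I[OF UNIV_I])
  qed
  moreover have "nowhere X (case_prod F (prod_decode m))" for m
    using F(2) by (simp split: prod.split)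
  ultimately show ?thesis unfolding thin_def by (intro exI conjI allI)
qed

lemma thin_UN:
  assumes "countable I" "\<And>i. i \<in> I \<Longrightarrow> thin X (E i)"
  shows "thin X (\<Union>i\<in>I. E i)"
proof (cases "I = {}")
  case False
  have "thin X (\<Union>n. E (from_nat_into I n))"
    using False assms by (intro thin_UN_nat) (auto intro: from_nat_into)
  moreover have "(\<Union>i\<in>I. E i) \<subseteq> (\<Union>n. E (from_nat_into I n))"
    using from_nat_into_surj[OF assms(1)] by blast
  ultimately show ?thesis by (rule thin_subset)
qed (simp add: thin_empty)

text \<open>Baire's theorem for the coordinates in \<open>X\<close>: nested boxes that avoid the
  sets one after another shrink to a point.\<close>

lemma not_thin_UNIV: "\<not> thin X UNIV"
proof
  assume "thin X UNIV"
  then obtain F :: "nat \<Rightarrow> (nat \<Rightarrow> real) set" where F: "UNIV \<subseteq> (\<Union>k. F k)" "\<And>k. nowhere X (F k)"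
    unfolding thin_def by blast
  \<comment> \<open>Each box lies in the half-size box around the previous centre, so that the limit
    of the centres belongs to all the open boxes.\<close>
  have "\<exists>f :: nat \<Rightarrow> (nat \<Rightarrow> real) \<times> real. \<forall>n. snd (f n) > 0 \<and>
      (snd (f (Suc n)) \<le> snd (f n) / 2 \<and> cube X (fst (f (Suc n))) (snd (f (Suc n))) \<subseteq> cube X (fst (f n)) (snd (f n) / 2) \<and>
       F n \<inter> cube X (fst (f (Suc n))) (snd (f (Suc n))) = {})"
  proof (rule dependent_nat_choice)
    show "\<exists>x. snd x > (0::real)" by (rule exI[of _ "(undefined, 1)"]) simp
    fix x :: "(nat \<Rightarrow> real) \<times> real" and n assume x: "snd x > 0"
    obtain c' \<delta>' where *: "\<delta>' > 0" "cube X c' \<delta>' \<subseteq> cube X (fst x) (snd x / 2)" "F n \<inter> cube X c' \<delta>' = {}"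
      using F(2)[of n] x unfolding nowhere_def by (metis half_gt_zero)
    show "\<exists>y. snd y > 0 \<and> snd y \<le> snd x / 2 \<and>
        cube X (fst y) (snd y) \<subseteq> cube X (fst x) (snd x / 2) \<and> F n \<inter> cube X (fst y) (snd y) = {}"
      using * x cube_mono[of "min \<delta>' (snd x / 2)" \<delta>' X c']
      by (intro exI[of _ "(c', min \<delta>' (snd x / 2))"]) auto
  qed
  then obtain f where f: "\<And>n. snd (f n) > (0::real)" "\<And>n. snd (f (Suc n)) \<le> snd (f n) / 2"
    "\<And>n. cube X (fst (f (Suc n))) (snd (f (Suc n))) \<subseteq> cube X (fst (f n)) (snd (f n) / 2)"
    "\<And>n. F n \<inter> cube X (fst (f (Suc n))) (snd (f (Suc n))) = {}" by blast
  define c where "c = (\<lambda>n. fst (f n))"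
  define d where "d = (\<lambda>n. snd (f n))"
  have d: "d n \<le> d 0 * (1 / 2) ^ n" for n
    by (induction n) (use f(2) in \<open>auto simp: d_def intro: order_trans\<close>)
  have nest: "cube X (c m) (d m) \<subseteq> cube X (c n) (d n)" if "n \<le> m" for n m
    using that
  proof (induction m rule: dec_induct)
    case (step m)
    have "cube X (c (Suc m)) (d (Suc m)) \<subseteq> cube X (c m) (d m / 2)" using f(3) by (simp add: c_def d_def)
    also have "\<dots> \<subseteq> cube X (c m) (d m)" using f(1)[of m] by (intro cube_mono) (auto simp: d_def)
    finally show ?case using step by blast
  qed auto
  have near: "\<bar>c m i - c n i\<bar> < d n / 2" if "n < m" "i \<in> X" for n m i
  proof -
    have "c m \<in> cube X (c m) (d m)" using f(1) by (auto simp: d_def intro: cube_center)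
    also have "\<dots> \<subseteq> cube X (c (Suc n)) (d (Suc n))" using that by (intro nest) auto
    also have "\<dots> \<subseteq> cube X (c n) (d n / 2)" using f(3) by (simp add: c_def d_def)
    finally show ?thesis using that by (auto simp: cube_def)
  qed
  have d0: "d \<longlonglongrightarrow> 0"
  proof (rule Lim_null_comparison)
    show "(\<lambda>n. d 0 * (1 / 2) ^ n) \<longlonglongrightarrow> 0"
      using tendsto_mult_right_zero[OF LIMSEQ_power_zero[of "1/2::real"]] by simp
    show "\<forall>\<^sub>F n in sequentially. norm (d n) \<le> d 0 * (1 / 2) ^ n"
      using d f(1) by (intro always_eventually) (auto simp: d_def less_imp_le)
  qed
  have "\<exists>l. (\<lambda>n. c n i) \<longlonglongrightarrow> l" if i: "i \<in> X" for i
  proof -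
    have "Cauchy (\<lambda>n. c n i)"
    proof (rule CauchyI')
      fix e :: real assume "e > 0"
      hence "\<forall>\<^sub>F n in sequentially. d n < e" using d0 by (intro order_tendstoD(2)) auto
      then obtain N where N: "\<And>n. n \<ge> N \<Longrightarrow> d n < e" by (auto simp: eventually_sequentially)
      show "\<exists>M. \<forall>m\<ge>M. \<forall>n>m. dist (c m i) (c n i) < e"
      proof (intro exI allI impI)
        fix m n assume "m \<ge> N" "n > m"
        hence "\<bar>c n i - c m i\<bar> < d m / 2" "d m < e" using near[of m n i] N i by auto
        moreover have "d m > 0" using f(1) by (simp add: d_def)
        ultimately show "dist (c m i) (c n i) < e" by (simp add: dist_real_def abs_minus_commute)
      qed
    qed
    thus ?thesis by (simp add: Cauchy_convergent_iff convergent_def)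
  qed
  then obtain z where z: "\<And>i. i \<in> X \<Longrightarrow> (\<lambda>n. c n i) \<longlonglongrightarrow> z i" by metis
  have "z \<in> cube X (c n) (d n)" for n
  proof -
    have "\<bar>z i - c n i\<bar> < d n" if i: "i \<in> X" for i
    proof -
      have "(\<lambda>m. \<bar>c m i - c n i\<bar>) \<longlonglongrightarrow> \<bar>z i - c n i\<bar>" by (intro tendsto_rabs tendsto_diff z i tendsto_const)
      moreover have "\<exists>N. \<forall>m\<ge>N. \<bar>c m i - c n i\<bar> \<le> d n / 2"
        using near[of n _ i] i by (intro exI[of _ "Suc n"]) (auto simp: less_imp_le)
      ultimately have "\<bar>z i - c n i\<bar> \<le> d n / 2" by (rule LIMSEQ_le_const2)
      thus ?thesis using f(1)[of n] by (simp add: d_def)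
    qed
    thus ?thesis by (auto simp: cube_def)
  qed
  hence "z \<notin> F n" for n using f(4)[of n] by (auto simp: c_def d_def)
  thus False using F(1) by blast
qed

lemma not_thin_dense:
  assumes "\<not> thin X E"
  shows "\<exists>c \<delta>. \<delta> > 0 \<and> (\<forall>c' \<delta>'. \<delta>' > 0 \<longrightarrow> cube X c' \<delta>' \<subseteq> cube X c \<delta> \<longrightarrow> E \<inter> cube X c' \<delta>' \<noteq> {})"
  using assms nowhere_thin[of X E] unfolding nowhere_def by meson

lemma open_cube: "finite J \<Longrightarrow> open (cube J c \<delta>)"
proof -
  assume J: "finite J"
  have "cube J c \<delta> = (\<Inter>j\<in>J. {z. \<bar>z j - c j\<bar> < \<delta>})" by (auto simp: cube_def)
  moreover have "open {z :: nat \<Rightarrow> real. \<bar>z j - c j\<bar> < \<delta>}" for j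
    by (intro open_Collect_less continuous_intros continuous_on_product_coordinates)
  ultimately show ?thesis using J by auto
qed

section \<open>Iterated derivatives and the identity theorem\<close>

definition lders :: "(nat \<Rightarrow> nat \<Rightarrow> lpoly) \<Rightarrow> nat list \<Rightarrow> lpoly \<Rightarrow> lpoly" where
  "lders P \<alpha> q = foldr (\<lambda>j. lder (P j)) \<alpha> q"

lemma lders_simps [simp]: "lders P [] q = q" "lders P (j # \<alpha>) q = lder (P j) (lders P \<alpha> q)"
  by (simp_all add: lders_def)

lemma lders_replicate: "(lder (P j) ^^ m) (lders P \<beta> q) = lders P (replicate m j @ \<beta>) q"
  by (induction m) auto

context chain begin

lemma lvar_lders: "lvar p q \<Longrightarrow> set \<alpha> \<subseteq> J \<Longrightarrow> lvar p (lders P \<alpha> q)"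
  by (induction \<alpha>) (auto intro: lvar_lder_P)

lemma chain_restrict:
  assumes "cube J c' \<delta>' \<subseteq> cube J c \<delta>" "\<delta>' > 0"
  shows "chain J c' \<delta>' p y P"
proof
  show "\<exists>R. \<forall>z\<in>cube J c' \<delta>'. \<forall>i<p. \<bar>y z i\<bar> \<le> R" using bounded assms by blast
qed (use finite_J dep vars part assms in blast)+

lemma chain_freeze:
  assumes "X \<subseteq> J"
  shows "chain X c \<delta> p (\<lambda>z. y (\<lambda>l. if l \<in> X then z l else c l)) P"
proof
  have fr: "(\<lambda>l. if l \<in> X then z l else c l) \<in> cube J c \<delta>" if "z \<in> cube X c \<delta>" for z
    using that \<delta>_pos by (auto simp: cube_def)
  show "finite X" using finite_J assms finite_subset by blast
  show "\<delta> > 0" by (rule \<delta>_pos)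
  show "\<exists>R. \<forall>z\<in>cube X c \<delta>. \<forall>i<p. \<bar>y (\<lambda>l. if l \<in> X then z l else c l) i\<bar> \<le> R"
    using bounded fr by blast
  show "lvar p (P j i)" if "j \<in> X" "i < p" for j i using that assms by (intro vars) auto
  show "y (\<lambda>l. if l \<in> X then z l else c l) i = y (\<lambda>l. if l \<in> X then z' l else c l) i"
    if "i < p" "\<And>j. j \<in> X \<Longrightarrow> z j = z' j" for i z z'
    using that(2) by (intro dep[OF that(1)]) auto
  fix z j i assume z: "z \<in> cube X c \<delta>" and j: "j \<in> X" and i: "i < p"
  have "(\<lambda>l. if l \<in> X then (z(j := s)) l else c l) = (\<lambda>l. if l \<in> X then z l else c l)(j := s)" for s
    using j by auto
  thus "((\<lambda>s. y (\<lambda>l. if l \<in> X then (z(j := s)) l else c l) i) has_real_derivative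
      lev (P j i) (y (\<lambda>l. if l \<in> X then z l else c l))) (at (z j))"
    using part[OF fr[OF z] _ i, of j] j assms by auto
qed

text \<open>A set that is not thin is dense in some box, and a continuous function that vanishes on
  a dense set vanishes.\<close>

lemma dense_zero:
  assumes q: "lvar p q" and E: "E \<subseteq> cube J c \<delta>" "\<And>z. z \<in> E \<Longrightarrow> lev q (y z) = 0" and nt: "\<not> thin J E"
  shows "\<exists>c' \<delta>'. \<delta>' > 0 \<and> cube J c' \<delta>' \<subseteq> cube J c \<delta> \<and> (\<forall>z\<in>cube J c' \<delta>'. lev q (y z) = 0)"
proof -
  obtain c1 \<delta>1 where d: "\<delta>1 > 0"
    "\<And>c' \<delta>'. \<delta>' > 0 \<Longrightarrow> cube J c' \<delta>' \<subseteq> cube J c1 \<delta>1 \<Longrightarrow> E \<inter> cube J c' \<delta>' \<noteq> {}"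
    using not_thin_dense[OF nt] by blast
  obtain z0 where z0: "z0 \<in> E" "z0 \<in> cube J c1 \<delta>1" using d(2)[of \<delta>1 c1] d(1) by auto
  obtain r1 where r1: "r1 > 0" "cube J z0 r1 \<subseteq> cube J c1 \<delta>1" using cube_shrink[OF finite_J z0(2)] by blast
  obtain r2 where r2: "r2 > 0" "cube J z0 r2 \<subseteq> cube J c \<delta>" using cube_shrink[OF finite_J] z0(1) E(1) by blast
  define r where "r = min r1 r2"
  have r: "r > 0" "cube J z0 r \<subseteq> cube J c1 \<delta>1" "cube J z0 r \<subseteq> cube J c \<delta>"
    using r1 r2 cube_mono[of r r1 J z0] cube_mono[of r r2 J z0] by (auto simp: r_def)
  have "lev q (y z) = 0" if z: "z \<in> cube J z0 r" for z
  proof (rule ccontr)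
    assume nz: "lev q (y z) \<noteq> 0"
    obtain s1 where s1: "s1 > 0" "\<And>w. w \<in> cube J z s1 \<Longrightarrow> \<bar>lev q (y w) - lev q (y z)\<bar> < \<bar>lev q (y z)\<bar>"
      using lev_near[OF q subsetD[OF r(3) z], of "\<bar>lev q (y z)\<bar>"] nz by auto
    obtain s2 where s2: "s2 > 0" "cube J z s2 \<subseteq> cube J z0 r" using cube_shrink[OF finite_J z] by blast
    have "cube J z (min s1 s2) \<subseteq> cube J c1 \<delta>1"
      using s2 r(2) cube_mono[of "min s1 s2" s2 J z] by auto
    then obtain w where w: "w \<in> E" "w \<in> cube J z (min s1 s2)" using d(2)[of "min s1 s2" z] s1 s2 by auto
    have "w \<in> cube J z s1" using w(2) cube_mono[of "min s1 s2" s1 J z] by auto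
    from s1(2)[OF this] E(2)[OF w(1)] show False by simp
  qed
  thus ?thesis using r by blast
qed

text \<open>All derivatives in the directions \<open>K\<close> are carried along, not just
  \<open>q\<close>, so that the move can be repeated in the next coordinate.\<close>

lemma identity_move:
  assumes z: "z \<in> cube J c \<delta>" "z(j := s) \<in> cube J c \<delta>" and j: "j \<in> K" "K \<subseteq> J" and q: "lvar p q"
    and 0: "\<And>\<alpha>. set \<alpha> \<subseteq> K \<Longrightarrow> lev (lders P \<alpha> q) (y z) = 0" and \<beta>: "set \<beta> \<subseteq> K"
  shows "lev (lders P \<beta> q) (y (z(j := s))) = 0"
proof -
  have jJ: "j \<in> J" using j by auto
  obtain R where R: "\<forall>z\<in>cube J c \<delta>. \<forall>i<p. \<bar>y z i\<bar> \<le> R" using bounded by blast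
  have cube: "z(j := t) \<in> cube J c \<delta>" if "t \<in> {c j - \<delta><..<c j + \<delta>}" for t
    using z(1) that by (intro cube_updI) (auto simp: abs_less_iff)
  have in_ivl: "t \<in> {c j - \<delta><..<c j + \<delta>}" if "z(j := t) \<in> cube J c \<delta>" for t
    using that jJ by (auto simp: cube_def abs_less_iff dest!: bspec[of _ _ j])
  show ?thesis
  proof (rule flat_lev_vanishes[where P="P j" and p=p and Y="\<lambda>t. y (z(j := t))" and R=R and
        a="c j - \<delta>" and b="c j + \<delta>" and ?s0.0="z j"])
    show "lvar p (lders P \<beta> q)" using \<beta> j(2) by (intro lvar_lders q) auto
    show "lvar p (P j i)" if "i < p" for i by (rule vars[OF jJ that])
    show "((\<lambda>t. y (z(j := t)) i) has_real_derivative lev (P j i) (y (z(j := s)))) (at s)"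
      if "s \<in> {c j - \<delta><..<c j + \<delta>}" "i < p" for s i
      using part[OF cube[OF that(1)] jJ that(2)] by simp
    show "\<bar>y (z(j := s)) i\<bar> \<le> R" if "s \<in> {c j - \<delta><..<c j + \<delta>}" "i < p" for s i
      using R cube[OF that(1)] that(2) by blast
    show "z j \<in> {c j - \<delta><..<c j + \<delta>}" using z(1) by (intro in_ivl) simp
    show "lev ((lder (P j) ^^ m) (lders P \<beta> q)) (y (z(j := z j))) = 0" for m
      using \<beta> j(1) unfolding lders_replicate by (simp, intro 0) auto
    show "s \<in> {c j - \<delta><..<c j + \<delta>}" by (rule in_ivl[OF z(2)])
  qed
qed

lemma identity_theorem:
  assumes z: "z \<in> cube J c \<delta>" and z': "z' \<in> cube J c \<delta>" and K: "K \<subseteq> J" and q: "lvar p q"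
    and 0: "\<And>\<alpha>. set \<alpha> \<subseteq> K \<Longrightarrow> lev (lders P \<alpha> q) (y z) = 0"
    and eq: "\<And>j. j \<in> J - K \<Longrightarrow> z j = z' j"
  shows "lev q (y z') = 0"
proof -
  define W where "W = (\<lambda>L j. if j \<in> L then z' j else z j)"
  have Wbox: "W L \<in> cube J c \<delta>" for L using z z' by (auto simp: W_def cube_def)
  have "\<forall>\<beta>. set \<beta> \<subseteq> K \<longrightarrow> lev (lders P \<beta> q) (y (W L)) = 0" if "L \<subseteq> K" for L
    using finite_subset[OF order_trans[OF that K] finite_J] that
  proof (induction L rule: finite_induct)
    case empty
    have "W {} = z" by (auto simp: W_def)
    thus ?case using 0 by simp
  next
    case (insert k L)
    have eq: "W (insert k L) = (W L)(k := z' k)" by (auto simp: W_def)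
    have IH: "\<And>\<beta>. set \<beta> \<subseteq> K \<Longrightarrow> lev (lders P \<beta> q) (y (W L)) = 0" using insert by auto
    show ?case
    proof (intro allI impI)
      fix \<beta> assume \<beta>: "set \<beta> \<subseteq> K"
      show "lev (lders P \<beta> q) (y (W (insert k L))) = 0" unfolding eq
      proof (rule identity_move[OF Wbox _ _ K q IH \<beta>])
        show "(W L)(k := z' k) \<in> cube J c \<delta>" using Wbox[of "insert k L"] by (simp only: eq)
        show "k \<in> K" using insert by auto
      qed
    qed
  qed
  from this[of K] have "lev q (y (W K)) = 0" using lders_simps(1) by (metis empty_set empty_subsetI order_refl)
  moreover have "lev q (y (W K)) = lev q (y z')"
    using eq by (intro lev_dep[OF q]) (auto simp: W_def)
  ultimately show ?thesis by simp
qed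

end

text \<open>A coordinate outside \<open>X\<close> is eliminated as follows. By Baire, either all iterated derivatives of \<open>h\<close> in the
  directions outside \<open>X\<close> vanish on a set that is not thin, and then the coordinates can be frozen by the identity
  theorem; or some iterated derivative vanishes while one of its partial derivatives does not, and then the
  implicit function theorem applies to it.\<close>

theorem selection:
  assumes "chain J c \<delta> p y P" "X \<subseteq> J" "lvar p h" "S \<subseteq> cube J c \<delta>"
    and "\<And>z. z \<in> S \<Longrightarrow> lev h (y z) = 0" and "\<not> thin X S"
  shows "\<exists>c' \<delta>' p' y' P' \<Phi>. chain X c' \<delta>' p' y' P' \<and> p \<le> p' \<and>
    (\<forall>z\<in>cube X c' \<delta>'. \<Phi> z \<in> cube J c \<delta> \<and> (\<forall>i\<in>X. \<Phi> z i = z i) \<and> lev h (y (\<Phi> z)) = 0 \<and>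
      (\<forall>l<p. y' z l = y (\<Phi> z) l))"
  using assms
proof (induction "card (J - X)" arbitrary: J c \<delta> p y P S rule: less_induct)
  case less
  interpret chain J c \<delta> p y P by (rule less.prems(1))
  define K where "K = J - X"
  have KJ: "K \<subseteq> J" and finK: "finite K" using finite_J by (auto simp: K_def)
  define A where "A = {z \<in> S. \<forall>\<alpha>. set \<alpha> \<subseteq> K \<longrightarrow> lev (lders P \<alpha> h) (y z) = 0}"
  define B where "B = (\<lambda>(\<alpha>, i). {z \<in> S. lev (lders P \<alpha> h) (y z) = 0 \<and> lev (lder (P i) (lders P \<alpha> h)) (y z) \<noteq> 0})"
  \<comment> \<open>If an iterated derivative is nonzero at \<open>z\<close>, take the shortest tail
    of its word with this property. It is nonempty since \<open>h\<close> vanishes at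
    \<open>z\<close>, and dropping its first letter gives a derivative that vanishes.\<close>
  have cover: "S \<subseteq> A \<union> (\<Union>\<alpha>i\<in>{\<alpha>. set \<alpha> \<subseteq> K} \<times> K. B \<alpha>i)"
  proof
    fix z assume z: "z \<in> S"
    have *: "set \<alpha> \<subseteq> K \<Longrightarrow> lev (lders P \<alpha> h) (y z) = 0 \<or> z \<in> (\<Union>\<alpha>i\<in>{\<alpha>. set \<alpha> \<subseteq> K} \<times> K. B \<alpha>i)" for \<alpha>
    proof (induction \<alpha>)
      case Nil
      thus ?case using less.prems(5)[OF z] by simp
    next
      case (Cons i \<alpha>)
      thus ?case using z by (cases "lev (lders P (i # \<alpha>) h) (y z) = 0") (force simp: B_def)+
    qed
    thus "z \<in> A \<union> (\<Union>\<alpha>i\<in>{\<alpha>. set \<alpha> \<subseteq> K} \<times> K. B \<alpha>i)" using z by (auto simp: A_def)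
  qed
  show ?case
  proof (cases "thin X A")
    case False
    define fr where "fr = (\<lambda>z l. if l \<in> X then z l else c l)"
    interpret fr: chain X c \<delta> p "\<lambda>z. y (fr z)" P
      unfolding fr_def by (rule chain_freeze[OF less.prems(2)])
    have frb: "fr z \<in> cube J c \<delta>" if "z \<in> cube X c \<delta>" for z
      using that \<delta>_pos by (auto simp: cube_def fr_def)
    have SX: "z \<in> cube X c \<delta>" "z \<in> cube J c \<delta>" if "z \<in> A" for z
      using that less.prems(2,4) by (auto simp: A_def cube_def)
    have "lev h (y (fr z)) = 0" if "z \<in> A" for z
      by (rule identity_theorem[OF SX(2)[OF that] frb[OF SX(1)[OF that]] KJ less.prems(3)])
        (use that in \<open>auto simp: A_def K_def fr_def\<close>)
    from fr.dense_zero[OF less.prems(3) _ this False] SX(1)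
    obtain c' \<delta>' where *: "\<delta>' > 0" "cube X c' \<delta>' \<subseteq> cube X c \<delta>" "\<And>z. z \<in> cube X c' \<delta>' \<Longrightarrow> lev h (y (fr z)) = 0"
      by blast
    show ?thesis
      using fr.chain_restrict[OF *(2,1)] * frb
      by (intro exI[of _ c'] exI[of _ \<delta>'] exI[of _ p] exI[of _ "\<lambda>z. y (fr z)"] exI[of _ P] exI[of _ fr])
        (auto simp: fr_def)
  next
    case True
    have cnt: "countable ({\<alpha>. set \<alpha> \<subseteq> K} \<times> K)" by (intro countable_SIGMA countableI_type)
    have "\<not> thin X (\<Union>\<alpha>i\<in>{\<alpha>. set \<alpha> \<subseteq> K} \<times> K. B \<alpha>i)"
    proof
      assume t: "thin X (\<Union>\<alpha>i\<in>{\<alpha>. set \<alpha> \<subseteq> K} \<times> K. B \<alpha>i)"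
      have "thin X (\<Union>b\<in>UNIV. if b then A else (\<Union>\<alpha>i\<in>{\<alpha>. set \<alpha> \<subseteq> K} \<times> K. B \<alpha>i))"
        by (rule thin_UN) (use t True in \<open>auto intro: countableI_type\<close>)
      hence "thin X S" by (rule thin_subset) (use cover in \<open>auto split: if_splits\<close>)
      thus False using less.prems(6) by blast
    qed
    then obtain \<alpha>i where "\<alpha>i \<in> {\<alpha>. set \<alpha> \<subseteq> K} \<times> K" "\<not> thin X (B \<alpha>i)" using thin_UN[OF cnt] by blast
    then obtain \<alpha> i where \<alpha>: "set \<alpha> \<subseteq> K" and i: "i \<in> K" and nt: "\<not> thin X (B (\<alpha>, i))" by auto
    define q where "q = lders P \<alpha> h"
    have q: "lvar p q" unfolding q_def using \<alpha> KJ by (intro lvar_lders less.prems(3)) auto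
    have iJ: "i \<in> J" using i KJ by auto
    define Chart where "Chart z0 \<epsilon> \<psi> P' \<longleftrightarrow> \<epsilon> > 0 \<and> cube J z0 \<epsilon> \<subseteq> cube J c \<delta> \<and>
      (\<forall>z. z \<in> cube (J - {i}) z0 \<epsilon> \<longrightarrow> z(i := \<psi> z) \<in> cube J c \<delta>) \<and>
      (\<forall>z. z \<in> cube J z0 \<epsilon> \<longrightarrow> lev q (y z) = 0 \<longrightarrow> z i = \<psi> z) \<and>
      chain (J - {i}) z0 \<epsilon> (Suc p)
       (\<lambda>z l. if l < p then y (z(i := \<psi> z)) l else 1 / lev (lder (P i) q) (y (z(i := \<psi> z)))) P'"
      for z0 \<epsilon> \<psi> P'
    have "\<exists>\<epsilon> \<psi> P'. Chart z0 \<epsilon> \<psi> P'" if "z0 \<in> B (\<alpha>, i)" for z0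
    proof -
      have "z0 \<in> cube J c \<delta>" "lev q (y z0) = 0" "lev (lder (P i) q) (y z0) \<noteq> 0"
        using that less.prems(4) by (auto simp: B_def q_def)
      thus ?thesis
        by (rule implicit_function[OF _ iJ q]) (unfold Chart_def, blast)
    qed
    then obtain \<epsilon> where \<epsilon>: "\<And>z0. z0 \<in> B (\<alpha>, i) \<Longrightarrow> \<exists>\<psi> P'. Chart z0 (\<epsilon> z0) \<psi> P'" by metis
    \<comment> \<open>The charts may form an uncountable cover. By the Lindelof property countably
      many suffice, and one of them contains a part of the solutions that is not thin.\<close>
    obtain \<F> where \<F>: "\<F> \<subseteq> (\<lambda>z0. cube J z0 (\<epsilon> z0)) ` B (\<alpha>, i)" "countable \<F>"
      "\<Union>\<F> = (\<Union>z0\<in>B (\<alpha>, i). cube J z0 (\<epsilon> z0))"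
      by (rule Lindelof[of "(\<lambda>z0. cube J z0 (\<epsilon> z0)) ` B (\<alpha>, i)"]) (auto intro: open_cube finite_J)
    have "z0 \<in> cube J z0 (\<epsilon> z0)" if "z0 \<in> B (\<alpha>, i)" for z0
      using \<epsilon>[OF that] by (auto simp: Chart_def intro: cube_center)
    hence "B (\<alpha>, i) \<subseteq> (\<Union>U\<in>\<F>. B (\<alpha>, i) \<inter> U)" using \<F>(3) by blast
    hence "\<not> thin X (\<Union>U\<in>\<F>. B (\<alpha>, i) \<inter> U)" using nt thin_subset by blast
    then obtain U where "U \<in> \<F>" "\<not> thin X (B (\<alpha>, i) \<inter> U)" using thin_UN[OF \<F>(2)] by blast
    then obtain z0 where z0: "z0 \<in> B (\<alpha>, i)" and nt': "\<not> thin X (B (\<alpha>, i) \<inter> cube J z0 (\<epsilon> z0))"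
      using \<F>(1) by blast
    from \<epsilon>[OF z0] obtain \<psi> P' where "Chart z0 (\<epsilon> z0) \<psi> P'" by blast
    hence ch: "\<And>z. z \<in> cube (J - {i}) z0 (\<epsilon> z0) \<Longrightarrow> z(i := \<psi> z) \<in> cube J c \<delta>"
      "\<And>z. z \<in> cube J z0 (\<epsilon> z0) \<Longrightarrow> lev q (y z) = 0 \<Longrightarrow> z i = \<psi> z"
      and ch': "chain (J - {i}) z0 (\<epsilon> z0) (Suc p)
       (\<lambda>z l. if l < p then y (z(i := \<psi> z)) l else 1 / lev (lder (P i) q) (y (z(i := \<psi> z)))) P'"
      unfolding Chart_def by blast+
    define y1 where "y1 = (\<lambda>z l. if l < p then y (z(i := \<psi> z)) l else 1 / lev (lder (P i) q) (y (z(i := \<psi> z))))"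
    have lev_y1: "lev h (y1 z) = lev h (y (z(i := \<psi> z)))" for z
      by (rule lev_cong[OF less.prems(3)]) (simp add: y1_def)
    have card: "card (J - {i} - X) < card (J - X)"
      using i finite_J by (intro psubset_card_mono) (auto simp: K_def)
    have IH: "\<exists>c' \<delta>' p' y' P' \<Phi>. chain X c' \<delta>' p' y' P' \<and> Suc p \<le> p' \<and>
      (\<forall>z\<in>cube X c' \<delta>'. \<Phi> z \<in> cube (J - {i}) z0 (\<epsilon> z0) \<and> (\<forall>i\<in>X. \<Phi> z i = z i) \<and> lev h (y1 (\<Phi> z)) = 0 \<and>
      (\<forall>l<Suc p. y' z l = y1 (\<Phi> z) l))"
    proof (rule less.hyps[OF card])
      show "chain (J - {i}) z0 (\<epsilon> z0) (Suc p) y1 P'" using ch' unfolding y1_def .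
      show "X \<subseteq> J - {i}" using i less.prems(2) by (auto simp: K_def)
      show "lvar (Suc p) h" using less.prems(3) by (rule lvar_mono) simp
      show "B (\<alpha>, i) \<inter> cube J z0 (\<epsilon> z0) \<subseteq> cube (J - {i}) z0 (\<epsilon> z0)" by (auto simp: cube_def)
      \<comment> \<open>In the chart the solutions lie on the graph of \<open>\<psi>\<close>, so
        resetting coordinate \<open>i\<close> does not move them.\<close>
      show "lev h (y1 z) = 0" if "z \<in> B (\<alpha>, i) \<inter> cube J z0 (\<epsilon> z0)" for z
      proof -
        have "z i = \<psi> z" using that by (intro ch(2)) (auto simp: B_def q_def)
        hence "z(i := \<psi> z) = z" by auto
        thus ?thesis using less.prems(5) that by (auto simp: lev_y1 B_def)
      qed
      show "\<not> thin X (B (\<alpha>, i) \<inter> cube J z0 (\<epsilon> z0))" by (rule nt')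
    qed
    then obtain c' \<delta>' p' y' P'' \<Phi> where *: "chain X c' \<delta>' p' y' P''" "Suc p \<le> p'"
      "\<And>z. z \<in> cube X c' \<delta>' \<Longrightarrow> \<Phi> z \<in> cube (J - {i}) z0 (\<epsilon> z0) \<and> (\<forall>i\<in>X. \<Phi> z i = z i) \<and>
        lev h (y1 (\<Phi> z)) = 0 \<and> (\<forall>l<Suc p. y' z l = y1 (\<Phi> z) l)"
      by blast
    have iX: "i \<notin> X" using i by (auto simp: K_def)
    show ?thesis
    proof (intro exI conjI ballI)
      show "chain X c' \<delta>' p' y' P''" by (rule *)
      show "p \<le> p'" using *(2) by simp
      fix z assume z: "z \<in> cube X c' \<delta>'"
      let ?\<Phi> = "(\<lambda>z. (\<Phi> z)(i := \<psi> (\<Phi> z)))"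
      show "?\<Phi> z \<in> cube J c \<delta>" using *(3)[OF z] by (intro ch(1)) auto
      show "?\<Phi> z k = z k" if "k \<in> X" for k using that iX *(3)[OF z] by auto
      show "lev h (y (?\<Phi> z)) = 0" using *(3)[OF z] by (simp add: lev_y1)
      show "\<forall>l<p. y' z l = y (?\<Phi> z) l" using *(3)[OF z] by (simp add: y1_def)
    qed
  qed
qed

section \<open>Blow-up of representations as sums of squares\<close>

text \<open>A closure definition suits what is proved about these functions: restriction to curves,
  substitution and continuity are all inductions.\<close>

inductive polyfun :: "((nat \<Rightarrow> real) \<Rightarrow> real) \<Rightarrow> bool" where
  polyfun_const: "polyfun (\<lambda>_. r)"
| polyfun_var: "polyfun (\<lambda>z. z i)"
| polyfun_add: "polyfun f \<Longrightarrow> polyfun g \<Longrightarrow> polyfun (\<lambda>z. f z + g z)"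
| polyfun_mult: "polyfun f \<Longrightarrow> polyfun g \<Longrightarrow> polyfun (\<lambda>z. f z * g z)"

lemma polyfun_sum: "(\<And>i. i \<in> I \<Longrightarrow> polyfun (f i)) \<Longrightarrow> polyfun (\<lambda>z. \<Sum>i\<in>I. f i z)"
  by (induction I rule: infinite_finite_induct) (auto intro: polyfun.intros)

lemma polyfun_prod_list: "polyfun (\<lambda>z. \<Prod>i\<leftarrow>a. z i)"
  by (induction a) (auto intro: polyfun.intros)

lemma lvar_exists: "\<exists>p. lvar p q"
proof (induction q)
  case (Cons ca q)
  then obtain p where p: "lvar p q" by blast
  obtain c a where [simp]: "ca = (c, a)" by force
  have "set a \<subseteq> {..<Suc (sum_list a)}" using member_le_sum_list by (fastforce simp: less_Suc_eq_le)
  hence "set a \<subseteq> {..<max p (Suc (sum_list a))}" by fastforce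
  moreover have "lvar (max p (Suc (sum_list a))) q" using p by (rule lvar_mono) simp
  ultimately show ?case by auto
qed auto

text \<open>The straight line that leaves \<open>v\<close> with the velocity prescribed by the field
  is enough; no integral curve has to exist.\<close>

lemma lev_lder_directional:
  "((\<lambda>t. lev q (\<lambda>i. v i + t * lev (D i) v)) has_real_derivative lev (lder D q) v) (at 0)"
proof -
  obtain p where p: "lvar p q" using lvar_exists by blast
  have "((\<lambda>t. lev q (\<lambda>i. v i + t * lev (D i) v)) has_real_derivative
      lev (lder D q) (\<lambda>i. v i + 0 * lev (D i) v)) (at 0)"
    by (rule lev_lder_has_derivative[OF p]) (auto intro!: derivative_eq_intros)
  thus ?thesis by simp
qed

text \<open>By uniqueness of derivatives, the values of a formal derivative depend only on the
  function that \<open>q\<close> defines, not on the list.\<close>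

lemma lev_lder_cong:
  assumes "\<And>v. lev q v = (\<Sum>i\<in>I. a i * lev (r i) v)"
  shows "lev (lder D q) v = (\<Sum>i\<in>I. a i * lev (lder D (r i)) v)"
proof -
  have "((\<lambda>t. lev q (\<lambda>i. v i + t * lev (D i) v)) has_real_derivative
      (\<Sum>i\<in>I. a i * lev (lder D (r i)) v)) (at 0)"
    unfolding assms by (intro DERIV_sum DERIV_cmult lev_lder_directional)
  thus ?thesis using lev_lder_directional DERIV_unique by blast
qed

lemma lev_lder_linear_field:
  assumes D: "\<And>i v. lev (D i) v = (\<Sum>j\<in>J. h j * lev (P j i) v)" and "finite J"
  shows "lev (lder D q) v = (\<Sum>j\<in>J. h j * lev (lder (P j) q) v)"
proof -
  have *: "lev (tder D a) v = (\<Sum>j\<in>J. h j * lev (tder (P j) a) v)" for a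
    by (induction a) (auto simp: lev_Cons D sum_distrib_left sum_distrib_right sum.distrib algebra_simps)
  show ?thesis
  proof (induction q)
    case (Cons ca q)
    obtain c a where [simp]: "ca = (c, a)" by force
    have "lev (lder D (ca # q)) v = c * lev (tder D a) v + lev (lder D q) v" by (simp add: lder_def)
    also have "\<dots> = (\<Sum>j\<in>J. h j * (c * lev (tder (P j) a) v + lev (lder (P j) q) v))"
      unfolding Cons * by (simp add: sum_distrib_left sum.distrib algebra_simps)
    finally show ?case by (simp add: lder_def)
  qed (simp add: lder_def)
qed

lemma lder_append: "lder D (q @ r) = lder D q @ lder D r"
  by (simp add: lder_def)

lemma lder_scale: "lder D (lscale r q) = lscale r (lder D q)"
proof -
  have "lscale (r * c) q = lscale r (lscale c q)" for c q by (auto simp: lscale_def mult.assoc)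
  moreover have "lscale r (q @ q') = lscale r q @ lscale r q'" for q q' by (simp add: lscale_def)
  moreover have "lscale r ((c, a) # q) = (r * c, a) # lscale r q" for c a q by (simp add: lscale_def)
  moreover have "lscale r [] = []" by (simp add: lscale_def)
  ultimately show ?thesis by (induction q) (auto simp: lder_def)
qed

lemma lder_funpow_append: "(lder D ^^ k) (q @ r) = (lder D ^^ k) q @ (lder D ^^ k) r"
  by (induction k) (auto simp: lder_append)

lemma lder_funpow_scale: "(lder D ^^ k) (lscale r q) = lscale r ((lder D ^^ k) q)"
  by (induction k) (auto simp: lder_scale)

lemma lder_funpow_Nil: "(lder D ^^ k) [] = []"
  by (induction k) (auto simp: lder_def)

text \<open>Bolzano-Weierstrass for finitely many bounded sequences at once; it supplies compactness
  for the blow-up, for order units and for ternary quartics.\<close>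

lemma finite_family_subseq:
  assumes "finite I" "\<And>i k. i \<in> I \<Longrightarrow> \<bar>x i k\<bar> \<le> (B::real)"
  shows "\<exists>r l. strict_mono (r :: nat \<Rightarrow> nat) \<and> (\<forall>i\<in>I. (\<lambda>k. x i (r k)) \<longlonglongrightarrow> l i)"
  using assms
proof (induction I rule: finite_induct)
  case empty
  show ?case by (rule exI[of _ id]) (auto simp: strict_mono_def)
next
  case (insert i I)
  then obtain r l where r: "strict_mono (r :: nat \<Rightarrow> nat)" "\<And>i. i \<in> I \<Longrightarrow> (\<lambda>k. x i (r k)) \<longlonglongrightarrow> l i" by blast
  have "bounded (range (\<lambda>k. x i (r k)))" using insert.prems by (intro boundedI[of _ B]) auto
  then obtain l' s where s: "strict_mono (s :: nat \<Rightarrow> nat)" "((\<lambda>k. x i (r k)) \<circ> s) \<longlonglongrightarrow> l'"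
    using bounded_imp_convergent_subsequence by blast
  have "(\<lambda>k. x j (r (s k))) \<longlonglongrightarrow> (l(i := l')) j" if "j \<in> insert i I" for j
  proof (cases "j = i")
    case False
    thus ?thesis using LIMSEQ_subseq_LIMSEQ[OF r(2)[of j] s(1)] that by (auto simp: o_def)
  qed (use s in \<open>auto simp: o_def\<close>)
  moreover have "strict_mono (r \<circ> s)" by (rule strict_mono_o[OF r(1) s(1)])
  ultimately show ?case by (intro exI[of _ "r \<circ> s"] exI[of _ "l(i := l')"]) (auto simp add: o_def simp del: fun_upd_apply)
qed

section \<open>Jets along rays\<close>

context chain begin

text \<open>Along a ray of direction \<open>h\<close> the functions \<open>y\<close> form an
  integral curve of this field.\<close>

definition dirP :: "(nat \<Rightarrow> real) \<Rightarrow> nat \<Rightarrow> lpoly" where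
  "dirP h i = concat (map (\<lambda>j. lscale (h j) (P j i)) (sorted_list_of_set J))"

definition ray :: "(nat \<Rightarrow> real) \<Rightarrow> real \<Rightarrow> (nat \<Rightarrow> real)" where
  "ray h t = (\<lambda>i. c i + t * h i)"

text \<open>The \<open>k\<close>-th derivative at \<open>t = 0\<close> of \<open>q\<close> along the ray from the centre in direction \<open>h\<close>.\<close>

definition jet :: "nat \<Rightarrow> (nat \<Rightarrow> real) \<Rightarrow> lpoly \<Rightarrow> real" where
  "jet k h q = lev ((lder (dirP h) ^^ k) q) (y c)"

lemma lev_dirP: "lev (dirP h i) v = (\<Sum>j\<in>J. h j * lev (P j i) v)"
proof -
  have "lev (concat (map (\<lambda>j. lscale (h j) (P j i)) xs)) v = (\<Sum>j\<leftarrow>xs. h j * lev (P j i) v)" for xs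
    by (induction xs) auto
  thus ?thesis using finite_J by (simp add: dirP_def sum_list_distinct_conv_sum_set)
qed

lemma lvar_dirP: "i < p \<Longrightarrow> lvar p (dirP h i)"
  unfolding dirP_def using finite_J by (intro lvar_concat) (auto intro!: lvar_scale vars)

lemma lvar_dir_funpow: "lvar p q \<Longrightarrow> lvar p ((lder (dirP h) ^^ k) q)"
  by (induction k) (auto intro!: lvar_lder lvar_dirP)

lemma ray_derivative:
  assumes "ray h t \<in> cube J c \<delta>" "lvar p q"
  shows "((\<lambda>t. lev q (y (ray h t))) has_real_derivative lev (lder (dirP h) q) (y (ray h t))) (at t)"
proof (rule lev_lder_has_derivative[OF assms(2)])
  fix i assume i: "i < p"
  have "((\<lambda>t. ray h t j) has_real_derivative h j) (at t)" for j
    unfolding ray_def by (auto intro!: derivative_eq_intros)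
  from curve_derivative[OF assms(1) i this]
  show "((\<lambda>t. y (ray h t) i) has_real_derivative lev (dirP h i) (y (ray h t))) (at t)"
    by (simp add: lev_dirP)
qed

lemma ray_in_cube: "\<exists>\<tau>>0. \<forall>t. \<bar>t\<bar> < \<tau> \<longrightarrow> ray h t \<in> cube J c \<delta>"
proof -
  define H where "H = 1 + (\<Sum>j\<in>J. \<bar>h j\<bar>)"
  have H: "H > 0" by (auto simp: H_def add_pos_nonneg sum_nonneg)
  have "\<bar>t * h j\<bar> < \<delta>" if "\<bar>t\<bar> < \<delta> / H" "j \<in> J" for t j
  proof -
    have "\<bar>h j\<bar> \<le> (\<Sum>j\<in>J. \<bar>h j\<bar>)" using that finite_J by (intro member_le_sum) auto
    hence "\<bar>h j\<bar> \<le> H" by (simp add: H_def)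
    hence "\<bar>t * h j\<bar> \<le> \<bar>t\<bar> * H" by (simp add: abs_mult mult_left_mono)
    also have "\<dots> < \<delta>" using that H by (simp add: field_simps)
    finally show ?thesis .
  qed
  thus ?thesis using H \<delta>_pos by (intro exI[of _ "\<delta> / H"]) (auto simp: cube_def ray_def)
qed

lemma cube_rayI: "ray h s \<in> cube J c \<delta> \<Longrightarrow> \<bar>t\<bar> \<le> \<bar>s\<bar> \<Longrightarrow> ray h t \<in> cube J c \<delta>"
  unfolding cube_def ray_def by (auto simp: abs_mult intro: le_less_trans[OF mult_right_mono])

text \<open>Quasi-analyticity on the ray. It is stated for open intervals, so the ray first has to
  be prolonged a little beyond \<open>s\<close> inside the open box.\<close>

lemma jet_zero_imp_zero:
  assumes q: "lvar p q" and 0: "\<And>k. jet k h q = 0" and s: "ray h s \<in> cube J c \<delta>"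
  shows "lev q (y (ray h s)) = 0"
proof -
  obtain R where R: "\<forall>z\<in>cube J c \<delta>. \<forall>i<p. \<bar>y z i\<bar> \<le> R" using bounded by blast
  obtain \<epsilon> where e: "\<epsilon> > 0" "cube J (ray h s) \<epsilon> \<subseteq> cube J c \<delta>" using cube_shrink[OF finite_J s] by blast
  have ex: "\<exists>b>\<bar>s\<bar>. \<forall>t. \<bar>t\<bar> < b \<longrightarrow> ray h t \<in> cube J c \<delta>"
  proof (cases "s = 0")
    case True
    thus ?thesis using ray_in_cube[of h] by auto
  next
    case False
    define H where "H = 1 + (\<Sum>j\<in>J. \<bar>h j\<bar>)"
    have H: "H > 0" by (auto simp: H_def add_pos_nonneg sum_nonneg)
    define b where "b = \<bar>s\<bar> + \<epsilon> / (2 * H)"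
    have b: "b > \<bar>s\<bar>" using e H by (simp add: b_def)
    have "ray h (sgn s * b) \<in> cube J (ray h s) \<epsilon>"
    proof -
      have "\<bar>sgn s * b * h j - s * h j\<bar> < \<epsilon>" if "j \<in> J" for j
      proof -
        have "\<bar>h j\<bar> \<le> (\<Sum>j\<in>J. \<bar>h j\<bar>)" using that finite_J by (intro member_le_sum) auto
        hence hH: "\<bar>h j\<bar> \<le> H" by (simp add: H_def)
        have "sgn s * b * h j - s * h j = sgn s * (b - \<bar>s\<bar>) * h j"
        proof -
          have "s * h j = sgn s * \<bar>s\<bar> * h j" by (simp only: mult.commute[of "sgn s"] abs_mult_sgn)
          thus ?thesis by (simp only: left_diff_distrib right_diff_distrib)
        qed
        hence "\<bar>sgn s * b * h j - s * h j\<bar> = \<epsilon> / (2 * H) * \<bar>h j\<bar>"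
          using False e H by (simp add: b_def abs_mult)
        also have "\<dots> \<le> \<epsilon> / (2 * H) * H" using hH e H by (intro mult_left_mono) auto
        also have "\<dots> < \<epsilon>" using e H by simp
        finally show ?thesis .
      qed
      thus ?thesis by (auto simp: cube_def ray_def)
    qed
    hence "ray h (sgn s * b) \<in> cube J c \<delta>" using e by blast
    moreover have "\<bar>sgn s * b\<bar> = b" using False b by (simp add: abs_mult)
    ultimately have "\<forall>t. \<bar>t\<bar> < b \<longrightarrow> ray h t \<in> cube J c \<delta>" by (metis cube_rayI less_imp_le)
    thus ?thesis using b by blast
  qed
  then obtain b where b: "b > \<bar>s\<bar>" "\<And>t. \<bar>t\<bar> < b \<Longrightarrow> ray h t \<in> cube J c \<delta>" by blast
  show ?thesis
  proof (rule flat_lev_vanishes[where P="dirP h" and p=p and Y="\<lambda>t. y (ray h t)" and R=R and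
        a="-b" and b=b and ?s0.0=0])
    show "((\<lambda>t. y (ray h t) i) has_real_derivative lev (dirP h i) (y (ray h s))) (at s)"
      if "s \<in> {-b<..<b}" "i < p" for s i
      using ray_derivative[of h s "[(1, [i])]"] b(2)[of s] that by (simp add: lev_Cons lder_single abs_less_iff)
    show "\<bar>y (ray h s) i\<bar> \<le> R" if "s \<in> {-b<..<b}" "i < p" for s i
      using R b(2)[of s] that by (auto simp: abs_less_iff)
    show "lev ((lder (dirP h) ^^ m) q) (y (ray h 0)) = 0" for m
      using 0[of m] by (simp add: jet_def ray_def)
  qed (use b q lvar_dirP in \<open>auto simp: abs_less_iff\<close>)
qed

lemma jet_append: "jet k h (q @ r) = jet k h q + jet k h r"
  by (simp add: jet_def lder_funpow_append)

lemma jet_scale: "jet k h (lscale r q) = r * jet k h q"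
  by (simp add: jet_def lder_funpow_scale)

lemma jet_concat: "jet k h (concat (map (\<lambda>l. lscale (a l) (b l)) xs)) = (\<Sum>l\<leftarrow>xs. a l * jet k h (b l))"
  by (induction xs) (auto simp: jet_append jet_scale, simp add: jet_def lder_funpow_Nil)

text \<open>Exhibits \<open>jet k h q\<close> as a homogeneous polynomial of degree \<open>k\<close>
  in the direction \<open>h\<close>; the polynomials in the final sum of squares originate
  here.\<close>

lemma dir_funpow_expand:
  "lev ((lder (dirP h) ^^ k) q) v =
    (\<Sum>\<alpha>\<in>{\<alpha>. set \<alpha> \<subseteq> J \<and> length \<alpha> = k}. (\<Prod>i\<leftarrow>\<alpha>. h i) * lev (lders P \<alpha> q) v)"
proof (induction k arbitrary: v)
  case 0
  have "{\<alpha>. set \<alpha> \<subseteq> J \<and> length \<alpha> = 0} = {[]}" by auto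
  thus ?case by simp
next
  case (Suc k)
  let ?L = "\<lambda>k. {\<alpha>. set \<alpha> \<subseteq> J \<and> length \<alpha> = k}"
  have fin: "finite (?L k)" using finite_J by (rule finite_lists_length_eq)
  have "lev ((lder (dirP h) ^^ Suc k) q) v =
      (\<Sum>\<alpha>\<in>?L k. (\<Prod>i\<leftarrow>\<alpha>. h i) * lev (lder (dirP h) (lders P \<alpha> q)) v)"
    using lev_lder_cong[OF Suc] by simp
  also have "\<dots> = (\<Sum>\<alpha>\<in>?L k. \<Sum>j\<in>J. (\<Prod>i\<leftarrow>j # \<alpha>. h i) * lev (lders P (j # \<alpha>) q) v)"
    by (subst lev_lder_linear_field[OF lev_dirP finite_J]) (simp add: sum_distrib_left algebra_simps)
  also have "\<dots> = (\<Sum>j\<alpha>\<in>J \<times> ?L k. (\<Prod>i\<leftarrow>fst j\<alpha> # snd j\<alpha>. h i) * lev (lders P (fst j\<alpha> # snd j\<alpha>) q) v)"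
    by (subst sum.swap) (simp add: sum.cartesian_product case_prod_beta)
  also have "\<dots> = (\<Sum>\<alpha>\<in>?L (Suc k). (\<Prod>i\<leftarrow>\<alpha>. h i) * lev (lders P \<alpha> q) v)"
    by (rule sum.reindex_bij_witness[of _ "\<lambda>\<alpha>. (hd \<alpha>, tl \<alpha>)" "\<lambda>(j, \<alpha>). j # \<alpha>"])
      (auto simp: length_Suc_conv)
  finally show ?case .
qed

lemma polyfun_jet: "polyfun (\<lambda>h. jet k h q)"
  unfolding jet_def dir_funpow_expand
  by (intro polyfun_sum polyfun_mult polyfun_prod_list polyfun_const)

lemma jet_homogeneous: "jet k (\<lambda>i. r * h i) q = r ^ k * jet k h q"
proof -
  have "(\<Prod>i\<leftarrow>\<alpha>. r * h i) = r ^ length \<alpha> * (\<Prod>i\<leftarrow>\<alpha>. h i)" for \<alpha> :: "nat list"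
    by (induction \<alpha>) auto
  thus ?thesis unfolding jet_def dir_funpow_expand by (simp add: sum_distrib_left mult.assoc)
qed

text \<open>Maclaurin's formula with remainder: the lower terms vanish, and the term of order
  \<open>k\<close> is taken at a point that tends to 0 with \<open>t\<close>.\<close>

lemma jet_leading:
  assumes q: "lvar p q" and 0: "\<And>j. j < k \<Longrightarrow> jet j h q = 0"
  shows "((\<lambda>t. lev q (y (ray h t)) / t ^ k) \<longlongrightarrow> jet k h q / fact k) (at_right 0)"
proof (cases "k = 0")
  case True
  have "ray h 0 \<in> cube J c \<delta>" using ray_in_cube[of h] by auto
  from DERIV_isCont[OF ray_derivative[OF this q]]
  have "((\<lambda>t. lev q (y (ray h t))) \<longlongrightarrow> lev q (y (ray h 0))) (at 0)" by (simp add: isCont_def)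
  hence "((\<lambda>t. lev q (y (ray h t))) \<longlongrightarrow> lev q (y (ray h 0))) (at_right 0)"
    by (rule filterlim_mono) (auto simp: at_le)
  thus ?thesis using True by (simp add: jet_def ray_def)
next
  case False
  obtain \<tau> where \<tau>: "\<tau> > 0" "\<And>t. \<bar>t\<bar> < \<tau> \<Longrightarrow> ray h t \<in> cube J c \<delta>" using ray_in_cube by blast
  define G where "G = (\<lambda>m t. lev ((lder (dirP h) ^^ m) q) (y (ray h t)))"
  have der: "(G m has_real_derivative G (Suc m) t) (at t)" if "\<bar>t\<bar> < \<tau>" for m t
    unfolding G_def using ray_derivative[OF \<tau>(2)[OF that] lvar_dir_funpow[OF q]] by simp
  have G0: "G m 0 = jet m h q" for m by (simp add: G_def jet_def ray_def)
  have ex: "\<exists>\<xi>. 0 < \<xi> \<and> \<xi> < t \<and> G 0 t = G k \<xi> / fact k * t ^ k" if t: "0 < t" "t < \<tau>" for t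
  proof -
    have "\<exists>\<xi>>0. \<xi> < t \<and> G 0 t = (\<Sum>m<k. G m 0 / fact m * t ^ m) + G k \<xi> / fact k * t ^ k"
      using t False by (intro Maclaurin) (auto intro!: der)
    thus ?thesis using 0 by (auto simp: G0)
  qed
  define \<xi> where "\<xi> = (\<lambda>t. SOME x. 0 < x \<and> x < t \<and> G 0 t = G k x / fact k * t ^ k)"
  have \<xi>: "0 < \<xi> t \<and> \<xi> t < t \<and> G 0 t = G k (\<xi> t) / fact k * t ^ k" if "0 < t" "t < \<tau>" for t
    unfolding \<xi>_def by (rule someI_ex[OF ex[OF that]])
  have ev: "\<forall>\<^sub>F t in at_right 0. 0 < t \<and> t < \<tau>"
    using \<tau>(1) by (auto simp: eventually_at_right_field)
  have "(\<xi> \<longlongrightarrow> 0) (at_right 0)"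
  proof (rule tendsto_sandwich[of "\<lambda>_. 0" _ _ "\<lambda>t. t"])
    show "\<forall>\<^sub>F t in at_right 0. 0 \<le> \<xi> t" using ev by eventually_elim (use \<xi> in \<open>auto intro: less_imp_le\<close>)
    show "\<forall>\<^sub>F t in at_right 0. \<xi> t \<le> t" using ev by eventually_elim (use \<xi> in \<open>auto intro: less_imp_le\<close>)
  qed (auto intro: tendsto_ident_at)
  moreover have "isCont (G k) 0" using der[of 0 k] \<tau>(1) by (auto intro: DERIV_isCont)
  ultimately have "((\<lambda>t. G k (\<xi> t)) \<longlongrightarrow> G k 0) (at_right 0)" by (rule isCont_tendsto_compose[rotated])
  hence "((\<lambda>t. G k (\<xi> t) / fact k) \<longlongrightarrow> jet k h q / fact k) (at_right 0)"
    unfolding G0 by (intro tendsto_divide) auto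
  moreover have "\<forall>\<^sub>F t in at_right 0. G k (\<xi> t) / fact k = lev q (y (ray h t)) / t ^ k"
    using ev
  proof eventually_elim
    case (elim t)
    from \<xi>[of t] elim have "G 0 t = G k (\<xi> t) / fact k * t ^ k" by blast
    thus ?case using elim by (simp add: G_def)
  qed
  ultimately show ?thesis by (rule Lim_transform_eventually)
qed

section \<open>Echelon bases of spaces of functions\<close>

text \<open>The functionals \<open>jet (ord l) (g l)\<close> are dual to the functions
  \<open>b l\<close>, and \<open>ord l\<close> is the exact order of vanishing of \<open>b l\<close>
  at the centre. Duality keeps the leading forms independent even when several orders
  coincide.\<close>

definition echelon :: "nat \<Rightarrow> (nat \<Rightarrow> lpoly) \<Rightarrow> (nat \<Rightarrow> nat) \<Rightarrow> (nat \<Rightarrow> nat \<Rightarrow> real) \<Rightarrow> bool" where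
  "echelon n b ord g \<longleftrightarrow> (\<forall>l<n. lvar p (b l)) \<and>
    (\<forall>k<n. \<forall>l<n. jet (ord l) (g l) (b k) = (if k = l then 1 else 0)) \<and>
    (\<forall>l<n. \<forall>j<ord l. \<forall>h. jet j h (b l) = 0)"

definition lspan :: "nat \<Rightarrow> (nat \<Rightarrow> lpoly) \<Rightarrow> lpoly \<Rightarrow> bool" where
  "lspan n b q \<longleftrightarrow> (\<exists>\<gamma>. \<forall>z\<in>cube J c \<delta>. lev q (y z) = (\<Sum>l<n. \<gamma> l * lev (b l) (y z)))"

lemma echelon_basis:
  assumes "\<And>q. q \<in> set qs \<Longrightarrow> lvar p q"
  shows "\<exists>n b ord g. echelon n b ord g \<and> (\<forall>q\<in>set qs. lspan n b q)"
  using assms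
proof (induction qs)
  case Nil
  show ?case by (rule exI[of _ 0]) (auto simp: echelon_def)
next
  case (Cons q qs)
  then obtain n b ord g where ech: "echelon n b ord g" and span: "\<And>q. q \<in> set qs \<Longrightarrow> lspan n b q"
    by auto
  have b: "\<And>l. l < n \<Longrightarrow> lvar p (b l)"
    and dual: "\<And>k l. k < n \<Longrightarrow> l < n \<Longrightarrow> jet (ord l) (g l) (b k) = (if k = l then 1 else 0)"
    and low: "\<And>l j h. l < n \<Longrightarrow> j < ord l \<Longrightarrow> jet j h (b l) = 0"
    using ech unfolding echelon_def by blast+
  define a where "a = (\<lambda>l. jet (ord l) (g l) q)"
  \<comment> \<open>Removes from \<open>q\<close> its components along the basis, as measured by the
    dual functionals. What is left is either flat in every direction, hence zero on the box, or of
    finite order.\<close>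
  define q1 where "q1 = q @ concat (map (\<lambda>l. lscale (- a l) (b l)) [0..<n])"
  have q1v: "lvar p q1" unfolding q1_def using Cons.prems b by (auto intro!: lvar_concat lvar_scale)
  have lev_q1: "lev q1 v = lev q v - (\<Sum>l<n. a l * lev (b l) v)" for v
  proof -
    have "lev (concat (map (\<lambda>l. lscale (- a l) (b l)) xs)) v = - (\<Sum>l\<leftarrow>xs. a l * lev (b l) v)" for xs
      by (induction xs) auto
    thus ?thesis by (simp add: q1_def sum_list_distinct_conv_sum_set atLeast0LessThan interv_sum_list_conv_sum_set_nat)
  qed
  have jet_q1: "jet k h q1 = jet k h q - (\<Sum>l<n. a l * jet k h (b l))" for k h
    unfolding q1_def by (simp add: jet_append jet_concat sum_list_distinct_conv_sum_set atLeast0LessThan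
        interv_sum_list_conv_sum_set_nat sum_negf)
  have dual_q1: "jet (ord l) (g l) q1 = 0" if "l < n" for l
  proof -
    have "(\<Sum>k<n. a k * jet (ord l) (g l) (b k)) = (\<Sum>k<n. if k = l then a k else 0)"
      using that by (intro sum.cong) (auto simp: dual)
    also have "\<dots> = a l" using that by simp
    finally show ?thesis by (simp add: jet_q1) (simp add: a_def)
  qed
  show ?case
  proof (cases "\<forall>k h. jet k h q1 = 0")
    case True
    have "lev q1 (y z) = 0" if "z \<in> cube J c \<delta>" for z
    proof -
      have "ray (\<lambda>i. z i - c i) 1 = z" by (simp add: ray_def)
      thus ?thesis using jet_zero_imp_zero[OF q1v, of "\<lambda>i. z i - c i" 1] True that by simp
    qed
    hence "\<forall>z\<in>cube J c \<delta>. lev q (y z) = (\<Sum>l<n. a l * lev (b l) (y z))" by (simp add: lev_q1)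
    hence "lspan n b q" unfolding lspan_def by blast
    hence "\<forall>q'\<in>set (q # qs). lspan n b q'" using span by simp
    thus ?thesis using ech by blast
  next
    case False
    define o' where "o' = (LEAST k. \<exists>h. jet k h q1 \<noteq> 0)"
    have "\<exists>h. jet o' h q1 \<noteq> 0" unfolding o'_def by (rule LeastI_ex) (use False in blast)
    then obtain g' where g': "jet o' g' q1 \<noteq> 0" by blast
    have low1: "jet j h q1 = 0" if "j < o'" for j h using not_less_Least[of j] that unfolding o'_def by blast
    define q2 where "q2 = lscale (1 / jet o' g' q1) q1"
    have q2: "lvar p q2" "jet o' g' q2 = 1" "\<And>j h. j < o' \<Longrightarrow> jet j h q2 = 0"
      "\<And>l. l < n \<Longrightarrow> jet (ord l) (g l) q2 = 0"
      using q1v g' low1 dual_q1 by (auto simp: q2_def jet_scale)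
    \<comment> \<open>The old functions are corrected so that the new functional vanishes on them;
      the new function is already annihilated by the old functionals.\<close>
    define b' where "b' = (\<lambda>l. if l < n then b l @ lscale (- jet o' g' (b l)) q2 else q2)"
    define ord' where "ord' = (\<lambda>l. if l < n then ord l else o')"
    define gg where "gg = (\<lambda>l. if l < n then g l else g')"
    have b'v: "lvar p (b' l)" if "l < Suc n" for l using b q2 by (auto simp: b'_def)
    have dual': "jet (ord' l) (gg l) (b' k) = (if k = l then 1 else 0)" if "k < Suc n" "l < Suc n" for k l
      using that dual q2 by (auto simp: b'_def ord'_def gg_def jet_append jet_scale)
    have low': "jet j h (b' l) = 0" if "l < Suc n" "j < ord' l" for l j h
    proof (cases "l < n")
      case True
      hence "j < ord l" using that by (simp add: ord'_def)
      \<comment> \<open>For \<open>j < o'\<close> both parts have zero jets; otherwise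
        \<open>o' < ord l\<close>, and the correction has coefficient 0.\<close>
      thus ?thesis using True low[of l] q2(3)[of j h]
        by (cases "j < o'") (auto simp: b'_def jet_append jet_scale)
    qed (use that q2 in \<open>auto simp: b'_def ord'_def\<close>)
    have b_b': "lev (b l) v = lev (b' l) v + jet o' g' (b l) * lev (b' n) v" if "l < n" for l v
      using that by (simp add: b'_def)
    have comb: "\<exists>\<gamma>'. \<forall>z\<in>cube J c \<delta>. (\<Sum>l<n. \<gamma> l * lev (b l) (y z)) + r * lev (b' n) (y z) =
        (\<Sum>l<Suc n. \<gamma>' l * lev (b' l) (y z))" for \<gamma> r
    proof (intro exI[of _ "\<lambda>l. if l < n then \<gamma> l else r + (\<Sum>l<n. \<gamma> l * jet o' g' (b l))"] ballI)
      fix z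
      have "(\<Sum>l<n. \<gamma> l * lev (b l) (y z)) = (\<Sum>l<n. \<gamma> l * lev (b' l) (y z)) +
          (\<Sum>l<n. \<gamma> l * jet o' g' (b l)) * lev (b' n) (y z)"
        by (simp add: b_b' distrib_left sum.distrib sum_distrib_right mult.assoc)
      thus "(\<Sum>l<n. \<gamma> l * lev (b l) (y z)) + r * lev (b' n) (y z) = (\<Sum>l<Suc n.
          (if l < n then \<gamma> l else r + (\<Sum>l<n. \<gamma> l * jet o' g' (b l))) * lev (b' l) (y z))"
        by (simp add: algebra_simps)
    qed
    have "lspan (Suc n) b' q'" if q': "q' \<in> set (q # qs)" for q'
    proof -
      have "\<exists>\<gamma> r. \<forall>z\<in>cube J c \<delta>. lev q' (y z) = (\<Sum>l<n. \<gamma> l * lev (b l) (y z)) + r * lev (b' n) (y z)"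
      proof (cases "q' = q")
        case True
        have "lev (b' n) v = 1 / jet o' g' q1 * lev q1 v" for v by (simp add: b'_def q2_def)
        thus ?thesis using True g'
          by (intro exI[of _ a] exI[of _ "jet o' g' q1"]) (auto simp: lev_q1)
      next
        case False
        then obtain \<gamma> where "\<forall>z\<in>cube J c \<delta>. lev q' (y z) = (\<Sum>l<n. \<gamma> l * lev (b l) (y z))"
          using span[of q'] q' by (auto simp: lspan_def)
        thus ?thesis by (intro exI[of _ \<gamma>] exI[of _ 0]) auto
      qed
      then obtain \<gamma> r where "\<And>z. z \<in> cube J c \<delta> \<Longrightarrow> lev q' (y z) = (\<Sum>l<n. \<gamma> l * lev (b l) (y z)) + r * lev (b' n) (y z)" by blast
      with comb[of \<gamma> r] show ?thesis unfolding lspan_def by simp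
    qed
    moreover have "echelon (Suc n) b' ord' gg" unfolding echelon_def using b'v dual' low' by blast
    ultimately show ?thesis by blast
  qed
qed

text \<open>Inserting \<open>r * g k\<close> for \<open>h\<close> gives a polynomial in
  \<open>r\<close> to which \<open>b l\<close> contributes in degree \<open>ord l\<close>. Its
  coefficient in degree \<open>ord k\<close> sees only functions of that order, and among these
  duality leaves \<open>b k\<close> alone.\<close>

lemma echelon_leading_independent:
  assumes ech: "echelon n b ord g"
    and 0: "\<And>h. (\<Sum>l<n. G l * (jet (ord l) h (b l) / fact (ord l))) = 0" and k: "k < n"
  shows "G k = 0"
proof -
  define Q where "Q = (\<Sum>l<n. monom (G l * (jet (ord l) (g k) (b l) / fact (ord l))) (ord l))"
  have "poly Q r = 0" for r
    using 0[of "\<lambda>i. r * g k i"] by (simp add: Q_def poly_sum poly_monom jet_homogeneous algebra_simps)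
  hence "Q = 0" by (simp add: poly_all_0_iff_0[symmetric])
  hence "0 = coeff Q (ord k)" by simp
  also have "\<dots> = (\<Sum>l<n. if l = k then G k / fact (ord k) else 0)"
    unfolding Q_def coeff_sum
  proof (intro sum.cong refl)
    fix l assume "l \<in> {..<n}"
    hence l: "l < n" by simp
    have "jet (ord k) (g k) (b l) = (if l = k then 1 else 0)" using ech k l by (simp add: echelon_def)
    thus "coeff (monom (G l * (jet (ord l) (g k) (b l) / fact (ord l))) (ord l)) (ord k) =
        (if l = k then G k / fact (ord k) else 0)" by auto
  qed
  also have "\<dots> = G k / fact (ord k)" using k by simp
  finally show ?thesis by simp
qed

text \<open>In an echelon basis \<open>b\<close>, the functions \<open>b k / t ^ ord k\<close> converge along rays to linearly independent
  polynomials in the direction \<open>h\<close>. Independence bounds the coefficients, and a convergent subsequence gives squares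
  of polynomials.\<close>

theorem blow_up:
  fixes f :: "(nat \<Rightarrow> real) \<Rightarrow> real" and N M D :: nat
  assumes qs: "\<And>l. l < N \<Longrightarrow> lvar p (q l)" and \<tau>: "\<tau> > 0"
    and sq: "\<And>t. 0 < t \<Longrightarrow> t < \<tau> \<Longrightarrow> \<exists>\<gamma>. \<forall>h. ray h t \<in> cube J c \<delta> \<longrightarrow>
      t ^ (2 * D) * f h = (\<Sum>j<M. (\<Sum>l<N. \<gamma> j l * lev (q l) (y (ray h t)))\<^sup>2)"
  shows "\<exists>\<phi>. (\<forall>j<M. polyfun (\<phi> j)) \<and> (\<forall>h. f h = (\<Sum>j<M. (\<phi> j h)\<^sup>2))"
proof -
  obtain n b ord g where ech: "echelon n b ord g" and span: "\<And>l. l < N \<Longrightarrow> lspan n b (q l)"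
  proof -
    have "\<And>r. r \<in> set (map q [0..<N]) \<Longrightarrow> lvar p r" using qs by auto
    from echelon_basis[OF this] obtain n b ord g where "echelon n b ord g"
      "\<forall>r\<in>set (map q [0..<N]). lspan n b r" by blast
    thus ?thesis by (intro that) auto
  qed
  obtain a where a: "\<And>l z. l < N \<Longrightarrow> z \<in> cube J c \<delta> \<Longrightarrow> lev (q l) (y z) = (\<Sum>k<n. a l k * lev (b k) (y z))"
    using span unfolding lspan_def by metis
  have rescaled: "\<exists>\<gamma>. \<forall>h. ray h t \<in> cube J c \<delta> \<longrightarrow>
      f h = (\<Sum>j<M. (\<Sum>k<n. \<gamma> j k * (lev (b k) (y (ray h t)) / t ^ ord k))\<^sup>2)" if t: "0 < t" "t < \<tau>" for t
  proof -
    obtain \<gamma> where \<gamma>: "\<And>h. ray h t \<in> cube J c \<delta> \<Longrightarrow>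
        t ^ (2 * D) * f h = (\<Sum>j<M. (\<Sum>l<N. \<gamma> j l * lev (q l) (y (ray h t)))\<^sup>2)"
      using sq[OF t] by blast
    \<comment> \<open>All powers of \<open>t\<close> go into the coefficients. The functions
      \<open>lev (b k) / t ^ ord k\<close> then have limits, while nothing is known yet about
      \<open>\<Gamma>\<close>.\<close>
    define \<Gamma> where "\<Gamma> = (\<lambda>j k. (\<Sum>l<N. \<gamma> j l * a l k) * t ^ ord k / t ^ D)"
    have "f h = (\<Sum>j<M. (\<Sum>k<n. \<Gamma> j k * (lev (b k) (y (ray h t)) / t ^ ord k))\<^sup>2)"
      if h: "ray h t \<in> cube J c \<delta>" for h
    proof -
      have "(\<Sum>k<n. \<Gamma> j k * (lev (b k) (y (ray h t)) / t ^ ord k)) =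
          (\<Sum>l<N. \<gamma> j l * lev (q l) (y (ray h t))) / t ^ D" for j
      proof -
        have "(\<Sum>l<N. \<gamma> j l * lev (q l) (y (ray h t))) =
            (\<Sum>k<n. (\<Sum>l<N. \<gamma> j l * a l k) * lev (b k) (y (ray h t)))"
        proof -
          have "(\<Sum>l<N. \<gamma> j l * lev (q l) (y (ray h t))) =
              (\<Sum>l<N. \<Sum>k<n. \<gamma> j l * a l k * lev (b k) (y (ray h t)))"
            using a[OF _ h] by (simp add: sum_distrib_left mult.assoc)
          also have "\<dots> = (\<Sum>k<n. \<Sum>l<N. \<gamma> j l * a l k * lev (b k) (y (ray h t)))" by (rule sum.swap)
          finally show ?thesis by (simp add: sum_distrib_right)
        qed
        thus ?thesis using t by (simp add: \<Gamma>_def sum_divide_distrib)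
      qed
      hence "(\<Sum>j<M. (\<Sum>k<n. \<Gamma> j k * (lev (b k) (y (ray h t)) / t ^ ord k))\<^sup>2) =
          (\<Sum>j<M. (\<Sum>l<N. \<gamma> j l * lev (q l) (y (ray h t)))\<^sup>2) / t ^ (2 * D)"
        by (simp only: power_divide sum_divide_distrib[symmetric] power_mult[symmetric] mult.commute[of 2])
      also have "\<dots> = f h" using t \<gamma>[OF h] by (simp add: field_simps)
      finally show ?thesis ..
    qed
    thus ?thesis by blast
  qed
  obtain \<Gamma> where \<Gamma>: "\<And>t h. 0 < t \<Longrightarrow> t < \<tau> \<Longrightarrow> ray h t \<in> cube J c \<delta> \<Longrightarrow>
      f h = (\<Sum>j<M. (\<Sum>k<n. \<Gamma> t j k * (lev (b k) (y (ray h t)) / t ^ ord k))\<^sup>2)"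
  proof -
    have "\<forall>t. \<exists>\<gamma>. 0 < t \<and> t < \<tau> \<longrightarrow> (\<forall>h. ray h t \<in> cube J c \<delta> \<longrightarrow>
        f h = (\<Sum>j<M. (\<Sum>k<n. \<gamma> j k * (lev (b k) (y (ray h t)) / t ^ ord k))\<^sup>2))"
      using rescaled by blast
    from choice[OF this] obtain \<Gamma> where "\<forall>t. 0 < t \<and> t < \<tau> \<longrightarrow> (\<forall>h. ray h t \<in> cube J c \<delta> \<longrightarrow>
        f h = (\<Sum>j<M. (\<Sum>k<n. \<Gamma> t j k * (lev (b k) (y (ray h t)) / t ^ ord k))\<^sup>2))" ..
    thus ?thesis by (intro that[of \<Gamma>]) blast
  qed
  define T where "T = (\<lambda>m. \<tau> / real (Suc (Suc m)))"
  have T: "0 < T m" "T m < \<tau>" for m using \<tau> by (auto simp: T_def field_simps add_pos_nonneg)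
  have T0: "filterlim T (at_right 0) sequentially"
  proof -
    have "T \<longlonglongrightarrow> 0" unfolding T_def by real_asymp
    thus ?thesis using T(1) by (auto simp: filterlim_at less_imp_neq[THEN not_sym] intro!: always_eventually)
  qed
  define I where "I = {..<M} \<times> {..<n}"
  \<comment> \<open>Normalisation: \<open>1 / S\<close> and the absolute values of the coefficients
    divided by \<open>S\<close> add up to 1, so that their limits cannot all be zero.\<close>
  define S where "S = (\<lambda>m. 1 + (\<Sum>(j, k)\<in>I. \<bar>\<Gamma> (T m) j k\<bar>))"
  have S1: "S m \<ge> 1" for m by (auto simp: S_def intro!: sum_nonneg)
  \<comment> \<open>The index \<open>None\<close> holds \<open>1 / S\<close>, whose square
    multiplies \<open>f\<close>; its limit is \<open>\<nu>\<close>.\<close>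
  define x where "x = (\<lambda>i m. case i of None \<Rightarrow> 1 / S m | Some (j, k) \<Rightarrow> \<Gamma> (T m) j k / S m)"
  define I' where "I' = insert None (Some ` I)"
  have finI: "finite I" by (simp add: I_def)
  have bnd: "\<bar>x i m\<bar> \<le> 1" if "i \<in> I'" for i m
  proof (cases i)
    case None
    thus ?thesis using S1[of m] by (simp add: x_def)
  next
    case (Some jk)
    obtain j k where jk: "jk = (j, k)" by force
    have "(j, k) \<in> I" using that Some jk by (auto simp: I'_def)
    hence "\<bar>\<Gamma> (T m) j k\<bar> \<le> (\<Sum>(j, k)\<in>I. \<bar>\<Gamma> (T m) j k\<bar>)"
      using member_le_sum[of "(j, k)" I "\<lambda>(j, k). \<bar>\<Gamma> (T m) j k\<bar>"] finI by auto
    hence "\<bar>\<Gamma> (T m) j k\<bar> \<le> S m" by (simp add: S_def)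
    thus ?thesis using S1[of m] by (simp add: x_def Some jk)
  qed
  obtain r L where r: "strict_mono (r :: nat \<Rightarrow> nat)" and L: "\<And>i. i \<in> I' \<Longrightarrow> (\<lambda>m. x i (r m)) \<longlonglongrightarrow> L i"
  proof -
    have "finite I'" using finI by (simp add: I'_def)
    from finite_family_subseq[OF this, of x 1] bnd show ?thesis using that by blast
  qed
  define \<nu> where "\<nu> = L None"
  define G where "G = (\<lambda>j k. L (Some (j, k)))"
  have Tr: "filterlim (\<lambda>m. T (r m)) (at_right 0) sequentially"
    using filterlim_compose[OF T0 filterlim_subseq[OF r]] .
  define e where "e = (\<lambda>k h. jet (ord k) h (b k) / fact (ord k))"
  have lim: "\<nu>\<^sup>2 * f h = (\<Sum>j<M. (\<Sum>k<n. G j k * e k h)\<^sup>2)" for h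
  proof -
    have u: "(\<lambda>m. lev (b k) (y (ray h (T (r m)))) / T (r m) ^ ord k) \<longlonglongrightarrow> e k h" if "k < n" for k
      unfolding e_def
      by (rule filterlim_compose[OF jet_leading Tr]) (use ech that in \<open>auto simp: echelon_def\<close>)
    have "(\<lambda>m. \<Sum>j<M. (\<Sum>k<n. x (Some (j, k)) (r m) * (lev (b k) (y (ray h (T (r m)))) / T (r m) ^ ord k))\<^sup>2)
        \<longlonglongrightarrow> (\<Sum>j<M. (\<Sum>k<n. G j k * e k h)\<^sup>2)"
      unfolding G_def
      by (intro tendsto_sum tendsto_power tendsto_mult L u) (auto simp: I'_def I_def)
    moreover have "\<forall>\<^sub>F m in sequentially.
        (\<Sum>j<M. (\<Sum>k<n. x (Some (j, k)) (r m) * (lev (b k) (y (ray h (T (r m)))) / T (r m) ^ ord k))\<^sup>2) =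
        (x None (r m))\<^sup>2 * f h"
    proof -
      obtain \<tau>' where \<tau>': "\<tau>' > 0" "\<And>t. \<bar>t\<bar> < \<tau>' \<Longrightarrow> ray h t \<in> cube J c \<delta>" using ray_in_cube by blast
      have "\<forall>\<^sub>F t in at_right 0. 0 < t \<and> t < \<tau>'" using \<tau>'(1) by (auto simp: eventually_at_right_field)
      hence "\<forall>\<^sub>F m in sequentially. 0 < T (r m) \<and> T (r m) < \<tau>'" using Tr unfolding filterlim_iff by blast
      thus ?thesis
      proof eventually_elim
        case (elim m)
        hence "ray h (T (r m)) \<in> cube J c \<delta>" by (intro \<tau>') simp
        note \<Gamma>[OF T[of "r m"] this]
        hence "(x None (r m))\<^sup>2 * f h = (1 / S (r m))\<^sup>2 *
            (\<Sum>j<M. (\<Sum>k<n. \<Gamma> (T (r m)) j k * (lev (b k) (y (ray h (T (r m)))) / T (r m) ^ ord k))\<^sup>2)"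
          by (simp add: x_def)
        also have "\<dots> = (\<Sum>j<M. (\<Sum>k<n. x (Some (j, k)) (r m) * (lev (b k) (y (ray h (T (r m)))) / T (r m) ^ ord k))\<^sup>2)"
          by (simp add: x_def sum_distrib_left power_mult_distrib[symmetric] sum_distrib_left)
        finally show ?case ..
      qed
    qed
    ultimately have "(\<lambda>m. (x None (r m))\<^sup>2 * f h) \<longlonglongrightarrow> (\<Sum>j<M. (\<Sum>k<n. G j k * e k h)\<^sup>2)"
      by (rule Lim_transform_eventually)
    moreover have "(\<lambda>m. (x None (r m))\<^sup>2 * f h) \<longlonglongrightarrow> \<nu>\<^sup>2 * f h"
      unfolding \<nu>_def by (intro tendsto_intros L) (simp add: I'_def)
    ultimately show ?thesis by (rule LIMSEQ_unique[rotated])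
  qed
  have total: "\<nu> + (\<Sum>(j, k)\<in>I. \<bar>G j k\<bar>) = 1"
  proof -
    have "(\<lambda>m. x None (r m) + (\<Sum>(j, k)\<in>I. \<bar>x (Some (j, k)) (r m)\<bar>)) \<longlonglongrightarrow> \<nu> + (\<Sum>(j, k)\<in>I. \<bar>G j k\<bar>)"
      unfolding \<nu>_def G_def case_prod_beta prod.collapse
      by (intro tendsto_add tendsto_sum tendsto_rabs L) (auto simp: I'_def)
    moreover have "x None m + (\<Sum>(j, k)\<in>I. \<bar>x (Some (j, k)) m\<bar>) = 1" for m
    proof -
      have "x None m + (\<Sum>(j, k)\<in>I. \<bar>x (Some (j, k)) m\<bar>) = (1 + (\<Sum>(j, k)\<in>I. \<bar>\<Gamma> (T m) j k\<bar>)) / S m"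
        using S1[of m] by (simp add: x_def abs_divide case_prod_beta sum_divide_distrib add_divide_distrib)
      thus ?thesis using S1[of m] by (simp add: S_def)
    qed
    ultimately have "(\<lambda>m. 1) \<longlonglongrightarrow> \<nu> + (\<Sum>(j, k)\<in>I. \<bar>G j k\<bar>)" by simp
    thus ?thesis using LIMSEQ_unique tendsto_const by blast
  qed
  \<comment> \<open>Otherwise every limiting square vanishes, independence of the leading forms
    annihilates all coefficients, and \<open>total\<close> is violated.\<close>
  have "\<nu> \<noteq> 0"
  proof
    assume \<nu>: "\<nu> = 0"
    have "G j k = 0" if j: "j < M" and k: "k < n" for j k
    proof (rule echelon_leading_independent[OF ech _ k])
      fix h
      have "(\<Sum>j<M. (\<Sum>k<n. G j k * e k h)\<^sup>2) = 0" using lim[of h] \<nu> by simp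
      hence "(\<Sum>k<n. G j k * e k h)\<^sup>2 = 0" using j by (subst (asm) sum_nonneg_eq_0_iff) auto
      thus "(\<Sum>l<n. G j l * (jet (ord l) h (b l) / fact (ord l))) = 0" by (simp add: e_def)
    qed
    hence "(\<Sum>(j, k)\<in>I. \<bar>G j k\<bar>) = 0" by (intro sum.neutral) (auto simp: I_def)
    thus False using total \<nu> by simp
  qed
  define \<phi> where "\<phi> = (\<lambda>j h. \<Sum>k<n. (G j k / \<nu> / fact (ord k)) * jet (ord k) h (b k))"
  have "polyfun (\<phi> j)" for j
    unfolding \<phi>_def by (intro polyfun_sum polyfun_mult polyfun_const polyfun_jet)
  moreover have "f h = (\<Sum>j<M. (\<phi> j h)\<^sup>2)" for h
  proof -
    have "\<phi> j h = (\<Sum>k<n. G j k * e k h) / \<nu>" for j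
      by (simp add: \<phi>_def e_def sum_divide_distrib mult.commute)
    hence "(\<Sum>j<M. (\<phi> j h)\<^sup>2) = (\<Sum>j<M. (\<Sum>k<n. G j k * e k h)\<^sup>2) / \<nu>\<^sup>2"
      by (simp only: power_divide sum_divide_distrib[symmetric])
    also have "\<dots> = \<nu>\<^sup>2 * f h / \<nu>\<^sup>2" by (simp only: lim)
    finally show ?thesis using \<open>\<nu> \<noteq> 0\<close> by simp
  qed
  ultimately show ?thesis by blast
qed

end

section \<open>Two nonnegative polynomials that are not sums of squares\<close>

text \<open>Reduces degree arguments in several variables to univariate polynomials.\<close>

lemma polyfun_along_curve:
  assumes "polyfun g" "\<And>i. \<exists>q. \<forall>t. z t i = poly q t"
  shows "\<exists>q. \<forall>t. g (z t) = poly q t"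
  using assms(1)
proof induction
  case (polyfun_const r)
  show ?case by (rule exI[of _ "[:r:]"]) simp
next
  case (polyfun_add f g)
  then obtain p q where "\<forall>t. f (z t) = poly p t" "\<forall>t. g (z t) = poly q t" by blast
  thus ?case by (intro exI[of _ "p + q"]) simp
next
  case (polyfun_mult f g)
  then obtain p q where "\<forall>t. f (z t) = poly p t" "\<forall>t. g (z t) = poly q t" by blast
  thus ?case by (intro exI[of _ "p * q"]) simp
qed (rule assms(2))

text \<open>Otherwise the leading term of \<open>q\<^sup>2\<close>, which is positive, would win at
  infinity.\<close>

lemma degree_le_of_square_le:
  fixes p q :: "real poly"
  assumes "\<And>t. (poly q t)\<^sup>2 \<le> poly p t" "degree p \<le> 2 * k"
  shows "degree q \<le> k"
proof (rule ccontr)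
  assume "\<not> degree q \<le> k"
  hence d: "degree q > k" by simp
  hence q0: "q \<noteq> 0" by auto
  let ?r = "q\<^sup>2 - p"
  have dq: "degree (q\<^sup>2) = 2 * degree q" using q0 by (simp add: degree_power_eq)
  hence lt: "degree p < degree (q\<^sup>2)" using d assms(2) by linarith
  have "degree ?r = degree (q\<^sup>2)"
    using degree_add_eq_left[of "- p" "q\<^sup>2"] lt by simp
  hence "lead_coeff ?r = lead_coeff (q\<^sup>2)" using lt by (simp add: coeff_eq_0)
  hence pos: "lead_coeff ?r > 0" using q0 by (simp add: lead_coeff_power)
  then obtain n where "\<forall>x\<ge>n. poly ?r x \<ge> lead_coeff ?r" using poly_pinfty_gt_lc by blast
  hence "poly ?r n > 0" using pos by force
  thus False using assms(1)[of n] by simp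
qed

lemma poly_degree_0: "degree q \<le> 0 \<Longrightarrow> poly q t = poly q (0::real)"
  by (auto elim: degree_eq_zeroE)

lemma poly_altdef_le:
  assumes "degree q \<le> n" shows "poly q x = (\<Sum>i\<le>n. coeff q i * (x::real) ^ i)"
  unfolding poly_altdef by (rule sum.mono_neutral_left) (use assms in \<open>auto simp: coeff_eq_0\<close>)

lemma poly_degree_1:
  assumes "degree q \<le> 1" shows "poly q t = poly q 0 + (poly q 1 - poly q 0) * (t::real)"
proof -
  have "poly q x = coeff q 0 + coeff q 1 * x" for x
    using poly_altdef_le[OF assms, of x] by simp
  thus ?thesis by simp
qed

lemma poly_degree_2:
  assumes "degree q \<le> 2"
  shows "poly q t = poly q 0 + (poly q 1 - poly q (-1)) / 2 * t + ((poly q 1 + poly q (-1)) / 2 - poly q 0) * (t::real)\<^sup>2"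
proof -
  have "poly q x = coeff q 0 + coeff q 1 * x + coeff q 2 * x\<^sup>2" for x
    using poly_altdef_le[OF assms, of x] by (simp add: numeral_2_eq_2)
  thus ?thesis by (simp add: field_simps)
qed

definition motz :: "(nat \<Rightarrow> real) \<Rightarrow> real" where
  "motz z = 1 + z 0 ^ 4 * z 1 ^ 2 + z 0 ^ 2 * z 1 ^ 4 - 3 * z 0 ^ 2 * z 1 ^ 2"

definition quart :: "(nat \<Rightarrow> real) \<Rightarrow> real" where
  "quart z = 1 + z 0 ^ 2 * z 1 ^ 2 + z 1 ^ 2 * z 2 ^ 2 + z 2 ^ 2 * z 0 ^ 2 - 4 * z 0 * z 1 * z 2"

text \<open>Degrees on lines parallel to the axes, on the axes and on the diagonal leave each
  \<open>\<phi> j\<close> without the monomial \<open>x\<^sup>2 y\<^sup>2\<close>, so that its mean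
  over the four points with coordinates 1 or -1 is its value at the origin. The Motzkin polynomial
  is 0 at these points and 1 at the origin, against the inequality between mean and quadratic
  mean.\<close>

lemma motz_not_sos:
  fixes M :: nat
  assumes \<phi>: "\<And>j. j < M \<Longrightarrow> polyfun (\<phi> j)" and sq: "\<And>z. motz z = (\<Sum>j<M. (\<phi> j z)\<^sup>2)"
  shows False
proof -
  define pt where "pt = (\<lambda>x y (i::nat). if i = 0 then x else if i = 1 then y else (0::real))"
  have sq': "(\<Sum>j<M. (\<phi> j (pt x y))\<^sup>2) = 1 + x ^ 4 * y ^ 2 + x ^ 2 * y ^ 4 - 3 * x ^ 2 * y ^ 2" for x y
    using sq[of "pt x y"] by (simp add: motz_def pt_def)
  have le: "(\<phi> j (pt x y))\<^sup>2 \<le> 1 + x ^ 4 * y ^ 2 + x ^ 2 * y ^ 4 - 3 * x ^ 2 * y ^ 2" if "j < M" for j x y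
    unfolding sq'[symmetric] by (rule member_le_sum) (use that in auto)
  have curve: "\<exists>q. (\<forall>t. \<phi> j (pt (poly a t) (poly b t)) = poly q t) \<and> degree q \<le> k"
    if "j < M" "degree (1 + a ^ 4 * b ^ 2 + a ^ 2 * b ^ 4 - 3 * a ^ 2 * b ^ 2) \<le> 2 * k" for j a b k
  proof -
    have "\<exists>q. \<forall>t. \<phi> j (pt (poly a t) (poly b t)) = poly q t"
    proof (rule polyfun_along_curve[OF \<phi>[OF that(1)]])
      show "\<exists>q. \<forall>t. pt (poly a t) (poly b t) i = poly q t" for i
        unfolding pt_def by (cases "i = 0"; cases "i = 1") (auto intro: exI[of _ a] exI[of _ b] exI[of _ 0])
    qed
    then obtain q where q: "\<forall>t. \<phi> j (pt (poly a t) (poly b t)) = poly q t" by blast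
    have "degree q \<le> k"
      by (rule degree_le_of_square_le[OF _ that(2)]) (use le[OF that(1)] q in \<open>simp flip: q\<close>)
    thus ?thesis using q by blast
  qed
  have key: "(\<phi> j (pt 1 1))\<^sup>2 + (\<phi> j (pt 1 (-1)))\<^sup>2 + (\<phi> j (pt (-1) 1))\<^sup>2 + (\<phi> j (pt (-1) (-1)))\<^sup>2 \<ge> 4 * (\<phi> j (pt 0 0))\<^sup>2"
    if j: "j < M" for j
  proof -
    let ?g = "\<lambda>x y. \<phi> j (pt x y)"
    have gx: "?g x y = ?g 0 y + (?g 1 y - ?g (-1) y) / 2 * x + ((?g 1 y + ?g (-1) y) / 2 - ?g 0 y) * x\<^sup>2" for x y
    proof -
      have "degree (1 + [:0, 1:] ^ 4 * [:y:] ^ 2 + [:0, 1:] ^ 2 * [:y:] ^ 4 - 3 * [:0, 1:] ^ 2 * [:y:] ^ 2) \<le> 2 * 2"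
        by (simp add: power2_eq_square power4_eq_xxxx numeral_poly one_pCons)
      from curve[OF j this] obtain q where "\<And>t. ?g t y = poly q t" "degree q \<le> 2" by auto
      thus ?thesis using poly_degree_2[of q x] by simp
    qed
    have gy: "?g x y = ?g x 0 + (?g x 1 - ?g x (-1)) / 2 * y + ((?g x 1 + ?g x (-1)) / 2 - ?g x 0) * y\<^sup>2" for x y
    proof -
      have "degree (1 + [:x:] ^ 4 * [:0, 1:] ^ 2 + [:x:] ^ 2 * [:0, 1:] ^ 4 - 3 * [:x:] ^ 2 * [:0, 1:] ^ 2) \<le> 2 * 2"
        by (simp add: power2_eq_square power4_eq_xxxx numeral_poly one_pCons)
      from curve[OF j this] obtain q where "\<And>t. ?g x t = poly q t" "degree q \<le> 2" by auto
      thus ?thesis using poly_degree_2[of q y] by simp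
    qed
    have gx0: "?g x 0 = ?g 0 0" for x
    proof -
      have "degree (1 + [:0, 1:] ^ 4 * 0 ^ 2 + [:0, 1:] ^ 2 * 0 ^ 4 - 3 * [:0, 1:] ^ 2 * 0 ^ 2 :: real poly) \<le> 2 * 0" by simp
      from curve[OF j this] obtain q where "\<And>t. ?g t 0 = poly q t" "degree q \<le> 0" by auto
      thus ?thesis using poly_degree_0[of q x] by simp
    qed
    have g0y: "?g 0 y = ?g 0 0" for y
    proof -
      have "degree (1 + 0 ^ 4 * [:0, 1:] ^ 2 + 0 ^ 2 * [:0, 1:] ^ 4 - 3 * 0 ^ 2 * [:0, 1:] ^ 2 :: real poly) \<le> 2 * 0" by simp
      from curve[OF j this] obtain q where "\<And>t. ?g 0 t = poly q t" "degree q \<le> 0" by auto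
      thus ?thesis using poly_degree_0[of q y] by simp
    qed
    define c where "c = ?g 0 0"
    \<comment> \<open>Interpolation at the four sign points: \<open>w\<close> and \<open>u\<close>
      are the coefficients of \<open>x\<^sup>2 y\<^sup>2\<close> and \<open>x y\<close>, while
      \<open>v\<close> adds up those of \<open>x\<^sup>2 y\<close> and \<open>x y\<^sup>2\<close>,
      which coincide on the diagonal.\<close>
    define w where "w = (?g 1 1 + ?g 1 (-1) + ?g (-1) 1 + ?g (-1) (-1)) / 4 - c"
    define u where "u = (?g 1 1 - ?g 1 (-1) - ?g (-1) 1 + ?g (-1) (-1)) / 4"
    define v where "v = (?g 1 1 + ?g 1 (-1) - ?g (-1) 1 - ?g (-1) (-1)) / 4 + (?g 1 1 - ?g 1 (-1) + ?g (-1) 1 - ?g (-1) (-1)) / 4"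
    have diag: "?g t t = c + u * t\<^sup>2 + v * t ^ 3 + w * t ^ 4" for t
    proof -
      have "?g t t = c + (?g 1 t - ?g (-1) t) / 2 * t + ((?g 1 t + ?g (-1) t) / 2 - c) * t\<^sup>2"
        using gx[of t t] g0y[of t] by (simp add: c_def)
      also have "?g 1 t = c + (?g 1 1 - ?g 1 (-1)) / 2 * t + ((?g 1 1 + ?g 1 (-1)) / 2 - c) * t\<^sup>2"
        using gy[of 1 t] gx0[of 1] by (simp add: c_def)
      also have "?g (-1) t = c + (?g (-1) 1 - ?g (-1) (-1)) / 2 * t + ((?g (-1) 1 + ?g (-1) (-1)) / 2 - c) * t\<^sup>2"
        using gy[of "-1" t] gx0[of "-1"] by (simp add: c_def)
      finally show ?thesis
        by (simp add: u_def v_def w_def field_simps power2_eq_square power3_eq_cube power4_eq_xxxx)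
    qed
    have "degree (1 + [:0, 1:] ^ 4 * [:0, 1:] ^ 2 + [:0, 1:] ^ 2 * [:0, 1:] ^ 4 - 3 * [:0, 1:] ^ 2 * [:0, 1:] ^ 2 :: real poly) \<le> 2 * 3"
      by (simp add: power2_eq_square power4_eq_xxxx numeral_poly one_pCons)
    from curve[OF j this] obtain q where q: "\<And>t. ?g t t = poly q t" "degree q \<le> 3" by auto
    have "q = [:c, 0, u, v, w:]"
      by (rule poly_eq_poly_eq_iff[THEN iffD1], rule ext) (simp add: q(1)[symmetric] diag power2_eq_square power3_eq_cube power4_eq_xxxx algebra_simps)
    hence "w = 0" using q(2) by (cases "w = 0") auto
    hence "?g 1 1 + ?g 1 (-1) + ?g (-1) 1 + ?g (-1) (-1) = 4 * c" by (simp add: w_def)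
    moreover have "(x + y + z + t)\<^sup>2 \<le> 4 * (x\<^sup>2 + y\<^sup>2 + z\<^sup>2 + t\<^sup>2)" for x y z t :: real
    proof -
      have "4 * (x\<^sup>2 + y\<^sup>2 + z\<^sup>2 + t\<^sup>2) - (x + y + z + t)\<^sup>2 =
          (x - y)\<^sup>2 + (x - z)\<^sup>2 + (x - t)\<^sup>2 + (y - z)\<^sup>2 + (y - t)\<^sup>2 + (z - t)\<^sup>2"
        by (simp add: power2_eq_square algebra_simps)
      also have "\<dots> \<ge> 0" by simp
      finally show ?thesis by simp
    qed
    ultimately have "(4 * c)\<^sup>2 \<le> 4 * ((?g 1 1)\<^sup>2 + (?g 1 (-1))\<^sup>2 + (?g (-1) 1)\<^sup>2 + (?g (-1) (-1))\<^sup>2)" by metis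
    thus ?thesis by (simp add: c_def power_mult_distrib)
  qed
  have "4 * (\<Sum>j<M. (\<phi> j (pt 0 0))\<^sup>2) \<le> (\<Sum>j<M. (\<phi> j (pt 1 1))\<^sup>2) + (\<Sum>j<M. (\<phi> j (pt 1 (-1)))\<^sup>2) +
      (\<Sum>j<M. (\<phi> j (pt (-1) 1))\<^sup>2) + (\<Sum>j<M. (\<phi> j (pt (-1) (-1)))\<^sup>2)"
    unfolding sum_distrib_left sum.distrib[symmetric] by (intro sum_mono key) simp
  thus False unfolding sq' by simp
qed

text \<open>Each \<open>\<phi> j\<close> is affine in every variable and constant on the axes, and
  the degree on the diagonal excludes the monomial \<open>x y z\<close>. Hence it has equal values
  at (1, 1, 1) and (-1, -1, -1), where the Choi-Lam polynomial takes the values 0 and 8.\<close>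

lemma quart_not_sos:
  fixes M :: nat
  assumes \<phi>: "\<And>j. j < M \<Longrightarrow> polyfun (\<phi> j)" and sq: "\<And>z. quart z = (\<Sum>j<M. (\<phi> j z)\<^sup>2)"
  shows False
proof -
  define pt where "pt = (\<lambda>x y z (i::nat). if i = 0 then x else if i = 1 then y else if i = 2 then z else (0::real))"
  let ?f = "\<lambda>x y z. 1 + x ^ 2 * y ^ 2 + y ^ 2 * z ^ 2 + z ^ 2 * x ^ 2 - 4 * x * y * z"
  have sq': "(\<Sum>j<M. (\<phi> j (pt x y z))\<^sup>2) = ?f x y z" for x y z
    using sq[of "pt x y z"] by (simp add: quart_def pt_def)
  have le: "(\<phi> j (pt x y z))\<^sup>2 \<le> ?f x y z" if "j < M" for j x y z
    unfolding sq'[symmetric] by (rule member_le_sum) (use that in auto)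
  have curve: "\<exists>q. (\<forall>t. \<phi> j (pt (poly a t) (poly b t) (poly d t)) = poly q t) \<and> degree q \<le> k"
    if "j < M" "degree (1 + a ^ 2 * b ^ 2 + b ^ 2 * d ^ 2 + d ^ 2 * a ^ 2 - 4 * a * b * d) \<le> 2 * k" for j a b d k
  proof -
    have "\<exists>q. \<forall>t. \<phi> j (pt (poly a t) (poly b t) (poly d t)) = poly q t"
    proof (rule polyfun_along_curve[OF \<phi>[OF that(1)]])
      show "\<exists>q. \<forall>t. pt (poly a t) (poly b t) (poly d t) i = poly q t" for i
        unfolding pt_def by (cases "i = 0"; cases "i = 1"; cases "i = 2")
          (auto intro: exI[of _ a] exI[of _ b] exI[of _ d] exI[of _ 0])
    qed
    then obtain q where q: "\<forall>t. \<phi> j (pt (poly a t) (poly b t) (poly d t)) = poly q t" by blast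
    have "degree q \<le> k"
      by (rule degree_le_of_square_le[OF _ that(2)]) (use le[OF that(1)] q in \<open>simp flip: q\<close>)
    thus ?thesis using q by blast
  qed
  have odd: "\<phi> j (pt (-1) (-1) (-1)) = \<phi> j (pt 1 1 1)" if j: "j < M" for j
  proof -
    let ?g = "\<lambda>x y z. \<phi> j (pt x y z)"
    have gx: "?g x y z = ?g 0 y z + (?g 1 y z - ?g 0 y z) * x" for x y z
    proof -
      have "degree (1 + [:0, 1:] ^ 2 * [:y:] ^ 2 + [:y:] ^ 2 * [:z:] ^ 2 + [:z:] ^ 2 * [:0, 1:] ^ 2 - 4 * [:0, 1:] * [:y:] * [:z:]) \<le> 2 * 1"
        by (simp add: power2_eq_square numeral_poly one_pCons)
      from curve[OF j this] obtain q where "\<And>t. ?g t y z = poly q t" "degree q \<le> 1" by auto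
      thus ?thesis using poly_degree_1[of q x] by simp
    qed
    have gy: "?g x y z = ?g x 0 z + (?g x 1 z - ?g x 0 z) * y" for x y z
    proof -
      have "degree (1 + [:x:] ^ 2 * [:0, 1:] ^ 2 + [:0, 1:] ^ 2 * [:z:] ^ 2 + [:z:] ^ 2 * [:x:] ^ 2 - 4 * [:x:] * [:0, 1:] * [:z:]) \<le> 2 * 1"
        by (simp add: power2_eq_square numeral_poly one_pCons)
      from curve[OF j this] obtain q where "\<And>t. ?g x t z = poly q t" "degree q \<le> 1" by auto
      thus ?thesis using poly_degree_1[of q y] by simp
    qed
    have gz: "?g x y z = ?g x y 0 + (?g x y 1 - ?g x y 0) * z" for x y z
    proof -
      have "degree (1 + [:x:] ^ 2 * [:y:] ^ 2 + [:y:] ^ 2 * [:0, 1:] ^ 2 + [:0, 1:] ^ 2 * [:x:] ^ 2 - 4 * [:x:] * [:y:] * [:0, 1:]) \<le> 2 * 1"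
        by (simp add: power2_eq_square numeral_poly one_pCons)
      from curve[OF j this] obtain q where "\<And>t. ?g x y t = poly q t" "degree q \<le> 1" by auto
      thus ?thesis using poly_degree_1[of q z] by simp
    qed
    have g0: "?g x 0 0 = ?g 0 0 0" "?g 0 x 0 = ?g 0 0 0" "?g 0 0 x = ?g 0 0 0" for x
    proof -
      have "degree (1 + [:0, 1:] ^ 2 * 0 ^ 2 + 0 ^ 2 * 0 ^ 2 + 0 ^ 2 * [:0, 1:] ^ 2 - 4 * [:0, 1:] * 0 * 0 :: real poly) \<le> 2 * 0" by simp
      from curve[OF j this] obtain q where "\<And>t. ?g t 0 0 = poly q t" "degree q \<le> 0" by auto
      thus "?g x 0 0 = ?g 0 0 0" using poly_degree_0[of q x] by simp
      have "degree (1 + 0 ^ 2 * [:0, 1:] ^ 2 + [:0, 1:] ^ 2 * 0 ^ 2 + 0 ^ 2 * 0 ^ 2 - 4 * 0 * [:0, 1:] * 0 :: real poly) \<le> 2 * 0" by simp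
      from curve[OF j this] obtain q where "\<And>t. ?g 0 t 0 = poly q t" "degree q \<le> 0" by auto
      thus "?g 0 x 0 = ?g 0 0 0" using poly_degree_0[of q x] by simp
      have "degree (1 + 0 ^ 2 * 0 ^ 2 + 0 ^ 2 * [:0, 1:] ^ 2 + [:0, 1:] ^ 2 * 0 ^ 2 - 4 * 0 * 0 * [:0, 1:] :: real poly) \<le> 2 * 0" by simp
      from curve[OF j this] obtain q where "\<And>t. ?g 0 0 t = poly q t" "degree q \<le> 0" by auto
      thus "?g 0 0 x = ?g 0 0 0" using poly_degree_0[of q x] by simp
    qed
    define c where "c = ?g 0 0 0"
    define u where "u = ?g 1 1 0 + ?g 1 0 1 + ?g 0 1 1 - 3 * c"
    define w where "w = ?g 1 1 1 - ?g 1 1 0 - ?g 1 0 1 - ?g 0 1 1 + 2 * c"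
    have diag: "?g t t t = c + u * t\<^sup>2 + w * t ^ 3" for t
    proof -
      have e: "?g 0 0 t = c" "?g 1 0 t = c + (?g 1 0 1 - c) * t" "?g 0 1 t = c + (?g 0 1 1 - c) * t"
        "?g 1 1 t = ?g 1 1 0 + (?g 1 1 1 - ?g 1 1 0) * t"
        using gz[of 1 0 t] gz[of 0 1 t] gz[of 1 1 t] g0(1)[of 1] g0(2)[of 1] g0(3)[of t] by (simp_all add: c_def)
      have "?g t t t = ?g 0 t t + (?g 1 t t - ?g 0 t t) * t" by (rule gx)
      also have "?g 0 t t = ?g 0 0 t + (?g 0 1 t - ?g 0 0 t) * t" by (rule gy)
      also have "?g 1 t t = ?g 1 0 t + (?g 1 1 t - ?g 1 0 t) * t" by (rule gy)
      finally show ?thesis unfolding e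
        by (simp add: u_def w_def algebra_simps power2_eq_square power3_eq_cube)
    qed
    have "degree (1 + [:0, 1:] ^ 2 * [:0, 1:] ^ 2 + [:0, 1:] ^ 2 * [:0, 1:] ^ 2 + [:0, 1:] ^ 2 * [:0, 1:] ^ 2 - 4 * [:0, 1:] * [:0, 1:] * [:0, 1:] :: real poly) \<le> 2 * 2"
      by (simp add: power2_eq_square numeral_poly one_pCons)
    from curve[OF j this] obtain q where q: "\<And>t. ?g t t t = poly q t" "degree q \<le> 2" by auto
    have "q = [:c, 0, u, w:]"
      by (rule poly_eq_poly_eq_iff[THEN iffD1], rule ext) (simp add: q(1)[symmetric] diag power2_eq_square power3_eq_cube algebra_simps)
    hence "w = 0" using q(2) by (cases "w = 0") auto
    thus ?thesis using diag[of 1] diag[of "-1"] by simp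
  qed
  have "(\<Sum>j<M. (\<phi> j (pt (-1) (-1) (-1)))\<^sup>2) = (\<Sum>j<M. (\<phi> j (pt 1 1 1))\<^sup>2)"
    by (intro sum.cong) (auto simp: odd)
  thus False unfolding sq' by simp
qed

section \<open>Forms as functions\<close>

abbreviation "lk \<equiv> Poly_Mapping.lookup"
abbreviation "ks \<equiv> Poly_Mapping.keys"

definition mon :: "monomial \<Rightarrow> (nat \<Rightarrow> real) \<Rightarrow> real" where
  "mon m z = (\<Prod>i\<in>ks m. z i ^ lk m i)"

text \<open>Points are total functions instead of vectors of a fixed dimension, in keeping with
  monomials that may involve any variable.\<close>

definition ev :: "rpoly \<Rightarrow> (nat \<Rightarrow> real) \<Rightarrow> real" where
  "ev p z = (\<Sum>m\<in>ks p. lk p m * mon m z)"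

lemma eval_poly_ev: "eval_poly p x = ev p (vec_index x)"
  by (simp add: eval_poly_def ev_def mon_def)

lemma mon_superset: "finite A \<Longrightarrow> ks m \<subseteq> A \<Longrightarrow> mon m z = (\<Prod>i\<in>A. z i ^ lk m i)"
  unfolding mon_def by (rule prod.mono_neutral_left) (auto simp: in_keys_iff)

lemma mon_add: "mon (m + m') z = mon m z * mon m' z"
proof -
  let ?A = "ks m \<union> ks m'"
  have "mon (m + m') z = (\<Prod>i\<in>?A. z i ^ lk (m + m') i)"
    using keys_add[of m m'] by (intro mon_superset) auto
  also have "\<dots> = (\<Prod>i\<in>?A. z i ^ lk m i) * (\<Prod>i\<in>?A. z i ^ lk m' i)"
    by (simp add: lookup_add power_add prod.distrib)
  finally show ?thesis using mon_superset[of ?A m z] mon_superset[of ?A m' z] by simp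
qed

lemma ev_superset: "finite A \<Longrightarrow> ks p \<subseteq> A \<Longrightarrow> ev p z = (\<Sum>m\<in>A. lk p m * mon m z)"
  unfolding ev_def by (rule sum.mono_neutral_left) (auto simp: in_keys_iff)

lemma ev_add: "ev (p + q) z = ev p z + ev q z"
proof -
  let ?A = "ks p \<union> ks q"
  have "ev (p + q) z = (\<Sum>m\<in>?A. lk (p + q) m * mon m z)"
    using keys_add[of p q] by (intro ev_superset) auto
  also have "\<dots> = (\<Sum>m\<in>?A. lk p m * mon m z) + (\<Sum>m\<in>?A. lk q m * mon m z)"
    by (simp add: lookup_add sum.distrib algebra_simps)
  finally show ?thesis using ev_superset[of ?A p z] ev_superset[of ?A q z] by simp
qed

lemma ev_zero [simp]: "ev 0 z = 0"
  by (simp add: ev_def)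

lemma ev_sum: "ev (\<Sum>i\<in>I. p i) z = (\<Sum>i\<in>I. ev (p i) z)"
  by (induction I rule: infinite_finite_induct) (auto simp: ev_add)

lemma ev_single: "ev (Poly_Mapping.single m a) z = a * mon m z"
  by (cases "a = 0") (auto simp: ev_def)

lemma poly_as_sum: "p = (\<Sum>m\<in>ks p. Poly_Mapping.single m (lk p m))"
proof (rule poly_mapping_eqI)
  fix m
  have "lk (\<Sum>m\<in>ks p. Poly_Mapping.single m (lk p m)) m = (\<Sum>k\<in>ks p. if k = m then lk p k else 0)"
    by (simp add: lookup_sum lookup_single when_def)
  also have "\<dots> = lk p m" by (simp add: in_keys_iff)
  finally show "lk p m = lk (\<Sum>m\<in>ks p. Poly_Mapping.single m (lk p m)) m" ..
qed

lemma ev_mult: "ev (p * q) z = ev p z * ev q z"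
proof -
  have "p * q = (\<Sum>m\<in>ks p. \<Sum>m'\<in>ks q. Poly_Mapping.single (m + m') (lk p m * lk q m'))"
    by (subst poly_as_sum[of p], subst poly_as_sum[of q]) (simp add: sum_product mult_single)
  hence "ev (p * q) z = (\<Sum>m\<in>ks p. \<Sum>m'\<in>ks q. (lk p m * mon m z) * (lk q m' * mon m' z))"
    by (simp add: ev_sum ev_single mon_add algebra_simps)
  thus ?thesis by (simp add: ev_def sum_product)
qed

lemma ev_scaleR: "ev (r *\<^sub>R p) z = r * ev p z"
proof -
  have lk: "lk (r *\<^sub>R p) m = r * lk p m" for m
    by (simp add: scaleR_poly_mapping_def Abs_poly_mapping_inverse)
  have "ev (r *\<^sub>R p) z = (\<Sum>m\<in>ks p. lk (r *\<^sub>R p) m * mon m z)"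
    by (rule ev_superset) (auto simp: in_keys_iff lk)
  thus ?thesis by (simp add: lk ev_def sum_distrib_left mult.assoc)
qed

lemma ev_one [simp]: "ev 1 z = 1"
proof -
  have "ev 1 z = ev (Poly_Mapping.single 0 1) z" by (simp only: single_one)
  thus ?thesis by (simp only: ev_single) (simp add: mon_def)
qed

lemma ev_power: "ev (p ^ k) z = ev p z ^ k"
  by (induction k) (auto simp: ev_mult)

lemma ev_diff: "ev (p - q) z = ev p z - ev q z"
  using ev_add[of "p - q" q z] by simp

lemma ev_sum_list: "ev (\<Sum>q\<leftarrow>qs. f q) z = (\<Sum>q\<leftarrow>qs. ev (f q) z)"
  by (induction qs) (auto simp: ev_add)

definition Xv :: "nat \<Rightarrow> rpoly" where
  "Xv i = Poly_Mapping.single (Poly_Mapping.single i 1) 1"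

lemma ev_Xv [simp]: "ev (Xv i) z = z i"
  by (simp add: Xv_def ev_single mon_def)

section \<open>Degrees and spaces of forms\<close>

lemma monomial_degree_superset:
  "finite A \<Longrightarrow> ks m \<subseteq> A \<Longrightarrow> monomial_degree m = (\<Sum>i\<in>A. lk m i)"
  unfolding monomial_degree_def by (rule sum.mono_neutral_left) (auto simp: in_keys_iff)

lemma monomial_degree_add: "monomial_degree (m + m') = monomial_degree m + monomial_degree m'"
proof -
  let ?A = "ks m \<union> ks m'"
  have "monomial_degree (m + m') = (\<Sum>i\<in>?A. lk (m + m') i)"
    using keys_add[of m m'] by (intro monomial_degree_superset) auto
  thus ?thesis using monomial_degree_superset[of ?A m] monomial_degree_superset[of ?A m']
    by (simp add: lookup_add sum.distrib)
qed

lemma zero_in_forms [simp]: "0 \<in> forms n k"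
  by (simp add: forms_def)

lemma forms_add: "p \<in> forms n k \<Longrightarrow> q \<in> forms n k \<Longrightarrow> p + q \<in> forms n k"
  using keys_add[of p q] unfolding forms_def by blast

lemma forms_uminus: "p \<in> forms n k \<Longrightarrow> - p \<in> forms n k"
  by (simp add: forms_def)

lemma forms_diff: "p \<in> forms n k \<Longrightarrow> q \<in> forms n k \<Longrightarrow> p - q \<in> forms n k"
  using forms_add[of p n k "- q"] forms_uminus[of q n k] by simp

lemma forms_sum: "(\<And>i. i \<in> I \<Longrightarrow> p i \<in> forms n k) \<Longrightarrow> (\<Sum>i\<in>I. p i) \<in> forms n k"
  by (induction I rule: infinite_finite_induct) (auto intro: forms_add)

lemma forms_mult:
  assumes "p \<in> forms n j" "q \<in> forms n k" shows "p * q \<in> forms n (j + k)"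
  unfolding forms_def mem_Collect_eq
proof
  fix m assume "m \<in> ks (p * q)"
  then obtain a b where m: "m = a + b" and a: "a \<in> ks p" and b: "b \<in> ks q"
    using keys_mult[of p q] by blast
  have "ks a \<subseteq> {..<n}" "ks b \<subseteq> {..<n}" "monomial_degree a = j" "monomial_degree b = k"
    using a b assms by (auto simp: forms_def)
  thus "ks m \<subseteq> {..<n} \<and> monomial_degree m = j + k"
    unfolding m monomial_degree_add using keys_add[of a b] by blast
qed

lemma forms_single: "ks m \<subseteq> {..<n} \<Longrightarrow> monomial_degree m = k \<Longrightarrow> Poly_Mapping.single m a \<in> forms n k"
  by (cases "a = 0") (auto simp: forms_def)

lemma forms_one: "1 \<in> forms n 0"
  using forms_single[of 0 n 0 1] by (simp add: monomial_degree_def)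

lemma forms_Xv: "i < n \<Longrightarrow> Xv i \<in> forms n 1"
  unfolding Xv_def by (rule forms_single) (auto simp: monomial_degree_def)

lemma forms_power: "p \<in> forms n j \<Longrightarrow> p ^ k \<in> forms n (j * k)"
  by (induction k) (use forms_one forms_mult[of p n j] in auto)

lemma forms_scaleR: "p \<in> forms n k \<Longrightarrow> r *\<^sub>R p \<in> forms n k"
proof -
  have lk: "lk (r *\<^sub>R p) m = r * lk p m" for m
    by (simp add: scaleR_poly_mapping_def Abs_poly_mapping_inverse)
  thus "p \<in> forms n k \<Longrightarrow> r *\<^sub>R p \<in> forms n k"
    by (auto simp: forms_def in_keys_iff)
qed

lemma ev_form_cong:
  assumes "p \<in> forms n k" "\<And>i. i < n \<Longrightarrow> z i = z' i" shows "ev p z = ev p z'"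
  unfolding ev_def mon_def
  by (intro sum.cong prod.cong arg_cong2[where f=times] refl) (use assms in \<open>force simp: forms_def\<close>)

section \<open>Forms are determined by their values\<close>

text \<open>Serves the Kronecker substitution: exponents below \<open>K\<close> are recovered as
  digits.\<close>

lemma digits_unique:
  fixes a b :: "nat \<Rightarrow> nat"
  assumes "\<And>i. i < n \<Longrightarrow> a i < K \<and> b i < K" "(\<Sum>i<n. a i * K ^ i) = (\<Sum>i<n. b i * K ^ i)" "i < n"
  shows "a i = b i"
  using assms
proof (induction n arbitrary: i)
  case (Suc n)
  have lt: "(\<Sum>i<m. f i * K ^ i) < K ^ m" if "\<And>i. i < m \<Longrightarrow> f i < K" for f m
    using that
  proof (induction m)
    case (Suc m)
    have "(\<Sum>i<m. f i * K ^ i) < K ^ m" using Suc by simp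
    moreover have "f m * K ^ m + K ^ m \<le> K * K ^ m"
      using mult_le_mono1[of "Suc (f m)" K "K ^ m"] Suc.prems[of m] by simp
    ultimately show ?case by simp
  qed simp
  have la: "(\<Sum>i<n. a i * K ^ i) < K ^ n" "(\<Sum>i<n. b i * K ^ i) < K ^ n" using Suc.prems(1) by (auto intro!: lt)
  have K: "K ^ n \<noteq> 0" using la by linarith
  have "a n = ((\<Sum>i<n. a i * K ^ i) + a n * K ^ n) div K ^ n" using la(1) K by (simp add: div_mult_self1)
  also have "\<dots> = ((\<Sum>i<n. b i * K ^ i) + b n * K ^ n) div K ^ n" using Suc.prems(2) by simp
  also have "\<dots> = b n" using la(2) K by (simp add: div_mult_self1)
  finally have "a n = b n" .
  moreover from this have "(\<Sum>i<n. a i * K ^ i) = (\<Sum>i<n. b i * K ^ i)" using Suc.prems(2) by simp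
  ultimately show ?case using Suc.IH[of i] Suc.prems by (cases "i = n") auto
qed simp

text \<open>Kronecker substitution of \<open>t ^ (Suc k ^ i)\<close> for variable \<open>i\<close>:
  no exponent exceeds \<open>k\<close>, so different monomials become different powers of
  \<open>t\<close>, and the univariate case applies.\<close>

lemma form_eq_0:
  assumes p: "p \<in> forms n k" and 0: "\<And>z. ev p z = 0" shows "p = 0"
proof (rule ccontr)
  assume "p \<noteq> 0"
  then obtain m0 where m0: "m0 \<in> ks p" using keys_eq_empty by blast
  let ?K = "Suc k"
  define e where "e = (\<lambda>m::monomial. \<Sum>i<n. lk m i * ?K ^ i)"
  have keys: "ks m \<subseteq> {..<n}" "monomial_degree m = k" if "m \<in> ks p" for m using p that by (auto simp: forms_def)
  have small: "lk m i < ?K" if "m \<in> ks p" for m i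
  proof (cases "i \<in> ks m")
    case True
    hence "lk m i \<le> monomial_degree m" unfolding monomial_degree_def by (intro member_le_sum) auto
    thus ?thesis using keys[OF that] by simp
  qed (simp add: in_keys_iff)
  have inj: "m = m'" if "m \<in> ks p" "m' \<in> ks p" "e m = e m'" for m m'
  proof (rule poly_mapping_eqI)
    fix i
    show "lk m i = lk m' i"
    proof (cases "i < n")
      case True
      show ?thesis
        by (rule digits_unique[of n "lk m" ?K "lk m'"]) (use that small True in \<open>auto simp: e_def\<close>)
    next
      case False
      hence "i \<notin> ks m" "i \<notin> ks m'" using keys that by auto
      thus ?thesis by (simp add: in_keys_iff)
    qed
  qed
  define Q where "Q = (\<Sum>m\<in>ks p. monom (lk p m) (e m))"
  have "poly Q t = 0" for t
  proof -
    have "mon m (\<lambda>i. t ^ (?K ^ i)) = t ^ e m" if "m \<in> ks p" for m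
    proof -
      have "mon m (\<lambda>i. t ^ (?K ^ i)) = (\<Prod>i<n. (t ^ (?K ^ i)) ^ lk m i)" using keys[OF that] by (intro mon_superset) auto
      also have "\<dots> = t ^ e m" by (simp add: e_def power_sum power_mult[symmetric] mult.commute)
      finally show ?thesis .
    qed
    hence "poly Q t = ev p (\<lambda>i. t ^ (?K ^ i))" by (simp add: Q_def poly_sum poly_monom ev_def)
    thus ?thesis using 0 by simp
  qed
  hence "Q = 0" by (simp add: poly_all_0_iff_0[symmetric])
  moreover have "coeff Q (e m0) = lk p m0"
  proof -
    have "coeff Q (e m0) = (\<Sum>m\<in>ks p. if m = m0 then lk p m else 0)"
      unfolding Q_def coeff_sum using inj m0 by (intro sum.cong) auto
    thus ?thesis using m0 by simp
  qed
  ultimately show False using m0 by (simp add: in_keys_iff)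
qed

lemma form_eqI:
  assumes "p \<in> forms n k" "q \<in> forms n k" "\<And>z. ev p z = ev q z" shows "p = q"
  using form_eq_0[OF forms_diff[OF assms(1,2)]] assms(3) by (simp add: ev_diff)

lemma psd_forms_iff: "p \<in> psd_forms n k \<longleftrightarrow> p \<in> forms n k \<and> (\<forall>z. 0 \<le> ev p z)"
proof -
  have "0 \<le> ev p z" if "p \<in> forms n k" "\<forall>x\<in>carrier_vec n. 0 \<le> eval_poly p x" for z
  proof -
    have "0 \<le> eval_poly p (Matrix.vec n z)" using that(2) by auto
    also have "eval_poly p (Matrix.vec n z) = ev p z"
      unfolding eval_poly_ev using that(1) by (intro ev_form_cong) auto
    finally show ?thesis .
  qed
  thus ?thesis unfolding psd_forms_def by (auto simp: eval_poly_ev)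
qed

text \<open>The functions defined by forms of degree \<open>k\<close> in \<open>n\<close> variables, without reference to monomials.\<close>

primrec hom_fun :: "nat \<Rightarrow> nat \<Rightarrow> ((nat \<Rightarrow> real) \<Rightarrow> real) set" where
  "hom_fun n 0 = {f. \<exists>c. f = (\<lambda>_. c)}"
| "hom_fun n (Suc k) = {f. \<exists>G. (\<forall>i<n. G i \<in> hom_fun n k) \<and> f = (\<lambda>z. \<Sum>i<n. z i * G i z)}"

lemma hom_fun_add: "f \<in> hom_fun n k \<Longrightarrow> g \<in> hom_fun n k \<Longrightarrow> (\<lambda>z. f z + g z) \<in> hom_fun n k"
proof (induction k arbitrary: f g)
  case 0
  thus ?case by auto
next
  case (Suc k)
  from Suc.prems obtain F G where "\<And>i. i < n \<Longrightarrow> F i \<in> hom_fun n k" "f = (\<lambda>z. \<Sum>i<n. z i * F i z)"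
    "\<And>i. i < n \<Longrightarrow> G i \<in> hom_fun n k" "g = (\<lambda>z. \<Sum>i<n. z i * G i z)" by auto
  thus ?case using Suc.IH
    by (auto intro!: exI[of _ "\<lambda>i z. F i z + G i z"] simp: sum.distrib distrib_left)
qed

lemma hom_fun_scale: "f \<in> hom_fun n k \<Longrightarrow> (\<lambda>z. r * f z) \<in> hom_fun n k"
proof (induction k arbitrary: f)
  case 0
  thus ?case by auto
next
  case (Suc k)
  from Suc.prems obtain F where "\<And>i. i < n \<Longrightarrow> F i \<in> hom_fun n k" "f = (\<lambda>z. \<Sum>i<n. z i * F i z)" by auto
  thus ?case using Suc.IH
    by (auto intro!: exI[of _ "\<lambda>i z. r * F i z"] simp: sum_distrib_left mult.left_commute)
qed

lemma hom_fun_zero: "(\<lambda>_. 0) \<in> hom_fun n k"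
proof (induction k)
  case (Suc k)
  thus ?case by (auto intro!: exI[of _ "\<lambda>_ _. 0"])
qed auto

lemma hom_fun_sum: "(\<And>i. i \<in> I \<Longrightarrow> f i \<in> hom_fun n k) \<Longrightarrow> (\<lambda>z. \<Sum>i\<in>I. f i z) \<in> hom_fun n k"
  by (induction I rule: infinite_finite_induct) (auto intro: hom_fun_add hom_fun_zero)

lemma hom_fun_times_var: "i < n \<Longrightarrow> f \<in> hom_fun n k \<Longrightarrow> (\<lambda>z. z i * f z) \<in> hom_fun n (Suc k)"
proof -
  assume i: "i < n" and f: "f \<in> hom_fun n k"
  define G where "G = (\<lambda>j z. if j = i then f z else 0)"
  have "G j \<in> hom_fun n k" for j using f hom_fun_zero by (cases "j = i") (auto simp: G_def)
  moreover have "(\<lambda>z. z i * f z) = (\<lambda>z. \<Sum>j<n. z j * G j z)"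
  proof
    fix z
    have "(\<Sum>j<n. z j * G j z) = (\<Sum>j<n. if j = i then z i * f z else 0)" by (intro sum.cong) (auto simp: G_def)
    thus "z i * f z = (\<Sum>j<n. z j * G j z)" using i by simp
  qed
  ultimately show ?thesis unfolding hom_fun.simps mem_Collect_eq by (intro exI[of _ G]) simp
qed

lemma hom_fun_mult: "f \<in> hom_fun n j \<Longrightarrow> g \<in> hom_fun n k \<Longrightarrow> (\<lambda>z. f z * g z) \<in> hom_fun n (j + k)"
proof (induction j arbitrary: f)
  case 0
  thus ?case by (auto intro: hom_fun_scale)
next
  case (Suc j)
  then obtain F where F: "\<And>i. i < n \<Longrightarrow> F i \<in> hom_fun n j" "f = (\<lambda>z. \<Sum>i<n. z i * F i z)" by auto
  have "(\<lambda>z. \<Sum>i<n. z i * (F i z * g z)) \<in> hom_fun n (Suc (j + k))"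
    using Suc F(1) by (intro hom_fun_sum hom_fun_times_var) auto
  thus ?case by (simp add: F(2) sum_distrib_right mult.assoc)
qed

lemma ev_monomial_hom_fun: "ks m \<subseteq> {..<n} \<Longrightarrow> monomial_degree m = k \<Longrightarrow> mon m \<in> hom_fun n k"
proof (induction k arbitrary: m)
  case 0
  have "ks m = {}"
  proof (rule ccontr)
    assume "ks m \<noteq> {}"
    then obtain i where i: "i \<in> ks m" by blast
    have "lk m i \<le> monomial_degree m" unfolding monomial_degree_def by (intro member_le_sum) (use i in auto)
    thus False using 0 i by (simp add: in_keys_iff)
  qed
  thus ?case by (auto simp: mon_def[abs_def])
next
  case (Suc k)
  hence "ks m \<noteq> {}" by (auto simp: monomial_degree_def)
  then obtain i where i: "i \<in> ks m" by blast
  define m' where "m' = m - Poly_Mapping.single i 1"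
  have m: "m = Poly_Mapping.single i 1 + m'"
    using i by (intro poly_mapping_eqI) (auto simp: m'_def lookup_add lookup_minus lookup_single when_def in_keys_iff)
  have "monomial_degree (Poly_Mapping.single i 1) = 1" by (simp add: monomial_degree_def)
  hence d: "monomial_degree m' = k" using Suc.prems(2) unfolding m monomial_degree_add by simp
  have "ks m' \<subseteq> {..<n}" using Suc.prems(1) by (auto simp: m'_def in_keys_iff lookup_minus subset_iff)
  from hom_fun_times_var[OF _ Suc.IH[OF this d], of i] i Suc.prems(1)
  have "(\<lambda>z. z i * mon m' z) \<in> hom_fun n (Suc k)" by auto
  also have "(\<lambda>z. z i * mon m' z) = mon m"
  proof
    fix z show "z i * mon m' z = mon m z" unfolding m mon_add by (simp add: mon_def)
  qed
  finally show ?case .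
qed

lemma ev_form_hom_fun: "p \<in> forms n k \<Longrightarrow> ev p \<in> hom_fun n k"
proof -
  assume p: "p \<in> forms n k"
  have "(\<lambda>z. \<Sum>m\<in>ks p. lk p m * mon m z) \<in> hom_fun n k"
    by (intro hom_fun_sum hom_fun_scale ev_monomial_hom_fun) (use p in \<open>auto simp: forms_def\<close>)
  thus ?thesis by (simp add: ev_def[abs_def])
qed

lemma hom_fun_form: "f \<in> hom_fun n k \<Longrightarrow> \<exists>p\<in>forms n k. ev p = f"
proof (induction k arbitrary: f)
  case 0
  then obtain c where c: "f = (\<lambda>_. c)" by auto
  show ?case
  proof (rule bexI)
    show "ev (Poly_Mapping.single 0 c) = f" by (rule ext) (simp add: ev_single mon_def c)
    show "Poly_Mapping.single 0 c \<in> forms n 0" by (rule forms_single) (auto simp: monomial_degree_def)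
  qed
next
  case (Suc k)
  then obtain F where F: "\<And>i. i < n \<Longrightarrow> F i \<in> hom_fun n k" "f = (\<lambda>z. \<Sum>i<n. z i * F i z)" by auto
  obtain q where q: "\<And>i. i < n \<Longrightarrow> q i \<in> forms n k" "\<And>i. i < n \<Longrightarrow> ev (q i) = F i"
  proof -
    have "\<forall>i\<in>{..<n}. \<exists>q. q \<in> forms n k \<and> ev q = F i" using Suc.IH F(1) by blast
    from bchoice[OF this] show ?thesis using that by auto
  qed
  show ?case
  proof (rule bexI)
    show "ev (\<Sum>i<n. Xv i * q i) = f" by (rule ext) (simp add: ev_sum ev_mult F(2) q(2))
    show "(\<Sum>i<n. Xv i * q i) \<in> forms n (Suc k)"
      using forms_mult[OF forms_Xv q(1)] by (intro forms_sum) auto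
  qed
qed

lemma hom_fun_polyfun: "f \<in> hom_fun n k \<Longrightarrow> polyfun f"
proof (induction k arbitrary: f)
  case 0
  thus ?case by (auto intro: polyfun_const)
next
  case (Suc k)
  then obtain F where F: "\<And>i. i < n \<Longrightarrow> F i \<in> hom_fun n k" "f = (\<lambda>z. \<Sum>i<n. z i * F i z)" by auto
  show ?case unfolding F(2) using F(1) Suc.IH by (intro polyfun_sum polyfun_mult polyfun_var) auto
qed

lemma hom_fun_homogeneous: "f \<in> hom_fun n k \<Longrightarrow> f (\<lambda>i. r * z i) = r ^ k * f z"
proof (induction k arbitrary: f)
  case (Suc k)
  then obtain F where F: "\<And>i. i < n \<Longrightarrow> F i \<in> hom_fun n k" "f = (\<lambda>z. \<Sum>i<n. z i * F i z)" by auto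
  show ?case unfolding F(2) using Suc.IH[OF F(1)] by (simp add: sum_distrib_left algebra_simps)
qed auto

lemma hom_fun_cong: "f \<in> hom_fun n k \<Longrightarrow> (\<And>i. i < n \<Longrightarrow> z i = z' i) \<Longrightarrow> f z = f z'"
proof (induction k arbitrary: f)
  case (Suc k)
  then obtain F where F: "\<And>i. i < n \<Longrightarrow> F i \<in> hom_fun n k" "f = (\<lambda>z. \<Sum>i<n. z i * F i z)" by auto
  show ?case unfolding F(2) using Suc.IH[OF F(1) Suc.prems(2)] Suc.prems(2) by (intro sum.cong) auto
qed auto

section \<open>Sums of squares of homogeneous functions\<close>

definition sos_fun :: "nat \<Rightarrow> nat \<Rightarrow> ((nat \<Rightarrow> real) \<Rightarrow> real) \<Rightarrow> bool" where
  "sos_fun n d f \<longleftrightarrow> (\<exists>N g. (\<forall>j<N::nat. g j \<in> hom_fun n d) \<and> (\<forall>z. f z = (\<Sum>j<N. (g j z)\<^sup>2)))"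

lemma sos_fun_square: "g \<in> hom_fun n d \<Longrightarrow> sos_fun n d (\<lambda>z. (g z)\<^sup>2)"
  unfolding sos_fun_def by (rule exI[of _ 1], rule exI[of _ "\<lambda>_. g"]) auto

lemma sos_fun_zero: "sos_fun n d (\<lambda>_. 0)"
  unfolding sos_fun_def by (rule exI[of _ 0]) auto

lemma sos_fun_add:
  assumes "sos_fun n d f" "sos_fun n d g" shows "sos_fun n d (\<lambda>z. f z + g z)"
proof -
  obtain N F M G where F: "\<And>j. j < N \<Longrightarrow> F j \<in> hom_fun n d" "\<And>z. f z = (\<Sum>j<N::nat. (F j z)\<^sup>2)"
    and G: "\<And>j. j < M \<Longrightarrow> G j \<in> hom_fun n d" "\<And>z. g z = (\<Sum>j<M::nat. (G j z)\<^sup>2)"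
    using assms unfolding sos_fun_def by blast
  define H where "H = (\<lambda>j. if j < N then F j else G (j - N))"
  have "(\<Sum>j<N + M. (H j z)\<^sup>2) = f z + g z" for z
  proof -
    have "(\<Sum>j<N + M. (H j z)\<^sup>2) = (\<Sum>j<N. (H j z)\<^sup>2) + (\<Sum>j<M. (H (N + j) z)\<^sup>2)"
      by (induction M) auto
    thus ?thesis by (simp add: H_def F G)
  qed
  moreover have "\<forall>j<N + M. H j \<in> hom_fun n d" using F G by (auto simp: H_def)
  ultimately show ?thesis unfolding sos_fun_def by metis
qed

lemma sos_fun_sum: "(\<And>i. i \<in> I \<Longrightarrow> sos_fun n d (f i)) \<Longrightarrow> sos_fun n d (\<lambda>z. \<Sum>i\<in>I. f i z)"
  by (induction I rule: infinite_finite_induct) (auto intro: sos_fun_add sos_fun_zero)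

lemma sos_fun_times_square:
  assumes "g \<in> hom_fun n e" "sos_fun n d f" shows "sos_fun n (e + d) (\<lambda>z. (g z)\<^sup>2 * f z)"
proof -
  obtain N F where F: "\<And>j. j < N \<Longrightarrow> F j \<in> hom_fun n d" "\<And>z. f z = (\<Sum>j<N::nat. (F j z)\<^sup>2)"
    using assms unfolding sos_fun_def by blast
  show ?thesis unfolding sos_fun_def
    by (rule exI[of _ N], rule exI[of _ "\<lambda>j z. g z * F j z"])
      (use F assms(1) in \<open>auto intro: hom_fun_mult simp: sum_distrib_left power_mult_distrib\<close>)
qed

lemma sos_fun_scale:
  assumes "r \<ge> 0" "sos_fun n d f" shows "sos_fun n d (\<lambda>z. r * f z)"
  using sos_fun_times_square[of "\<lambda>_. sqrt r" n 0 d f] assms by auto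

lemma sos_forms_I:
  assumes p: "p \<in> forms n (2 * d)" and "sos_fun n d (ev p)"
  shows "p \<in> sos_forms n (2 * d)"
proof -
  obtain N g where g: "\<And>j. j < N \<Longrightarrow> g j \<in> hom_fun n d" "\<And>z. ev p z = (\<Sum>j<N::nat. (g j z)\<^sup>2)"
    using assms unfolding sos_fun_def by blast
  obtain q where q: "\<And>j. j < N \<Longrightarrow> q j \<in> forms n d" "\<And>j. j < N \<Longrightarrow> ev (q j) = g j"
    using hom_fun_form[OF g(1)] by metis
  have "p = (\<Sum>j<N. q j ^ 2)"
  proof (rule form_eqI[OF p])
    have "q j ^ 2 \<in> forms n (2 * d)" if "j < N" for j
      using forms_power[OF q(1)[OF that], of 2] by (simp add: mult.commute)
    thus "(\<Sum>j<N. q j ^ 2) \<in> forms n (2 * d)" by (intro forms_sum) auto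
    show "ev p z = ev (\<Sum>j<N. q j ^ 2) z" for z by (simp add: g(2) ev_sum ev_power q(2))
  qed
  also have "\<dots> = (\<Sum>q\<leftarrow>map q [0..<N]. q ^ 2)"
    by (simp add: interv_sum_list_conv_sum_set_nat atLeast0LessThan comp_def)
  finally have "p = (\<Sum>q\<leftarrow>map q [0..<N]. q ^ 2)" .
  moreover have "\<forall>r\<in>set (map q [0..<N]). \<exists>j. r \<in> forms n j"
  proof
    fix r assume "r \<in> set (map q [0..<N])"
    hence "r \<in> forms n d" using q(1) by auto
    thus "\<exists>j. r \<in> forms n j" ..
  qed
  ultimately show ?thesis unfolding sos_forms_def using p by blast
qed

text \<open>The degrees of the squares are forgotten, since the two counterexamples exclude squares
  of arbitrary polynomials.\<close>

lemma sos_forms_polyfun: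
  assumes "p \<in> sos_forms n k"
  shows "\<exists>N \<phi>. (\<forall>j<N::nat. polyfun (\<phi> j)) \<and> (\<forall>z. ev p z = (\<Sum>j<N. (\<phi> j z)\<^sup>2))"
proof -
  obtain qs where qs: "\<And>q. q \<in> set qs \<Longrightarrow> \<exists>j. q \<in> forms n j" "p = (\<Sum>q\<leftarrow>qs. q ^ 2)"
    using assms by (auto simp: sos_forms_def)
  have "ev p z = (\<Sum>q\<leftarrow>qs. (ev q z)\<^sup>2)" for z by (simp add: qs(2) ev_sum_list ev_power)
  also have "(\<Sum>q\<leftarrow>qs. (ev q z)\<^sup>2) = (\<Sum>j<length qs. (ev (qs ! j) z)\<^sup>2)" for z
    by (simp add: sum_list_sum_nth atLeast0LessThan)
  finally have "ev p z = (\<Sum>j<length qs. (ev (qs ! j) z)\<^sup>2)" for z .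
  moreover have "polyfun (ev (qs ! j))" if "j < length qs" for j
    using qs(1)[of "qs ! j"] that ev_form_hom_fun hom_fun_polyfun by (metis nth_mem)
  ultimately show ?thesis by (intro exI[of _ "length qs"] exI[of _ "\<lambda>j. ev (qs ! j)"]) auto
qed

lemma sos_subset_psd: "sos_forms n k \<subseteq> psd_forms n k"
proof
  fix p assume p: "p \<in> sos_forms n k"
  then obtain N \<phi> where "\<And>z. ev p z = (\<Sum>j<N::nat. (\<phi> j z)\<^sup>2)" using sos_forms_polyfun by blast
  hence "ev p z \<ge> 0" for z by (simp add: sum_nonneg)
  thus "p \<in> psd_forms n k" using p by (auto simp: psd_forms_iff sos_forms_def)
qed

section \<open>Quadratic forms and conic duality\<close>

text \<open>Matrices are functions of two indices, so that a principal submatrix is obtained by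
  shrinking \<open>I\<close>.\<close>

definition quad_form :: "'i set \<Rightarrow> ('i \<Rightarrow> 'i \<Rightarrow> real) \<Rightarrow> ('i \<Rightarrow> real) \<Rightarrow> real" where
  "quad_form I A v = (\<Sum>a\<in>I. \<Sum>b\<in>I. v a * v b * A a b)"

definition bilin_form :: "'i set \<Rightarrow> ('i \<Rightarrow> 'i \<Rightarrow> real) \<Rightarrow> ('i \<Rightarrow> real) \<Rightarrow> ('i \<Rightarrow> real) \<Rightarrow> real" where
  "bilin_form I A v w = (\<Sum>a\<in>I. \<Sum>b\<in>I. v a * w b * A a b)"

definition psd_on :: "'i set \<Rightarrow> ('i \<Rightarrow> 'i \<Rightarrow> real) \<Rightarrow> bool" where
  "psd_on I A \<longleftrightarrow> (\<forall>v. 0 \<le> quad_form I A v)"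

lemma quad_form_bilin_form: "quad_form I A v = bilin_form I A v v"
  by (simp add: quad_form_def bilin_form_def)

lemma bilin_form_add_left: "bilin_form I A (\<lambda>a. v a + v' a) w = bilin_form I A v w + bilin_form I A v' w"
  by (simp add: bilin_form_def distrib_right sum.distrib)

lemma bilin_form_add_right: "bilin_form I A v (\<lambda>a. w a + w' a) = bilin_form I A v w + bilin_form I A v w'"
  by (simp add: bilin_form_def distrib_right distrib_left sum.distrib)

lemma bilin_form_scale_left: "bilin_form I A (\<lambda>a. r * v a) w = r * bilin_form I A v w"
  by (simp add: bilin_form_def sum_distrib_left mult.assoc)

lemma bilin_form_scale_right: "bilin_form I A v (\<lambda>a. r * w a) = r * bilin_form I A v w"
  by (simp add: bilin_form_def sum_distrib_left mult.assoc mult.left_commute)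

lemma bilin_form_sym: "(\<And>a b. a \<in> I \<Longrightarrow> b \<in> I \<Longrightarrow> A a b = A b a) \<Longrightarrow> bilin_form I A v w = bilin_form I A w v"
  unfolding bilin_form_def by (subst sum.swap) (intro sum.cong refl, simp add: mult.commute)

lemma bilin_form_matrix_sum: "bilin_form I (\<lambda>a b. \<Sum>i\<in>K. c i * B i a b) v w = (\<Sum>i\<in>K. c i * bilin_form I (B i) v w)"
proof -
  have "bilin_form I (\<lambda>a b. \<Sum>i\<in>K. c i * B i a b) v w = (\<Sum>a\<in>I. \<Sum>b\<in>I. \<Sum>i\<in>K. c i * (v a * w b * B i a b))"
    by (simp add: bilin_form_def sum_distrib_left mult.left_commute mult.assoc)
  also have "\<dots> = (\<Sum>a\<in>I. \<Sum>i\<in>K. \<Sum>b\<in>I. c i * (v a * w b * B i a b))"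
    by (intro sum.cong refl sum.swap)
  also have "\<dots> = (\<Sum>i\<in>K. \<Sum>a\<in>I. \<Sum>b\<in>I. c i * (v a * w b * B i a b))" by (rule sum.swap)
  finally show ?thesis by (simp add: bilin_form_def sum_distrib_left)
qed

lemma quad_form_matrix_sum: "quad_form I (\<lambda>a b. \<Sum>i\<in>K. c i * B i a b) v = (\<Sum>i\<in>K. c i * quad_form I (B i) v)"
  by (simp add: quad_form_bilin_form bilin_form_matrix_sum)

lemma quad_form_matrix_add: "quad_form I (\<lambda>a b. A a b + B a b) v = quad_form I A v + quad_form I B v"
  by (simp add: quad_form_def distrib_left sum.distrib)

lemma quad_form_matrix_scale: "quad_form I (\<lambda>a b. r * A a b) v = r * quad_form I A v"
  by (simp add: quad_form_def sum_distrib_left mult.left_commute mult.assoc)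

lemma quad_form_cong: "(\<And>a. a \<in> I \<Longrightarrow> v a = w a) \<Longrightarrow> quad_form I A v = quad_form I A w"
  unfolding quad_form_def by (intro sum.cong) auto

lemma bilin_form_subset:
  assumes "finite I" "S \<subseteq> I" "\<And>a. a \<in> I - S \<Longrightarrow> v a = 0" "\<And>a. a \<in> I - S \<Longrightarrow> w a = 0"
  shows "bilin_form I A v w = bilin_form S A v w"
proof -
  have "bilin_form I A v w = (\<Sum>a\<in>S. \<Sum>b\<in>I. v a * w b * A a b)"
    unfolding bilin_form_def by (rule sum.mono_neutral_right) (use assms in auto)
  also have "\<dots> = bilin_form S A v w"
    unfolding bilin_form_def by (intro sum.cong refl sum.mono_neutral_right) (use assms in auto)
  finally show ?thesis .
qed

lemma quad_form_add:
  assumes "\<And>a b. a \<in> I \<Longrightarrow> b \<in> I \<Longrightarrow> A a b = A b a"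
  shows "quad_form I A (\<lambda>a. v a + t * w a) = quad_form I A v + 2 * t * bilin_form I A v w + t\<^sup>2 * quad_form I A w"
  using bilin_form_sym[where I=I and A=A and v=v and w=w, OF assms]
  by (simp add: quad_form_bilin_form bilin_form_add_left bilin_form_add_right bilin_form_scale_left bilin_form_scale_right power2_eq_square algebra_simps)

text \<open>A null vector minimises a semidefinite form, so the linear term in every direction
  vanishes.\<close>

lemma psd_on_kernel:
  assumes sym: "\<And>a b. a \<in> I \<Longrightarrow> b \<in> I \<Longrightarrow> A a b = A b a" and psd: "psd_on I A" and 0: "quad_form I A v = 0"
  shows "bilin_form I A v w = 0"
proof (rule ccontr)
  assume nz: "bilin_form I A v w \<noteq> 0"
  define Q where "Q = quad_form I A w"
  define \<beta> where "\<beta> = bilin_form I A v w"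
  have ge: "0 \<le> 2 * t * \<beta> + t\<^sup>2 * Q" for t
    
  proof -
    have "0 \<le> quad_form I A (\<lambda>a. v a + t * w a)" using psd by (simp add: psd_on_def)
    thus ?thesis using quad_form_add[where I=I and A=A and v=v and t=t and w=w, OF sym] 0 by (simp add: Q_def \<beta>_def)
  qed
  have Q: "Q \<ge> 0" using psd by (simp add: Q_def psd_on_def)
  \<comment> \<open>The denominator \<open>Q + 1\<close> is positive even when
    \<open>Q = 0\<close>.\<close>
  define t where "t = - \<beta> / (Q + 1)"
  have "2 * t * \<beta> + t\<^sup>2 * Q = - \<beta>\<^sup>2 * (Q + 2) / (Q + 1)\<^sup>2"
  proof -
    define D where "D = Q + 1"
    have D: "D \<noteq> 0" and QD: "Q = D - 1" using Q by (auto simp: D_def)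
    show ?thesis unfolding t_def QD using D by (simp add: power2_eq_square field_simps)
  qed
  moreover have "\<beta>\<^sup>2 * (Q + 2) / (Q + 1)\<^sup>2 > 0" using Q nz by (simp add: \<beta>_def)
  ultimately show False using ge[of t] by simp
qed

lemma quad_form_insert:
  assumes "finite I" "r \<notin> I" "\<And>a. a \<in> I \<Longrightarrow> A a r = A r a"
  shows "quad_form (insert r I) A v = quad_form I A v + 2 * v r * (\<Sum>a\<in>I. v a * A a r) + (v r)\<^sup>2 * A r r"
  using assms by (simp add: quad_form_def sum.distrib sum_distrib_left power2_eq_square algebra_simps)

text \<open>Symmetric elimination: the Schur complement of the entry at \<open>r\<close> is again
  semidefinite, and its Gram vectors are completed by one more.\<close>

lemma gram:
  assumes "finite I" "\<And>a b. a \<in> I \<Longrightarrow> b \<in> I \<Longrightarrow> A a b = A b a" "psd_on I A"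
  shows "\<exists>u. \<forall>a\<in>I. \<forall>b\<in>I. A a b = (\<Sum>j\<in>I. u j a * u j b)"
  using assms
proof (induction I arbitrary: A rule: finite_induct)
  case (insert r I)
  have sym: "A a b = A b a" if "a \<in> insert r I" "b \<in> insert r I" for a b using insert.prems(1) that by blast
  have ins: "quad_form (insert r I) A v = quad_form I A v + 2 * v r * (\<Sum>a\<in>I. v a * A a r) + (v r)\<^sup>2 * A r r" for v
    by (rule quad_form_insert) (use insert sym in auto)
  have nonneg: "0 \<le> quad_form I A v + 2 * v r * (\<Sum>a\<in>I. v a * A a r) + (v r)\<^sup>2 * A r r" for v
    using insert.prems(2) unfolding psd_on_def ins by blast
  have set_r: "quad_form I A (v(r := x)) = quad_form I A v" "(\<Sum>a\<in>I. (v(r := x)) a * A a r) = (\<Sum>a\<in>I. v a * A a r)" for v x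
    using insert.hyps by (auto intro!: quad_form_cong sum.cong)
  have nn: "0 \<le> quad_form I A v + 2 * x * (\<Sum>a\<in>I. v a * A a r) + x\<^sup>2 * A r r" for v x
    using nonneg[of "v(r := x)"] unfolding set_r by simp
  have rr: "A r r \<ge> 0" using nn[of "\<lambda>_. 0" 1] by (simp add: quad_form_def)
  \<comment> \<open>If the pivot is 0, division by zero leaves \<open>A' = A\<close>; the row of
    \<open>r\<close> vanishes in that case.\<close>
  define A' where "A' = (\<lambda>a b. A a b - A a r * A b r / A r r)"
  have psdA': "psd_on I A'"
    unfolding psd_on_def
  proof
    fix v
    define s where "s = (\<Sum>a\<in>I. v a * A a r)"
    have "quad_form I A' v = quad_form I A v - s\<^sup>2 / A r r"
    proof -
      have "(\<Sum>a\<in>I. \<Sum>b\<in>I. v a * v b * (A a r * A b r / A r r)) = s\<^sup>2 / A r r"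
        by (simp add: s_def power2_eq_square sum_product sum_divide_distrib mult_ac)
      thus ?thesis by (simp add: quad_form_def A'_def right_diff_distrib sum_subtractf)
    qed
    moreover have "0 \<le> quad_form I A v - s\<^sup>2 / A r r"
    proof (cases "A r r = 0")
      case True
      thus ?thesis using nn[of v 0] by simp
    next
      case False
      \<comment> \<open>This value of the coordinate \<open>r\<close> minimises the form.\<close>
      thus ?thesis using nn[of v "- s / A r r"] by (simp add: s_def[symmetric] power2_eq_square field_simps)
    qed
    ultimately show "0 \<le> quad_form I A' v" by simp
  qed
  have symA': "A' a b = A' b a" if "a \<in> I" "b \<in> I" for a b
    using sym[of a b] that by (simp add: A'_def mult.commute)
  from insert.IH[OF symA' psdA'] obtain u where u: "\<And>a b. a \<in> I \<Longrightarrow> b \<in> I \<Longrightarrow> A' a b = (\<Sum>j\<in>I. u j a * u j b)"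
    by blast
  have zero_row: "A a r = 0" if "A r r = 0" "a \<in> I" for a
  proof (rule ccontr)
    assume nz: "A a r \<noteq> 0"
    have s: "(\<Sum>b\<in>I. (if b = a then x else 0) * A b r) = x * A a r" for x
    proof -
      have "(\<Sum>b\<in>I. (if b = a then x else 0) * A b r) = (\<Sum>b\<in>I. if b = a then x * A a r else 0)"
        by (intro sum.cong) auto
      thus ?thesis using that insert.hyps by simp
    qed
    define Q where "Q = quad_form I A (\<lambda>b. if b = a then 1 else 0)"
    have "0 \<le> Q + 2 * x * A a r" for x
      using nn[of "\<lambda>b. if b = a then 1 else 0" x] that(1) unfolding s Q_def by simp
    from this[of "- (Q + 1) / (2 * A a r)"] nz show False by (simp add: field_simps)
  qed
  define w where "w = (\<lambda>j a. if j = r then (if a = r then sqrt (A r r) else A a r / sqrt (A r r)) else if a = r then 0 else u j a)"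
  have "A a b = (\<Sum>j\<in>insert r I. w j a * w j b)" if ab: "a \<in> insert r I" "b \<in> insert r I" for a b
  proof -
    have 1: "(\<Sum>j\<in>insert r I. w j a * w j b) = w r a * w r b + (\<Sum>j\<in>I. w j a * w j b)"
      using insert.hyps by simp
    consider "a = r" "b = r" | "a = r" "b \<in> I" | "a \<in> I" "b = r" | "a \<in> I" "b \<in> I" using ab by blast
    thus ?thesis
    proof cases
      case 1
      have "(\<Sum>j\<in>I. w j a * w j b) = 0" using 1 insert.hyps by (intro sum.neutral) (auto simp: w_def)
      thus ?thesis using 1 insert.hyps rr by (simp add: w_def)
    next
      case 2
      have "(\<Sum>j\<in>I. w j a * w j b) = 0" using 2 insert.hyps by (intro sum.neutral) (auto simp: w_def)
      moreover have "b \<noteq> r" using 2 insert.hyps by auto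
      ultimately show ?thesis using 2 insert.hyps rr zero_row[of b] sym[of r b] by (cases "A r r = 0") (auto simp: w_def)
    next
      case 3
      have "(\<Sum>j\<in>I. w j a * w j b) = 0" using 3 insert.hyps by (intro sum.neutral) (auto simp: w_def)
      moreover have "a \<noteq> r" using 3 insert.hyps by auto
      ultimately show ?thesis using 3 insert.hyps rr zero_row[of a] by (cases "A r r = 0") (auto simp: w_def)
    next
      case 4
      have ne: "a \<noteq> r" "b \<noteq> r" using 4 insert.hyps by auto
      have "(\<Sum>j\<in>I. w j a * w j b) = (\<Sum>j\<in>I. u j a * u j b)"
        using ne insert.hyps by (intro sum.cong) (auto simp: w_def)
      also have "\<dots> = A' a b" using u[OF 4] ..
      moreover have "w r a * w r b = A a r * A b r / A r r" using ne rr by (simp add: w_def)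
      ultimately show ?thesis unfolding 1 by (simp add: A'_def)
    qed
  qed
  thus ?case by blast
qed auto

lemma gram_quad_form:
  assumes "\<And>a b. a \<in> I \<Longrightarrow> b \<in> I \<Longrightarrow> A a b = (\<Sum>j\<in>J. u j a * u j b)"
  shows "quad_form I A v = (\<Sum>j\<in>J. (\<Sum>a\<in>I. u j a * v a)\<^sup>2)"
proof -
  have "quad_form I A v = (\<Sum>a\<in>I. \<Sum>b\<in>I. \<Sum>j\<in>J. (u j a * v a) * (u j b * v b))"
    unfolding quad_form_def by (intro sum.cong refl) (simp add: assms sum_distrib_left mult_ac)
  also have "\<dots> = (\<Sum>a\<in>I. \<Sum>j\<in>J. \<Sum>b\<in>I. (u j a * v a) * (u j b * v b))" by (intro sum.cong refl sum.swap)
  also have "\<dots> = (\<Sum>j\<in>J. \<Sum>a\<in>I. \<Sum>b\<in>I. (u j a * v a) * (u j b * v b))" by (rule sum.swap)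
  finally show ?thesis by (simp add: power2_eq_square sum_product)
qed

lemma quadratic_sos_fun:
  assumes f: "f \<in> hom_fun n 2" and nonneg: "\<And>z. f z \<ge> 0" shows "sos_fun n 1 f"
proof -
  have "f \<in> hom_fun n (Suc (Suc 0))" using f by (simp add: numeral_2_eq_2)
  then obtain G where G: "\<And>i. i < n \<Longrightarrow> G i \<in> hom_fun n (Suc 0)" "f = (\<lambda>z. \<Sum>i<n. z i * G i z)"
    unfolding hom_fun.simps(2)[of n "Suc 0"] by blast
  have "\<exists>c. G i = (\<lambda>z. \<Sum>j<n. z j * c j)" if i: "i < n" for i
  proof -
    from G(1)[OF i] obtain F where F: "\<forall>j<n. F j \<in> hom_fun n 0" "G i = (\<lambda>z. \<Sum>j<n. z j * F j z)" by auto
    hence "\<forall>j<n. \<exists>c. F j = (\<lambda>_. c)" by simp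
    then obtain c where "\<And>j. j < n \<Longrightarrow> F j = (\<lambda>_. c j)" by metis
    hence "G i = (\<lambda>z. \<Sum>j<n. z j * c j)" unfolding F(2) by (intro ext sum.cong) auto
    thus ?thesis by blast
  qed
  then obtain C where C: "\<And>i. i < n \<Longrightarrow> G i = (\<lambda>z. \<Sum>j<n. z j * C i j)" by metis
  define A where "A = (\<lambda>a b. (C a b + C b a) / 2)"
  have fq: "f z = quad_form {..<n} A z" for z
  proof -
    have "f z = (\<Sum>a<n. \<Sum>b<n. z a * z b * C a b)" by (simp add: G(2) C sum_distrib_left mult.assoc)
    moreover have "(\<Sum>a<n. \<Sum>b<n. z a * z b * C a b) = (\<Sum>a<n. \<Sum>b<n. z a * z b * C b a)"
      by (subst sum.swap) (simp add: mult.commute)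
    ultimately have "f z = ((\<Sum>a<n. \<Sum>b<n. z a * z b * C a b) + (\<Sum>a<n. \<Sum>b<n. z a * z b * C b a)) / 2" by simp
    thus ?thesis by (simp add: quad_form_def A_def sum.distrib[symmetric] sum_divide_distrib distrib_left add_divide_distrib)
  qed
  have "\<exists>u. \<forall>a\<in>{..<n}. \<forall>b\<in>{..<n}. A a b = (\<Sum>j\<in>{..<n}. u j a * u j b)"
  proof (rule gram)
    show "A a b = A b a" for a b by (simp add: A_def)
    show "psd_on {..<n} A" using nonneg fq by (simp add: psd_on_def)
  qed simp
  then obtain u where u: "\<And>a b. a \<in> {..<n} \<Longrightarrow> b \<in> {..<n} \<Longrightarrow> A a b = (\<Sum>j<n. u j a * u j b)" by blast
  have "f z = (\<Sum>j<n. (\<Sum>a<n. z a * u j a)\<^sup>2)" for z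
    using gram_quad_form[where I="{..<n}" and J="{..<n}" and A=A and u=u and v=z, OF u] by (simp add: fq mult.commute)
  moreover have "(\<lambda>z. \<Sum>a<n. z a * u j a) \<in> hom_fun n 1" for j
    by (auto intro!: exI[of _ "\<lambda>a _. u j a"])
  ultimately show ?thesis unfolding sos_fun_def
    by (intro exI[of _ n] exI[of _ "\<lambda>j z. \<Sum>a<n. z a * u j a"]) simp
qed

text \<open>Gaussian elimination, one equation at a time. Keeping always \<open>N\<close>
  generators, possibly dependent or zero, avoids dimension counts and leaves the number of
  parameters of a pencil unchanged.\<close>

lemma solution_space_generated:
  fixes cs :: "(nat \<Rightarrow> real) list" and N :: nat
  shows "\<exists>el :: nat \<Rightarrow> nat \<Rightarrow> real. \<forall>\<eta>. (\<forall>c\<in>set cs. (\<Sum>i<N. c i * \<eta> i) = 0) \<longleftrightarrow>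
    (\<exists>t. \<forall>i<N. \<eta> i = (\<Sum>j<N. t j * el j i))"
proof (induction cs)
  case Nil
  have "(\<Sum>j<N. t j * (if i = j then 1 else 0)) = t i" if "i < N" for t :: "nat \<Rightarrow> real" and i
  proof -
    have "(\<Sum>j<N. t j * (if i = j then 1 else 0)) = (\<Sum>j<N. if j = i then t i else 0)" by (intro sum.cong) auto
    thus ?thesis using that by simp
  qed
  thus ?case by (intro exI[of _ "\<lambda>j i. if i = j then 1 else 0"]) auto
next
  case (Cons c cs)
  then obtain el :: "nat \<Rightarrow> nat \<Rightarrow> real" where el: "\<And>\<eta>. (\<forall>c\<in>set cs. (\<Sum>i<N. c i * \<eta> i) = 0) \<longleftrightarrow>
    (\<exists>t. \<forall>i<N. \<eta> i = (\<Sum>j<N. t j * el j i))" by blast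
  define d where "d = (\<lambda>j. \<Sum>i<N. c i * el j i)"
  have cd: "(\<Sum>i<N. c i * \<eta> i) = (\<Sum>j<N. t j * d j)" if "\<forall>i<N. \<eta> i = (\<Sum>j<N. t j * el j i)" for \<eta> t
  proof -
    have "(\<Sum>i<N. c i * \<eta> i) = (\<Sum>i<N. \<Sum>j<N. t j * (c i * el j i))"
      using that by (simp add: sum_distrib_left mult.left_commute)
    also have "\<dots> = (\<Sum>j<N. \<Sum>i<N. t j * (c i * el j i))" by (rule sum.swap)
    finally show ?thesis by (simp add: d_def sum_distrib_left)
  qed
  show ?case
  proof (cases "\<forall>j<N. d j = 0")
    case True
    have "(\<forall>c\<in>set (c # cs). (\<Sum>i<N. c i * \<eta> i) = 0) \<longleftrightarrow> (\<exists>t. \<forall>i<N. \<eta> i = (\<Sum>j<N. t j * el j i))" for \<eta>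
      using el[of \<eta>] cd[of \<eta>] True by auto
    thus ?thesis by blast
  next
    case False
    then obtain q where q: "q < N" "d q \<noteq> 0" by blast
    define el' where "el' = (\<lambda>j i. el j i - d j / d q * el q i)"
    have comb: "(\<Sum>j<N. t j * el' j i) = (\<Sum>j<N. t j * el j i) - (\<Sum>j<N. t j * d j) / d q * el q i" for t i
      by (simp add: el'_def right_diff_distrib sum_subtractf sum_distrib_right sum_divide_distrib mult.assoc)
    have "(\<forall>c\<in>set (c # cs). (\<Sum>i<N. c i * \<eta> i) = 0) \<longleftrightarrow> (\<exists>t. \<forall>i<N. \<eta> i = (\<Sum>j<N. t j * el' j i))" for \<eta>
    proof
      assume a: "\<forall>c\<in>set (c # cs). (\<Sum>i<N. c i * \<eta> i) = 0"
      then obtain t where t: "\<forall>i<N. \<eta> i = (\<Sum>j<N. t j * el j i)" using el[of \<eta>] by auto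
      hence "(\<Sum>j<N. t j * d j) = 0" using cd[OF t] a by simp
      thus "\<exists>t. \<forall>i<N. \<eta> i = (\<Sum>j<N. t j * el' j i)" using t by (intro exI[of _ t]) (simp add: comb)
    next
      assume "\<exists>t. \<forall>i<N. \<eta> i = (\<Sum>j<N. t j * el' j i)"
      then obtain t where t: "\<forall>i<N. \<eta> i = (\<Sum>j<N. t j * el' j i)" by blast
      \<comment> \<open>Rewrites a combination of the \<open>el'\<close> as one of the
        \<open>el\<close>; the coefficient at the pivot \<open>q\<close> absorbs all
        corrections.\<close>
      define t' where "t' = t(q := t q - (\<Sum>j<N. t j * d j) / d q)"
      have upd: "(\<Sum>j<N. t' j * e j) = (\<Sum>j<N. t j * e j) - (\<Sum>j<N. t j * d j) / d q * e q" for e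
      proof -
        have "(\<Sum>j<N. t' j * e j) = (\<Sum>j<N. t j * e j - (if j = q then (\<Sum>j<N. t j * d j) / d q * e q else 0))"
          by (intro sum.cong) (auto simp: t'_def algebra_simps)
        thus ?thesis using q(1) by (simp add: sum_subtractf)
      qed
      have t': "\<forall>i<N. \<eta> i = (\<Sum>j<N. t' j * el j i)" using t by (simp add: comb upd)
      moreover have "(\<Sum>j<N. t' j * d j) = 0" using q by (simp add: upd)
      ultimately show "\<forall>c\<in>set (c # cs). (\<Sum>i<N. c i * \<eta> i) = 0" using el[of \<eta>] cd[OF t'] by auto
    qed
    thus ?thesis by blast
  qed
qed

section \<open>Order units and positive functionals\<close>

text \<open>Compactness of the unit sphere: normalised vectors that violate the bounds
  \<open>real k\<close> would accumulate at a unit vector on which \<open>M\<close> is not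
  positive.\<close>

lemma order_unit:
  assumes fin: "finite I" and pd: "\<And>v. (\<exists>a\<in>I. v a \<noteq> 0) \<Longrightarrow> quad_form I M v > 0"
  shows "\<exists>R. \<forall>v. \<bar>quad_form I S v\<bar> \<le> R * quad_form I M v"
proof -
  define nn where "nn v = (\<Sum>a\<in>I. (v a)\<^sup>2)" for v :: "'a \<Rightarrow> real"
  have "\<exists>k::nat. \<forall>v. nn v \<le> real k * quad_form I M v"
  proof (rule ccontr)
    assume "\<not> (\<exists>k::nat. \<forall>v. nn v \<le> real k * quad_form I M v)"
    hence "\<forall>k::nat. \<exists>v. nn v > real k * quad_form I M v" by (simp add: not_le)
    then obtain V where V: "\<And>k::nat. nn (V k) > real k * quad_form I M (V k)" by metis
    have nz: "nn (V k) > 0" for k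
    proof (rule ccontr)
      assume "\<not> nn (V k) > 0"
      moreover have "nn (V k) \<ge> 0" by (simp add: nn_def sum_nonneg)
      ultimately have n0: "nn (V k) = 0" by simp
      hence "\<forall>a\<in>I. V k a = 0" using fin by (simp add: nn_def sum_nonneg_eq_0_iff)
      hence "quad_form I M (V k) = 0" by (simp add: quad_form_def)
      thus False using V[of k] n0 by simp
    qed
    define W where "W = (\<lambda>k a. V k a / sqrt (nn (V k)))"
    have nW: "nn (W k) = 1" for k
    proof -
      have "(W k a)\<^sup>2 = (V k a)\<^sup>2 / nn (V k)" for a using nz[of k] by (simp add: W_def power_divide)
      hence "nn (W k) = nn (V k) / nn (V k)" by (simp only: nn_def[of "W k"] nn_def[of "V k", symmetric] sum_divide_distrib[symmetric])
      thus ?thesis using nz[of k] by simp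
    qed
    have qW: "quad_form I M (W k) * real k < 1" for k
    proof -
      define r where "r = 1 / sqrt (nn (V k))"
      have rr: "r * r = 1 / nn (V k)" using nz[of k] by (simp add: r_def)
      have "W k = (\<lambda>a. r * V k a)" by (simp add: W_def r_def)
      hence "quad_form I M (W k) = r * (r * quad_form I M (V k))" by (simp only: quad_form_bilin_form bilin_form_scale_left bilin_form_scale_right)
      also have "\<dots> = quad_form I M (V k) / nn (V k)" unfolding mult.assoc[symmetric] rr by simp
      finally have "quad_form I M (W k) * real k = (real k * quad_form I M (V k)) / nn (V k)" by simp
      also have "\<dots> < 1" using V[of k] nz[of k] by (simp add: divide_less_eq)
      finally show ?thesis .
    qed
    have "\<bar>W k a\<bar> \<le> 1" if "a \<in> I" for a k
    proof -
      have "(W k a)\<^sup>2 \<le> nn (W k)" unfolding nn_def using that fin by (intro member_le_sum) auto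
      thus ?thesis using nW by (simp add: abs_square_le_1)
    qed
    from finite_family_subseq[OF fin, of "\<lambda>a k. W k a" 1, OF this] obtain r L where r: "strict_mono (r :: nat \<Rightarrow> nat)"
      and L: "\<And>a. a \<in> I \<Longrightarrow> (\<lambda>k. W (r k) a) \<longlonglongrightarrow> L a" by blast
    have "(\<lambda>k. nn (W (r k))) \<longlonglongrightarrow> nn L" unfolding nn_def by (intro tendsto_intros L)
    hence "nn L = 1" using nW LIMSEQ_unique[OF _ tendsto_const[of 1]] by simp
    hence "\<exists>a\<in>I. L a \<noteq> 0" by (rule contrapos_pp) (simp add: nn_def)
    hence pos: "quad_form I M L > 0" by (rule pd)
    have lim: "(\<lambda>k. quad_form I M (W (r k))) \<longlonglongrightarrow> quad_form I M L" unfolding quad_form_def by (intro tendsto_intros L)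
    hence "\<forall>\<^sub>F k in sequentially. quad_form I M (W (r k)) > quad_form I M L / 2" using pos by (intro order_tendstoD(1)[OF lim]) simp
    moreover have "\<forall>\<^sub>F k in sequentially. real k \<ge> 2 / quad_form I M L" by (rule eventually_ge_at_top[THEN eventually_compose_filterlim, OF filterlim_real_sequentially])
    ultimately have "\<forall>\<^sub>F k in sequentially. False"
    proof eventually_elim
      case (elim k)
      have "real k \<le> real (r k)" using r by (simp add: seq_suble)
      hence "2 / quad_form I M L \<le> real (r k)" using elim by simp
      hence "quad_form I M L / 2 * (2 / quad_form I M L) \<le> quad_form I M (W (r k)) * real (r k)"
        using elim pos by (intro mult_mono) auto
      thus False using qW[of "r k"] pos by simp
    qed
    thus False by simp
  qed
  then obtain k where k: "\<And>v. nn v \<le> real k * quad_form I M v" by blast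
  define C where "C = (\<Sum>a\<in>I. \<Sum>b\<in>I. \<bar>S a b\<bar>)"
  have C: "C \<ge> 0" by (simp add: C_def sum_nonneg)
  have "\<bar>quad_form I S v\<bar> \<le> C * nn v" for v
  proof -
    have "\<bar>v a * v b\<bar> \<le> nn v" if "a \<in> I" "b \<in> I" for a b
    proof -
      have "(v a)\<^sup>2 \<le> nn v" "(v b)\<^sup>2 \<le> nn v" unfolding nn_def using that fin by (auto intro!: member_le_sum)
      moreover have "2 * \<bar>v a * v b\<bar> \<le> (v a)\<^sup>2 + (v b)\<^sup>2"
        using sum_squares_bound[of "\<bar>v a\<bar>" "\<bar>v b\<bar>"] by (simp add: abs_mult)
      ultimately show ?thesis by linarith
    qed
    hence "\<bar>v a * v b * S a b\<bar> \<le> nn v * \<bar>S a b\<bar>" if "a \<in> I" "b \<in> I" for a b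
      using that by (subst abs_mult) (intro mult_right_mono, auto)
    hence "(\<Sum>a\<in>I. \<Sum>b\<in>I. \<bar>v a * v b * S a b\<bar>) \<le> (\<Sum>a\<in>I. \<Sum>b\<in>I. nn v * \<bar>S a b\<bar>)" by (intro sum_mono) auto
    moreover have "\<bar>quad_form I S v\<bar> \<le> (\<Sum>a\<in>I. \<Sum>b\<in>I. \<bar>v a * v b * S a b\<bar>)"
      unfolding quad_form_def by (rule order_trans[OF sum_abs sum_mono[OF sum_abs]])
    ultimately show ?thesis by (simp add: C_def sum_distrib_left mult.commute)
  qed
  hence "\<bar>quad_form I S v\<bar> \<le> C * (real k * quad_form I M v)" for v
    using k[of v] C by (meson mult_left_mono order_trans)
  thus ?thesis by (intro exI[of _ "C * real k"]) (simp add: mult.assoc)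
qed

text \<open>\<open>\<beta>\<close> is a functional on the span of the \<open>B i\<close>,
  nonnegative on the semidefinite members. It is well defined there, since a linear dependence
  yields the inequality for \<open>c\<close> and for \<open>- c\<close>.\<close>

definition pos_on :: "'i set \<Rightarrow> nat \<Rightarrow> (nat \<Rightarrow> 'i \<Rightarrow> 'i \<Rightarrow> real) \<Rightarrow> (nat \<Rightarrow> real) \<Rightarrow> bool" where
  "pos_on I n B \<beta> \<longleftrightarrow> (\<forall>c. (\<forall>v. 0 \<le> (\<Sum>i<n. c i * quad_form I (B i) v)) \<longrightarrow> 0 \<le> (\<Sum>i<n. c i * \<beta> i))"

text \<open>The step of Riesz' extension theorem. The value at \<open>S\<close> has to lie between
  the values at matrices below and above \<open>S\<close>; the infimum of the upper ones will do,
  and the order unit \<open>B 0\<close> provides such matrices on both sides.\<close>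

lemma pos_on_extend:
  assumes pos: "pos_on I n B \<beta>" and n: "n > 0" and R: "\<And>v. \<bar>quad_form I S v\<bar> \<le> R * quad_form I (B 0) v"
  shows "\<exists>s. pos_on I (Suc n) (B(n := S)) (\<beta>(n := s))"
proof -
  define U where "U = {c. \<forall>v. quad_form I S v \<le> (\<Sum>i<n. c i * quad_form I (B i) v)}"
  define val where "val = (\<lambda>c::nat \<Rightarrow> real. \<Sum>i<n. c i * \<beta> i)"
  have e0: "(\<Sum>i<n. (if i = 0 then x else 0) * g i) = x * g 0" for x :: real and g
  proof -
    have "(\<Sum>i<n. (if i = 0 then x else 0) * g i) = (\<Sum>i<n. if i = 0 then x * g 0 else 0)" by (intro sum.cong) auto
    thus ?thesis using n by simp
  qed
  have ne: "(\<lambda>i. if i = 0 then R else 0) \<in> U"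
    unfolding U_def using R by (auto simp: e0 abs_le_iff)
  have below: "- val c' \<le> val c" if c: "c \<in> U" and c': "\<And>v. 0 \<le> (\<Sum>i<n. c' i * quad_form I (B i) v) + quad_form I S v" for c c'
  proof -
    have "0 \<le> (\<Sum>i<n. (c i + c' i) * quad_form I (B i) v)" for v
    proof -
      have "quad_form I S v \<le> (\<Sum>i<n. c i * quad_form I (B i) v)" using c by (simp add: U_def)
      thus ?thesis using c'[of v] by (simp add: distrib_right sum.distrib)
    qed
    hence "0 \<le> (\<Sum>i<n. (c i + c' i) * \<beta> i)"
      using pos by (simp add: pos_on_def)
    thus ?thesis by (simp add: val_def distrib_right sum.distrib)
  qed
  have bdd: "bdd_below (val ` U)"
  proof (rule bdd_belowI2)
    fix c assume "c \<in> U"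
    thus "- val (\<lambda>i. if i = 0 then R else 0) \<le> val c"
      by (rule below) (use R in \<open>simp add: e0 abs_le_iff\<close>, smt (verit) R)
  qed
  define s where "s = Inf (val ` U)"
  have s_le: "s \<le> val c" if "c \<in> U" for c unfolding s_def using bdd that by (intro cInf_lower) auto
  have le_s: "- val c' \<le> s" if "\<And>v. 0 \<le> (\<Sum>i<n. c' i * quad_form I (B i) v) + quad_form I S v" for c'
    unfolding s_def using ne below that by (intro cInf_greatest) auto
  have "pos_on I (Suc n) (B(n := S)) (\<beta>(n := s))"
    unfolding pos_on_def
  proof (intro allI impI)
    fix c assume a: "\<forall>v. 0 \<le> (\<Sum>i<Suc n. c i * quad_form I ((B(n := S)) i) v)"
    have a': "0 \<le> (\<Sum>i<n. c i * quad_form I (B i) v) + c n * quad_form I S v" for v using a by simp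
    have "0 \<le> val c + c n * s"
    proof (cases "c n" "0::real" rule: linorder_cases)
      case equal
      thus ?thesis using pos a' by (simp add: pos_on_def val_def)
    next
      case greater
      have "0 \<le> (\<Sum>i<n. c i / c n * quad_form I (B i) v) + quad_form I S v" for v
      proof -
        have "(\<Sum>i<n. c i / c n * quad_form I (B i) v) + quad_form I S v = ((\<Sum>i<n. c i * quad_form I (B i) v) + c n * quad_form I S v) / c n"
          using greater by (simp add: sum_divide_distrib add_divide_distrib)
        thus ?thesis using a'[of v] greater by simp
      qed
      from le_s[OF this] have "- (val c / c n) \<le> s" by (simp add: val_def sum_divide_distrib)
      thus ?thesis using greater by (simp add: field_simps)
    next
      case less
      have "quad_form I S v \<le> (\<Sum>i<n. c i / - c n * quad_form I (B i) v)" for v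
      proof -
        have eq: "(\<Sum>i<n. c i / - c n * quad_form I (B i) v) = (\<Sum>i<n. c i * quad_form I (B i) v) / - c n"
          by (simp add: sum_divide_distrib sum_negf)
        have "quad_form I S v * - c n \<le> (\<Sum>i<n. c i * quad_form I (B i) v)" using a'[of v] by (simp add: mult.commute)
        thus ?thesis unfolding eq using less by (subst pos_le_divide_eq) simp_all
      qed
      hence "s \<le> val (\<lambda>i. c i / - c n)" by (intro s_le) (simp add: U_def)
      also have "\<dots> = val c / - c n" by (simp add: val_def sum_divide_distrib sum_negf)
      finally show ?thesis using less by (simp add: field_simps)
    qed
    thus "0 \<le> (\<Sum>i<Suc n. c i * (\<beta>(n := s)) i)" by (simp add: val_def)
  qed
  thus ?thesis by blast
qed

lemma pos_on_extend_list:
  assumes "pos_on I n B \<beta>" "n > 0" "\<And>S. \<exists>R. \<forall>v. \<bar>quad_form I S v\<bar> \<le> R * quad_form I (B 0) v"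
  shows "\<exists>B' \<beta>'. pos_on I (n + length Ss) B' \<beta>' \<and> (\<forall>i<n. B' i = B i \<and> \<beta>' i = \<beta> i) \<and>
    (\<forall>j<length Ss. B' (n + j) = Ss ! j)"
proof (induction Ss rule: rev_induct)
  case Nil
  show ?case using assms(1) by (intro exI[of _ B] exI[of _ \<beta>]) auto
next
  case (snoc S Ss)
  then obtain B' \<beta>' where *: "pos_on I (n + length Ss) B' \<beta>'" "\<forall>i<n. B' i = B i \<and> \<beta>' i = \<beta> i"
    "\<forall>j<length Ss. B' (n + j) = Ss ! j" by blast
  obtain R where "\<forall>v. \<bar>quad_form I S v\<bar> \<le> R * quad_form I (B' 0) v" using assms(2,3) *(2) by metis
  with pos_on_extend[OF *(1)] assms(2) obtain s
    where "pos_on I (Suc (n + length Ss)) (B'(n + length Ss := S)) (\<beta>'(n + length Ss := s))" by blast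
  thus ?case using *(2,3)
    by (intro exI[of _ "B'(n + length Ss := S)"] exI[of _ "\<beta>'(n + length Ss := s)"]) (auto simp: nth_append less_Suc_eq simp del: fun_upd_apply simp: fun_upd_other fun_upd_same)
qed

text \<open>The functional \<open>B i \<mapsto> \<beta> i\<close> is extended one matrix at a time to all matrices, keeping it nonnegative on
  positive semidefinite ones; a functional on all matrices is given by a Gram matrix.\<close>

lemma sdp_duality:
  fixes I :: "'i set"
  assumes fin: "finite I" and pos: "pos_on I n B \<beta>" and n: "n > 0"
    and unit: "\<And>S. \<exists>R. \<forall>v. \<bar>quad_form I S v\<bar> \<le> R * quad_form I (B 0) v"
  shows "\<exists>u. \<forall>i<n. \<beta> i = (\<Sum>j\<in>I. quad_form I (B i) (u j))"
proof -
  obtain ps where ps: "set ps = I \<times> I" "distinct ps" using finite_distinct_list[of "I \<times> I"] fin by auto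
  \<comment> \<open>All elementary matrices, not only symmetric combinations; the symmetry of the
    extended functional is derived afterwards.\<close>
  define E where "E = (\<lambda>(a::'i, b::'i) x y. if x = a \<and> y = b then 1 else (0::real))"
  obtain B' \<beta>' where B': "pos_on I (n + length ps) B' \<beta>'" "\<And>i. i < n \<Longrightarrow> B' i = B i" "\<And>i. i < n \<Longrightarrow> \<beta>' i = \<beta> i"
    "\<And>j. j < length ps \<Longrightarrow> B' (n + j) = E (ps ! j)"
    using pos_on_extend_list[OF pos n unit, of "map E ps"] by auto
  have qfE: "quad_form I (E (a, b)) v = v a * v b" if "a \<in> I" "b \<in> I" for a b v
  proof -
    have "quad_form I (E (a, b)) v = (\<Sum>x\<in>I. if x = a then (\<Sum>y\<in>I. if y = b then v a * v b else 0) else 0)"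
      unfolding quad_form_def E_def by (intro sum.cong refl) (auto intro!: sum.cong)
    thus ?thesis using that fin by simp
  qed
  define idx where "idx = (\<lambda>ab. THE j. j < length ps \<and> ps ! j = ab)"
  have idx: "idx (ps ! j) = j" if "j < length ps" for j
    unfolding idx_def using that ps(2) by (intro the_equality) (auto simp: nth_eq_iff_index_eq)
  define A where "A = (\<lambda>a b. \<beta>' (n + idx (a, b)))"
  have sum_ps: "(\<Sum>j<length ps. g (ps ! j)) = (\<Sum>a\<in>I. \<Sum>b\<in>I. g (a, b))" for g :: "'i \<times> 'i \<Rightarrow> real"
  proof -
    have "(\<Sum>j<length ps. g (ps ! j)) = (\<Sum>ab\<leftarrow>ps. g ab)" by (simp add: sum_list_sum_nth atLeast0LessThan)
    also have "\<dots> = (\<Sum>ab\<in>I \<times> I. g ab)" using ps by (simp add: sum_list_distinct_conv_sum_set)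
    finally show ?thesis by (simp add: sum.cartesian_product)
  qed
  have split: "(\<Sum>i<n + k. f i) = (\<Sum>i<n. f i) + (\<Sum>j<k. f (n + j))" for f :: "nat \<Rightarrow> real" and k
    by (induction k) auto
  \<comment> \<open>Positivity of the extended functional, whose values at the elementary matrices
    are the entries of \<open>A\<close>.\<close>
  have key: "0 \<le> (\<Sum>i<n. c i * \<beta> i) + (\<Sum>a\<in>I. \<Sum>b\<in>I. e (a, b) * A a b)"
    if "\<And>v. 0 \<le> (\<Sum>i<n. c i * quad_form I (B i) v) + (\<Sum>a\<in>I. \<Sum>b\<in>I. e (a, b) * (v a * v b))" for c e
  proof -
    define c' where "c' = (\<lambda>i. if i < n then c i else e (ps ! (i - n)))"
    have "0 \<le> (\<Sum>i<n + length ps. c' i * quad_form I (B' i) v)" for v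
    proof -
      have "(\<Sum>j<length ps. e (ps ! j) * quad_form I (E (ps ! j)) v) = (\<Sum>a\<in>I. \<Sum>b\<in>I. e (a, b) * quad_form I (E (a, b)) v)"
        by (rule sum_ps)
      also have "\<dots> = (\<Sum>a\<in>I. \<Sum>b\<in>I. e (a, b) * (v a * v b))" by (intro sum.cong refl) (simp add: qfE)
      finally show ?thesis using that[of v] by (simp add: split c'_def B')
    qed
    hence "0 \<le> (\<Sum>i<n + length ps. c' i * \<beta>' i)" using B'(1) by (simp add: pos_on_def)
    moreover have "(\<Sum>j<length ps. e (ps ! j) * \<beta>' (n + idx (ps ! j))) = (\<Sum>a\<in>I. \<Sum>b\<in>I. e (a, b) * A a b)"
      unfolding A_def by (rule sum_ps)
    ultimately show ?thesis by (simp add: split c'_def B' idx)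
  qed
  have two: "(\<Sum>x\<in>I. \<Sum>y\<in>I. (if x = a \<and> y = b then 1 else if x = b \<and> y = a then -1 else 0) * g x y) = g a b - g b a"
    if "a \<in> I" "b \<in> I" "a \<noteq> b" for a b and g :: "'i \<Rightarrow> 'i \<Rightarrow> real"
  proof -
    have "(\<Sum>x\<in>I. \<Sum>y\<in>I. (if x = a \<and> y = b then 1 else if x = b \<and> y = a then -1 else 0) * g x y) =
      (\<Sum>x\<in>I. (if x = a then (\<Sum>y\<in>I. if y = b then g a b else 0) else 0) - (if x = b then (\<Sum>y\<in>I. if y = a then g b a else 0) else 0))"
      using that(3) by (intro sum.cong refl) (auto simp: sum_negf[symmetric] intro!: sum.cong)
    thus ?thesis using that fin by (simp add: sum_subtractf)
  qed
  \<comment> \<open>The difference of \<open>E (a, b)\<close> and \<open>E (b, a)\<close> has zero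
    quadratic form, and so has its negative; the functional therefore vanishes on it.\<close>
  have sym: "A a b = A b a" if "a \<in> I" "b \<in> I" for a b
  proof -
    have le: "A b a \<le> A a b" if "a \<in> I" "b \<in> I" "a \<noteq> b" for a b
    proof -
      let ?e = "\<lambda>(x, y). if x = a \<and> y = b then 1 else if x = b \<and> y = a then -1 else (0::real)"
      have "0 \<le> (\<Sum>i<n. 0 * \<beta> i) + (\<Sum>x\<in>I. \<Sum>y\<in>I. ?e (x, y) * A x y)"
      proof (rule key)
        fix v show "0 \<le> (\<Sum>i<n. 0 * quad_form I (B i) v) + (\<Sum>x\<in>I. \<Sum>y\<in>I. ?e (x, y) * (v x * v y))"
          using two[OF that, of "\<lambda>x y. v x * v y"] by (simp add: mult.commute)
      qed
      thus ?thesis using two[OF that, of A] by simp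
    qed
    show ?thesis using le[of a b] le[of b a] that by (cases "a = b") auto
  qed
  have "psd_on I A"
    unfolding psd_on_def
  proof
    fix w
    have "0 \<le> (\<Sum>i<n. 0 * \<beta> i) + (\<Sum>a\<in>I. \<Sum>b\<in>I. (\<lambda>(a, b). w a * w b) (a, b) * A a b)"
    proof (rule key)
      fix v
      have "(\<Sum>a\<in>I. \<Sum>b\<in>I. (w a * w b) * (v a * v b)) = (\<Sum>a\<in>I. w a * v a)\<^sup>2"
        by (simp add: power2_eq_square sum_product mult_ac)
      thus "0 \<le> (\<Sum>i<n. 0 * quad_form I (B i) v) + (\<Sum>a\<in>I. \<Sum>b\<in>I. (\<lambda>(a, b). w a * w b) (a, b) * (v a * v b))" by simp
    qed
    thus "0 \<le> quad_form I A w" by (simp add: quad_form_def)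
  qed
  from gram[OF fin sym this] obtain u where u: "\<And>a b. a \<in> I \<Longrightarrow> b \<in> I \<Longrightarrow> A a b = (\<Sum>j\<in>I. u j a * u j b)" by blast
  have "\<beta> i = (\<Sum>j\<in>I. quad_form I (B i) (u j))" if i: "i < n" for i
  proof -
    have e: "(\<Sum>k<n. (if k = i then x else 0) * g k) = x * g i" for x :: real and g
    proof -
      have "(\<Sum>k<n. (if k = i then x else 0) * g k) = (\<Sum>k<n. if k = i then x * g i else 0)" by (intro sum.cong) auto
      thus ?thesis using i by simp
    qed
    have BA: "(\<Sum>a\<in>I. \<Sum>b\<in>I. (\<lambda>(a, b). x * B i a b) (a, b) * (v a * v b)) = x * quad_form I (B i) v" for v x
      by (simp add: quad_form_def sum_distrib_left mult_ac)
    define S where "S = (\<Sum>a\<in>I. \<Sum>b\<in>I. B i a b * A a b)"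
    have S: "(\<Sum>a\<in>I. \<Sum>b\<in>I. (\<lambda>(a, b). x * B i a b) (a, b) * A a b) = x * S" for x
      by (simp add: S_def sum_distrib_left mult_ac)
    \<comment> \<open>\<open>B i\<close> minus its expansion in elementary matrices has zero
      quadratic form; the two signs together give \<open>\<beta> i = S\<close>.\<close>
    have "0 \<le> (\<Sum>k<n. (if k = i then 1 else 0) * \<beta> k) + (\<Sum>a\<in>I. \<Sum>b\<in>I. (\<lambda>(a, b). (-1) * B i a b) (a, b) * A a b)"
      by (rule key) (simp only: e BA)
    hence "S \<le> \<beta> i" by (simp only: e S)
    moreover have "0 \<le> (\<Sum>k<n. (if k = i then -1 else 0) * \<beta> k) + (\<Sum>a\<in>I. \<Sum>b\<in>I. (\<lambda>(a, b). 1 * B i a b) (a, b) * A a b)"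
      by (rule key) (simp only: e BA)
    hence "\<beta> i \<le> S" by (simp only: e S)
    ultimately have "\<beta> i = S" by simp
    also have "S = (\<Sum>a\<in>I. \<Sum>b\<in>I. \<Sum>j\<in>I. u j a * u j b * B i a b)"
      unfolding S_def by (intro sum.cong refl) (simp add: u sum_distrib_left mult_ac)
    also have "\<dots> = (\<Sum>a\<in>I. \<Sum>j\<in>I. \<Sum>b\<in>I. u j a * u j b * B i a b)" by (intro sum.cong refl sum.swap)
    also have "\<dots> = (\<Sum>j\<in>I. \<Sum>a\<in>I. \<Sum>b\<in>I. u j a * u j b * B i a b)" by (rule sum.swap)
    finally show ?thesis by (simp add: quad_form_def)
  qed
  thus ?thesis by blast
qed

section \<open>Semidefinite representations of the cone of nonnegative forms\<close>

definition pencil :: "nat \<Rightarrow> (nat \<Rightarrow> nat \<Rightarrow> nat \<Rightarrow> real) \<Rightarrow> (nat \<Rightarrow> real) \<Rightarrow> nat \<Rightarrow> nat \<Rightarrow> real" where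
  "pencil N m \<eta> a b = m 0 a b + (\<Sum>i<N. \<eta> i * m (Suc i) a b)"

text \<open>Affine in \<open>\<eta>\<close>, although a shadow is a linear image, because the origin
  of the parameter space is moved below.\<close>

definition form_pencil :: "nat \<Rightarrow> (nat \<Rightarrow> rpoly) \<Rightarrow> (nat \<Rightarrow> real) \<Rightarrow> rpoly" where
  "form_pencil N p \<eta> = p 0 + (\<Sum>i<N. \<eta> i *\<^sub>R p (Suc i))"

definition represents :: "rpoly set \<Rightarrow> nat set \<Rightarrow> nat \<Rightarrow> (nat \<Rightarrow> nat \<Rightarrow> nat \<Rightarrow> real) \<Rightarrow> (nat \<Rightarrow> rpoly) \<Rightarrow> bool" where
  "represents K I N m p \<longleftrightarrow> finite I \<and> (\<forall>i a b. m i a b = m i b a) \<and> K = {form_pencil N p \<eta> | \<eta>. psd_on I (pencil N m \<eta>)}"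

lemma pencil_sym: "(\<And>i a b. m i a b = m i b a) \<Longrightarrow> pencil N m \<eta> a b = pencil N m \<eta> b a"
  unfolding pencil_def by (intro arg_cong2[where f="(+)"] sum.cong) auto

lemma pencil_reparam:
  "pencil N (\<lambda>j a b. case j of 0 \<Rightarrow> pencil N m \<eta>0 a b | Suc j \<Rightarrow> \<Sum>i<N. el j i * m (Suc i) a b) t a b =
   pencil N m (\<lambda>i. \<eta>0 i + (\<Sum>j<N. t j * el j i)) a b"
proof -
  have "(\<Sum>j<N. t j * (\<Sum>i<N. el j i * m (Suc i) a b)) = (\<Sum>j<N. \<Sum>i<N. t j * el j i * m (Suc i) a b)"
    by (simp add: sum_distrib_left mult.assoc)
  also have "\<dots> = (\<Sum>i<N. \<Sum>j<N. t j * el j i * m (Suc i) a b)" by (rule sum.swap)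
  finally show ?thesis by (simp add: pencil_def distrib_right sum.distrib sum_distrib_right)
qed

lemma form_pencil_reparam:
  "form_pencil N (\<lambda>j. case j of 0 \<Rightarrow> form_pencil N p \<eta>0 | Suc j \<Rightarrow> \<Sum>i<N. el j i *\<^sub>R p (Suc i)) t =
   form_pencil N p (\<lambda>i. \<eta>0 i + (\<Sum>j<N. t j * el j i))"
proof -
  have "(\<Sum>j<N. t j *\<^sub>R (\<Sum>i<N. el j i *\<^sub>R p (Suc i))) = (\<Sum>j<N. \<Sum>i<N. (t j * el j i) *\<^sub>R p (Suc i))"
    by (simp add: scaleR_right.sum)
  also have "\<dots> = (\<Sum>i<N. \<Sum>j<N. (t j * el j i) *\<^sub>R p (Suc i))" by (rule sum.swap)
  finally show ?thesis by (simp add: form_pencil_def scaleR_left_distrib sum.distrib scaleR_left.sum)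
qed

lemma pencil_cong: "(\<And>i. i < N \<Longrightarrow> \<eta> i = \<eta>' i) \<Longrightarrow> pencil N m \<eta> = pencil N m \<eta>'"
  by (simp add: pencil_def[abs_def])

lemma form_pencil_cong: "(\<And>i. i < N \<Longrightarrow> \<eta> i = \<eta>' i) \<Longrightarrow> form_pencil N p \<eta> = form_pencil N p \<eta>'"
  by (simp add: form_pencil_def)

text \<open>The new parameters have to reach every feasible old one; they may do so
  redundantly.\<close>

lemma represents_reparam:
  assumes r: "represents K I N m p"
    and sub: "\<And>\<eta>. psd_on I (pencil N m \<eta>) \<Longrightarrow> \<exists>t. \<forall>i<N. \<eta> i = \<eta>0 i + (\<Sum>j<N. t j * el j i)"
  shows "represents K I N (\<lambda>j a b. case j of 0 \<Rightarrow> pencil N m \<eta>0 a b | Suc j \<Rightarrow> \<Sum>i<N. el j i * m (Suc i) a b)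
    (\<lambda>j. case j of 0 \<Rightarrow> form_pencil N p \<eta>0 | Suc j \<Rightarrow> \<Sum>i<N. el j i *\<^sub>R p (Suc i))"
    (is "represents K I N ?m ?p")
proof -
  have fin: "finite I" and sym: "\<And>i a b. m i a b = m i b a" and K: "K = {form_pencil N p \<eta> | \<eta>. psd_on I (pencil N m \<eta>)}"
    using r by (auto simp: represents_def)
  have sym': "?m i a b = ?m i b a" for i a b
    using sym pencil_sym[of m N \<eta>0 a b, OF sym] by (cases i) (auto intro!: sum.cong)
  have mr: "pencil N ?m t = pencil N m (\<lambda>i. \<eta>0 i + (\<Sum>j<N. t j * el j i))" for t
    by (intro ext) (rule pencil_reparam)
  have "K = {form_pencil N ?p t | t. psd_on I (pencil N ?m t)}"
    unfolding mr form_pencil_reparam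
  proof (intro Set.set_eqI iffI)
    fix q assume "q \<in> K"
    then obtain \<eta> where \<eta>: "q = form_pencil N p \<eta>" "psd_on I (pencil N m \<eta>)" using K by blast
    obtain t where t: "\<forall>i<N. \<eta> i = \<eta>0 i + (\<Sum>j<N. t j * el j i)" using sub[OF \<eta>(2)] by blast
    have "q = form_pencil N p (\<lambda>i. \<eta>0 i + (\<Sum>j<N. t j * el j i))"
      unfolding \<eta>(1) by (rule form_pencil_cong) (use t in simp)
    moreover have "pencil N m \<eta> = pencil N m (\<lambda>i. \<eta>0 i + (\<Sum>j<N. t j * el j i))" by (rule pencil_cong) (use t in simp)
    ultimately show "q \<in> {form_pencil N p (\<lambda>i. \<eta>0 i + (\<Sum>j<N. t j * el j i)) | t. psd_on I (pencil N m (\<lambda>i. \<eta>0 i + (\<Sum>j<N. t j * el j i)))}"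
      using \<eta>(2) by auto
  qed (use K in blast)
  thus ?thesis unfolding represents_def using fin sym' by blast
qed

section \<open>Reduction to a definite pencil\<close>

text \<open>Adding a multiple of the kernel vector \<open>v\<close> changes no value of the form and
  can make coordinate \<open>r\<close> zero.\<close>

lemma psd_on_remove:
  assumes fin: "finite I" and r: "r \<in> I" "v r \<noteq> 0" and sym: "\<And>a b. A a b = A b a"
    and ker: "\<And>w. bilin_form I A v w = 0"
  shows "psd_on I A \<longleftrightarrow> psd_on (I - {r}) A"
proof
  assume psd: "psd_on I A"
  show "psd_on (I - {r}) A" unfolding psd_on_def
  proof
    fix w
    have "quad_form (I - {r}) A w = quad_form (I - {r}) A (w(r := 0))" by (rule quad_form_cong) auto
    also have "\<dots> = quad_form I A (w(r := 0))" unfolding quad_form_bilin_form by (rule bilin_form_subset[symmetric]) (use fin in auto)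
    finally show "0 \<le> quad_form (I - {r}) A w" using psd by (simp add: psd_on_def)
  qed
next
  assume psd: "psd_on (I - {r}) A"
  show "psd_on I A" unfolding psd_on_def
  proof
    fix w
    define t where "t = - w r / v r"
    let ?w = "\<lambda>a. w a + t * v a"
    have "quad_form I A ?w = quad_form I A w"
    proof -
      have "quad_form I A ?w = quad_form I A w + 2 * t * bilin_form I A w v + t\<^sup>2 * quad_form I A v" by (rule quad_form_add) (rule sym)
      also have "bilin_form I A w v = bilin_form I A v w" by (rule bilin_form_sym) (rule sym)
      finally show ?thesis using ker by (simp add: quad_form_bilin_form)
    qed
    moreover have "quad_form I A ?w = quad_form (I - {r}) A ?w"
      unfolding quad_form_bilin_form by (rule bilin_form_subset) (use fin r in \<open>auto simp: t_def\<close>)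
    moreover have "0 \<le> quad_form (I - {r}) A ?w" using psd by (simp add: psd_on_def)
    ultimately show "0 \<le> quad_form I A w" by linarith
  qed
qed

lemma represents_remove:
  assumes r: "represents K I N m p" and ne: "psd_on I (pencil N m \<eta>0)"
    and v: "\<exists>a\<in>I. v a \<noteq> 0" and ker: "\<And>\<eta>. psd_on I (pencil N m \<eta>) \<Longrightarrow> quad_form I (pencil N m \<eta>) v = 0"
  shows "\<exists>I' N m p. represents K I' N m p \<and> card I' < card I"
proof -
  have fin: "finite I" and sym: "\<And>i a b. m i a b = m i b a" using r by (auto simp: represents_def)
  obtain r where rI: "r \<in> I" "v r \<noteq> 0" using v by blast
  define e where "e = (\<lambda>a i. \<Sum>b\<in>I. v b * m (Suc i) a b)"
  have row: "(\<Sum>b\<in>I. v b * pencil N m \<eta> a b) = (\<Sum>b\<in>I. v b * m 0 a b) + (\<Sum>i<N. e a i * \<eta> i)" for \<eta> a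
  proof -
    have "(\<Sum>b\<in>I. v b * (\<Sum>i<N. \<eta> i * m (Suc i) a b)) = (\<Sum>b\<in>I. \<Sum>i<N. v b * m (Suc i) a b * \<eta> i)"
      by (simp add: sum_distrib_left mult_ac)
    also have "\<dots> = (\<Sum>i<N. \<Sum>b\<in>I. v b * m (Suc i) a b * \<eta> i)" by (rule sum.swap)
    finally show ?thesis by (simp add: pencil_def distrib_left sum.distrib e_def sum_distrib_right)
  qed
  have row0: "(\<Sum>b\<in>I. v b * pencil N m \<eta> a b) = 0" if psd: "psd_on I (pencil N m \<eta>)" and a: "a \<in> I" for \<eta> a
  proof -
    have "bilin_form I (pencil N m \<eta>) v (\<lambda>b. if b = a then 1 else 0) = 0"
      by (rule psd_on_kernel[OF _ psd ker[OF psd]]) (rule pencil_sym, rule sym)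
    also have "bilin_form I (pencil N m \<eta>) v (\<lambda>b. if b = a then 1 else 0) = (\<Sum>b\<in>I. \<Sum>b'\<in>I. if b' = a then v b * pencil N m \<eta> b a else 0)"
      unfolding bilin_form_def by (intro sum.cong) auto
    also have "\<dots> = (\<Sum>b\<in>I. v b * pencil N m \<eta> b a)" using a fin by simp
    finally show ?thesis using pencil_sym[of m N \<eta>, OF sym] by simp
  qed
  obtain xs where xs: "set xs = I" using finite_list fin by blast
  obtain el where el: "\<And>\<eta>. (\<forall>c\<in>set (map e xs). (\<Sum>i<N. c i * \<eta> i) = 0) \<longleftrightarrow>
      (\<exists>t. \<forall>i<N. \<eta> i = (\<Sum>j<N. t j * el j i))"
    using solution_space_generated[of "map e xs" N] by blast
  have diff: "(\<Sum>i<N. e a i * (\<eta> i - \<eta>0 i)) = (\<Sum>b\<in>I. v b * pencil N m \<eta> a b) - (\<Sum>b\<in>I. v b * pencil N m \<eta>0 a b)" for a \<eta>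
    unfolding row by (simp add: right_diff_distrib sum_subtractf)
  let ?m = "\<lambda>j a b. case j of 0 \<Rightarrow> pencil N m \<eta>0 a b | Suc j \<Rightarrow> \<Sum>i<N. el j i * m (Suc i) a b"
  let ?p = "\<lambda>j. case j of 0 \<Rightarrow> form_pencil N p \<eta>0 | Suc j \<Rightarrow> \<Sum>i<N. el j i *\<^sub>R p (Suc i)"
  have r': "represents K I N ?m ?p"
  proof (rule represents_reparam[OF r])
    fix \<eta> assume psd: "psd_on I (pencil N m \<eta>)"
    have "\<forall>c\<in>set (map e xs). (\<Sum>i<N. c i * (\<eta> i - \<eta>0 i)) = 0"
      using row0[OF psd] row0[OF ne] diff xs by auto
    then obtain t where "\<forall>i<N. \<eta> i - \<eta>0 i = (\<Sum>j<N. t j * el j i)" using el[of "\<lambda>i. \<eta> i - \<eta>0 i"] by auto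
    thus "\<exists>t. \<forall>i<N. \<eta> i = \<eta>0 i + (\<Sum>j<N. t j * el j i)" by (intro exI[of _ t]) (simp add: algebra_simps)
  qed
  have sym': "pencil N ?m t a b = pencil N ?m t b a" for t a b
    by (rule pencil_sym) (use r' in \<open>simp add: represents_def\<close>)
  have ker': "bilin_form I (pencil N ?m t) v w = 0" for t w
  proof -
    define \<eta> where "\<eta> = (\<lambda>i. \<eta>0 i + (\<Sum>j<N. t j * el j i))"
    have "\<forall>c\<in>set (map e xs). (\<Sum>i<N. c i * (\<eta> i - \<eta>0 i)) = 0"
      using el[of "\<lambda>i. \<eta> i - \<eta>0 i"] by (auto simp: \<eta>_def)
    hence "(\<Sum>b\<in>I. v b * pencil N m \<eta> a b) = 0" if "a \<in> I" for a
      using diff[of a \<eta>] row0[OF ne that] that xs by auto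
    hence "(\<Sum>b\<in>I. v b * pencil N ?m t a b) = 0" if "a \<in> I" for a
      using that by (simp add: pencil_reparam \<eta>_def)
    hence z: "(\<Sum>b\<in>I. v b * pencil N ?m t b a) = 0" if "a \<in> I" for a
      using that by (subst sym') blast
    have "bilin_form I (pencil N ?m t) v w = (\<Sum>a\<in>I. w a * (\<Sum>b\<in>I. v b * pencil N ?m t b a))"
      unfolding bilin_form_def by (subst sum.swap) (simp add: sum_distrib_left mult_ac)
    thus ?thesis using z by simp
  qed
  have "psd_on I (pencil N ?m t) \<longleftrightarrow> psd_on (I - {r}) (pencil N ?m t)" for t
    by (rule psd_on_remove[where v=v and r=r]) (use fin rI sym' ker' in auto)
  hence "represents K (I - {r}) N ?m ?p" using r' unfolding represents_def by auto
  moreover have "card (I - {r}) < card I" using fin rI by (intro card_Diff1_less)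
  ultimately show ?thesis by blast
qed

lemma pencil_average:
  "pencil N m (\<lambda>i. (\<eta> i + \<eta>' i) / 2) a b = (pencil N m \<eta> a b + pencil N m \<eta>' a b) / 2"
  by (simp add: pencil_def add_divide_distrib distrib_right sum.distrib sum_divide_distrib)

definition pd_on :: "'i set \<Rightarrow> ('i \<Rightarrow> 'i \<Rightarrow> real) \<Rightarrow> bool" where
  "pd_on I A \<longleftrightarrow> (\<forall>v. (\<exists>a\<in>I. v a \<noteq> 0) \<longrightarrow> quad_form I A v > 0)"

text \<open>Take a maximal set \<open>S\<close> of indices on which some feasible matrix is
  definite, and an \<open>r\<close> outside. Averaging with another feasible matrix cannot be
  definite on \<open>insert r S\<close>, which yields a common null vector there; definiteness on
  \<open>S\<close> makes it unique up to a factor, so all feasible matrices share it.\<close>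

lemma pd_or_common_kernel:
  assumes fin: "finite I" and sym: "\<And>i a b. m i a b = m i b a" and ne: "psd_on I (pencil N m \<eta>1)"
  shows "(\<exists>\<eta>. psd_on I (pencil N m \<eta>) \<and> pd_on I (pencil N m \<eta>)) \<or>
    (\<exists>v. (\<exists>a\<in>I. v a \<noteq> 0) \<and> (\<forall>\<eta>. psd_on I (pencil N m \<eta>) \<longrightarrow> quad_form I (pencil N m \<eta>) v = 0))"
proof -
  define \<S> where "\<S> = {S. S \<subseteq> I \<and> (\<exists>\<eta>. psd_on I (pencil N m \<eta>) \<and> pd_on S (pencil N m \<eta>))}"
  have "{} \<in> \<S>" using ne by (auto simp: \<S>_def pd_on_def)
  moreover have "finite \<S>" using fin by (auto simp: \<S>_def)
  ultimately obtain S where S: "S \<in> \<S>" "\<And>S'. S' \<in> \<S> \<Longrightarrow> S \<subseteq> S' \<Longrightarrow> S' = S"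
    using finite_has_maximal[of \<S>] by (metis empty_iff)
  then obtain \<eta>0 where \<eta>0: "psd_on I (pencil N m \<eta>0)" "pd_on S (pencil N m \<eta>0)" and SI: "S \<subseteq> I" by (auto simp: \<S>_def)
  show ?thesis
  proof (cases "S = I")
    case True
    thus ?thesis using \<eta>0 by blast
  next
    case False
    then obtain r where r: "r \<in> I" "r \<notin> S" using SI by blast
    let ?S = "insert r S"
    have SI': "?S \<subseteq> I" using r SI by blast
    have sub: "quad_form ?S A w = quad_form I A w" if "\<And>a. a \<notin> ?S \<Longrightarrow> w a = 0" for A w
      unfolding quad_form_bilin_form by (rule bilin_form_subset[symmetric]) (use fin SI' that in auto)
    have subS: "quad_form S A w = quad_form I A w" if "\<And>a. a \<notin> S \<Longrightarrow> w a = 0" for A w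
      unfolding quad_form_bilin_form by (rule bilin_form_subset[symmetric]) (use fin SI that in auto)
    have kern: "\<exists>w. w r \<noteq> 0 \<and> (\<forall>a. a \<notin> ?S \<longrightarrow> w a = 0) \<and> quad_form I (pencil N m \<eta>) w = 0 \<and> quad_form I (pencil N m \<eta>0) w = 0"
      if psd: "psd_on I (pencil N m \<eta>)" for \<eta>
    proof -
      \<comment> \<open>A null vector of the average of two semidefinite matrices is a null vector
        of both.\<close>
      define \<zeta> where "\<zeta> = (\<lambda>i. (\<eta>0 i + \<eta> i) / 2)"
      have q\<zeta>: "quad_form I (pencil N m \<zeta>) w = (quad_form I (pencil N m \<eta>0) w + quad_form I (pencil N m \<eta>) w) / 2" for w
      proof -
        have "pencil N m \<zeta> = (\<lambda>a b. (1/2) * (pencil N m \<eta>0 a b + pencil N m \<eta> a b))"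
          by (intro ext) (simp add: \<zeta>_def pencil_average)
        thus ?thesis by (simp only: quad_form_matrix_scale quad_form_matrix_add)
      qed
      have psd\<zeta>: "psd_on I (pencil N m \<zeta>)" using \<eta>0(1) psd by (simp add: psd_on_def q\<zeta>)
      have "\<not> pd_on ?S (pencil N m \<zeta>)" using S(2)[of ?S] psd\<zeta> SI' r by (auto simp: \<S>_def)
      then obtain w0 where w0: "\<exists>a\<in>?S. w0 a \<noteq> 0" "quad_form ?S (pencil N m \<zeta>) w0 \<le> 0" by (auto simp: pd_on_def not_less)
      define w where "w = (\<lambda>a. if a \<in> ?S then w0 a else 0)"
      have wout: "w a = 0" if "a \<notin> ?S" for a using that by (simp add: w_def)
      have "quad_form ?S (pencil N m \<zeta>) w0 = quad_form ?S (pencil N m \<zeta>) w" by (rule quad_form_cong) (simp add: w_def)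
      hence "quad_form I (pencil N m \<zeta>) w \<le> 0" using w0(2) sub[OF wout] by simp
      moreover have "quad_form I (pencil N m \<eta>0) w \<ge> 0" "quad_form I (pencil N m \<eta>) w \<ge> 0" using \<eta>0(1) psd by (auto simp: psd_on_def)
      ultimately have z: "quad_form I (pencil N m \<eta>0) w = 0" "quad_form I (pencil N m \<eta>) w = 0" using q\<zeta>[of w] by auto
      have "w r \<noteq> 0"
      proof
        assume wr: "w r = 0"
        hence "w a = 0" if "a \<notin> S" for a using that wout[of a] by (cases "a = r") auto
        hence "quad_form S (pencil N m \<eta>0) w = 0" using subS[of w] z(1) by simp
        moreover have "\<exists>a\<in>S. w a \<noteq> 0" using w0(1) wr by (auto simp: w_def split: if_splits)
        ultimately show False using \<eta>0(2) by (auto simp: pd_on_def)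
      qed
      thus ?thesis using wout z by blast
    qed
    from kern[OF \<eta>0(1)] obtain v where v: "v r \<noteq> 0" "\<And>a. a \<notin> ?S \<Longrightarrow> v a = 0" "quad_form I (pencil N m \<eta>0) v = 0" by blast
    have "quad_form I (pencil N m \<eta>) v = 0" if psd: "psd_on I (pencil N m \<eta>)" for \<eta>
    proof -
      from kern[OF psd] obtain w where w: "w r \<noteq> 0" "\<And>a. a \<notin> ?S \<Longrightarrow> w a = 0"
        "quad_form I (pencil N m \<eta>) w = 0" "quad_form I (pencil N m \<eta>0) w = 0" by blast
      define t where "t = v r / w r"
      \<comment> \<open>The combination of the two null vectors without component at
        \<open>r\<close> is supported on \<open>S\<close>, where the matrix at
        \<open>\<eta>0\<close> is definite; hence it is zero.\<close>
      define u where "u = (\<lambda>a. v a + (- t) * w a)"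
      have ur: "u r = 0" using w by (simp add: u_def t_def)
      have uS: "u a = 0" if "a \<notin> S" for a using that ur v(2) w(2) by (cases "a = r") (auto simp: u_def)
      have sym': "pencil N m \<eta>0 a b = pencil N m \<eta>0 b a" for a b by (rule pencil_sym) (rule sym)
      have "bilin_form I (pencil N m \<eta>0) v w = 0" by (rule psd_on_kernel[OF _ \<eta>0(1) v(3)]) (rule sym')
      moreover have "quad_form I (pencil N m \<eta>0) u = quad_form I (pencil N m \<eta>0) v + 2 * (- t) * bilin_form I (pencil N m \<eta>0) v w + (- t)\<^sup>2 * quad_form I (pencil N m \<eta>0) w"
        unfolding u_def by (rule quad_form_add) (rule sym')
      ultimately have "quad_form I (pencil N m \<eta>0) u = 0" using v(3) w(4) by simp
      hence "quad_form S (pencil N m \<eta>0) u = 0" using subS[OF uS] by simp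
      hence "u a = 0" if "a \<in> S" for a using \<eta>0(2) that unfolding pd_on_def by (metis less_irrefl)
      hence "v = (\<lambda>a. t * w a)" using uS by (auto simp: u_def fun_eq_iff)
      hence "quad_form I (pencil N m \<eta>) v = t * (t * quad_form I (pencil N m \<eta>) w)" by (simp only: quad_form_bilin_form bilin_form_scale_left bilin_form_scale_right)
      thus ?thesis using w(3) by simp
    qed
    thus ?thesis using v(1) r(1) by blast
  qed
qed

text \<open>If no matrix of the pencil were definite, all feasible ones would share a kernel vector, and a coordinate could
  be dropped from a representation of least size.\<close>

lemma represents_minimal:
  assumes "represents K I N m p" "K \<noteq> {}"
  shows "\<exists>I N m p. represents K I N m p \<and> pd_on I (m 0)"
  using assms
proof (induction "card I" arbitrary: I N m p rule: less_induct)
  case less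
  have fin: "finite I" and sym: "\<And>i a b. m i a b = m i b a" and K: "K = {form_pencil N p \<eta> | \<eta>. psd_on I (pencil N m \<eta>)}"
    using less.prems(1) by (auto simp: represents_def)
  obtain \<eta>1 where \<eta>1: "psd_on I (pencil N m \<eta>1)" using less.prems(2) unfolding K by blast
  from pd_or_common_kernel[of I m N, OF fin sym \<eta>1] show ?case
  proof
    assume "\<exists>\<eta>. psd_on I (pencil N m \<eta>) \<and> pd_on I (pencil N m \<eta>)"
    then obtain \<eta>0 where \<eta>0: "pd_on I (pencil N m \<eta>0)" by blast
    \<comment> \<open>With the identity matrix only the origin changes: it moves to
      \<open>\<eta>0\<close>, and the definite matrix becomes \<open>m 0\<close>.\<close>
    define el where "el = (\<lambda>(j::nat) (i::nat). if i = j then 1 else (0::real))"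
    have el: "(\<Sum>j<N. t j * el j i) = t i" if "i < N" for t i
    proof -
      have "(\<Sum>j<N. t j * el j i) = (\<Sum>j<N. if j = i then t i else 0)" by (intro sum.cong) (auto simp: el_def)
      thus ?thesis using that by simp
    qed
    have "represents K I N (\<lambda>j a b. case j of 0 \<Rightarrow> pencil N m \<eta>0 a b | Suc j \<Rightarrow> \<Sum>i<N. el j i * m (Suc i) a b)
      (\<lambda>j. case j of 0 \<Rightarrow> form_pencil N p \<eta>0 | Suc j \<Rightarrow> \<Sum>i<N. el j i *\<^sub>R p (Suc i))"
    proof (rule represents_reparam[OF less.prems(1)])
      fix \<eta>
      show "\<exists>t. \<forall>i<N. \<eta> i = \<eta>0 i + (\<Sum>j<N. t j * el j i)"
        by (rule exI[of _ "\<lambda>i. \<eta> i - \<eta>0 i"]) (simp add: el)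
    qed
    thus ?thesis using \<eta>0 by (intro exI conjI) (assumption, simp)
  next
    assume "\<exists>v. (\<exists>a\<in>I. v a \<noteq> 0) \<and> (\<forall>\<eta>. psd_on I (pencil N m \<eta>) \<longrightarrow> quad_form I (pencil N m \<eta>) v = 0)"
    then obtain v where "\<exists>a\<in>I. v a \<noteq> 0" "\<And>\<eta>. psd_on I (pencil N m \<eta>) \<Longrightarrow> quad_form I (pencil N m \<eta>) v = 0" by blast
    from represents_remove[OF less.prems(1) \<eta>1 this] obtain I' N' m' p' where "represents K I' N' m' p'" "card I' < card I" by blast
    thus ?thesis using less.hyps less.prems(2) by blast
  qed
qed

section \<open>From shadows to systems of equations\<close>

lemma shadow_represents:
  assumes "spectrahedral_shadow E K"
  shows "\<exists>I N m p. represents K I N m p"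
proof -
  obtain N T f where T: "spectrahedron N T" and f: "linear_from_vec N E f" and K: "K = f ` T"
    using assms by (auto simp: spectrahedral_shadow_def)
  obtain e M where M: "\<And>i. i \<le> N \<Longrightarrow> symmetric_mat e (M i)"
    and T: "T = {\<xi> \<in> carrier_vec N. psd_mat e (matrix_pencil N e M \<xi>)}"
    using T by (auto simp: spectrahedron_def)
  \<comment> \<open>Padding by zeros makes the symmetry demanded by \<open>represents\<close> hold
    for all indices.\<close>
  define m where "m = (\<lambda>i a b. if i \<le> N \<and> a < e \<and> b < e then M i $$ (a, b) else 0)"
  define p where "p = (\<lambda>i. case i of 0 \<Rightarrow> 0 | Suc i \<Rightarrow> f (unit_vec N i))"
  have symM: "M i $$ (a, b) = M i $$ (b, a)" if "i \<le> N" "a < e" "b < e" for i a b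
  proof -
    have "M i \<in> carrier_mat e e" "transpose_mat (M i) = M i" using M[OF that(1)] by (auto simp: symmetric_mat_def)
    thus ?thesis using that index_transpose_mat(1)[of a "M i" b] by auto
  qed
  have sym: "m i a b = m i b a" for i a b using symM by (auto simp: m_def)
  have psd: "psd_mat e (matrix_pencil N e M \<xi>) \<longleftrightarrow> psd_on {..<e} (pencil N m (vec_index \<xi>))" for \<xi>
  proof -
    let ?A = "matrix_pencil N e M \<xi>"
    have entry: "?A $$ (a, b) = pencil N m (vec_index \<xi>) a b" if "a < e" "b < e" for a b
      using that by (auto simp: matrix_pencil_def pencil_def m_def intro!: sum.cong)
    have car: "?A \<in> carrier_mat e e" by (simp add: matrix_pencil_def)
    have tr: "transpose_mat ?A = ?A"
    proof (rule eq_matI)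
      fix i j assume "i < dim_row ?A" "j < dim_col ?A"
      hence ij: "i < e" "j < e" by (auto simp: matrix_pencil_def)
      hence "transpose_mat ?A $$ (i, j) = ?A $$ (j, i)" using car by auto
      also have "\<dots> = ?A $$ (i, j)" unfolding entry[OF ij] entry[OF ij(2,1)] by (rule pencil_sym) (rule sym)
      finally show "transpose_mat ?A $$ (i, j) = ?A $$ (i, j)" .
    qed (auto simp: matrix_pencil_def)
    have quad: "scalar_prod v (?A *\<^sub>v v) = quad_form {..<e} (pencil N m (vec_index \<xi>)) (vec_index v)"
      if v: "v \<in> carrier_vec e" for v
    proof -
      have "scalar_prod v (?A *\<^sub>v v) = (\<Sum>a<e. v $ a * (\<Sum>b<e. ?A $$ (a, b) * v $ b))"
        using v car by (auto simp: scalar_prod_def atLeast0LessThan intro!: sum.cong)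
      also have "\<dots> = quad_form {..<e} (pencil N m (vec_index \<xi>)) (vec_index v)"
        unfolding quad_form_def by (intro sum.cong refl) (simp add: sum_distrib_left entry mult_ac)
      finally show ?thesis .
    qed
    have "(\<forall>v\<in>carrier_vec e. 0 \<le> scalar_prod v (?A *\<^sub>v v)) \<longleftrightarrow> psd_on {..<e} (pencil N m (vec_index \<xi>))"
    proof
      assume a: "\<forall>v\<in>carrier_vec e. 0 \<le> scalar_prod v (?A *\<^sub>v v)"
      show "psd_on {..<e} (pencil N m (vec_index \<xi>))" unfolding psd_on_def
      proof
        fix w :: "nat \<Rightarrow> real"
        have "0 \<le> quad_form {..<e} (pencil N m (vec_index \<xi>)) (vec_index (Matrix.vec e w))"
          using a[rule_format, of "Matrix.vec e w"] quad[of "Matrix.vec e w"] by simp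
        also have "\<dots> = quad_form {..<e} (pencil N m (vec_index \<xi>)) w" by (rule quad_form_cong) auto
        finally show "0 \<le> quad_form {..<e} (pencil N m (vec_index \<xi>)) w" .
      qed
    qed (auto simp: quad psd_on_def)
    thus ?thesis using car tr by (simp add: psd_mat_def symmetric_mat_def)
  qed
  have fsum: "f \<xi> = (\<Sum>i<N. \<xi> $ i *\<^sub>R f (unit_vec N i))" if \<xi>: "\<xi> \<in> carrier_vec N" for \<xi>
  proof -
    have add: "\<And>x y. x \<in> carrier_vec N \<Longrightarrow> y \<in> carrier_vec N \<Longrightarrow> f (x + y) = f x + f y"
      and scl: "\<And>c x. x \<in> carrier_vec N \<Longrightarrow> f (c \<cdot>\<^sub>v x) = c *\<^sub>R f x" using f by (auto simp: linear_from_vec_def)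
    have f0: "f (0\<^sub>v N) = 0"
    proof -
      have "f (0 \<cdot>\<^sub>v 0\<^sub>v N) = 0 *\<^sub>R f (0\<^sub>v N)" by (rule scl) simp
      moreover have "0 \<cdot>\<^sub>v 0\<^sub>v N = (0\<^sub>v N :: real Matrix.vec)" by (intro eq_vecI) auto
      ultimately show ?thesis by simp
    qed
    have "f (Matrix.vec N (\<lambda>i. if i < k then \<xi> $ i else 0)) = (\<Sum>i<k. \<xi> $ i *\<^sub>R f (unit_vec N i))" if "k \<le> N" for k
      using that
    proof (induction k)
      case 0
      have "Matrix.vec N (\<lambda>i. if i < 0 then \<xi> $ i else 0) = 0\<^sub>v N" by auto
      thus ?case using f0 by simp
    next
      case (Suc k)
      have "Matrix.vec N (\<lambda>i. if i < Suc k then \<xi> $ i else 0) =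
          Matrix.vec N (\<lambda>i. if i < k then \<xi> $ i else 0) + \<xi> $ k \<cdot>\<^sub>v unit_vec N k"
        using Suc.prems by (intro eq_vecI) (auto simp: less_Suc_eq)
      hence "f (Matrix.vec N (\<lambda>i. if i < Suc k then \<xi> $ i else 0)) =
          f (Matrix.vec N (\<lambda>i. if i < k then \<xi> $ i else 0)) + \<xi> $ k *\<^sub>R f (unit_vec N k)"
        using add[of "Matrix.vec N (\<lambda>i. if i < k then \<xi> $ i else 0)" "\<xi> $ k \<cdot>\<^sub>v unit_vec N k"] scl[of "unit_vec N k" "\<xi> $ k"] by simp
      thus ?case using Suc by simp
    qed
    from this[of N] have "f (Matrix.vec N (\<lambda>i. if i < N then \<xi> $ i else 0)) = (\<Sum>i<N. \<xi> $ i *\<^sub>R f (unit_vec N i))" by simp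
    moreover have "Matrix.vec N (\<lambda>i. if i < N then \<xi> $ i else 0) = \<xi>" using \<xi> by (intro eq_vecI) auto
    ultimately show ?thesis by simp
  qed
  have fpp: "f \<xi> = form_pencil N p (vec_index \<xi>)" if "\<xi> \<in> carrier_vec N" for \<xi>
    using fsum[OF that] by (simp add: form_pencil_def p_def)
  have "K = {form_pencil N p \<eta> | \<eta>. psd_on {..<e} (pencil N m \<eta>)}"
  proof (intro Set.set_eqI iffI)
    fix x assume "x \<in> K"
    thus "x \<in> {form_pencil N p \<eta> | \<eta>. psd_on {..<e} (pencil N m \<eta>)}" unfolding K T using fpp psd by auto
  next
    fix x assume "x \<in> {form_pencil N p \<eta> | \<eta>. psd_on {..<e} (pencil N m \<eta>)}"
    then obtain \<eta> where \<eta>: "x = form_pencil N p \<eta>" "psd_on {..<e} (pencil N m \<eta>)" by blast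
    let ?\<xi> = "Matrix.vec N \<eta>"
    have "pencil N m (vec_index ?\<xi>) = pencil N m \<eta>" "form_pencil N p (vec_index ?\<xi>) = form_pencil N p \<eta>" by (rule pencil_cong form_pencil_cong; simp)+
    thus "x \<in> K" unfolding K T using \<eta> psd[of ?\<xi>] fpp[of ?\<xi>] by (intro image_eqI[of _ _ ?\<xi>]) auto
  qed
  hence "represents K {..<e} N m p" unfolding represents_def using sym by blast
  thus ?thesis by blast
qed

text \<open>Evaluation at \<open>z\<close> is nonnegative on the cone and by duality given by
  vectors \<open>u j\<close>; a form of the cone has Gram vectors \<open>w j\<close>. Pairing the
  two turns the value of the form at \<open>z\<close> into the sum of the squares of all inner
  products of a \<open>w j\<close> with a \<open>u j'\<close>.\<close>

theorem shadow_system: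
  assumes sh: "spectrahedral_shadow (forms n k) (psd_forms n k)"
  shows "\<exists>I N m p. finite (I :: nat set) \<and>
    (\<forall>z. \<exists>u. \<forall>i\<le>N::nat. ev (p i) z = (\<Sum>j\<in>I. quad_form I (m i) (u j))) \<and>
    (\<forall>q\<in>psd_forms n k. \<exists>\<eta> w. q = form_pencil N p \<eta> \<and> (\<forall>a\<in>I. \<forall>b\<in>I. pencil N m \<eta> a b = (\<Sum>j\<in>I. w j a * w j b)))"
proof -
  let ?K = "psd_forms n k"
  have K0: "0 \<in> ?K" by (simp add: psd_forms_iff)
  obtain I0 N0 m0 p0 where "represents ?K I0 N0 m0 p0" using shadow_represents[OF sh] by blast
  then obtain I N m p where r: "represents ?K I N m p" and pd: "pd_on I (m 0)" using represents_minimal K0 by blast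
  have fin: "finite I" and sym: "\<And>i a b. m i a b = m i b a" and K: "?K = {form_pencil N p \<eta> | \<eta>. psd_on I (pencil N m \<eta>)}"
    using r by (auto simp: represents_def)
  have evpp: "ev (form_pencil N p \<eta>) z = ev (p 0) z + (\<Sum>i<N. \<eta> i * ev (p (Suc i)) z)" for \<eta> z
    by (simp add: form_pencil_def ev_add ev_sum ev_scaleR)
  have qfmm: "quad_form I (pencil N m \<eta>) v = quad_form I (m 0) v + (\<Sum>i<N. \<eta> i * quad_form I (m (Suc i)) v)" for \<eta> v
    unfolding pencil_def[abs_def] quad_form_matrix_add by (simp add: quad_form_matrix_sum)
  have split: "(\<Sum>i<Suc N. g i) = g 0 + (\<Sum>i<N. g (Suc i))" for g :: "nat \<Rightarrow> real"
    by (rule sum.lessThan_Suc_shift)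
  have "\<exists>u. \<forall>i<Suc N. ev (p i) z = (\<Sum>j\<in>I. quad_form I (m i) (u j))" for z
  proof (rule sdp_duality[OF fin])
    show "\<exists>R. \<forall>v. \<bar>quad_form I S v\<bar> \<le> R * quad_form I (m 0) v" for S
      by (rule order_unit[OF fin]) (use pd in \<open>simp add: pd_on_def\<close>)
    obtain \<eta>' where \<eta>': "0 = form_pencil N p \<eta>'" "psd_on I (pencil N m \<eta>')" using K0 unfolding K by blast
    show "pos_on I (Suc N) m (\<lambda>i. ev (p i) z)" unfolding pos_on_def
    proof (intro allI impI)
      fix c assume c: "\<forall>v. 0 \<le> (\<Sum>i<Suc N. c i * quad_form I (m i) v)"
      \<comment> \<open>Adding \<open>r\<close> times a parameter of the zero form does not change
        the evaluated form but makes the coefficient \<open>d\<close> of the constant matrix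
        positive; division by \<open>d\<close> then gives a feasible parameter.\<close>
      define r where "r = \<bar>c 0\<bar> + 1"
      define d where "d = c 0 + r"
      have rd: "r > 0" "d > 0" by (auto simp: r_def d_def)
      define \<zeta> where "\<zeta> = (\<lambda>i. (c (Suc i) + r * \<eta>' i) / d)"
      have scaled: "d * (g 0 + (\<Sum>i<N. \<zeta> i * g (Suc i))) =
          (\<Sum>i<Suc N. c i * g i) + r * (g 0 + (\<Sum>i<N. \<eta>' i * g (Suc i)))" for g :: "nat \<Rightarrow> real"
      proof -
        have "d * (\<Sum>i<N. \<zeta> i * g (Suc i)) = (\<Sum>i<N. c (Suc i) * g (Suc i)) + r * (\<Sum>i<N. \<eta>' i * g (Suc i))"
          using rd by (simp add: \<zeta>_def sum_distrib_left sum.distrib[symmetric] distrib_right mult.assoc)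
        thus ?thesis unfolding split by (simp add: d_def distrib_left distrib_right)
      qed
      have "psd_on I (pencil N m \<zeta>)" unfolding psd_on_def
      proof
        fix v
        have "d * quad_form I (pencil N m \<zeta>) v = (\<Sum>i<Suc N. c i * quad_form I (m i) v) + r * quad_form I (pencil N m \<eta>') v"
          unfolding qfmm by (rule scaled)
        also have "\<dots> \<ge> 0" using c \<eta>'(2) rd unfolding psd_on_def by (intro add_nonneg_nonneg mult_nonneg_nonneg) auto
        finally show "0 \<le> quad_form I (pencil N m \<zeta>) v" using rd by (simp add: zero_le_mult_iff)
      qed
      hence "form_pencil N p \<zeta> \<in> ?K" unfolding K by blast
      hence "0 \<le> d * ev (form_pencil N p \<zeta>) z" using rd by (simp add: psd_forms_iff)
      also have "\<dots> = (\<Sum>i<Suc N. c i * ev (p i) z) + r * ev (form_pencil N p \<eta>') z"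
        unfolding evpp by (rule scaled)
      also have "ev (form_pencil N p \<eta>') z = 0" unfolding \<eta>'(1)[symmetric] by simp
      finally show "0 \<le> (\<Sum>i<Suc N. c i * ev (p i) z)" by simp
    qed
  qed simp
  hence 1: "\<forall>z. \<exists>u. \<forall>i\<le>N. ev (p i) z = (\<Sum>j\<in>I. quad_form I (m i) (u j))" by (simp add: less_Suc_eq_le)
  have 2: "\<forall>q\<in>?K. \<exists>\<eta> w. q = form_pencil N p \<eta> \<and> (\<forall>a\<in>I. \<forall>b\<in>I. pencil N m \<eta> a b = (\<Sum>j\<in>I. w j a * w j b))"
  proof
    fix q assume "q \<in> ?K"
    then obtain \<eta> where \<eta>: "q = form_pencil N p \<eta>" "psd_on I (pencil N m \<eta>)" unfolding K by blast
    have "\<exists>u. \<forall>a\<in>I. \<forall>b\<in>I. pencil N m \<eta> a b = (\<Sum>j\<in>I. u j a * u j b)"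
      by (rule gram[OF fin _ \<eta>(2)]) (rule pencil_sym, rule sym)
    thus "\<exists>\<eta> w. q = form_pencil N p \<eta> \<and> (\<forall>a\<in>I. \<forall>b\<in>I. pencil N m \<eta> a b = (\<Sum>j\<in>I. w j a * w j b))"
      using \<eta>(1) by blast
  qed
  show ?thesis using fin 1 2 by blast
qed

section \<open>The cases without a semidefinite representation\<close>

definition list_poly :: "nat \<Rightarrow> ((nat \<Rightarrow> real) \<Rightarrow> real) \<Rightarrow> bool" where
  "list_poly p F \<longleftrightarrow> (\<exists>q. lvar p q \<and> (\<forall>y. lev q y = F y))"

lemma list_poly_const: "list_poly p (\<lambda>_. c)"
  unfolding list_poly_def by (rule exI[of _ "[(c, [])]"]) (simp add: lev_Cons)

lemma list_poly_var: "i < p \<Longrightarrow> list_poly p (\<lambda>y. y i)"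
  unfolding list_poly_def by (rule exI[of _ "[(1, [i])]"]) (simp add: lev_Cons)

lemma list_poly_add: "list_poly p F \<Longrightarrow> list_poly p G \<Longrightarrow> list_poly p (\<lambda>y. F y + G y)"
  unfolding list_poly_def by (metis lev_append lvar_append)

lemma list_poly_mult: "list_poly p F \<Longrightarrow> list_poly p G \<Longrightarrow> list_poly p (\<lambda>y. F y * G y)"
  unfolding list_poly_def by (metis lev_mul lvar_mul)

lemma list_poly_diff: "list_poly p F \<Longrightarrow> list_poly p G \<Longrightarrow> list_poly p (\<lambda>y. F y - G y)"
  using list_poly_add[of p F "\<lambda>y. (-1) * G y"] list_poly_mult[OF list_poly_const[of p "-1"]] by simp

lemma list_poly_sum: "(\<And>i. i \<in> I \<Longrightarrow> list_poly p (F i)) \<Longrightarrow> list_poly p (\<lambda>y. \<Sum>i\<in>I. F i y)"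
  by (induction I rule: infinite_finite_induct) (auto intro: list_poly_add list_poly_const)

lemma list_poly_hom_fun: "g \<in> hom_fun n k \<Longrightarrow> (\<And>i. i < n \<Longrightarrow> list_poly p (\<lambda>y. w y i)) \<Longrightarrow> list_poly p (\<lambda>y. g (w y))"
proof (induction k arbitrary: g)
  case 0
  thus ?case by (auto intro: list_poly_const)
next
  case (Suc k)
  then obtain F where F: "\<And>i. i < n \<Longrightarrow> F i \<in> hom_fun n k" "g = (\<lambda>z. \<Sum>i<n. z i * F i z)" by auto
  show ?case unfolding F(2) using Suc F(1) by (intro list_poly_sum list_poly_mult) auto
qed

text \<open>Boxes constrain only \<open>X\<close>, so a set is as large as its projection, and
  Baire's theorem applies to the projection.\<close>

lemma not_thin_surjective:
  assumes "\<And>x. \<exists>z\<in>S. \<forall>i\<in>X. z i = x i" shows "\<not> thin X S"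
proof
  assume "thin X S"
  then obtain F :: "nat \<Rightarrow> (nat \<Rightarrow> real) set" where F: "S \<subseteq> (\<Union>k. F k)" "\<And>k. nowhere X (F k)"
    by (auto simp: thin_def)
  define F' where "F' = (\<lambda>k. {x. \<exists>z\<in>F k. \<forall>i\<in>X. z i = x i})"
  have dis: "F' k \<inter> cube X c \<delta> = {} \<longleftrightarrow> F k \<inter> cube X c \<delta> = {}" for k c \<delta>
    by (auto simp: F'_def cube_def)
  have "nowhere X (F' k)" for k using F(2)[of k] unfolding nowhere_def dis .
  moreover have "UNIV \<subseteq> (\<Union>k. F' k)"
  proof
    fix x
    obtain z where z: "z \<in> S" "\<forall>i\<in>X. z i = x i" using assms by blast
    then obtain k where "z \<in> F k" using F(1) by blast
    hence "x \<in> F' k" using z by (auto simp: F'_def)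
    thus "x \<in> (\<Union>k. F' k)" by blast
  qed
  ultimately have "thin X UNIV" unfolding thin_def by (intro exI[of _ F']) auto
  thus False using not_thin_UNIV by blast
qed

text \<open>The affine chart in which the first of the homogeneous coordinates is 1.\<close>

definition emb :: "nat \<Rightarrow> (nat \<Rightarrow> real) \<Rightarrow> nat \<Rightarrow> real" where
  "emb \<nu> s i = (if i = 0 then 1 else if i \<le> \<nu> then s (i - 1) else 0)"

lemma emb_cong: "(\<And>i. i < \<nu> \<Longrightarrow> s i = s' i) \<Longrightarrow> emb \<nu> s = emb \<nu> s'"
  by (rule ext) (auto simp: emb_def)

lemma polyfun_emb: "polyfun g \<Longrightarrow> polyfun (\<lambda>s. g (emb \<nu> s))"
proof (induction rule: polyfun.induct)
  case (polyfun_var i)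
  show ?case unfolding emb_def by (cases "i = 0"; cases "i \<le> \<nu>") (auto intro: polyfun.intros)
qed (auto intro: polyfun.intros)

text \<open>\<open>fam\<close> is assumed for all centres because the relevant one is the centre of
  the box that \<open>selection\<close> happens to find, and for arbitrarily small \<open>t\<close>
  because of the blow-up.\<close>

theorem shadow_imp_sos:
  assumes sh: "spectrahedral_shadow (forms n (2 * D)) (psd_forms n (2 * D))"
    and fam: "\<And>c t. t > 0 \<Longrightarrow> \<exists>p\<in>psd_forms n (2 * D). \<forall>s. ev p (emb \<nu> s) = t ^ (2 * D) * f (\<lambda>i. (s i - c i) / t)"
  shows "\<exists>M \<phi>. (\<forall>j<M::nat. polyfun (\<phi> j)) \<and> (\<forall>h. f h = (\<Sum>j<M. (\<phi> j h)\<^sup>2))"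
proof -
  let ?K = "psd_forms n (2 * D)"
  from shadow_system[OF sh] obtain I N m p where "finite (I :: nat set) \<and>
    (\<forall>z. \<exists>u. \<forall>i\<le>N::nat. ev (p i) z = (\<Sum>j\<in>I. quad_form I (m i) (u j))) \<and>
    (\<forall>q\<in>?K. \<exists>\<eta> w. q = form_pencil N p \<eta> \<and> (\<forall>a\<in>I. \<forall>b\<in>I. pencil N m \<eta> a b = (\<Sum>j\<in>I. w j a * w j b)))"
    by (elim exE) (erule that)
  hence fin: "finite I"
    and sys: "\<And>z. \<exists>u. \<forall>i\<le>N. ev (p i) z = (\<Sum>j\<in>I. quad_form I (m i) (u j))"
    and gr: "\<And>q. q \<in> ?K \<Longrightarrow> \<exists>\<eta> w. q = form_pencil N p \<eta> \<and> (\<forall>a\<in>I. \<forall>b\<in>I. pencil N m \<eta> a b = (\<Sum>j\<in>I. w j a * w j b))"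
    by blast+
  define X where "X = {..<\<nu>}"
  \<comment> \<open>Variables below \<open>\<nu>\<close> are the affine coordinates of the point;
    the others are the entries of the vectors \<open>u j\<close> from duality.\<close>
  define idx where "idx = (\<lambda>j a. \<nu> + prod_encode (j, a))"
  have idx_inj: "idx j a = idx j' a' \<longleftrightarrow> j = j' \<and> a = a'" for j a j' a' by (simp add: idx_def)
  define J where "J = X \<union> (\<lambda>(j, a). idx j a) ` (I \<times> I)"
  have finJ: "finite J" using fin by (auto simp: J_def X_def)
  define P0 where "P0 = Suc (Max (insert 0 J))"
  have JP0: "i < P0" if "i \<in> J" for i using that finJ by (auto simp: P0_def less_Suc_eq_le)
  \<comment> \<open>The initial chain consists of coordinate functions; the value 0 outside
    \<open>J\<close> keeps it bounded on boxes.\<close>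
  define y where "y = (\<lambda>(z :: nat \<Rightarrow> real) i. if i \<in> J then z i else 0)"
  \<comment> \<open>A sum of squares condenses the system into the single equation that elimination
    works with.\<close>
  define F where "F = (\<lambda>v. \<Sum>i\<le>N. (ev (p i) (emb \<nu> v) - (\<Sum>j\<in>I. quad_form I (m i) (\<lambda>a. v (idx j a)))) *
      (ev (p i) (emb \<nu> v) - (\<Sum>j\<in>I. quad_form I (m i) (\<lambda>a. v (idx j a)))))"
  have "list_poly P0 F"
  proof -
    have "list_poly P0 (\<lambda>v. emb \<nu> v i)" for i
    proof -
      have "i - 1 \<in> J" if "i \<noteq> 0" "i \<le> \<nu>" using that by (auto simp: J_def X_def)
      thus ?thesis unfolding emb_def using JP0[of "i - 1"]
        by (cases "i = 0"; cases "i \<le> \<nu>") (auto intro: list_poly_const list_poly_var)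
    qed
    hence "list_poly P0 (\<lambda>v. mon mo (emb \<nu> v))" for mo
      using list_poly_hom_fun[OF ev_monomial_hom_fun[of mo "Suc (Max (insert 0 (ks mo)))" "monomial_degree mo"]]
      by (auto simp: less_Suc_eq_le subset_iff)
    hence 1: "list_poly P0 (\<lambda>v. ev (p i) (emb \<nu> v))" for i
      unfolding ev_def by (intro list_poly_sum list_poly_mult list_poly_const)
    have "list_poly P0 (\<lambda>v. v (idx j a))" if "j \<in> I" "a \<in> I" for j a
      using that by (intro list_poly_var JP0) (auto simp: J_def)
    hence 2: "list_poly P0 (\<lambda>v. \<Sum>j\<in>I. quad_form I (m i) (\<lambda>a. v (idx j a)))" for i
      unfolding quad_form_def by (intro list_poly_sum list_poly_mult list_poly_const) auto
    show ?thesis unfolding F_def by (intro list_poly_sum list_poly_mult list_poly_diff 1 2)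
  qed
  then obtain h where h: "lvar P0 h" "\<And>v. lev h v = F v" unfolding list_poly_def by blast
  have F0: "F v = 0 \<longleftrightarrow> (\<forall>i\<le>N. ev (p i) (emb \<nu> v) = (\<Sum>j\<in>I. quad_form I (m i) (\<lambda>a. v (idx j a))))" for v
    unfolding F_def by (subst sum_nonneg_eq_0_iff) auto
  define S where "S = {z. F (y z) = 0}"
  have "\<not> thin X S"
  proof (rule not_thin_surjective)
    fix x :: "nat \<Rightarrow> real"
    obtain u where u: "\<forall>i\<le>N. ev (p i) (emb \<nu> x) = (\<Sum>j\<in>I. quad_form I (m i) (u j))" using sys by blast
    define z where "z = (\<lambda>l. if l < \<nu> then x l else case prod_decode (l - \<nu>) of (j, a) \<Rightarrow> u j a)"
    have zi: "z (idx j a) = u j a" for j a by (simp add: z_def idx_def)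
    have "emb \<nu> (y z) = emb \<nu> x" by (rule emb_cong) (auto simp: y_def z_def J_def X_def)
    moreover have "quad_form I (m i) (\<lambda>a. y z (idx j a)) = quad_form I (m i) (u j)" if "j \<in> I" for i j
      by (rule quad_form_cong) (use that in \<open>auto simp: y_def J_def zi\<close>)
    ultimately have "F (y z) = 0" using u by (simp add: F0)
    thus "\<exists>z\<in>S. \<forall>i\<in>X. z i = x i" by (intro bexI[of _ z]) (auto simp: S_def z_def X_def)
  qed
  \<comment> \<open>Chains are bounded, so the solutions are exhausted by countably many boxes, one
    of which keeps a part that is not thin.\<close>
  moreover have "S \<subseteq> (\<Union>k::nat. S \<inter> cube J (\<lambda>_. 0) (real k + 1))"
  proof
    fix z assume z: "z \<in> S"
    obtain k :: nat where k: "(\<Sum>j\<in>J. \<bar>z j\<bar>) \<le> real k" using real_arch_simple by blast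
    have "\<bar>z j\<bar> < real k + 1" if "j \<in> J" for j
      using member_le_sum[OF that, of "\<lambda>j. \<bar>z j\<bar>"] finJ k by auto
    thus "z \<in> (\<Union>k::nat. S \<inter> cube J (\<lambda>_. 0) (real k + 1))" using z by (auto simp: cube_def)
  qed
  ultimately have "\<not> thin X (\<Union>k::nat. S \<inter> cube J (\<lambda>_. 0) (real k + 1))" using thin_subset by blast
  then obtain k :: nat where k: "\<not> thin X (S \<inter> cube J (\<lambda>_. 0) (real k + 1))"
    using thin_UN_nat[of X "\<lambda>k. S \<inter> cube J (\<lambda>_. 0) (real k + 1)"] by blast
  define P where "P = (\<lambda>(j::nat) (i::nat). if i = j then [(1, [])] else [] :: lpoly)"
  have ch: "chain J (\<lambda>_. 0) (real k + 1) P0 y P"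
  proof
    show "finite J" by (rule finJ)
    show "real k + 1 > 0" by simp
    show "y z i = y z' i" if "i < P0" "\<And>j. j \<in> J \<Longrightarrow> z j = z' j" for i z z' using that by (simp add: y_def)
    show "\<exists>R. \<forall>z\<in>cube J (\<lambda>_. 0) (real k + 1). \<forall>i<P0. \<bar>y z i\<bar> \<le> R"
      by (rule exI[of _ "real k + 1"]) (auto simp: y_def cube_def less_imp_le)
    show "lvar P0 (P j i)" for j i by (simp add: P_def)
    fix z j i assume j: "j \<in> J"
    show "((\<lambda>s. y (z(j := s)) i) has_real_derivative lev (P j i) (y z)) (at (z j))"
      using j by (cases "i = j"; cases "i \<in> J") (simp_all add: y_def P_def lev_Cons)
  qed
  have XJ: "X \<subseteq> J" by (auto simp: J_def)
  have zero: "lev h (y z) = 0" if "z \<in> S \<inter> cube J (\<lambda>_. 0) (real k + 1)" for z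
    using that by (simp add: h S_def)
  obtain c \<delta> p' y' P' \<Phi> where ch': "chain X c \<delta> p' y' P'" and p': "P0 \<le> p'"
    and \<Phi>: "\<And>z. z \<in> cube X c \<delta> \<Longrightarrow> (\<forall>i\<in>X. \<Phi> z i = z i) \<and> lev h (y (\<Phi> z)) = 0 \<and> (\<forall>l<P0. y' z l = y (\<Phi> z) l)"
    using selection[OF ch XJ h(1) _ zero k] by blast
  interpret C: chain X c \<delta> p' y' P' by (rule ch')
  \<comment> \<open>On the selected solutions the vectors \<open>u j\<close> are functions of the
    point with entries in the chain, and the squares are those of their inner products with the Gram
    vectors of \<open>q\<close>.\<close>
  have val_eq: "ev q (emb \<nu> s) = (\<Sum>(j, j')\<in>I \<times> I. (\<Sum>a\<in>I. w j' a * y' s (idx j a))\<^sup>2)"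
    if q: "q = form_pencil N p \<eta>" "\<forall>a\<in>I. \<forall>b\<in>I. pencil N m \<eta> a b = (\<Sum>j\<in>I. w j a * w j b)" and s: "s \<in> cube X c \<delta>"
    for q \<eta> w s
  proof -
    define v where "v = y (\<Phi> s)"
    have "F v = 0" using \<Phi>[OF s] by (simp add: h v_def)
    moreover have "emb \<nu> v = emb \<nu> s"
      by (rule emb_cong) (use \<Phi>[OF s] in \<open>auto simp: v_def y_def J_def X_def\<close>)
    ultimately have eqs: "\<And>i. i \<le> N \<Longrightarrow> ev (p i) (emb \<nu> s) = (\<Sum>j\<in>I. quad_form I (m i) (\<lambda>a. v (idx j a)))" by (simp add: F0)
    have "ev q (emb \<nu> s) = ev (p 0) (emb \<nu> s) + (\<Sum>i<N. \<eta> i * ev (p (Suc i)) (emb \<nu> s))"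
      unfolding q(1) by (simp add: form_pencil_def ev_add ev_sum ev_scaleR)
    also have "\<dots> = (\<Sum>j\<in>I. quad_form I (m 0) (\<lambda>a. v (idx j a))) + (\<Sum>i<N. \<eta> i * (\<Sum>j\<in>I. quad_form I (m (Suc i)) (\<lambda>a. v (idx j a))))"
      by (simp add: eqs)
    also have "(\<Sum>i<N. \<eta> i * (\<Sum>j\<in>I. quad_form I (m (Suc i)) (\<lambda>a. v (idx j a)))) =
        (\<Sum>j\<in>I. \<Sum>i<N. \<eta> i * quad_form I (m (Suc i)) (\<lambda>a. v (idx j a)))"
      unfolding sum_distrib_left by (rule sum.swap)
    also have "(\<Sum>j\<in>I. quad_form I (m 0) (\<lambda>a. v (idx j a))) + \<dots> = (\<Sum>j\<in>I. quad_form I (pencil N m \<eta>) (\<lambda>a. v (idx j a)))"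
      unfolding pencil_def[abs_def] quad_form_matrix_add by (simp add: quad_form_matrix_sum sum.distrib)
    also have "\<dots> = (\<Sum>j\<in>I. \<Sum>j'\<in>I. (\<Sum>a\<in>I. w j' a * v (idx j a))\<^sup>2)"
      by (intro sum.cong refl gram_quad_form) (use q(2) in auto)
    also have "\<dots> = (\<Sum>(j, j')\<in>I \<times> I. (\<Sum>a\<in>I. w j' a * v (idx j a))\<^sup>2)" by (rule sum.cartesian_product)
    also have "\<dots> = (\<Sum>(j, j')\<in>I \<times> I. (\<Sum>a\<in>I. w j' a * y' s (idx j a))\<^sup>2)"
    proof (intro sum.cong refl, clarify)
      fix j j' assume "j \<in> I" "j' \<in> I"
      have "v (idx j a) = y' s (idx j a)" if "a \<in> I" for a
      proof -
        have "idx j a \<in> J" using that \<open>j \<in> I\<close> by (auto simp: J_def)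
        thus ?thesis using \<Phi>[OF s] JP0 by (simp add: v_def)
      qed
      thus "(\<Sum>a\<in>I. w j' a * v (idx j a))\<^sup>2 = (\<Sum>a\<in>I. w j' a * y' s (idx j a))\<^sup>2" by simp
    qed
    finally show ?thesis .
  qed
  \<comment> \<open>The number of squares depends on the pencil alone, as \<open>blow_up\<close>
    requires.\<close>
  define M where "M = card (I \<times> I)"
  obtain g where g: "bij_betw g {..<M} (I \<times> I)"
    using ex_bij_betw_nat_finite[of "I \<times> I"] fin by (auto simp: M_def atLeast0LessThan)
  have "\<exists>\<phi>. (\<forall>j<M. polyfun (\<phi> j)) \<and> (\<forall>h. f h = (\<Sum>j<M. (\<phi> j h)\<^sup>2))"
  proof (rule C.blow_up[where N=P0 and q="\<lambda>l. [(1, [l])]" and \<tau>=1 and D=D])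
    show "lvar p' [(1, [l])]" if "l < P0" for l using that p' by simp
    fix t :: real assume t: "0 < t" "t < 1"
    obtain q where q: "q \<in> ?K" "\<And>s. ev q (emb \<nu> s) = t ^ (2 * D) * f (\<lambda>i. (s i - c i) / t)" using fam[OF t(1)] by blast
    obtain \<eta> w where w: "q = form_pencil N p \<eta>" "\<forall>a\<in>I. \<forall>b\<in>I. pencil N m \<eta> a b = (\<Sum>j\<in>I. w j a * w j b)" using gr[OF q(1)] by blast
    define \<gamma> where "\<gamma> = (\<lambda>k l. \<Sum>a\<in>I. if l = idx (fst (g k)) a then w (snd (g k)) a else 0)"
    have "t ^ (2 * D) * f h = (\<Sum>k<M. (\<Sum>l<P0. \<gamma> k l * lev [(1, [l])] (y' (C.ray h t)))\<^sup>2)"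
      if r: "C.ray h t \<in> cube X c \<delta>" for h
    proof -
      have "(\<Sum>l<P0. \<gamma> k l * lev [(1, [l])] (y' (C.ray h t))) = (\<Sum>a\<in>I. w (snd (g k)) a * y' (C.ray h t) (idx (fst (g k)) a))"
        if k: "k < M" for k
      proof -
        have gk: "fst (g k) \<in> I" using g k by (metis bij_betwE lessThan_iff mem_Times_iff)
        have "(\<Sum>l<P0. \<gamma> k l * lev [(1, [l])] (y' (C.ray h t))) =
            (\<Sum>l<P0. \<Sum>a\<in>I. if l = idx (fst (g k)) a then w (snd (g k)) a * y' (C.ray h t) l else 0)"
          unfolding \<gamma>_def sum_distrib_right by (intro sum.cong refl) (auto simp: lev_Cons)
        also have "\<dots> = (\<Sum>a\<in>I. \<Sum>l<P0. if l = idx (fst (g k)) a then w (snd (g k)) a * y' (C.ray h t) l else 0)"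
          by (rule sum.swap)
        also have "\<dots> = (\<Sum>a\<in>I. w (snd (g k)) a * y' (C.ray h t) (idx (fst (g k)) a))"
        proof (intro sum.cong refl)
          fix a assume "a \<in> I"
          hence "idx (fst (g k)) a \<in> J" using gk by (auto simp: J_def)
          thus "(\<Sum>l<P0. if l = idx (fst (g k)) a then w (snd (g k)) a * y' (C.ray h t) l else 0) =
              w (snd (g k)) a * y' (C.ray h t) (idx (fst (g k)) a)" using JP0 by simp
        qed
        finally show ?thesis .
      qed
      hence "(\<Sum>k<M. (\<Sum>l<P0. \<gamma> k l * lev [(1, [l])] (y' (C.ray h t)))\<^sup>2) =
          (\<Sum>k<M. (\<lambda>(j, j'). (\<Sum>a\<in>I. w j' a * y' (C.ray h t) (idx j a))\<^sup>2) (g k))"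
        by (intro sum.cong refl) (simp add: case_prod_beta)
      also have "\<dots> = (\<Sum>(j, j')\<in>I \<times> I. (\<Sum>a\<in>I. w j' a * y' (C.ray h t) (idx j a))\<^sup>2)"
        by (rule sum.reindex_bij_betw[OF g])
      also have "\<dots> = ev q (emb \<nu> (C.ray h t))" by (rule val_eq[OF w r, symmetric])
      also have "\<dots> = t ^ (2 * D) * f h" using t by (simp add: q(2) C.ray_def)
      finally show ?thesis ..
    qed
    thus "\<exists>\<gamma>. \<forall>h. C.ray h t \<in> cube X c \<delta> \<longrightarrow>
        t ^ (2 * D) * f h = (\<Sum>j<M. (\<Sum>l<P0. \<gamma> j l * lev [(1, [l])] (y' (C.ray h t)))\<^sup>2)" by blast
  qed simp
  thus ?thesis by blast
qed

section \<open>Translated and scaled Motzkin and Choi-Lam forms\<close>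

text \<open>In the affine chart this is \<open>t ^ (2 * D)\<close> times the Motzkin polynomial with
  its origin moved to \<open>c\<close> and its scale to \<open>t\<close>. The even power of
  \<open>w\<close> raises the degree from 6 to \<open>2 * D\<close> and preserves
  nonnegativity.\<close>

definition motz_form :: "nat \<Rightarrow> (nat \<Rightarrow> real) \<Rightarrow> real \<Rightarrow> rpoly" where
  "motz_form D c t = (let w = t *\<^sub>R Xv 0; x = Xv 1 - c 0 *\<^sub>R Xv 0; y = Xv 2 - c 1 *\<^sub>R Xv 0 in
     w ^ (2 * (D - 3)) * (w ^ 6 + x ^ 4 * y ^ 2 + x ^ 2 * y ^ 4 - 3 *\<^sub>R (w ^ 2 * x ^ 2 * y ^ 2)))"

definition quart_form :: "nat \<Rightarrow> (nat \<Rightarrow> real) \<Rightarrow> real \<Rightarrow> rpoly" where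
  "quart_form D c t = (let w = t *\<^sub>R Xv 0; x = Xv 1 - c 0 *\<^sub>R Xv 0; y = Xv 2 - c 1 *\<^sub>R Xv 0; z = Xv 3 - c 2 *\<^sub>R Xv 0 in
     w ^ (2 * (D - 2)) * (w ^ 4 + x ^ 2 * y ^ 2 + y ^ 2 * z ^ 2 + z ^ 2 * x ^ 2 - 4 *\<^sub>R (w * x * y * z)))"

text \<open>The bound \<open>a + b \<ge> 2 * s\<close> reduces the inequality to two variables,
  where \<open>c ^ 3 + 2 * s ^ 3 - 3 * c * s\<^sup>2\<close> has the double root
  \<open>s = c\<close>.\<close>

lemma motzkin_nonneg: "(0::real) \<le> w ^ 6 + x ^ 4 * y ^ 2 + x ^ 2 * y ^ 4 - 3 * (w ^ 2 * x ^ 2 * y ^ 2)"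
proof -
  define a b c where "a = x\<^sup>2" and "b = y\<^sup>2" and "c = w\<^sup>2"
  have ab: "a \<ge> 0" "b \<ge> 0" "c \<ge> 0" by (auto simp: a_def b_def c_def)
  have eq: "w ^ 6 + x ^ 4 * y ^ 2 + x ^ 2 * y ^ 4 - 3 * (w ^ 2 * x ^ 2 * y ^ 2) = c ^ 3 + (a * b) * (a + b) - 3 * c * (a * b)"
    by (simp add: a_def b_def c_def power_mult[symmetric] algebra_simps) 
  define s where "s = sqrt (a * b)"
  have s: "s \<ge> 0" "a * b = s\<^sup>2" using ab by (auto simp: s_def)
  have "a + b \<ge> 2 * s" using arith_geo_mean_sqrt[of a b] ab by (simp add: s_def)
  hence "s\<^sup>2 * (2 * s) \<le> s\<^sup>2 * (a + b)" by (intro mult_left_mono) auto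
  hence "c ^ 3 + (a * b) * (a + b) - 3 * c * (a * b) \<ge> c ^ 3 + s\<^sup>2 * (2 * s) - 3 * c * s\<^sup>2" unfolding s(2) by simp
  moreover have "c ^ 3 + s\<^sup>2 * (2 * s) - 3 * c * s\<^sup>2 = (s - c)\<^sup>2 * (2 * s + c)"
    by (simp add: power2_eq_square power3_eq_cube algebra_simps)
  moreover have "(s - c)\<^sup>2 * (2 * s + c) \<ge> 0" using s ab by (intro mult_nonneg_nonneg) auto
  ultimately show ?thesis unfolding eq by linarith
qed

text \<open>For nonnegative variables the form is a combination of squares with nonnegative weights;
  absolute values reduce to this case, since only the last term has odd powers.\<close>

lemma choi_lam_nonneg:
  "(0::real) \<le> w ^ 4 + x ^ 2 * y ^ 2 + y ^ 2 * z ^ 2 + z ^ 2 * x ^ 2 - 4 * (w * x * y * z)"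
proof -
  define a b c d where "a = \<bar>w\<bar>" and "b = \<bar>x\<bar>" and "c = \<bar>y\<bar>" and "d = \<bar>z\<bar>"
  have "w ^ 4 + x ^ 2 * y ^ 2 + y ^ 2 * z ^ 2 + z ^ 2 * x ^ 2 = a ^ 4 + b ^ 2 * c ^ 2 + c ^ 2 * d ^ 2 + d ^ 2 * b ^ 2"
    by (simp add: a_def b_def c_def d_def power_even_abs)
  also have "\<dots> = (a\<^sup>2 - b * c)\<^sup>2 + (c * d - d * b)\<^sup>2 + 2 * (b * c) * (a - d)\<^sup>2 + 4 * (a * b * c * d)"
    by (simp add: power2_eq_square power4_eq_xxxx algebra_simps)
  also have "\<dots> \<ge> 4 * (a * b * c * d)" by (simp add: b_def c_def)
  also have "a * b * c * d = \<bar>w * x * y * z\<bar>" by (simp add: a_def b_def c_def d_def abs_mult)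
  also have "4 * \<bar>w * x * y * z\<bar> \<ge> 4 * (w * x * y * z)" by simp
  finally show ?thesis by simp
qed

lemma ev_motz_form: "ev (motz_form D c t) z = (let w = t * z 0; x = z 1 - c 0 * z 0; y = z 2 - c 1 * z 0 in
     w ^ (2 * (D - 3)) * (w ^ 6 + x ^ 4 * y ^ 2 + x ^ 2 * y ^ 4 - 3 * (w ^ 2 * x ^ 2 * y ^ 2)))"
  by (simp add: motz_form_def Let_def ev_mult ev_add ev_diff ev_power ev_scaleR)

lemma ev_quart_form: "ev (quart_form D c t) v = (let w = t * v 0; x = v 1 - c 0 * v 0; y = v 2 - c 1 * v 0; z = v 3 - c 2 * v 0 in
     w ^ (2 * (D - 2)) * (w ^ 4 + x ^ 2 * y ^ 2 + y ^ 2 * z ^ 2 + z ^ 2 * x ^ 2 - 4 * (w * x * y * z)))"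
  by (simp add: quart_form_def Let_def ev_mult ev_add ev_diff ev_power ev_scaleR)

lemma forms_mult': "p \<in> forms n j \<Longrightarrow> q \<in> forms n k \<Longrightarrow> l = j + k \<Longrightarrow> p * q \<in> forms n l"
  using forms_mult by blast

lemma forms_power': "p \<in> forms n 1 \<Longrightarrow> p ^ k \<in> forms n k"
  using forms_power[of p n 1 k] by simp

lemma motz_form_psd:
  assumes "n \<ge> 3" "D \<ge> 3" shows "motz_form D c t \<in> psd_forms n (2 * D)"
proof -
  define w x y where "w = t *\<^sub>R Xv 0" and "x = Xv 1 - c 0 *\<^sub>R Xv 0" and "y = Xv 2 - c 1 *\<^sub>R Xv 0"
  have f: "w \<in> forms n 1" "x \<in> forms n 1" "y \<in> forms n 1"
    unfolding w_def x_def y_def by (intro forms_diff forms_scaleR forms_Xv; use assms in linarith)+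
  have "w ^ 6 \<in> forms n 6" by (rule forms_power'[OF f(1)])
  moreover have "x ^ 4 * y ^ 2 \<in> forms n 6" "x ^ 2 * y ^ 4 \<in> forms n 6"
    by (rule forms_mult'[OF forms_power'[OF f(2)] forms_power'[OF f(3)]]; simp)+
  moreover have "w ^ 2 * x ^ 2 * y ^ 2 \<in> forms n 6"
    by (rule forms_mult'[OF forms_mult'[OF forms_power'[OF f(1)] forms_power'[OF f(2)] refl] forms_power'[OF f(3)]]) simp
  ultimately have "w ^ 6 + x ^ 4 * y ^ 2 + x ^ 2 * y ^ 4 - 3 *\<^sub>R (w ^ 2 * x ^ 2 * y ^ 2) \<in> forms n 6"
    by (intro forms_diff forms_add forms_scaleR)
  hence "motz_form D c t \<in> forms n (2 * D)"
    unfolding motz_form_def Let_def w_def[symmetric] x_def[symmetric] y_def[symmetric]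
    by (rule forms_mult'[OF forms_power'[OF f(1)]]) (use assms in simp)
  moreover have "0 \<le> ev (motz_form D c t) z" for z
    unfolding ev_motz_form Let_def by (intro mult_nonneg_nonneg motzkin_nonneg) simp
  ultimately show ?thesis by (simp add: psd_forms_iff)
qed

lemma quart_form_psd:
  assumes "n \<ge> 4" "D \<ge> 2" shows "quart_form D c t \<in> psd_forms n (2 * D)"
proof -
  define w x y z where "w = t *\<^sub>R Xv 0" and "x = Xv 1 - c 0 *\<^sub>R Xv 0" and "y = Xv 2 - c 1 *\<^sub>R Xv 0" and "z = Xv 3 - c 2 *\<^sub>R Xv 0"
  have f: "w \<in> forms n 1" "x \<in> forms n 1" "y \<in> forms n 1" "z \<in> forms n 1"
    unfolding w_def x_def y_def z_def by (intro forms_diff forms_scaleR forms_Xv; use assms in linarith)+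
  have "w ^ 4 \<in> forms n 4" by (rule forms_power'[OF f(1)])
  moreover have "x ^ 2 * y ^ 2 \<in> forms n 4" "y ^ 2 * z ^ 2 \<in> forms n 4" "z ^ 2 * x ^ 2 \<in> forms n 4"
    by (rule forms_mult'[OF forms_power' forms_power']; (rule f | simp))+
  moreover have "w * x * y * z \<in> forms n 4"
    by (rule forms_mult'[OF forms_mult'[OF forms_mult'[OF f(1) f(2) refl] f(3) refl] f(4)]) simp
  ultimately have "w ^ 4 + x ^ 2 * y ^ 2 + y ^ 2 * z ^ 2 + z ^ 2 * x ^ 2 - 4 *\<^sub>R (w * x * y * z) \<in> forms n 4"
    by (intro forms_diff forms_add forms_scaleR)
  hence "quart_form D c t \<in> forms n (2 * D)"
    unfolding quart_form_def Let_def w_def[symmetric] x_def[symmetric] y_def[symmetric] z_def[symmetric]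
    by (rule forms_mult'[OF forms_power'[OF f(1)]]) (use assms in simp)
  moreover have "0 \<le> ev (quart_form D c t) v" for v
    unfolding ev_quart_form Let_def by (intro mult_nonneg_nonneg choi_lam_nonneg) simp
  ultimately show ?thesis by (simp add: psd_forms_iff)
qed

lemma ev_motz_emb:
  assumes "D \<ge> 3" "t > 0"
  shows "ev (motz_form D c t) (emb 2 s) = t ^ (2 * D) * motz (\<lambda>i. (s i - c i) / t)"
proof -
  have D: "2 * D = 2 * (D - 3) + 6" using assms by simp
  define a b where "a = (s 0 - c 0) / t" and "b = (s 1 - c 1) / t"
  have ab: "s 0 - c 0 = t * a" "s 1 - c 1 = t * b" using assms(2) by (auto simp: a_def b_def)
  have m: "motz (\<lambda>i. (s i - c i) / t) = 1 + a ^ 4 * b ^ 2 + a ^ 2 * b ^ 4 - 3 * a ^ 2 * b ^ 2"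
    by (simp only: motz_def a_def b_def)
  have "ev (motz_form D c t) (emb 2 s) = t ^ (2 * (D - 3)) * (t ^ 6 + (t * a) ^ 4 * (t * b) ^ 2 +
      (t * a) ^ 2 * (t * b) ^ 4 - 3 * (t ^ 2 * (t * a) ^ 2 * (t * b) ^ 2))"
    unfolding ev_motz_form Let_def ab[symmetric] by (simp add: emb_def)
  also have "\<dots> = t ^ (2 * D) * motz (\<lambda>i. (s i - c i) / t)"
    unfolding D power_add m by (simp add: eval_nat_numeral algebra_simps)
  finally show ?thesis .
qed

lemma ev_quart_emb:
  assumes "D \<ge> 2" "t > 0"
  shows "ev (quart_form D c t) (emb 3 s) = t ^ (2 * D) * quart (\<lambda>i. (s i - c i) / t)"
proof -
  have D: "2 * D = 2 * (D - 2) + 4" using assms by simp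
  define a b d where "a = (s 0 - c 0) / t" and "b = (s 1 - c 1) / t" and "d = (s 2 - c 2) / t"
  have ab: "s 0 - c 0 = t * a" "s 1 - c 1 = t * b" "s 2 - c 2 = t * d"
    using assms(2) by (auto simp: a_def b_def d_def)
  have m: "quart (\<lambda>i. (s i - c i) / t) = 1 + a ^ 2 * b ^ 2 + b ^ 2 * d ^ 2 + d ^ 2 * a ^ 2 - 4 * a * b * d"
    by (simp only: quart_def a_def b_def d_def)
  have "ev (quart_form D c t) (emb 3 s) = t ^ (2 * (D - 2)) * (t ^ 4 + (t * a) ^ 2 * (t * b) ^ 2 +
      (t * b) ^ 2 * (t * d) ^ 2 + (t * d) ^ 2 * (t * a) ^ 2 - 4 * (t * (t * a) * (t * b) * (t * d)))"
    unfolding ev_quart_form Let_def ab[symmetric] by (simp add: emb_def)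
  also have "\<dots> = t ^ (2 * D) * quart (\<lambda>i. (s i - c i) / t)"
    unfolding D power_add m by (simp add: eval_nat_numeral algebra_simps)
  finally show ?thesis .
qed

theorem non_hilbert:
  assumes "(n \<ge> 3 \<and> D \<ge> 3) \<or> (n \<ge> 4 \<and> D \<ge> 2)"
  shows "\<not> spectrahedral_shadow (forms n (2 * D)) (psd_forms n (2 * D)) \<and>
    psd_forms n (2 * D) \<noteq> sos_forms n (2 * D)"
proof -
  have sos: "\<exists>N \<phi>. (\<forall>j<N::nat. polyfun (\<phi> j)) \<and> (\<forall>s. ev p (emb \<nu> s) = (\<Sum>j<N. (\<phi> j s)\<^sup>2))"
    if p: "p \<in> sos_forms n (2 * D)" for p \<nu>
  proof -
    obtain N \<phi> where "\<forall>j<N::nat. polyfun (\<phi> j)" "\<forall>z. ev p z = (\<Sum>j<N. (\<phi> j z)\<^sup>2)"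
      using sos_forms_polyfun[OF p] by (elim exE conjE)
    thus ?thesis by (intro exI[of _ N] exI[of _ "\<lambda>j s. \<phi> j (emb \<nu> s)"]) (auto intro: polyfun_emb)
  qed
  from assms show ?thesis
  proof
    assume a: "n \<ge> 3 \<and> D \<ge> 3"
    have fam: "\<exists>p\<in>psd_forms n (2 * D). \<forall>s. ev p (emb 2 s) = t ^ (2 * D) * motz (\<lambda>i. (s i - c i) / t)"
      if "t > 0" for c t
      using motz_form_psd[of n D c t] ev_motz_emb[of D t c] a that by blast
    have "\<not> spectrahedral_shadow (forms n (2 * D)) (psd_forms n (2 * D))"
      using shadow_imp_sos[OF _ fam] motz_not_sos by blast
    moreover have "psd_forms n (2 * D) \<noteq> sos_forms n (2 * D)"
    proof
      assume eq: "psd_forms n (2 * D) = sos_forms n (2 * D)"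
      \<comment> \<open>Scale 1 and centre 0 give the Motzkin polynomial itself.\<close>
      obtain p where "p \<in> psd_forms n (2 * D)" "\<And>s. ev p (emb 2 s) = motz s"
        using fam[of 1 "\<lambda>_. 0"] by auto
      thus False using sos[of p 2] motz_not_sos unfolding eq by metis
    qed
    ultimately show ?thesis by blast
  next
    assume a: "n \<ge> 4 \<and> D \<ge> 2"
    have fam: "\<exists>p\<in>psd_forms n (2 * D). \<forall>s. ev p (emb 3 s) = t ^ (2 * D) * quart (\<lambda>i. (s i - c i) / t)"
      if "t > 0" for c t
      using quart_form_psd[of n D c t] ev_quart_emb[of D t c] a that by blast
    have "\<not> spectrahedral_shadow (forms n (2 * D)) (psd_forms n (2 * D))"
      using shadow_imp_sos[OF _ fam] quart_not_sos by blast
    moreover have "psd_forms n (2 * D) \<noteq> sos_forms n (2 * D)"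
    proof
      assume eq: "psd_forms n (2 * D) = sos_forms n (2 * D)"
      obtain p where "p \<in> psd_forms n (2 * D)" "\<And>s. ev p (emb 3 s) = quart s"
        using fam[of 1 "\<lambda>_. 0"] by auto
      thus False using sos[of p 3] quart_not_sos unfolding eq by metis
    qed
    ultimately show ?thesis by blast
  qed
qed

section \<open>Binary forms\<close>

definition hom2 :: "nat \<Rightarrow> (real \<Rightarrow> real \<Rightarrow> real) \<Rightarrow> bool" where
  "hom2 k G \<longleftrightarrow> (\<lambda>v. G (v 0) (v 1)) \<in> hom_fun 2 k"

lemma hom_fun_subst:
  assumes "g \<in> hom_fun n k" "\<And>i. i < n \<Longrightarrow> (\<lambda>v. w v i) \<in> hom_fun n' 1"
  shows "(\<lambda>v. g (w v)) \<in> hom_fun n' k"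
  using assms(1)
proof (induction k arbitrary: g)
  case (Suc k)
  then obtain F where F: "\<And>i. i < n \<Longrightarrow> F i \<in> hom_fun n k" "g = (\<lambda>z. \<Sum>i<n. z i * F i z)" by auto
  have "(\<lambda>v. w v i * F i (w v)) \<in> hom_fun n' (Suc k)" if "i < n" for i
    using hom_fun_mult[OF assms(2)[OF that] Suc.IH[OF F(1)[OF that]]] by simp
  thus ?case unfolding F(2) by (intro hom_fun_sum) auto
qed auto

lemma hom_fun_uminus: "f \<in> hom_fun n k \<Longrightarrow> (\<lambda>z. - f z) \<in> hom_fun n k"
  using hom_fun_scale[of f n k "-1"] by simp

lemma hom_fun_diff: "f \<in> hom_fun n k \<Longrightarrow> g \<in> hom_fun n k \<Longrightarrow> (\<lambda>z. f z - g z) \<in> hom_fun n k"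
  using hom_fun_add[of f n k "\<lambda>z. - g z"] hom_fun_uminus[of g n k] by simp

lemma hom_fun_const: "(\<lambda>_. c) \<in> hom_fun n 0"
  by auto

lemma hom_fun_var: "i < n \<Longrightarrow> (\<lambda>z. z i) \<in> hom_fun n 1"
  using hom_fun_times_var[OF _ hom_fun_const[of 1 n], of i] by (simp del: hom_fun.simps)

lemma hom_fun_power: "f \<in> hom_fun n j \<Longrightarrow> (\<lambda>z. f z ^ k) \<in> hom_fun n (j * k)"
proof (induction k)
  case (Suc k)
  thus ?case using hom_fun_mult[of f n j "\<lambda>z. f z ^ k" "j * k"] by simp
qed auto

lemma hom_fun2_curry: "f \<in> hom_fun 2 k \<Longrightarrow> f v = f (\<lambda>i. if i = 0 then v 0 else v 1)"
  by (erule hom_fun_cong) (auto simp: less_2_cases_iff)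

lemma hom_fun2_hom2: "f \<in> hom_fun 2 k \<Longrightarrow> hom2 k (\<lambda>y z. f (\<lambda>i. if i = 0 then y else z))"
  unfolding hom2_def using hom_fun2_curry[of f k] by (metis (no_types, lifting) ext)

lemma hom2_add: "hom2 k F \<Longrightarrow> hom2 k G \<Longrightarrow> hom2 k (\<lambda>y z. F y z + G y z)"
  unfolding hom2_def by (rule hom_fun_add)

lemma hom2_diff: "hom2 k F \<Longrightarrow> hom2 k G \<Longrightarrow> hom2 k (\<lambda>y z. F y z - G y z)"
  unfolding hom2_def by (rule hom_fun_diff)

lemma hom2_scale: "hom2 k F \<Longrightarrow> hom2 k (\<lambda>y z. r * F y z)"
  unfolding hom2_def by (rule hom_fun_scale)

lemma hom2_mult: "hom2 j F \<Longrightarrow> hom2 k G \<Longrightarrow> hom2 (j + k) (\<lambda>y z. F y z * G y z)"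
  unfolding hom2_def by (rule hom_fun_mult)

lemma hom2_linear: "hom2 1 (\<lambda>y z. a * y + b * z)"
  unfolding hom2_def by (intro hom_fun_add hom_fun_scale hom_fun_var) auto

lemma hom2_const: "hom2 0 (\<lambda>y z. c)"
  by (auto simp: hom2_def)

lemma hom2_0: "hom2 0 G \<Longrightarrow> G y z = G 0 0"
proof -
  assume "hom2 0 G"
  then obtain c where c: "(\<lambda>v :: nat \<Rightarrow> real. G (v 0) (v 1)) = (\<lambda>_. c)"
    unfolding hom2_def hom_fun.simps mem_Collect_eq by (elim exE)
  show ?thesis
    using fun_cong[OF c, of "\<lambda>i. if i = 0 then y else z"] fun_cong[OF c, of "\<lambda>_. 0"] by simp
qed

lemma hom2_homogeneous: "hom2 k G \<Longrightarrow> G (r * y) (r * z) = r ^ k * G y z"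
  unfolding hom2_def using hom_fun_homogeneous[of "\<lambda>v. G (v 0) (v 1)" 2 k r "\<lambda>i. if i = 0 then y else z"] by simp

lemma hom2_Suc: "hom2 (Suc k) G \<Longrightarrow> \<exists>A B. hom2 k A \<and> hom2 k B \<and> (\<forall>y z. G y z = y * A y z + z * B y z)"
proof -
  assume "hom2 (Suc k) G"
  then obtain F where F: "\<And>i. i < 2 \<Longrightarrow> F i \<in> hom_fun 2 k" "(\<lambda>v. G (v 0) (v 1)) = (\<lambda>z. \<Sum>i<2. z i * F i z)"
    unfolding hom2_def by auto
  let ?v = "\<lambda>y z i. if i = (0::nat) then y else (z::real)"
  have "G y z = y * F 0 (?v y z) + z * F 1 (?v y z)" for y z
    using fun_cong[OF F(2), of "?v y z"] by (simp add: numeral_2_eq_2)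
  thus ?thesis using hom_fun2_hom2[OF F(1)[of 0]] hom_fun2_hom2[OF F(1)[of 1]] by auto
qed

lemma hom2_along: "hom2 k G \<Longrightarrow> \<exists>q. \<forall>t. G (y0 + t * y1) (z0 + t * z1) = poly q t"
proof -
  assume "hom2 k G"
  hence "polyfun (\<lambda>v. G (v 0) (v 1))" unfolding hom2_def by (rule hom_fun_polyfun)
  moreover have "\<exists>q. \<forall>t. (if i = 0 then y0 + t * y1 else z0 + t * z1) = poly q t" for i :: nat
    by (rule exI[of _ "if i = 0 then [:y0, y1:] else [:z0, z1:]"]) auto
  ultimately have "\<exists>q. \<forall>t. (\<lambda>v. G (v 0) (v 1)) (\<lambda>i::nat. if i = 0 then y0 + t * y1 else z0 + t * z1) = poly q t"
    by (rule polyfun_along_curve)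
  thus ?thesis by simp
qed

section \<open>Zeros of nonnegative binary forms\<close>

lemma poly_nonneg_at_0:
  assumes "\<And>t. t > 0 \<Longrightarrow> poly q t \<ge> (0::real)" shows "poly q 0 \<ge> 0"
proof -
  have "(poly q \<longlongrightarrow> poly q 0) (at_right 0)"
    using isContD[OF poly_isCont, of q 0] by (simp add: filterlim_at_split)
  moreover have "\<forall>\<^sub>F t in at_right 0. poly q t \<ge> 0"
    using assms by (auto simp: eventually_at_right_field intro: exI[of _ 1])
  ultimately show ?thesis by (intro tendsto_lowerbound) auto
qed

text \<open>Continuity at the line through \<open>(b, c)\<close>. With it an inequality can be
  divided by the square of the linear form that vanishes on this line.\<close>

lemma hom2_nonneg_closure:
  assumes G: "hom2 k G" and bc: "b\<^sup>2 + c\<^sup>2 = 1" and nn: "\<And>y z. c * y - b * z \<noteq> 0 \<Longrightarrow> G y z \<ge> 0"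
  shows "G y z \<ge> 0"
proof (cases "c * y - b * z = 0")
  case True
  \<comment> \<open>The direction \<open>(c, - b)\<close> is perpendicular to the excluded line, so
    the points with \<open>t > 0\<close> are off it.\<close>
  obtain q where q: "\<And>t. G (y + t * c) (z + t * - b) = poly q t" using hom2_along[OF G] by blast
  have "poly q t \<ge> 0" if "t > 0" for t
  proof -
    have "c * (y + t * c) - b * (z + t * - b) = (c * y - b * z) + t * (b\<^sup>2 + c\<^sup>2)"
      by (simp add: power2_eq_square algebra_simps)
    also have "\<dots> = t" using True bc by simp
    finally show ?thesis using nn[of "y + t * c" "z + t * - b"] q[of t] that by simp
  qed
  from poly_nonneg_at_0[OF this] show ?thesis using q[of 0] by simp
qed (rule nn)

text \<open>Division by the linear form that vanishes at \<open>(b, c)\<close>, in the rotated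
  coordinates \<open>b * y + c * z\<close> and \<open>c * y - b * z\<close>. In degree 0 the
  quotient is zero.\<close>

lemma hom2_factor_remainder:
  assumes bc: "b\<^sup>2 + c\<^sup>2 = 1"
  shows "hom2 k G \<Longrightarrow> \<exists>g. (if k = 0 then g = (\<lambda>_ _. 0) else hom2 (k - 1) g) \<and>
    (\<forall>y z. G y z = G b c * (b * y + c * z) ^ k + (c * y - b * z) * g y z)"
proof (induction k arbitrary: G)
  case 0
  show ?case using hom2_0[OF 0] by (intro exI[of _ "\<lambda>_ _. 0"]) (metis mult.right_neutral mult_zero_right add.right_neutral power_0)
next
  case (Suc k)
  obtain A B where A: "hom2 k A" and B: "hom2 k B" and G: "\<And>y z. G y z = y * A y z + z * B y z"
    using hom2_Suc[OF Suc.prems] by blast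
  obtain g where g: "if k = 0 then g = (\<lambda>_ _. 0) else hom2 (k - 1) g"
    "\<And>y z. A y z = A b c * (b * y + c * z) ^ k + (c * y - b * z) * g y z" using Suc.IH[OF A] by blast
  obtain h where h: "if k = 0 then h = (\<lambda>_ _. 0) else hom2 (k - 1) h"
    "\<And>y z. B y z = B b c * (b * y + c * z) ^ k + (c * y - b * z) * h y z" using Suc.IH[OF B] by blast
  define e where "e = (\<lambda>y z. (b * y + c * z) * (b * g y z + c * h y z) + (c * A y z + (- b) * B y z))"
  have alg: "s * (w * s ^ k + t * u) + t * (v - v') = w * s ^ Suc k + t * (s * u + (v - v'))"
    for s w t u v v' :: real by (simp add: algebra_simps)
  have "hom2 k (\<lambda>y z. (b * y + c * z) * (b * g y z + c * h y z))"
  proof (cases "k = 0")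
    case True
    thus ?thesis using g h by (simp add: hom2_const)
  next
    case False
    hence "hom2 (1 + (k - 1)) (\<lambda>y z. (b * y + c * z) * (b * g y z + c * h y z))"
      using g h by (intro hom2_mult hom2_linear hom2_add hom2_scale) auto
    thus ?thesis using False by simp
  qed
  hence "hom2 k e" unfolding e_def by (intro hom2_add hom2_scale A B)
  moreover have "G y z = G b c * (b * y + c * z) ^ Suc k + (c * y - b * z) * e y z" for y z
  proof -
    define s t where "s = b * y + c * z" and "t = c * y - b * z"
    have yz: "y = b * s + c * t" "z = c * s - b * t"
    proof -
      have "b * s + c * t = (b\<^sup>2 + c\<^sup>2) * y" "c * s - b * t = (b\<^sup>2 + c\<^sup>2) * z"
        by (simp_all add: s_def t_def power2_eq_square algebra_simps)
      thus "y = b * s + c * t" "z = c * s - b * t" using bc by simp_all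
    qed
    have "G y z = y * A y z + z * B y z" by (rule G)
    also have "\<dots> = (b * s + c * t) * A y z + (c * s - b * t) * B y z" by (simp only: yz[symmetric])
    also have "\<dots> = s * (b * A y z + c * B y z) + t * (c * A y z - b * B y z)" by (simp add: algebra_simps)
    also have "b * A y z + c * B y z = (b * A b c + c * B b c) * s ^ k + t * (b * g y z + c * h y z)"
      unfolding g(2)[of y z] h(2)[of y z] s_def[symmetric] t_def[symmetric] by (simp add: algebra_simps)
    also have "b * A b c + c * B b c = G b c" by (simp only: G)
    also have "s * (G b c * s ^ k + t * (b * g y z + c * h y z)) + t * (c * A y z - b * B y z) =
        G b c * s ^ Suc k + t * (s * (b * g y z + c * h y z) + (c * A y z + (- b) * B y z))"
      using alg by simp
    finally show ?thesis unfolding e_def s_def[symmetric] t_def[symmetric] .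
  qed
  moreover have "if Suc k = 0 then e = (\<lambda>_ _. 0) else hom2 (Suc k - 1) e" using \<open>hom2 k e\<close> by simp
  ultimately show ?case by blast
qed

lemma hom2_factor:
  assumes "hom2 (Suc k) G" "b\<^sup>2 + c\<^sup>2 = 1" "G b c = 0"
  shows "\<exists>g. hom2 k g \<and> (\<forall>y z. G y z = (c * y - b * z) * g y z)"
  using hom2_factor_remainder[OF assms(2,1)] assms(3) by auto

text \<open>A zero of a nonnegative form is at least double, for otherwise the form would change
  sign on crossing the line through the zero.\<close>

lemma hom2_factor_square:
  assumes G: "hom2 (Suc (Suc k)) G" and bc: "b\<^sup>2 + c\<^sup>2 = 1" and 0: "G b c = 0" and nn: "\<And>y z. G y z \<ge> 0"
  shows "\<exists>g. hom2 k g \<and> (\<forall>y z. G y z = (c * y - b * z)\<^sup>2 * g y z) \<and> (\<forall>y z. g y z \<ge> 0)"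
proof -
  obtain g where g: "hom2 (Suc k) g" "\<And>y z. G y z = (c * y - b * z) * g y z" using hom2_factor[OF G bc 0] by blast
  have "g b c = 0"
  proof -
    obtain q where q: "\<And>t. g (b + t * c) (c + t * - b) = poly q t" using hom2_along[OF g(1)] by blast
    have t: "c * (b + t * c) - b * (c + t * - b) = t" for t
    proof -
      have "c * (b + t * c) - b * (c + t * - b) = t * (b\<^sup>2 + c\<^sup>2)" by (simp add: power2_eq_square algebra_simps)
      thus ?thesis using bc by simp
    qed
    have tq: "t * poly q t \<ge> 0" for t
      using nn[of "b + t * c" "c + t * - b"] g(2)[of "b + t * c" "c + t * - b"] q[of t] t[of t] by simp
    have "poly q t \<ge> 0" if "t > 0" for t using tq[of t] that by (simp add: zero_le_mult_iff)
    hence 1: "poly q 0 \<ge> 0" by (rule poly_nonneg_at_0)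
    \<comment> \<open>Reflection turns the sign condition at negative \<open>t\<close> into one at
      positive \<open>t\<close>.\<close>
    have "poly (- pcompose q [:0, -1:]) t \<ge> 0" if "t > 0" for t
      using tq[of "- t"] that by (simp add: poly_pcompose mult_le_0_iff)
    hence "poly (- pcompose q [:0, -1:]) 0 \<ge> 0" by (rule poly_nonneg_at_0)
    hence "poly q 0 \<le> 0" by (simp add: poly_pcompose)
    thus ?thesis using 1 q[of 0] by simp
  qed
  then obtain e where e: "hom2 k e" "\<And>y z. g y z = (c * y - b * z) * e y z" using hom2_factor[OF g(1) bc] by blast
  have eq: "G y z = (c * y - b * z)\<^sup>2 * e y z" for y z by (simp add: g(2) e(2) power2_eq_square)
  have "e y z \<ge> 0" for y z
  proof (rule hom2_nonneg_closure[OF e(1) bc])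
    fix y z assume "c * y - b * z \<noteq> 0"
    thus "e y z \<ge> 0" using nn[of y z] unfolding eq by (simp add: zero_le_mult_iff)
  qed
  thus ?thesis using e(1) eq by blast
qed

lemma hom2_circle: "hom2 k G \<Longrightarrow> continuous_on S (\<lambda>\<theta>. G (cos \<theta>) (sin \<theta>))"
proof -
  assume "hom2 k G"
  hence "polyfun (\<lambda>v. G (v 0) (v 1))" unfolding hom2_def by (rule hom_fun_polyfun)
  moreover have "continuous_on S (\<lambda>\<theta>. g (\<lambda>i. if i = 0 then cos \<theta> else sin \<theta>))" if "polyfun g" for g
    using that
  proof induction
    case (polyfun_var i)
    thus ?case by (cases "i = 0") (auto intro!: continuous_intros)
  qed (auto intro!: continuous_intros)
  ultimately have "continuous_on S (\<lambda>\<theta>. (\<lambda>v. G (v 0) (v 1)) (\<lambda>i::nat. if i = 0 then cos \<theta> else sin \<theta>))" by blast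
  thus ?thesis by simp
qed

lemma hom2_circle_min:
  assumes G: "hom2 (2 * m) G"
  shows "\<exists>b c. b\<^sup>2 + c\<^sup>2 = 1 \<and> (\<forall>y z. G b c * (y\<^sup>2 + z\<^sup>2) ^ m \<le> G y z)"
proof -
  obtain \<theta> where \<theta>: "\<And>t. t \<in> {0..2 * pi} \<Longrightarrow> G (cos \<theta>) (sin \<theta>) \<le> G (cos t) (sin t)"
  proof -
    have "\<exists>x\<in>{0..2 * pi}. \<forall>t\<in>{0..2 * pi}. G (cos x) (sin x) \<le> G (cos t) (sin t)"
      by (intro continuous_attains_inf hom2_circle[OF G]) auto
    thus ?thesis using that by blast
  qed
  have "G (cos \<theta>) (sin \<theta>) * (y\<^sup>2 + z\<^sup>2) ^ m \<le> G y z" for y z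
  proof -
    define r where "r = sqrt (y\<^sup>2 + z\<^sup>2)"
    have r2: "r\<^sup>2 = y\<^sup>2 + z\<^sup>2" by (simp add: r_def)
    obtain t where t: "t \<in> {0..2 * pi}" "y = r * cos t" "z = r * sin t"
    proof (cases "r = 0")
      case True
      hence "y = 0" "z = 0" using r2 by (auto simp: sum_power2_eq_zero_iff)
      thus ?thesis using that[of 0] True by simp
    next
      case False
      have "(y / r)\<^sup>2 + (z / r)\<^sup>2 = 1" using False unfolding power_divide add_divide_distrib[symmetric] r2[symmetric] by simp
      from sincos_total_2pi_le[OF this] obtain t where "0 \<le> t" "t \<le> 2 * pi" "y / r = cos t" "z / r = sin t" by blast
      thus ?thesis using that[of t] False by (simp add: field_simps)
    qed
    have "G (cos \<theta>) (sin \<theta>) * r ^ (2 * m) \<le> G (cos t) (sin t) * r ^ (2 * m)"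
      using \<theta>[OF t(1)] by (intro mult_right_mono) auto
    also have "\<dots> = G y z" using hom2_homogeneous[OF G, of r "cos t" "sin t"] t by (simp add: mult.commute)
    finally show ?thesis by (simp add: power_mult r2)
  qed
  thus ?thesis by (intro exI[of _ "cos \<theta>"] exI[of _ "sin \<theta>"]) simp
qed

definition sos2 :: "nat \<Rightarrow> (real \<Rightarrow> real \<Rightarrow> real) \<Rightarrow> bool" where
  "sos2 m G \<longleftrightarrow> sos_fun 2 m (\<lambda>v. G (v 0) (v 1))"

lemma sos2_norm_power: "sos2 m (\<lambda>y z. (y\<^sup>2 + z\<^sup>2) ^ m)"
proof (induction m)
  case 0
  show ?case using sos_fun_square[OF hom_fun_const[of 1 2]] by (simp add: sos2_def)
next
  case (Suc m)
  have "sos_fun 2 (1 + m) (\<lambda>v. (v 0)\<^sup>2 * ((v 0)\<^sup>2 + (v 1)\<^sup>2) ^ m)" "sos_fun 2 (1 + m) (\<lambda>v. (v 1)\<^sup>2 * ((v 0)\<^sup>2 + (v 1)\<^sup>2) ^ m)"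
    using sos_fun_times_square[OF hom_fun_var[of 0 2] Suc[unfolded sos2_def]]
      sos_fun_times_square[OF hom_fun_var[of 1 2] Suc[unfolded sos2_def]] by simp_all
  from sos_fun_add[OF this] show ?case by (simp add: sos2_def distrib_right)
qed

lemma hom2_norm_power: "hom2 (2 * m) (\<lambda>y z. (y\<^sup>2 + z\<^sup>2) ^ m)"
  unfolding hom2_def
  using hom_fun_power[OF hom_fun_add[OF hom_fun_power[OF hom_fun_var[of 0 2], of 2] hom_fun_power[OF hom_fun_var[of 1 2], of 2]], of m] by simp

theorem binary_forms_sos:
  assumes "hom2 (2 * m) G" "\<And>y z. G y z \<ge> 0" shows "sos2 m G"
  using assms
proof (induction m arbitrary: G)
  case 0
  have "(\<lambda>v :: nat \<Rightarrow> real. G (v 0) (v 1)) = (\<lambda>_. (sqrt (G 0 0))\<^sup>2)"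
  proof
    fix v :: "nat \<Rightarrow> real"
    have "G (v 0) (v 1) = G 0 0" by (rule hom2_0) (use 0 in simp)
    thus "G (v 0) (v 1) = (sqrt (G 0 0))\<^sup>2" using 0(2)[of 0 0] by simp
  qed
  thus ?case using sos_fun_square[OF hom_fun_const[of "sqrt (G 0 0)" 2]] by (simp only: sos2_def)
next
  case (Suc m)
  obtain b c where bc: "b\<^sup>2 + c\<^sup>2 = 1" and min: "\<And>y z. G b c * (y\<^sup>2 + z\<^sup>2) ^ Suc m \<le> G y z"
    using hom2_circle_min[OF Suc.prems(1)] by blast
  define H where "H = (\<lambda>y z. G y z - G b c * (y\<^sup>2 + z\<^sup>2) ^ Suc m)"
  have H: "hom2 (2 * Suc m) H" unfolding H_def by (intro hom2_diff Suc.prems hom2_scale hom2_norm_power)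
  have "H b c = 0" using bc by (simp add: H_def)
  moreover have "H y z \<ge> 0" for y z using min[of y z] by (simp add: H_def)
  ultimately obtain g where g: "hom2 (2 * m) g" "\<And>y z. H y z = (c * y - b * z)\<^sup>2 * g y z" "\<And>y z. g y z \<ge> 0"
    using hom2_factor_square[of "2 * m" H b c] H bc by auto
  have "sos_fun 2 (Suc m) (\<lambda>v. (c * v 0 + (- b) * v 1)\<^sup>2 * g (v 0) (v 1))"
    using sos_fun_times_square[OF _ Suc.IH[OF g(1,3), unfolded sos2_def], of "\<lambda>v. c * v 0 + (- b) * v 1" 1]
      hom2_linear[of c "- b", unfolded hom2_def] by simp
  moreover have "sos_fun 2 (Suc m) (\<lambda>v. G b c * ((v 0)\<^sup>2 + (v 1)\<^sup>2) ^ Suc m)"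
    by (rule sos_fun_scale[OF Suc.prems(2)]) (rule sos2_norm_power[unfolded sos2_def])
  ultimately have "sos_fun 2 (Suc m) (\<lambda>v. (c * v 0 + (- b) * v 1)\<^sup>2 * g (v 0) (v 1) + G b c * ((v 0)\<^sup>2 + (v 1)\<^sup>2) ^ Suc m)"
    by (rule sos_fun_add)
  moreover have "(\<lambda>v. G (v 0) (v 1)) =
      (\<lambda>v. (c * v 0 + (- b) * v 1)\<^sup>2 * g (v 0) (v 1) + G b c * ((v 0)\<^sup>2 + (v (1::nat))\<^sup>2) ^ Suc m)"
  proof
    fix v :: "nat \<Rightarrow> real"
    show "G (v 0) (v 1) = (c * v 0 + (- b) * v 1)\<^sup>2 * g (v 0) (v 1) + G b c * ((v 0)\<^sup>2 + (v 1)\<^sup>2) ^ Suc m"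
      using g(2)[of "v 0" "v 1"] by (simp add: H_def)
  qed
  ultimately show ?case unfolding sos2_def by (simp only:)
qed

lemma hom_fun2_sos_fun:
  assumes f: "f \<in> hom_fun 2 (2 * m)" and nn: "\<And>z. f z \<ge> 0" shows "sos_fun 2 m f"
proof -
  have "sos2 m (\<lambda>y z. f (\<lambda>i. if i = 0 then y else z))"
    using binary_forms_sos[OF hom_fun2_hom2[OF f]] nn by simp
  moreover have "(\<lambda>v. f (\<lambda>i. if i = 0 then v 0 else v 1)) = f" using hom_fun2_curry[OF f] by auto
  ultimately show ?thesis unfolding sos2_def by simp
qed

lemma hom_fun1_sos_fun:
  assumes f: "f \<in> hom_fun 1 (2 * m)" and nn: "\<And>z. f z \<ge> 0" shows "sos_fun 1 m f"
proof -
  define c where "c = f (\<lambda>_. 1)"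
  have "f z = (sqrt c * z 0 ^ m)\<^sup>2" for z
  proof -
    have "f z = f (\<lambda>i. z 0 * 1)" by (rule hom_fun_cong[OF f]) simp
    also have "\<dots> = z 0 ^ (2 * m) * c" unfolding c_def by (rule hom_fun_homogeneous[OF f])
    finally show ?thesis using nn[of "\<lambda>_. 1"] by (simp add: c_def power_mult_distrib power_mult[symmetric] mult.commute)
  qed
  hence "f = (\<lambda>z. (sqrt c * z 0 ^ m)\<^sup>2)" by (rule ext)
  moreover have "sos_fun 1 m (\<lambda>z. (sqrt c * z 0 ^ m)\<^sup>2)"
    using sos_fun_square[OF hom_fun_scale[OF hom_fun_power[OF hom_fun_var[of 0 1], of m]]] by simp
  ultimately show ?thesis by (simp only:)
qed

section \<open>Ternary quartics\<close>

definition hom3 :: "nat \<Rightarrow> (real \<Rightarrow> real \<Rightarrow> real \<Rightarrow> real) \<Rightarrow> bool" where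
  "hom3 k F \<longleftrightarrow> (\<lambda>v. F (v 0) (v 1) (v 2)) \<in> hom_fun 3 k"

lemma hom_fun3_curry: "f \<in> hom_fun 3 k \<Longrightarrow> f v = f (\<lambda>i. if i = 0 then v 0 else if i = 1 then v 1 else v 2)"
  by (erule hom_fun_cong) (auto simp: less_Suc_eq numeral_3_eq_3 numeral_2_eq_2)

lemma hom_fun3_hom3: "f \<in> hom_fun 3 k \<Longrightarrow> hom3 k (\<lambda>x y z. f (\<lambda>i. if i = 0 then x else if i = 1 then y else z))"
proof -
  assume f: "f \<in> hom_fun 3 k"
  have "(\<lambda>v. f (\<lambda>i. if i = 0 then v 0 else if i = 1 then v 1 else v 2)) = f"
    using hom_fun3_curry[OF f] by (intro ext) (rule sym)
  thus ?thesis using f unfolding hom3_def by (simp only:)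
qed

lemma hom3_add: "hom3 k F \<Longrightarrow> hom3 k G \<Longrightarrow> hom3 k (\<lambda>x y z. F x y z + G x y z)"
  unfolding hom3_def by (rule hom_fun_add)

lemma hom3_scale: "hom3 k F \<Longrightarrow> hom3 k (\<lambda>x y z. r * F x y z)"
  unfolding hom3_def by (rule hom_fun_scale)

lemma hom3_mult: "hom3 j F \<Longrightarrow> hom3 k G \<Longrightarrow> hom3 (j + k) (\<lambda>x y z. F x y z * G x y z)"
  unfolding hom3_def by (rule hom_fun_mult)

lemma hom2_mult_eq: "hom2 j F \<Longrightarrow> hom2 k G \<Longrightarrow> j + k = m \<Longrightarrow> hom2 m (\<lambda>y z. F y z * G y z)"
  using hom2_mult[of j F k G] by simp

lemma hom3_mult_eq: "hom3 j F \<Longrightarrow> hom3 k G \<Longrightarrow> j + k = m \<Longrightarrow> hom3 m (\<lambda>x y z. F x y z * G x y z)"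
  using hom3_mult[of j F k G] by simp

lemma hom3_linear: "hom3 1 (\<lambda>x y z. a * x + b * y + c * z)"
  unfolding hom3_def by (intro hom_fun_add hom_fun_scale hom_fun_var) auto

lemma hom3_vars: "hom3 1 (\<lambda>x y z. x)" "hom3 1 (\<lambda>x y z. y)" "hom3 1 (\<lambda>x y z. z)"
  unfolding hom3_def by (intro hom_fun_var; simp)+

lemma hom3_of_hom2: "hom2 k G \<Longrightarrow> hom3 k (\<lambda>x y z. G y z)"
proof -
  assume G: "hom2 k G"
  have "(\<lambda>v. if i = 0 then v 1 else v 2) \<in> hom_fun 3 1" for i :: nat
    using hom_fun_var[of 1 3] hom_fun_var[of 2 3] by (cases "i = 0") (simp_all del: hom_fun.simps)
  from hom_fun_subst[OF G[unfolded hom2_def], of "\<lambda>v i. if i = 0 then v 1 else v 2", OF this] show ?thesis by (simp add: hom3_def)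
qed

lemma hom3_subst:
  assumes "hom3 k F"
  shows "hom3 k (\<lambda>x y z. F (a1 * x + b1 * y + c1 * z) (a2 * x + b2 * y + c2 * z) (a3 * x + b3 * y + c3 * z))"
proof -
  let ?w = "\<lambda>v i. if i = 0 then a1 * v 0 + b1 * v 1 + c1 * v 2 else if i = 1 then a2 * v 0 + b2 * v 1 + c2 * v 2
    else a3 * v 0 + b3 * v (1::nat) + c3 * v 2"
  have "(\<lambda>v. ?w v i) \<in> hom_fun 3 1" for i :: nat
  proof -
    consider "i = 0" | "i = 1" | "i \<noteq> 0" "i \<noteq> 1" by blast
    thus ?thesis
    proof cases
      case 1
      thus ?thesis using hom3_linear[of a1 b1 c1, unfolded hom3_def] by simp
    next
      case 2
      thus ?thesis using hom3_linear[of a2 b2 c2, unfolded hom3_def] by simp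
    next
      case 3
      thus ?thesis using hom3_linear[of a3 b3 c3, unfolded hom3_def] by simp
    qed
  qed
  from hom_fun_subst[OF assms[unfolded hom3_def], of ?w, OF this] show ?thesis by (simp add: hom3_def)
qed

lemma hom3_polyfun: "hom3 k F \<Longrightarrow> polyfun (\<lambda>v. F (v 0) (v 1) (v 2))"
  unfolding hom3_def by (rule hom_fun_polyfun)

lemma hom3_homogeneous: "hom3 k F \<Longrightarrow> F (r * x) (r * y) (r * z) = r ^ k * F x y z"
  unfolding hom3_def
  using hom_fun_homogeneous[of "\<lambda>v. F (v 0) (v 1) (v 2)" 3 k r "\<lambda>i. if i = 0 then x else if i = 1 then y else z"] by simp

lemma hom_fun3_split_first:
  "f \<in> hom_fun 3 k \<Longrightarrow> \<exists>g. (if k = 0 then g = (\<lambda>_. 0) else g \<in> hom_fun 3 (k - 1)) \<and> (\<forall>v. f v = v 0 * g v + f (v(0 := 0)))"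
proof (induction k arbitrary: f)
  case 0
  thus ?case by auto
next
  case (Suc k)
  then obtain G where G: "\<And>i. i < 3 \<Longrightarrow> G i \<in> hom_fun 3 k" "f = (\<lambda>z. \<Sum>i<3. z i * G i z)" by auto
  have f: "f v = v 0 * G 0 v + v 1 * G 1 v + v 2 * G 2 v" for v
    unfolding G(2) by (simp add: numeral_3_eq_3 numeral_2_eq_2)
  obtain g1 where g1: "if k = 0 then g1 = (\<lambda>_. 0) else g1 \<in> hom_fun 3 (k - 1)" "\<And>v. G 1 v = v 0 * g1 v + G 1 (v(0 := 0))"
  proof -
    have "(1::nat) < 3" by simp
    from Suc.IH[OF G(1)[OF this]] show ?thesis using that by blast
  qed
  obtain g2 where g2: "if k = 0 then g2 = (\<lambda>_. 0) else g2 \<in> hom_fun 3 (k - 1)" "\<And>v. G 2 v = v 0 * g2 v + G 2 (v(0 := 0))"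
  proof -
    have "(2::nat) < 3" by simp
    from Suc.IH[OF G(1)[OF this]] show ?thesis using that by blast
  qed
  define g where "g = (\<lambda>v. G 0 v + (v 1 * g1 v + v 2 * g2 v))"
  have "(\<lambda>v. v 1 * g1 v) \<in> hom_fun 3 k" "(\<lambda>v. v 2 * g2 v) \<in> hom_fun 3 k"
  proof -
    have "(\<lambda>v. v i * e v) \<in> hom_fun 3 k" if "i < 3" "if k = 0 then e = (\<lambda>_. 0) else e \<in> hom_fun 3 (k - 1)" for i e
    proof (cases "k = 0")
      case True
      thus ?thesis using that by auto
    next
      case False
      thus ?thesis using hom_fun_times_var[of i 3 e "k - 1"] that by simp
    qed
    thus "(\<lambda>v. v 1 * g1 v) \<in> hom_fun 3 k" "(\<lambda>v. v 2 * g2 v) \<in> hom_fun 3 k" using g1 g2 by auto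
  qed
  hence "g \<in> hom_fun 3 k" unfolding g_def using G(1)[of 0] by (intro hom_fun_add) auto
  moreover have "f v = v 0 * g v + f (v(0 := 0))" for v
    unfolding f g1(2)[of v] g2(2)[of v] g_def by (simp add: algebra_simps)
  moreover have "if Suc k = 0 then g = (\<lambda>_. 0) else g \<in> hom_fun 3 (Suc k - 1)" using \<open>g \<in> hom_fun 3 k\<close> by (simp del: hom_fun.simps)
  ultimately show ?case by blast
qed

lemma hom3_Suc: "hom3 (Suc k) F \<Longrightarrow> \<exists>G H. hom3 k G \<and> hom2 (Suc k) H \<and> (\<forall>x y z. F x y z = x * G x y z + H y z)"
proof -
  assume F: "hom3 (Suc k) F"
  from hom_fun3_split_first[OF this[unfolded hom3_def]] obtain g where g: "g \<in> hom_fun 3 k"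
    "\<And>v. F (v 0) (v 1) (v 2) = v 0 * g v + F 0 (v 1) (v 2)" by auto
  have "(\<lambda>v. if i = 0 then 0 else if i = 1 then v 0 else v 1) \<in> hom_fun 2 1" for i :: nat
  proof -
    consider "i = 0" | "i = 1" | "i \<noteq> 0" "i \<noteq> 1" by blast
    thus ?thesis
    proof cases
      case 1
      thus ?thesis using hom_fun_zero[of 2 1] by (simp del: hom_fun.simps)
    next
      case 2
      thus ?thesis using hom_fun_var[of 0 2] by (simp del: hom_fun.simps)
    next
      case 3
      thus ?thesis using hom_fun_var[of 1 2] by (simp del: hom_fun.simps)
    qed
  qed
  from hom_fun_subst[OF F[unfolded hom3_def], of "\<lambda>v i. if i = 0 then 0 else if i = 1 then v 0 else v 1", OF this]
  have "hom2 (Suc k) (F 0)" by (simp add: hom2_def del: hom_fun.simps)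
  moreover have "F x y z = x * g (\<lambda>i. if i = 0 then x else if i = 1 then y else z) + F 0 y z" for x y z
    using g(2)[of "\<lambda>i. if i = 0 then x else if i = 1 then y else z"] by simp
  ultimately show ?thesis using hom_fun3_hom3[OF g(1)] by blast
qed

section \<open>Squares below a nonnegative ternary quartic\<close>

definition dominates_square :: "(real \<Rightarrow> real \<Rightarrow> real \<Rightarrow> real) \<Rightarrow> bool" where
  "dominates_square F \<longleftrightarrow> (\<exists>q. hom3 2 q \<and> (\<exists>x y z. q x y z \<noteq> 0) \<and> (\<forall>x y z. (q x y z)\<^sup>2 \<le> F x y z))"

lemma dominates_squareI:
  "hom3 2 q \<Longrightarrow> q x0 y0 z0 \<noteq> 0 \<Longrightarrow> (\<And>x y z. (q x y z)\<^sup>2 \<le> F x y z) \<Longrightarrow> dominates_square F"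
  unfolding dominates_square_def by blast

text \<open>Invariance under linear changes of coordinates: the matrix with entries
  \<open>a1\<close> to \<open>c3\<close> is inverse to the substitution and carries the square
  back.\<close>

lemma dominates_square_subst:
  assumes "dominates_square (\<lambda>x y z. F (A1 x y z) (A2 x y z) (A3 x y z))"
    and AB: "\<And>x y z. A1 (a1 * x + b1 * y + c1 * z) (a2 * x + b2 * y + c2 * z) (a3 * x + b3 * y + c3 * z) = x"
      "\<And>x y z. A2 (a1 * x + b1 * y + c1 * z) (a2 * x + b2 * y + c2 * z) (a3 * x + b3 * y + c3 * z) = y"
      "\<And>x y z. A3 (a1 * x + b1 * y + c1 * z) (a2 * x + b2 * y + c2 * z) (a3 * x + b3 * y + c3 * z) = z"
    and BA: "\<And>x y z. a1 * A1 x y z + b1 * A2 x y z + c1 * A3 x y z = x"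
      "\<And>x y z. a2 * A1 x y z + b2 * A2 x y z + c2 * A3 x y z = y"
      "\<And>x y z. a3 * A1 x y z + b3 * A2 x y z + c3 * A3 x y z = z"
  shows "dominates_square F"
proof -
  obtain q x0 y0 z0 where q: "hom3 2 q" "q x0 y0 z0 \<noteq> 0" "\<And>x y z. (q x y z)\<^sup>2 \<le> F (A1 x y z) (A2 x y z) (A3 x y z)"
    using assms(1) unfolding dominates_square_def by blast
  let ?q = "\<lambda>x y z. q (a1 * x + b1 * y + c1 * z) (a2 * x + b2 * y + c2 * z) (a3 * x + b3 * y + c3 * z)"
  show ?thesis
  proof (rule dominates_squareI)
    show "hom3 2 ?q" by (rule hom3_subst[OF q(1)])
    show "?q (A1 x0 y0 z0) (A2 x0 y0 z0) (A3 x0 y0 z0) \<noteq> 0" unfolding BA by (rule q(2))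
    show "(?q x y z)\<^sup>2 \<le> F x y z" for x y z
      using q(3)[of "a1 * x + b1 * y + c1 * z" "a2 * x + b2 * y + c2 * z" "a3 * x + b3 * y + c3 * z"] unfolding AB .
  qed
qed

lemma quadratic_nonneg:
  assumes "\<And>x::real. f * x\<^sup>2 + g * x + h \<ge> 0"
  shows "f \<ge> 0 \<and> h \<ge> 0 \<and> g\<^sup>2 \<le> 4 * f * h"
proof -
  have h: "h \<ge> 0" using assms[of 0] by simp
  have f: "f \<ge> 0"
  proof (rule ccontr)
    assume "\<not> f \<ge> 0"
    hence f: "f < 0" by simp
    define T where "T = 1 + (\<bar>g\<bar> + \<bar>h\<bar>) / - f"
    have "(\<bar>g\<bar> + \<bar>h\<bar>) / - f \<ge> 0" using f by (intro divide_nonneg_pos) auto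
    hence T1: "T \<ge> 1" unfolding T_def by linarith
    have Tf: "- f * T = - f + \<bar>g\<bar> + \<bar>h\<bar>" using f by (simp add: T_def field_simps)
    have "- (f * T\<^sup>2) = T * (- f * T)" by (simp add: power2_eq_square)
    also have "\<dots> = T * - f + T * \<bar>g\<bar> + T * \<bar>h\<bar>" unfolding Tf by (simp add: algebra_simps)
    finally have 1: "- (f * T\<^sup>2) = T * - f + T * \<bar>g\<bar> + T * \<bar>h\<bar>" .
    have 2: "T * - f \<ge> 1 * - f" using T1 f by (intro mult_right_mono) auto
    have 3: "T * \<bar>h\<bar> \<ge> 1 * \<bar>h\<bar>" using T1 by (intro mult_right_mono) auto
    have 4: "T * g \<le> T * \<bar>g\<bar>" using T1 by (intro mult_left_mono) auto
    have "f * T\<^sup>2 + g * T + h < 0" using 1 2 3 4 f mult.commute[of g T] by linarith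
    thus False using assms[of T] by simp
  qed
  have "g\<^sup>2 \<le> 4 * f * h"
  proof (cases "f = 0")
    case True
    have "g = 0"
    proof (rule ccontr)
      assume "g \<noteq> 0"
      thus False using assms[of "- (h + 1) / g"] True by simp
    qed
    thus ?thesis using True by simp
  next
    case False
    hence "f > 0" using f by simp
    have "f * (- g / (2 * f))\<^sup>2 + g * (- g / (2 * f)) + h = (4 * f * h - g\<^sup>2) / (4 * f)"
      using False by (simp add: power2_eq_square field_simps)
    hence "(4 * f * h - g\<^sup>2) / (4 * f) \<ge> 0" using assms[of "- g / (2 * f)"] by simp
    thus ?thesis using \<open>f > 0\<close> by (simp add: zero_le_divide_iff)
  qed
  thus ?thesis using f h by blast
qed

lemma cubic_nonneg:
  assumes "\<And>x::real. l * x ^ 3 + f * x\<^sup>2 + g * x + h \<ge> 0"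
  shows "l = 0"
proof (rule ccontr)
  assume l: "l \<noteq> 0"
  \<comment> \<open>So large that the cubic term at \<open>- T / l\<close> beats the others: the
    value there, times \<open>l\<^sup>2\<close>, is at most \<open>- (T\<^sup>2)\<close>.\<close>
  define T where "T = 1 + \<bar>f\<bar> + \<bar>g * l\<bar> + \<bar>h\<bar> * l\<^sup>2"
  have T1: "T \<ge> 1" by (simp add: T_def)
  have T2: "T\<^sup>2 \<ge> T" using T1 by (simp add: power2_eq_square)
  have "l\<^sup>2 * (l * (- T / l) ^ 3 + f * (- T / l)\<^sup>2 + g * (- T / l) + h) = - (T ^ 3) + f * T\<^sup>2 + - (g * l) * T + h * l\<^sup>2"
    using l by (simp add: power2_eq_square power3_eq_cube field_simps)
  also have "\<dots> \<le> - (T ^ 3) + \<bar>f\<bar> * T\<^sup>2 + \<bar>g * l\<bar> * T\<^sup>2 + \<bar>h\<bar> * l\<^sup>2 * T\<^sup>2"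
  proof -
    have "f * T\<^sup>2 \<le> \<bar>f\<bar> * T\<^sup>2" by (intro mult_right_mono) auto
    moreover have "- (g * l) * T \<le> \<bar>g * l\<bar> * T\<^sup>2"
    proof -
      have "- (g * l) * T \<le> \<bar>g * l\<bar> * T" using T1 by (intro mult_right_mono) auto
      also have "\<dots> \<le> \<bar>g * l\<bar> * T\<^sup>2" using T2 by (intro mult_left_mono) auto
      finally show ?thesis .
    qed
    moreover have "h * l\<^sup>2 \<le> \<bar>h\<bar> * l\<^sup>2 * T\<^sup>2"
    proof -
      have "h * l\<^sup>2 * 1 \<le> \<bar>h\<bar> * l\<^sup>2 * T\<^sup>2" using T1 T2 by (intro mult_mono) (auto intro: mult_right_mono)
      thus ?thesis by simp
    qed
    ultimately show ?thesis by simp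
  qed
  also have "\<dots> = - (T\<^sup>2) * (T - \<bar>f\<bar> - \<bar>g * l\<bar> - \<bar>h\<bar> * l\<^sup>2)"
    by (simp add: power2_eq_square power3_eq_cube algebra_simps)
  also have "\<dots> = - (T\<^sup>2)" by (simp add: T_def)
  also have "\<dots> < 0" using T1 by simp
  finally have "l\<^sup>2 * (l * (- T / l) ^ 3 + f * (- T / l)\<^sup>2 + g * (- T / l) + h) < 0" .
  moreover have "l\<^sup>2 * (l * (- T / l) ^ 3 + f * (- T / l)\<^sup>2 + g * (- T / l) + h) \<ge> 0"
    by (intro mult_nonneg_nonneg assms) simp
  ultimately show False by linarith
qed

lemma hom2_zero: "hom2 (Suc k) G \<Longrightarrow> G 0 0 = 0"
  using hom2_homogeneous[of "Suc k" G 0 0 0] by simp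

lemma hom2_pos_or_zero:
  assumes G: "hom2 (Suc k) G" and nn: "\<And>y z. G y z \<ge> 0"
  shows "(\<forall>y z. (y, z) \<noteq> (0, 0) \<longrightarrow> G y z > 0) \<or> (\<exists>b c. b\<^sup>2 + c\<^sup>2 = 1 \<and> G b c = 0)"
proof (cases "\<forall>y z. (y, z) \<noteq> (0, 0) \<longrightarrow> G y z > 0")
  case False
  then obtain y z where yz: "(y, z) \<noteq> (0, 0)" "G y z \<le> 0" by (auto simp: not_less)
  hence 0: "G y z = 0" using nn[of y z] by simp
  define r where "r = sqrt (y\<^sup>2 + z\<^sup>2)"
  have r: "r \<noteq> 0" "r\<^sup>2 = y\<^sup>2 + z\<^sup>2" using yz by (auto simp: r_def sum_power2_eq_zero_iff)
  have "(y / r)\<^sup>2 + (z / r)\<^sup>2 = 1" unfolding power_divide add_divide_distrib[symmetric] r(2)[symmetric] using r(1) by simp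
  moreover have "G (y / r) (z / r) = 0" using hom2_homogeneous[OF G, of "1 / r" y z] 0 by simp
  ultimately show ?thesis by blast
qed blast

lemma hom2_lower:
  assumes G: "hom2 (2 * m) G" and pos: "\<And>y z. (y, z) \<noteq> (0, 0) \<Longrightarrow> G y z > 0"
  shows "\<exists>\<epsilon>>0. \<forall>y z. \<epsilon> * (y\<^sup>2 + z\<^sup>2) ^ m \<le> G y z"
proof -
  obtain b c where bc: "b\<^sup>2 + c\<^sup>2 = 1" "\<And>y z. G b c * (y\<^sup>2 + z\<^sup>2) ^ m \<le> G y z" using hom2_circle_min[OF G] by blast
  have "(b, c) \<noteq> (0, 0)" using bc(1) by auto
  thus ?thesis using pos[of b c] bc(2) by blast
qed

lemma hom2_upper:
  assumes G: "hom2 (2 * m) G"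
  shows "\<exists>C>0. \<forall>y z. G y z \<le> C * (y\<^sup>2 + z\<^sup>2) ^ m"
proof -
  have "hom2 (2 * m) (\<lambda>y z. -1 * G y z)" by (rule hom2_scale[OF G])
  from hom2_circle_min[OF this] obtain b c where bc: "\<And>y z. (-1 * G b c) * (y\<^sup>2 + z\<^sup>2) ^ m \<le> -1 * G y z" by blast
  have "G y z \<le> (\<bar>G b c\<bar> + 1) * (y\<^sup>2 + z\<^sup>2) ^ m" for y z
  proof -
    have "G y z \<le> G b c * (y\<^sup>2 + z\<^sup>2) ^ m" using bc[of y z] by simp
    also have "\<dots> \<le> (\<bar>G b c\<bar> + 1) * (y\<^sup>2 + z\<^sup>2) ^ m" by (intro mult_right_mono) auto
    finally show ?thesis .
  qed
  thus ?thesis by (intro exI[of _ "\<bar>G b c\<bar> + 1"]) auto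
qed

lemma hom2_psd_quadratic:
  assumes G: "hom2 2 G" and bc: "b\<^sup>2 + c\<^sup>2 = 1" "G b c = 0" and nn: "\<And>y z. G y z \<ge> 0"
  shows "\<exists>\<kappa>\<ge>0. \<forall>y z. G y z = \<kappa> * (c * y - b * z)\<^sup>2"
proof -
  have "hom2 (Suc (Suc 0)) G" using G by (simp add: numeral_2_eq_2)
  from hom2_factor_square[OF this bc nn] obtain g where g: "hom2 0 g" "\<And>y z. G y z = (c * y - b * z)\<^sup>2 * g y z" "\<And>y z. g y z \<ge> 0"
    by blast
  have "g y z = g 0 0" for y z using hom2_0[OF g(1)] .
  thus ?thesis using g(2,3) by (intro exI[of _ "g 0 0"]) (metis mult.commute)
qed

text \<open>If \<open>\<kappa> = 0\<close>, then \<open>F\<close> is the binary form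
  \<open>h\<close>, a sum of squares, and one of its squares serves. Otherwise
  \<open>c * y - b * z\<close> divides \<open>g\<close>, and completing the square leaves
  \<open>h - g1\<^sup>2 / (4 * \<kappa>)\<close>, which is nonnegative.\<close>

lemma singular_case:
  assumes f: "hom2 2 f" and g: "hom2 3 g" and h: "hom2 4 h"
    and F: "\<And>x y z. F x y z = x\<^sup>2 * f y z + x * g y z + h y z"
    and nn: "\<And>x y z. F x y z \<ge> 0" and nz: "F x0 y0 z0 \<noteq> 0"
    and bc: "b\<^sup>2 + c\<^sup>2 = 1" and k: "\<kappa> \<ge> 0" "\<And>y z. f y z = \<kappa> * (c * y - b * z)\<^sup>2"
  shows "dominates_square F"
proof -
  have disc: "h y z \<ge> 0" "(g y z)\<^sup>2 \<le> 4 * f y z * h y z" for y z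
    using quadratic_nonneg[of "f y z" "g y z" "h y z"] nn[of _ y z] unfolding F by (auto simp: mult.commute)
  show ?thesis
  proof (cases "\<kappa> = 0")
    case True
    hence f0: "f y z = 0" for y z using k by simp
    hence "g y z = 0" for y z using disc(2)[of y z] by simp
    hence Fh: "F x y z = h y z" for x y z using f0 by (simp add: F)
    have "sos2 2 h" using binary_forms_sos[of 2 h] h disc(1) by simp
    then obtain N q where q: "\<And>j. j < N \<Longrightarrow> q j \<in> hom_fun 2 2" "\<And>v. h (v 0) (v 1) = (\<Sum>j<N::nat. (q j v)\<^sup>2)"
      unfolding sos2_def sos_fun_def by blast
    let ?v = "\<lambda>y z i. if i = (0::nat) then y else (z::real)"
    have hq: "h y z = (\<Sum>j<N. (q j (?v y z))\<^sup>2)" for y z using q(2)[of "?v y z"] by simp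
    have "\<exists>j<N. q j (?v y0 z0) \<noteq> 0"
    proof (rule ccontr)
      assume "\<not> ?thesis"
      hence "h y0 z0 = 0" unfolding hq by simp
      thus False using nz Fh by simp
    qed
    then obtain j where j: "j < N" "q j (?v y0 z0) \<noteq> 0" by blast
    show ?thesis
    proof (rule dominates_squareI)
      show "hom3 2 (\<lambda>x y z. q j (?v y z))" by (rule hom3_of_hom2[OF hom_fun2_hom2[OF q(1)[OF j(1)]]])
      show "q j (?v y0 z0) \<noteq> 0" by (rule j)
      show "(q j (?v y z))\<^sup>2 \<le> F x y z" for x y z
        unfolding Fh hq by (rule member_le_sum) (use j in auto)
    qed
  next
    case False
    hence kp: "\<kappa> > 0" using k by simp
    define s where "s = sqrt \<kappa>"
    have s: "s > 0" "s\<^sup>2 = \<kappa>" using kp by (auto simp: s_def)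
    have "(g b c)\<^sup>2 \<le> 0" using disc(2)[of b c] k(2)[of b c] by (simp add: mult.commute)
    hence "g b c = 0" by simp
    moreover have "hom2 (Suc 2) g" using g by (simp add: numeral_3_eq_3 numeral_2_eq_2)
    ultimately obtain g1 where g1: "hom2 2 g1" "\<And>y z. g y z = (c * y - b * z) * g1 y z" using hom2_factor[OF _ bc] by blast
    have g1sq: "hom2 4 (\<lambda>y z. g1 y z * g1 y z)" using hom2_mult[OF g1(1) g1(1)] by simp
    have "hom2 4 (\<lambda>y z. 4 * \<kappa> * h y z + (- 1) * (g1 y z * g1 y z))" by (intro hom2_add hom2_scale h g1sq)
    hence rest: "4 * \<kappa> * h y z + (- 1) * (g1 y z * g1 y z) \<ge> 0" for y z
    proof (rule hom2_nonneg_closure[OF _ bc])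
      fix y z assume n0: "c * y - b * z \<noteq> 0"
      have "(c * y - b * z)\<^sup>2 * (g1 y z)\<^sup>2 \<le> (c * y - b * z)\<^sup>2 * (4 * \<kappa> * h y z)"
        using disc(2)[of y z] unfolding g1(2) k(2) by (simp add: power_mult_distrib mult_ac)
      hence "(g1 y z)\<^sup>2 \<le> 4 * \<kappa> * h y z" by (rule mult_left_le_imp_le) (use n0 in simp)
      thus "4 * \<kappa> * h y z + (- 1) * (g1 y z * g1 y z) \<ge> 0" by (simp add: power2_eq_square)
    qed
    define q where "q = (\<lambda>x y z. x * (s * (c * y + (- b) * z)) + 1 / (2 * s) * g1 y z)"
    have "hom3 2 (\<lambda>x y z. x * (s * (c * y + (- b) * z)))"
      by (rule hom3_mult_eq[OF hom3_vars(1) hom3_scale[OF hom3_of_hom2[OF hom2_linear]]]) simp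
    hence q2: "hom3 2 q" unfolding q_def by (rule hom3_add[OF _ hom3_scale[OF hom3_of_hom2[OF g1(1)]]])
    \<comment> \<open>Two values with a nonzero difference cannot both be zero, whatever
      \<open>g1\<close> is.\<close>
    have "q 1 c (- b) - q 0 c (- b) = s"
    proof -
      have "c * c + (- b) * (- b) = 1" using bc by (simp add: power2_eq_square)
      thus ?thesis by (simp add: q_def)
    qed
    hence "q 1 c (- b) \<noteq> 0 \<or> q 0 c (- b) \<noteq> 0" using s by auto
    moreover have "(q x y z)\<^sup>2 \<le> F x y z" for x y z
    proof -
      have "4 * \<kappa> * (q x y z)\<^sup>2 = (2 * s * q x y z)\<^sup>2" by (simp add: power_mult_distrib s(2))
      also have "2 * s * q x y z = 2 * s\<^sup>2 * x * (c * y - b * z) + g1 y z"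
        using s(1) by (simp add: q_def power2_eq_square field_simps)
      also have "(2 * s\<^sup>2 * x * (c * y - b * z) + g1 y z)\<^sup>2 =
          4 * \<kappa> * (x\<^sup>2 * f y z + x * g y z) + (g1 y z)\<^sup>2"
        unfolding s(2) k(2) g1(2) by (simp add: power2_eq_square algebra_simps)
      also have "\<dots> \<le> 4 * \<kappa> * F x y z"
        using rest[of y z] unfolding F by (simp add: power2_eq_square algebra_simps)
      finally show ?thesis using kp by simp
    qed
    ultimately show ?thesis using dominates_squareI[OF q2] by blast
  qed
qed

text \<open>The zero at \<open>(1, 0, 0)\<close> removes \<open>x ^ 4\<close>; the coefficient of
  \<open>x ^ 3\<close> then vanishes because a cubic polynomial changes sign.\<close>

lemma ternary_normal_form:
  assumes F: "hom3 4 F" and nn: "\<And>x y z. F x y z \<ge> 0" and 0: "F 1 0 0 = 0"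
  shows "\<exists>f g h. hom2 2 f \<and> hom2 3 g \<and> hom2 4 h \<and> (\<forall>x y z. F x y z = x\<^sup>2 * f y z + x * g y z + h y z)"
proof -
  have "hom3 (Suc 3) F" using F by simp
  then obtain G1 h where "hom3 3 G1" and h': "hom2 (Suc 3) h" and "\<And>x y z. F x y z = x * G1 x y z + h y z"
    using hom3_Suc[of 3 F] by blast
  moreover have "hom2 4 h" using h' by simp
  ultimately have 1: "hom3 3 G1" "hom2 4 h" "\<And>x y z. F x y z = x * G1 x y z + h y z" by blast+
  have "hom3 (Suc 2) G1" using 1(1) by (simp add: numeral_3_eq_3 numeral_2_eq_2)
  then obtain G2 g where 2: "hom3 2 G2" "hom2 3 g" "\<And>x y z. G1 x y z = x * G2 x y z + g y z"
    using hom3_Suc[of 2 G1] by auto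
  have "hom3 (Suc 1) G2" using 2(1) by (simp add: numeral_2_eq_2)
  then obtain G3 f where 3: "hom3 1 G3" "hom2 2 f" "\<And>x y z. G2 x y z = x * G3 x y z + f y z"
    using hom3_Suc[of 1 G2] by (auto simp: numeral_2_eq_2)
  have "hom3 (Suc 0) G3" using 3(1) by simp
  then obtain G4 l where 4: "hom3 0 G4" "hom2 (Suc 0) l" "\<And>x y z. G3 x y z = x * G4 x y z + l y z"
    using hom3_Suc[of 0 G3] by auto
  have G4: "G4 x y z = G4 1 0 0" for x y z
  proof -
    obtain c where c: "(\<lambda>v :: nat \<Rightarrow> real. G4 (v 0) (v 1) (v 2)) = (\<lambda>_. c)"
      using 4(1) unfolding hom3_def hom_fun.simps mem_Collect_eq by (elim exE)
    show ?thesis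
      using fun_cong[OF c, of "\<lambda>i. if i = 0 then x else if i = 1 then y else z"]
        fun_cong[OF c, of "\<lambda>i. if i = 0 then 1 else 0"] by simp
  qed
  have F4: "F x y z = x ^ 4 * G4 1 0 0 + l y z * x ^ 3 + f y z * x\<^sup>2 + g y z * x + h y z" for x y z
    unfolding 1(3) 2(3) 3(3) 4(3) G4[of x y z] by (simp add: algebra_simps power2_eq_square power3_eq_cube power4_eq_xxxx)
  have z: "l 0 0 = 0" "f 0 0 = 0" "g 0 0 = 0" "h 0 0 = 0"
    using hom2_zero[of 0 l] hom2_zero[of 1 f] hom2_zero[of 2 g] hom2_zero[OF h'] 2(2) 3(2) 4(2)
    by (simp_all add: numeral_2_eq_2 numeral_3_eq_3)
  have G0: "G4 1 0 0 = 0" using F4[of 1 0 0] 0 z by simp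
  have "l y z = 0" for y z
    by (rule cubic_nonneg[of "l y z" "f y z" "g y z" "h y z"]) (use nn[of _ y z] in \<open>simp add: F4 G0\<close>)
  hence "F x y z = x\<^sup>2 * f y z + x * g y z + h y z" for x y z
    unfolding F4 G0 by (simp add: mult.commute)
  thus ?thesis using 1(2) 2(2) 3(2) by blast
qed

text \<open>The second zero makes \<open>z\<close> divide \<open>g\<close> and
  \<open>z\<^sup>2\<close> divide \<open>h\<close> when \<open>f\<close> is definite. If the reduced
  discriminant \<open>D\<close> is positive, a multiple of \<open>z ^ 4\<close> lies below
  \<open>F\<close>. If it has a zero, a shear in \<open>x\<close> makes the new coefficients
  \<open>g'\<close> and \<open>h'\<close> vanish there, after which either
  \<open>x\<^sup>2 f\<close> is left or a square can be completed.\<close>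

lemma two_zeros_case:
  assumes F4: "hom3 4 F" and nn: "\<And>x y z. F x y z \<ge> 0" and 0: "F 1 0 0 = 0" "F 0 1 0 = 0" and nz: "F x0 y0 z0 \<noteq> 0"
  shows "dominates_square F"
proof -
  obtain f g h where f: "hom2 2 f" and g: "hom2 3 g" and h: "hom2 4 h"
    and F: "\<And>x y z. F x y z = x\<^sup>2 * f y z + x * g y z + h y z"
    using ternary_normal_form[OF F4 nn 0(1)] by blast
  have disc: "f y z \<ge> 0" "h y z \<ge> 0" "(g y z)\<^sup>2 \<le> 4 * f y z * h y z" for y z
    using quadratic_nonneg[of "f y z" "g y z" "h y z"] nn[of _ y z] unfolding F by (auto simp: mult.commute)
  have f': "hom2 (Suc 1) f" using f by (simp add: numeral_2_eq_2)
  from hom2_pos_or_zero[OF f' disc(1)] show ?thesis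
  proof
    assume "\<exists>b c. b\<^sup>2 + c\<^sup>2 = 1 \<and> f b c = 0"
    then obtain b c where bc: "b\<^sup>2 + c\<^sup>2 = 1" "f b c = 0" by blast
    obtain \<kappa> where "\<kappa> \<ge> 0" "\<And>y z. f y z = \<kappa> * (c * y - b * z)\<^sup>2" using hom2_psd_quadratic[OF f bc disc(1)] by blast
    thus ?thesis using singular_case[OF f g h F nn nz bc(1)] by blast
  next
    assume pd: "\<forall>y z. (y, z) \<noteq> (0, 0) \<longrightarrow> f y z > 0"
    have h10: "h 1 0 = 0" using 0(2) by (simp add: F)
    have one: "(1::real)\<^sup>2 + 0\<^sup>2 = 1" by simp
    have "hom2 (Suc (Suc 2)) h" using h by simp
    from hom2_factor_square[OF this one h10 disc(2)] obtain h1 where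
      h1: "hom2 2 h1" "\<And>y z. h y z = (0 * y - 1 * z)\<^sup>2 * h1 y z" "\<And>y z. h1 y z \<ge> 0" by blast
    have "g 1 0 = 0" using disc(3)[of 1 0] h10 by simp
    moreover have "hom2 (Suc 2) g" using g by (simp add: numeral_3_eq_3 numeral_2_eq_2)
    ultimately obtain g1 where g1: "hom2 2 g1" "\<And>y z. g y z = (0 * y - 1 * z) * g1 y z" using hom2_factor[OF _ one] by blast
    have F': "F x y z = x\<^sup>2 * f y z - x * z * g1 y z + z\<^sup>2 * h1 y z" for x y z
      by (simp add: F g1(2) h1(2))
    define D where "D = (\<lambda>y z. 4 * (f y z * h1 y z) + (- 1) * (g1 y z * g1 y z))"
    have D4: "hom2 4 D"
      unfolding D_def by (rule hom2_add[OF hom2_scale[OF hom2_mult_eq[OF f h1(1)]] hom2_scale[OF hom2_mult_eq[OF g1(1) g1(1)]]]) simp_all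
    have Dnn: "D y z \<ge> 0" for y z
    proof (rule hom2_nonneg_closure[OF D4 one])
      fix y z :: real assume "0 * y - 1 * z \<noteq> 0"
      hence z: "z \<noteq> 0" by simp
      have "z\<^sup>2 * D y z = 4 * f y z * h y z - (g y z)\<^sup>2"
        by (simp add: D_def g1(2) h1(2) power2_eq_square algebra_simps)
      hence "z\<^sup>2 * D y z \<ge> 0" using disc(3)[of y z] by simp
      thus "D y z \<ge> 0" using z by (simp add: zero_le_mult_iff)
    qed
    have D4': "hom2 (Suc 3) D" using D4 by simp
    from hom2_pos_or_zero[OF D4' Dnn] show ?thesis
    proof
      assume Dpos: "\<forall>y z. (y, z) \<noteq> (0, 0) \<longrightarrow> D y z > 0"
      obtain \<epsilon> where e: "\<epsilon> > 0" "\<And>y z. \<epsilon> * (y\<^sup>2 + z\<^sup>2)\<^sup>2 \<le> D y z" using hom2_lower[of 2 D] D4 Dpos by auto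
      obtain C where C: "C > 0" "\<And>y z. f y z \<le> C * (y\<^sup>2 + z\<^sup>2)" using hom2_upper[of 1 f] f by auto
      \<comment> \<open>From \<open>4 f F \<ge> z\<^sup>2 D\<close>, the lower bound for
        \<open>D\<close> and the upper bound for \<open>f\<close>; division by \<open>4 f\<close>
        leaves \<open>\<epsilon> / (4 * C) * z ^ 4\<close>.\<close>
      define r where "r = sqrt (\<epsilon> / (4 * C))"
      have r: "r > 0" "r\<^sup>2 = \<epsilon> / (4 * C)" using e C by (auto simp: r_def)
      show ?thesis
      proof (rule dominates_squareI)
        show "hom3 2 (\<lambda>x y z. r * (z * z))" by (rule hom3_scale[OF hom3_mult_eq[OF hom3_vars(3) hom3_vars(3)]]) simp
        show "r * (1 * 1) \<noteq> 0" using r by simp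
        fix x y z
        show "(r * (z * z))\<^sup>2 \<le> F x y z"
        proof (cases "(y, z) = (0, 0)")
          case True
          thus ?thesis using nn by simp
        next
          case False
          hence fp: "f y z > 0" using pd by blast
          have "4 * f y z * F x y z = (2 * x * f y z - z * g1 y z)\<^sup>2 + z\<^sup>2 * D y z"
            by (simp add: F' D_def power2_eq_square algebra_simps)
          also have "\<dots> \<ge> z\<^sup>2 * D y z" by simp
          also have "z\<^sup>2 * D y z \<ge> z\<^sup>2 * (\<epsilon> * (y\<^sup>2 + z\<^sup>2)\<^sup>2)" by (intro mult_left_mono e) simp
          also have "z\<^sup>2 * (\<epsilon> * (y\<^sup>2 + z\<^sup>2)\<^sup>2) \<ge> z\<^sup>2 * (\<epsilon> * (f y z / C * z\<^sup>2))"
          proof -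
            have "f y z / C \<le> y\<^sup>2 + z\<^sup>2" using C by (simp add: divide_le_eq mult.commute)
            hence "f y z / C * z\<^sup>2 \<le> (y\<^sup>2 + z\<^sup>2) * (y\<^sup>2 + z\<^sup>2)" by (intro mult_mono) auto
            thus ?thesis using e by (intro mult_left_mono) (auto simp: power2_eq_square)
          qed
          also have "z\<^sup>2 * (\<epsilon> * (f y z / C * z\<^sup>2)) = 4 * f y z * (r * (z * z))\<^sup>2"
            using C unfolding power_mult_distrib r(2) by (simp add: field_simps)
          finally show ?thesis using fp by simp
        qed
      qed
    next
      assume "\<exists>b c. b\<^sup>2 + c\<^sup>2 = 1 \<and> D b c = 0"
      then obtain b c where bc: "b\<^sup>2 + c\<^sup>2 = 1" "D b c = 0" by blast
      have "(b, c) \<noteq> (0, 0)" using bc(1) by auto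
      hence fbc: "f b c > 0" using pd by blast
      \<comment> \<open>Chosen so that \<open>g' b c = 0\<close>; then \<open>D b c = 0\<close>
        forces \<open>h' b c = 0\<close> as well.\<close>
      define \<alpha> where "\<alpha> = g1 b c / (2 * f b c)"
      define g' where "g' = (\<lambda>y z. 2 * \<alpha> * f y z + (- 1) * g1 y z)"
      define h' where "h' = (\<lambda>y z. \<alpha>\<^sup>2 * f y z + (- \<alpha>) * g1 y z + h1 y z)"
      have g'2: "hom2 2 g'" unfolding g'_def by (intro hom2_add hom2_scale f g1(1))
      have h'2: "hom2 2 h'" unfolding h'_def by (intro hom2_add hom2_scale f g1(1) h1(1))
      have D': "D y z = 4 * (f y z * h' y z) - (g' y z)\<^sup>2" for y z
        by (simp add: D_def g'_def h'_def power2_eq_square algebra_simps)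
      have h'nn: "h' y z \<ge> 0" for y z
      proof (cases "(y, z) = (0, 0)")
        case True
        have "hom2 (Suc 1) h'" using h'2 by (simp add: numeral_2_eq_2)
        thus ?thesis using True hom2_zero[of 1 h'] by simp
      next
        case False
        hence fp: "f y z > 0" using pd by blast
        have "4 * (f y z * h' y z) = D y z + (g' y z)\<^sup>2" using D'[of y z] by simp
        also have "\<dots> \<ge> 0" using Dnn by simp
        finally show ?thesis using fp by (simp add: zero_le_mult_iff)
      qed
      have g'0: "g' b c = 0" using fbc by (simp add: g'_def \<alpha>_def)
      have h'0: "h' b c = 0" using D'[of b c] bc(2) g'0 fbc by simp
      obtain \<kappa> where k: "\<kappa> \<ge> 0" "\<And>y z. h' y z = \<kappa> * (c * y - b * z)\<^sup>2" using hom2_psd_quadratic[OF h'2 bc(1) h'0 h'nn] by blast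
      define F1 where "F1 = (\<lambda>x y z. F (x + \<alpha> * z) y z)"
      have F1: "F1 x y z = x\<^sup>2 * f y z + x * z * g' y z + z\<^sup>2 * h' y z" for x y z
        by (simp add: F1_def F' g'_def h'_def power2_eq_square algebra_simps)
      have "dominates_square F1"
      proof (cases "\<kappa> = 0")
        case True
        hence h0: "h' y z = 0" for y z using k by simp
        have g0: "g' y z = 0" for y z using Dnn[of y z] D'[of y z] h0[of y z] by simp
        obtain \<delta> where d: "\<delta> > 0" "\<And>y z. \<delta> * (y\<^sup>2 + z\<^sup>2) \<le> f y z" using hom2_lower[of 1 f] f pd by auto
        show ?thesis
        proof (rule dominates_squareI)
          show "hom3 2 (\<lambda>x y z. sqrt \<delta> * (x * z))" by (rule hom3_scale[OF hom3_mult_eq[OF hom3_vars(1) hom3_vars(3)]]) simp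
          show "sqrt \<delta> * (1 * 1) \<noteq> 0" using d by simp
          show "(sqrt \<delta> * (x * z))\<^sup>2 \<le> F1 x y z" for x y z
          proof -
            have "(sqrt \<delta> * (x * z))\<^sup>2 = x\<^sup>2 * (\<delta> * z\<^sup>2)" using d by (simp add: power_mult_distrib)
            also have "\<dots> \<le> x\<^sup>2 * f y z"
            proof (intro mult_left_mono)
              have "\<delta> * z\<^sup>2 \<le> \<delta> * (y\<^sup>2 + z\<^sup>2)" using d by (intro mult_left_mono) auto
              thus "\<delta> * z\<^sup>2 \<le> f y z" using d(2)[of y z] by simp
            qed simp
            finally show ?thesis by (simp add: F1 h0 g0)
          qed
        qed
      next
        case False
        hence kp: "\<kappa> > 0" using k by simp
        define s where "s = sqrt \<kappa>"
        have s: "s > 0" "s\<^sup>2 = \<kappa>" using kp by (auto simp: s_def)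
        have "hom2 (Suc 1) g'" using g'2 by (simp add: numeral_2_eq_2)
        from hom2_factor[OF this bc(1) g'0] obtain g2 where g2: "hom2 1 g2" "\<And>y z. g' y z = (c * y - b * z) * g2 y z" by blast
        have "hom2 2 (\<lambda>y z. 4 * \<kappa> * f y z + (- 1) * (g2 y z * g2 y z))"
          by (rule hom2_add[OF hom2_scale[OF f] hom2_scale[OF hom2_mult_eq[OF g2(1) g2(1)]]]) simp
        hence rest: "4 * \<kappa> * f y z + (- 1) * (g2 y z * g2 y z) \<ge> 0" for y z
        proof (rule hom2_nonneg_closure[OF _ bc(1)])
          fix y z assume n0: "c * y - b * z \<noteq> 0"
          have "(c * y - b * z)\<^sup>2 * (4 * \<kappa> * f y z + (- 1) * (g2 y z * g2 y z)) = D y z"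
            unfolding D' k(2) g2(2) by (simp add: power2_eq_square algebra_simps)
          thus "4 * \<kappa> * f y z + (- 1) * (g2 y z * g2 y z) \<ge> 0" using Dnn[of y z] n0 by (metis zero_le_mult_iff zero_less_power2 not_less)
        qed
        define q where "q = (\<lambda>x y z. z * (s * (c * y + (- b) * z)) + 1 / (2 * s) * (x * g2 y z))"
        have "hom3 2 (\<lambda>x y z. z * (s * (c * y + (- b) * z)))"
          by (rule hom3_mult_eq[OF hom3_vars(3) hom3_scale[OF hom3_of_hom2[OF hom2_linear]]]) simp
        moreover have "hom3 2 (\<lambda>x y z. x * g2 y z)" by (rule hom3_mult_eq[OF hom3_vars(1) hom3_of_hom2[OF g2(1)]]) simp
        ultimately have q2: "hom3 2 q" unfolding q_def by (intro hom3_add hom3_scale)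
        have "\<exists>y. q 0 y 1 \<noteq> 0"
        proof (cases "c = 0")
          case True
          hence "b \<noteq> 0" using bc(1) by auto
          thus ?thesis using True s by (intro exI[of _ 0]) (simp add: q_def)
        next
          case False
          \<comment> \<open>At this \<open>y\<close> the linear form \<open>c * y - b\<close> has
            the value 1.\<close>
          thus ?thesis using s by (intro exI[of _ "(b + 1) / c"]) (simp add: q_def)
        qed
        moreover have "(q x y z)\<^sup>2 \<le> F1 x y z" for x y z
        proof -
          have "4 * \<kappa> * (q x y z)\<^sup>2 = (2 * s * q x y z)\<^sup>2" by (simp add: power_mult_distrib s(2))
          also have "2 * s * q x y z = 2 * s\<^sup>2 * z * (c * y - b * z) + x * g2 y z"
            using s(1) by (simp add: q_def power2_eq_square field_simps)
          also have "(2 * s\<^sup>2 * z * (c * y - b * z) + x * g2 y z)\<^sup>2 =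
              4 * \<kappa> * (x * z * g' y z + z\<^sup>2 * h' y z) + x\<^sup>2 * (g2 y z * g2 y z)"
            unfolding s(2) k(2) g2(2) by (simp add: power2_eq_square algebra_simps)
          also have "\<dots> \<le> 4 * \<kappa> * (x * z * g' y z + z\<^sup>2 * h' y z) + x\<^sup>2 * (4 * \<kappa> * f y z)"
            using rest[of y z] by (intro add_left_mono mult_left_mono) auto
          also have "\<dots> = 4 * \<kappa> * F1 x y z" unfolding F1 by (simp add: algebra_simps)
          finally show ?thesis using kp by simp
        qed
        ultimately show ?thesis using dominates_squareI[OF q2] by blast
      qed
      thus ?thesis unfolding F1_def
        by (rule dominates_square_subst[where ?a1.0=1 and ?b1.0=0 and ?c1.0="- \<alpha>" and ?a2.0=0 and ?b2.0=1 and ?c2.0=0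
            and ?a3.0=0 and ?b3.0=0 and ?c3.0=1]) auto
    qed
  qed
qed

text \<open>Let \<open>f\<close> be definite. If the discriminant of \<open>F\<close> in
  \<open>x\<close> is positive, a multiple of \<open>f\<^sup>2\<close> lies below \<open>F\<close>.
  A zero \<open>(b, c)\<close> of it gives a second zero \<open>(u, b, c)\<close> of
  \<open>F\<close>, which a linear change fixing \<open>(1, 0, 0)\<close> moves to
  \<open>(0, 1, 0)\<close>.\<close>

lemma one_zero_case:
  assumes F4: "hom3 4 F" and nn: "\<And>x y z. F x y z \<ge> 0" and 0: "F 1 0 0 = 0" and nz: "F x0 y0 z0 \<noteq> 0"
  shows "dominates_square F"
proof -
  obtain f g h where f: "hom2 2 f" and g: "hom2 3 g" and h: "hom2 4 h"
    and F: "\<And>x y z. F x y z = x\<^sup>2 * f y z + x * g y z + h y z"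
    using ternary_normal_form[OF F4 nn 0] by blast
  have disc: "f y z \<ge> 0" "h y z \<ge> 0" "(g y z)\<^sup>2 \<le> 4 * f y z * h y z" for y z
    using quadratic_nonneg[of "f y z" "g y z" "h y z"] nn[of _ y z] unfolding F by (auto simp: mult.commute)
  have f': "hom2 (Suc 1) f" using f by (simp add: numeral_2_eq_2)
  from hom2_pos_or_zero[OF f' disc(1)] show ?thesis
  proof
    assume "\<exists>b c. b\<^sup>2 + c\<^sup>2 = 1 \<and> f b c = 0"
    then obtain b c where bc: "b\<^sup>2 + c\<^sup>2 = 1" "f b c = 0" by blast
    obtain \<kappa> where "\<kappa> \<ge> 0" "\<And>y z. f y z = \<kappa> * (c * y - b * z)\<^sup>2" using hom2_psd_quadratic[OF f bc disc(1)] by blast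
    thus ?thesis using singular_case[OF f g h F nn nz bc(1)] by blast
  next
    assume pd: "\<forall>y z. (y, z) \<noteq> (0, 0) \<longrightarrow> f y z > 0"
    define D where "D = (\<lambda>y z. 4 * (f y z * h y z) + (- 1) * (g y z * g y z))"
    have D6: "hom2 6 D"
      unfolding D_def by (rule hom2_add[OF hom2_scale[OF hom2_mult_eq[OF f h]] hom2_scale[OF hom2_mult_eq[OF g g]]]) simp_all
    have Dnn: "D y z \<ge> 0" for y z using disc(3)[of y z] by (simp add: D_def power2_eq_square)
    have D6': "hom2 (Suc 5) D" using D6 by simp
    from hom2_pos_or_zero[OF D6' Dnn] show ?thesis
    proof
      assume Dpos: "\<forall>y z. (y, z) \<noteq> (0, 0) \<longrightarrow> D y z > 0"
      obtain \<epsilon> where e: "\<epsilon> > 0" "\<And>y z. \<epsilon> * (y\<^sup>2 + z\<^sup>2) ^ 3 \<le> D y z" using hom2_lower[of 3 D] D6 Dpos by auto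
      obtain C where C: "C > 0" "\<And>y z. f y z \<le> C * (y\<^sup>2 + z\<^sup>2)" using hom2_upper[of 1 f] f by auto
      \<comment> \<open>Here \<open>4 f F \<ge> D \<ge> \<epsilon> (f / C) ^ 3\<close>, and division
        by \<open>4 f\<close> gives \<open>r\<^sup>2 f\<^sup>2\<close>.\<close>
      define r where "r = sqrt (\<epsilon> / (4 * C ^ 3))"
      have r: "r > 0" "r\<^sup>2 = \<epsilon> / (4 * C ^ 3)" using e C by (auto simp: r_def)
      show ?thesis
      proof (rule dominates_squareI)
        show "hom3 2 (\<lambda>x y z. r * f y z)" by (rule hom3_scale[OF hom3_of_hom2[OF f]])
        show "r * f 1 0 \<noteq> 0" using r pd by (simp add: less_imp_neq[THEN not_sym])
        fix x y z
        show "(r * f y z)\<^sup>2 \<le> F x y z"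
        proof (cases "(y, z) = (0, 0)")
          case True
          thus ?thesis using nn hom2_zero[OF f'] by simp
        next
          case False
          hence fp: "f y z > 0" using pd by blast
          have "4 * f y z * F x y z = (2 * x * f y z + g y z)\<^sup>2 + D y z"
            by (simp add: F D_def power2_eq_square algebra_simps)
          also have "\<dots> \<ge> D y z" by simp
          also have "D y z \<ge> \<epsilon> * (y\<^sup>2 + z\<^sup>2) ^ 3" by (rule e)
          also have "\<epsilon> * (y\<^sup>2 + z\<^sup>2) ^ 3 \<ge> \<epsilon> * (f y z / C) ^ 3"
          proof -
            have "f y z / C \<le> y\<^sup>2 + z\<^sup>2" using C by (simp add: divide_le_eq mult.commute)
            thus ?thesis using e C fp by (intro mult_left_mono power_mono) auto
          qed
          also have "\<epsilon> * (f y z / C) ^ 3 = 4 * f y z * (r * f y z)\<^sup>2"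
            using C unfolding power_mult_distrib r(2) by (simp add: power_divide power2_eq_square power3_eq_cube mult_ac)
          finally show ?thesis using fp by simp
        qed
      qed
    next
      assume "\<exists>b c. b\<^sup>2 + c\<^sup>2 = 1 \<and> D b c = 0"
      then obtain b c where bc: "b\<^sup>2 + c\<^sup>2 = 1" "D b c = 0" by blast
      have "(b, c) \<noteq> (0, 0)" using bc(1) by auto
      hence fbc: "f b c > 0" using pd by blast
      \<comment> \<open>The double root of the quadratic polynomial \<open>F x b c\<close> in
        \<open>x\<close>.\<close>
      define u where "u = - g b c / (2 * f b c)"
      define F1 where "F1 = (\<lambda>x y z. F (1 * x + u * y + 0 * z) (0 * x + b * y + (- c) * z) (0 * x + c * y + b * z))"
      have Fu: "F u b c = 0"
      proof -
        have "4 * f b c * F u b c = (2 * u * f b c + g b c)\<^sup>2 + D b c"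
          by (simp add: F D_def power2_eq_square algebra_simps)
        also have "2 * u * f b c + g b c = 0" using fbc by (simp add: u_def)
        finally show ?thesis using bc(2) fbc by simp
      qed
      have cb: "b * b + c * c = 1" using bc(1) by (simp add: power2_eq_square)
      have inv: "b * (b * y + c * z) - c * (b * z - c * y) = y" "c * (b * y + c * z) + b * (b * z - c * y) = z"
        "b * (b * y - c * z) + c * (c * y + b * z) = y" "b * (c * y + b * z) - c * (b * y - c * z) = z" for y z
      proof -
        have "b * (b * y + c * z) - c * (b * z - c * y) = (b * b + c * c) * y"
          "c * (b * y + c * z) + b * (b * z - c * y) = (b * b + c * c) * z"
          "b * (b * y - c * z) + c * (c * y + b * z) = (b * b + c * c) * y"
          "b * (c * y + b * z) - c * (b * y - c * z) = (b * b + c * c) * z" by (simp_all add: algebra_simps)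
        thus "b * (b * y + c * z) - c * (b * z - c * y) = y" "c * (b * y + c * z) + b * (b * z - c * y) = z"
        "b * (b * y - c * z) + c * (c * y + b * z) = y" "b * (c * y + b * z) - c * (b * y - c * z) = z"
          unfolding cb by simp_all
      qed
      have "dominates_square F1"
      proof (rule two_zeros_case)
        show "hom3 4 F1" unfolding F1_def by (rule hom3_subst[OF F4])
        show "F1 x y z \<ge> 0" for x y z unfolding F1_def by (rule nn)
        show "F1 1 0 0 = 0" "F1 0 1 0 = 0" using 0 Fu by (simp_all add: F1_def)
        show "F1 (x0 - u * (b * y0 + c * z0)) (b * y0 + c * z0) (b * z0 - c * y0) \<noteq> 0"
          using nz inv(1,2)[of y0 z0] by (simp add: F1_def)
      qed
      moreover have "y * (b * (b * u)) + y * (c * (c * u)) = y * u" for y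
        using cb by (metis distrib_left mult.assoc mult.commute mult_1)
      ultimately show ?thesis unfolding F1_def
        by (elim dominates_square_subst[where ?a1.0=1 and ?b1.0="- u * b" and ?c1.0="- u * c" and ?a2.0=0 and ?b2.0=b and ?c2.0=c
            and ?a3.0=0 and ?b3.0="- c" and ?c3.0=b])
          (use inv in \<open>simp_all add: algebra_simps\<close>)
    qed
  qed
qed

text \<open>A zero is moved to \<open>(1, 0, 0)\<close> by a substitution chosen according to one of
  its nonzero coordinates. Without zeros, the minimum on the sphere gives a multiple of
  \<open>(x\<^sup>2 + y\<^sup>2 + z\<^sup>2)\<^sup>2\<close> below \<open>F\<close>.\<close>

lemma ternary_dominates:
  assumes F4: "hom3 4 F" and nn: "\<And>x y z. F x y z \<ge> 0" and nz: "F x0 y0 z0 \<noteq> 0"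
  shows "dominates_square F"
proof (cases "\<exists>a b c. (a, b, c) \<noteq> (0, 0, 0) \<and> F a b c = 0")
  case True
  then obtain a b c where abc: "(a, b, c) \<noteq> (0, 0, 0)" "F a b c = 0" by blast
  consider "a \<noteq> 0" | "b \<noteq> 0" | "c \<noteq> 0" using abc(1) by auto
  thus ?thesis
  proof cases
    case 1
    let ?F = "\<lambda>x y z. F (a * x + 0 * y + 0 * z) (b * x + 1 * y + 0 * z) (c * x + 0 * y + 1 * z)"
    have "dominates_square ?F"
    proof (rule one_zero_case[of _ "x0 / a" "y0 - b * x0 / a" "z0 - c * x0 / a"])
      show "hom3 4 ?F" by (rule hom3_subst[OF F4])
    qed (use nn nz abc(2) 1 in simp_all)
    thus ?thesis
      by (rule dominates_square_subst[where ?a1.0="1 / a" and ?b1.0=0 and ?c1.0=0 and ?a2.0="- b / a" and ?b2.0=1 and ?c2.0=0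
          and ?a3.0="- c / a" and ?b3.0=0 and ?c3.0=1])
        (use 1 in \<open>simp_all add: field_simps\<close>)
  next
    case 2
    let ?F = "\<lambda>x y z. F (a * x + 1 * y + 0 * z) (b * x + 0 * y + 0 * z) (c * x + 0 * y + 1 * z)"
    have "dominates_square ?F"
    proof (rule one_zero_case[of _ "y0 / b" "x0 - a * y0 / b" "z0 - c * y0 / b"])
      show "hom3 4 ?F" by (rule hom3_subst[OF F4])
    qed (use nn nz abc(2) 2 in simp_all)
    thus ?thesis
      by (rule dominates_square_subst[where ?a1.0=0 and ?b1.0="1 / b" and ?c1.0=0 and ?a2.0=1 and ?b2.0="- a / b" and ?c2.0=0
          and ?a3.0=0 and ?b3.0="- c / b" and ?c3.0=1])
        (use 2 in \<open>simp_all add: field_simps\<close>)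
  next
    case 3
    let ?F = "\<lambda>x y z. F (a * x + 1 * y + 0 * z) (b * x + 0 * y + 1 * z) (c * x + 0 * y + 0 * z)"
    have "dominates_square ?F"
    proof (rule one_zero_case[of _ "z0 / c" "x0 - a * z0 / c" "y0 - b * z0 / c"])
      show "hom3 4 ?F" by (rule hom3_subst[OF F4])
    qed (use nn nz abc(2) 3 in simp_all)
    thus ?thesis
      by (rule dominates_square_subst[where ?a1.0=0 and ?b1.0=0 and ?c1.0="1 / c" and ?a2.0=1 and ?b2.0=0 and ?c2.0="- a / c"
          and ?a3.0=0 and ?b3.0=1 and ?c3.0="- b / c"])
        (use 3 in \<open>simp_all add: field_simps\<close>)
  qed
next
  case False
  have cont: "continuous_on S (\<lambda>p. g (\<lambda>i::nat. if i = 0 then fst p else if i = 1 then fst (snd p) else snd (snd p)))"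
    if "polyfun g" for g and S :: "(real \<times> real \<times> real) set"
    using that
  proof induction
    case (polyfun_var i)
    consider "i = 0" | "i = 1" | "i \<noteq> 0" "i \<noteq> 1" by blast
    thus ?case by cases (auto intro!: continuous_intros)
  qed (auto intro!: continuous_intros)
  let ?S = "sphere (0 :: real \<times> real \<times> real) 1"
  have "continuous_on ?S (\<lambda>p. F (fst p) (fst (snd p)) (snd (snd p)))"
    using cont[OF hom3_polyfun[OF F4], of ?S] by simp
  hence "\<exists>p\<in>?S. \<forall>p'\<in>?S. F (fst p) (fst (snd p)) (snd (snd p)) \<le> F (fst p') (fst (snd p')) (snd (snd p'))"
    by (intro continuous_attains_inf) auto
  then obtain a b c where abc: "(a, b, c) \<in> ?S" "\<And>x y z. (x, y, z) \<in> ?S \<Longrightarrow> F a b c \<le> F x y z" by force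
  have "(a, b, c) \<noteq> (0, 0, 0)"
  proof
    assume "(a, b, c) = (0, 0, 0)"
    thus False using abc(1) by (simp add: norm_Pair)
  qed
  hence pos: "F a b c > 0" using False nn[of a b c] by (metis order_le_less)
  have low: "F a b c * (x\<^sup>2 + y\<^sup>2 + z\<^sup>2)\<^sup>2 \<le> F x y z" for x y z
  proof -
    define r where "r = sqrt (x\<^sup>2 + y\<^sup>2 + z\<^sup>2)"
    have r2: "r\<^sup>2 = x\<^sup>2 + y\<^sup>2 + z\<^sup>2" by (simp add: r_def)
    show ?thesis
    proof (cases "r = 0")
      case True
      thus ?thesis using nn[of x y z] r2 by simp
    next
      case False
      have "(x / r)\<^sup>2 + ((y / r)\<^sup>2 + (z / r)\<^sup>2) = 1"
        using False unfolding power_divide add_divide_distrib[symmetric] add.assoc[symmetric] r2[symmetric] by simp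
      hence "(x / r, y / r, z / r) \<in> ?S" by (simp add: norm_Pair abs_divide[symmetric] del: abs_divide)
      hence "r ^ 4 * F a b c \<le> r ^ 4 * F (x / r) (y / r) (z / r)" by (intro mult_left_mono abc(2)) auto
      also have "\<dots> = F x y z" using hom3_homogeneous[OF F4, of r "x / r" "y / r" "z / r"] False by simp
      finally show ?thesis unfolding r2[symmetric] by (simp add: mult.commute)
    qed
  qed
  show ?thesis
  proof (rule dominates_squareI)
    show "hom3 2 (\<lambda>x y z. sqrt (F a b c) * (x * x + y * y + z * z))"
      by (intro hom3_scale hom3_add hom3_mult_eq[OF hom3_vars(1) hom3_vars(1)] hom3_mult_eq[OF hom3_vars(2) hom3_vars(2)]
          hom3_mult_eq[OF hom3_vars(3) hom3_vars(3)]) simp_all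
    show "sqrt (F a b c) * (1 * 1 + 0 * 0 + 0 * 0) \<noteq> 0" using pos by simp
    show "(sqrt (F a b c) * (x * x + y * y + z * z))\<^sup>2 \<le> F x y z" for x y z
      using low[of x y z, unfolded power2_eq_square[of x] power2_eq_square[of y] power2_eq_square[of z]] pos
      by (simp add: power_mult_distrib)
  qed
qed

text \<open>The Gram vectors of a sum of squares of ternary quadratic forms are recorded by the values of these forms at six
  points, namely the unit vectors and their pairwise sums. The bounds needed for compactness are then immediate.\<close>

definition node :: "nat \<Rightarrow> nat \<Rightarrow> real" where
  "node s i = (if s < 3 then of_bool (i = s) else of_bool (i \<noteq> s - 3))"

text \<open>The Lagrange basis of the ternary quadratic forms for the points
  \<open>node s\<close>.\<close>

definition nodal :: "nat \<Rightarrow> (nat \<Rightarrow> real) \<Rightarrow> real" where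
  "nodal s z = (if s = 0 then z 0 * (z 0 - z 1 - z 2) else if s = 1 then z 1 * (z 1 - z 0 - z 2)
    else if s = 2 then z 2 * (z 2 - z 0 - z 1) else if s = 3 then z 1 * z 2 else if s = 4 then z 0 * z 2 else z 0 * z 1)"

lemma sum_lessThan_6: "(\<Sum>s<6. g s) = g 0 + g 1 + g 2 + g 3 + g 4 + g (5 :: nat)" for g :: "nat \<Rightarrow> real"
  by (simp add: eval_nat_numeral)

lemma ternary_quadratic_interpolation:
  assumes q: "q \<in> hom_fun 3 2" shows "q z = (\<Sum>s<6. q (node s) * nodal s z)"
proof -
  have "q \<in> hom_fun 3 (Suc (Suc 0))" using q by (simp add: numeral_2_eq_2)
  then obtain G where G: "\<And>i. i < 3 \<Longrightarrow> G i \<in> hom_fun 3 (Suc 0)" "q = (\<lambda>z. \<Sum>i<3. z i * G i z)"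
    unfolding hom_fun.simps(2)[of 3 "Suc 0"] by blast
  have "\<exists>c. G i = (\<lambda>z. \<Sum>j<3. z j * c j)" if i: "i < 3" for i
  proof -
    from G(1)[OF i] obtain F where F: "\<forall>j<3. F j \<in> hom_fun 3 0" "G i = (\<lambda>z. \<Sum>j<3. z j * F j z)" by auto
    hence "\<forall>j<3. \<exists>c. F j = (\<lambda>_. c)" by simp
    then obtain c where "\<And>j. j < 3 \<Longrightarrow> F j = (\<lambda>_. c j)" by metis
    hence "G i = (\<lambda>z. \<Sum>j<3. z j * c j)" unfolding F(2) by (intro ext sum.cong) auto
    thus ?thesis by blast
  qed
  then obtain C where "\<And>i. i < 3 \<Longrightarrow> G i = (\<lambda>z. \<Sum>j<3. z j * C i j)" by metis
  hence q': "q v = (\<Sum>i<3. v i * (\<Sum>j<3. v j * C i j))" for v unfolding G(2) by (intro sum.cong) auto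
  have s3: "(\<Sum>i<3. g i) = g 0 + g 1 + g (2 :: nat)" for g :: "nat \<Rightarrow> real" by (simp add: eval_nat_numeral)
  show ?thesis unfolding sum_lessThan_6 q' s3 by (simp add: node_def nodal_def algebra_simps)
qed

lemma nodal_hom_fun: "nodal s \<in> hom_fun 3 2"
proof -
  have v: "(\<lambda>z. z 0) \<in> hom_fun 3 1" "(\<lambda>z. z 1) \<in> hom_fun 3 1" "(\<lambda>z. z 2) \<in> hom_fun 3 1" by (intro hom_fun_var; simp)+
  have m: "(\<lambda>z. f z * g z) \<in> hom_fun 3 2" if "f \<in> hom_fun 3 1" "g \<in> hom_fun 3 1" for f g
    using hom_fun_mult[OF that] by (simp only: one_add_one)
  have F: "(\<lambda>z. z 0 * (z 0 - z 1 - z 2)) \<in> hom_fun 3 2" "(\<lambda>z. z 1 * (z 1 - z 0 - z 2)) \<in> hom_fun 3 2"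
    "(\<lambda>z. z 2 * (z 2 - z 0 - z 1)) \<in> hom_fun 3 2" "(\<lambda>z. z 1 * z 2) \<in> hom_fun 3 2" "(\<lambda>z. z 0 * z 2) \<in> hom_fun 3 2"
    "(\<lambda>z. z 0 * z 1) \<in> hom_fun 3 2" by (intro m hom_fun_diff v)+
  consider "s = 0" | "s = 1" | "s = 2" | "s = 3" | "s = 4" | "s \<noteq> 0" "s \<noteq> 1" "s \<noteq> 2" "s \<noteq> 3" "s \<noteq> 4" by blast
  thus ?thesis by cases (use F in \<open>simp_all add: nodal_def[abs_def] del: hom_fun.simps\<close>)
qed

lemma nodal_node: "s < 6 \<Longrightarrow> t < 6 \<Longrightarrow> nodal s (node t) = of_bool (s = t)"
proof -
  assume "s < 6" "t < 6"
  hence "s = 0 \<or> s = 1 \<or> s = 2 \<or> s = 3 \<or> s = 4 \<or> s = 5" "t = 0 \<or> t = 1 \<or> t = 2 \<or> t = 3 \<or> t = 4 \<or> t = 5" by linarith+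
  thus ?thesis by (elim disjE) (simp_all add: nodal_def node_def)
qed

definition nodal_sum :: "(nat \<Rightarrow> real) \<Rightarrow> (nat \<Rightarrow> real) \<Rightarrow> real" where
  "nodal_sum c z = (\<Sum>s<6. c s * nodal s z)"

lemma nodal_sum_hom_fun: "nodal_sum c \<in> hom_fun 3 2"
  unfolding nodal_sum_def[abs_def] by (intro hom_fun_sum hom_fun_scale nodal_hom_fun)

lemma nodal_sum_node: "t < 6 \<Longrightarrow> nodal_sum c (node t) = c t"
  unfolding nodal_sum_def by (simp add: nodal_node of_bool_def if_distrib sum.delta cong: if_cong)

text \<open>Six squares suffice because the space of ternary quadratic forms has dimension six: a
  seventh is absorbed by a new choice of Gram vectors. So a maximal sum of six squares below
  \<open>f\<close> leaves no nonzero remainder, as this would dominate a further square.\<close>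

theorem ternary_quartics_sos:
  assumes f: "f \<in> hom_fun 3 4" and nn: "\<And>z. f z \<ge> 0" shows "sos_fun 3 2 f"
proof -
  \<comment> \<open>Row \<open>r\<close> of \<open>B\<close> holds the values at the nodes of the
    form number \<open>r\<close>.\<close>
  define S where "S = {B :: nat \<Rightarrow> nat \<Rightarrow> real. \<forall>z. (\<Sum>r<6. (nodal_sum (B r) z)\<^sup>2) \<le> f z}"
  \<comment> \<open>The values of the sum of squares, added up over the nodes; any further nonzero
    square increases it strictly.\<close>
  define L where "L = (\<lambda>B :: nat \<Rightarrow> nat \<Rightarrow> real. \<Sum>s<6. \<Sum>r<6. (B r s)\<^sup>2)"
  define M where "M = (\<Sum>s<6. f (node s))"
  have bound: "L B \<le> M" if "B \<in> S" for B
  proof -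
    have "(\<Sum>r<6. (B r s)\<^sup>2) \<le> f (node s)" if "s < 6" for s
      using \<open>B \<in> S\<close> that unfolding S_def by (auto simp: nodal_sum_node dest!: spec[of _ "node s"])
    thus ?thesis unfolding L_def M_def by (intro sum_mono) auto
  qed
  have entry: "\<bar>B r s\<bar> \<le> sqrt M" if "B \<in> S" "r < 6" "s < 6" for B r s
  proof -
    have "(B r s)\<^sup>2 \<le> (\<Sum>r<6. (B r s)\<^sup>2)" by (rule member_le_sum) (use that in auto)
    also have "\<dots> \<le> L B" unfolding L_def
      by (rule member_le_sum[where f="\<lambda>s. \<Sum>r<6. (B r s)\<^sup>2"]) (use that in \<open>auto intro: sum_nonneg\<close>)
    also have "\<dots> \<le> M" using bound that by blast
    finally show ?thesis by (simp add: real_le_rsqrt)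
  qed
  have "(\<lambda>_ _. 0) \<in> S" using nn by (simp add: S_def nodal_sum_def)
  hence ne: "S \<noteq> {}" by blast
  have bdd: "bdd_above (L ` S)" using bound by (intro bdd_aboveI[of _ M]) auto
  define \<Lambda> where "\<Lambda> = Sup (L ` S)"
  have "\<exists>B\<in>S. \<Lambda> - 1 / Suc k < L B" for k
  proof -
    have "\<exists>x\<in>L ` S. \<Lambda> - 1 / Suc k < x" unfolding \<Lambda>_def
      by (rule less_cSupD) (use ne in auto)
    thus ?thesis by blast
  qed
  then obtain Bs where Bs: "\<And>k. Bs k \<in> S" "\<And>k. \<Lambda> - 1 / Suc k < L (Bs k)" by metis
  have "\<bar>Bs k (fst i) (snd i)\<bar> \<le> sqrt M" if "i \<in> {..<6} \<times> {..<6}" for i k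
    using entry[OF Bs(1)] that by auto
  moreover have "finite ({..<6} \<times> {..<6} :: (nat \<times> nat) set)" by simp
  ultimately obtain \<rho> l where
    \<rho>: "strict_mono (\<rho> :: nat \<Rightarrow> nat)" "\<forall>i\<in>{..<6} \<times> {..<6}. (\<lambda>k. Bs (\<rho> k) (fst i) (snd i)) \<longlonglongrightarrow> l i"
    using finite_family_subseq[of "{..<6} \<times> {..<6}" "\<lambda>i k. Bs k (fst i) (snd i)"] by metis
  define B where "B = (\<lambda>r s. l (r, s))"
  have lim: "(\<lambda>k. Bs (\<rho> k) r s) \<longlonglongrightarrow> B r s" if "r < 6" "s < 6" for r s
    using \<rho>(2) that unfolding B_def by force
  have BS: "B \<in> S"
  proof -
    have "(\<Sum>r<6. (nodal_sum (B r) z)\<^sup>2) \<le> f z" for z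
    proof (rule LIMSEQ_le_const2)
      show "(\<lambda>k. \<Sum>r<6. (nodal_sum (Bs (\<rho> k) r) z)\<^sup>2) \<longlonglongrightarrow> (\<Sum>r<6. (nodal_sum (B r) z)\<^sup>2)"
        unfolding nodal_sum_def by (intro tendsto_sum tendsto_power tendsto_mult tendsto_const lim) auto
      show "\<exists>N. \<forall>k\<ge>N. (\<Sum>r<6. (nodal_sum (Bs (\<rho> k) r) z)\<^sup>2) \<le> f z" using Bs(1) by (auto simp: S_def)
    qed
    thus ?thesis by (simp add: S_def)
  qed
  have "\<Lambda> \<le> L B"
  proof (rule LIMSEQ_le)
    show "(\<lambda>k. L (Bs (\<rho> k))) \<longlonglongrightarrow> L B"
      unfolding L_def by (intro tendsto_sum tendsto_power lim) auto
    have "(\<lambda>k. \<Lambda> - 1 / real (Suc k)) \<longlonglongrightarrow> \<Lambda> - 0" by (intro tendsto_intros lim_inverse_n' LIMSEQ_Suc) 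
    from LIMSEQ_subseq_LIMSEQ[OF this \<rho>(1)] show "(\<lambda>k. \<Lambda> - 1 / real (Suc (\<rho> k))) \<longlonglongrightarrow> \<Lambda>" by (simp add: comp_def)
    show "\<exists>N. \<forall>k\<ge>N. \<Lambda> - 1 / real (Suc (\<rho> k)) \<le> L (Bs (\<rho> k))" using Bs(2) by (auto intro: less_imp_le)
  qed
  hence max: "L B' \<le> L B" if "B' \<in> S" for B' using cSup_upper[OF _ bdd, of "L B'"] that unfolding \<Lambda>_def by fastforce
  define h where "h = (\<lambda>z. f z - (\<Sum>r<6. (nodal_sum (B r) z)\<^sup>2))"
  have "h z = 0" for z
  proof (rule ccontr)
    assume hz: "h z \<noteq> 0"
    have sq: "(\<lambda>z. (nodal_sum (B r) z)\<^sup>2) \<in> hom_fun 3 4" for r using hom_fun_power[OF nodal_sum_hom_fun[of "B r"], of 2] by simp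
    hence h4: "h \<in> hom_fun 3 4" unfolding h_def by (intro hom_fun_diff f hom_fun_sum)
    let ?v = "\<lambda>x y z i. if i = (0::nat) then x else if i = 1 then y else (z::real)"
    have hnn: "h z \<ge> 0" for z using BS by (simp add: h_def S_def)
    have "h (?v (z 0) (z 1) (z 2)) \<noteq> 0" using hz hom_fun3_curry[OF h4, of z] by simp
    from ternary_dominates[OF hom_fun3_hom3[OF h4] hnn this] obtain q x0 y0 z0 where
      q: "hom3 2 q" "q x0 y0 z0 \<noteq> 0" "\<And>x y z. (q x y z)\<^sup>2 \<le> h (?v x y z)" unfolding dominates_square_def by blast
    define p where "p = (\<lambda>v :: nat \<Rightarrow> real. q (v 0) (v 1) (v 2))"
    define c where "c = (\<lambda>s. p (node s))"
    have p: "p v = nodal_sum c v" for v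
      using ternary_quadratic_interpolation[of p v] q(1) by (simp add: hom3_def p_def c_def nodal_sum_def)
    have ph: "(p v)\<^sup>2 \<le> h v" for v using q(3)[of "v 0" "v 1" "v 2"] hom_fun3_curry[OF h4, of v] by (simp add: p_def)
    have "p (?v x0 y0 z0) \<noteq> 0" using q(2) by (simp add: p_def)
    hence "\<exists>s<6. c s \<noteq> 0" unfolding p nodal_sum_def by (metis (no_types, lifting) lessThan_iff mult_zero_left sum.neutral)
    then obtain s0 where s0: "s0 < 6" "c s0 \<noteq> 0" by blast
    \<comment> \<open>Seven vectors in six dimensions: their matrix \<open>A\<close> has size six,
      so \<open>gram\<close> returns six vectors with the same sum of squares.\<close>
    define w where "w = (\<lambda>j. if j < 6 then B j else c)"
    define A where "A = (\<lambda>a b. \<Sum>j<7::nat. w j a * w j b)"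
    have s7: "(\<Sum>j<7. g j) = (\<Sum>j<6. g j) + g (6 :: nat)" for g :: "nat \<Rightarrow> real" by (simp add: eval_nat_numeral)
    have qA: "quad_form {..<6} A v = (\<Sum>j<7. (\<Sum>a<6. w j a * v a)\<^sup>2)" for v
      by (rule gram_quad_form) (simp add: A_def)
    have "psd_on {..<6} A" unfolding psd_on_def qA by (simp add: sum_nonneg)
    hence "\<exists>u. \<forall>a\<in>{..<6}. \<forall>b\<in>{..<6}. A a b = (\<Sum>j\<in>{..<6::nat}. u j a * u j b)"
      by (intro gram) (simp_all add: A_def mult.commute)
    then obtain u where u: "\<And>a b. a < 6 \<Longrightarrow> b < 6 \<Longrightarrow> A a b = (\<Sum>j<6::nat. u j a * u j b)" by (elim exE) simp
    have qu: "quad_form {..<6} A v = (\<Sum>j<6. (\<Sum>a<6. u j a * v a)\<^sup>2)" for v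
      by (rule gram_quad_form) (simp add: u)
    have "(\<Sum>j<6. (nodal_sum (u j) z)\<^sup>2) = (\<Sum>j<6. (nodal_sum (B j) z)\<^sup>2) + (p z)\<^sup>2" for z
    proof -
      have "(\<Sum>j<6. (nodal_sum (u j) z)\<^sup>2) = (\<Sum>j<7. (nodal_sum (w j) z)\<^sup>2)"
        using qu[of "\<lambda>s. nodal s z"] unfolding qA nodal_sum_def by simp
      thus ?thesis unfolding s7 p by (simp add: w_def)
    qed
    hence "u \<in> S" using ph by (simp add: S_def h_def algebra_simps)
    hence "L u \<le> L B" by (rule max)
    moreover have "L u = L B + (\<Sum>s<6. (c s)\<^sup>2)"
    proof -
      have "(\<Sum>r<6. (u r s)\<^sup>2) = (\<Sum>r<6. (B r s)\<^sup>2) + (c s)\<^sup>2" if "s < 6" for s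
        using u[OF that that] unfolding A_def s7 by (simp add: w_def power2_eq_square)
      thus ?thesis unfolding L_def by (simp add: sum.distrib[symmetric])
    qed
    moreover have "(\<Sum>s<6. (c s)\<^sup>2) > 0" by (rule sum_pos2[of _ s0]) (use s0 in auto)
    ultimately show False by simp
  qed
  hence "f = (\<lambda>z. \<Sum>r<6. (nodal_sum (B r) z)\<^sup>2)" unfolding h_def by (intro ext) simp
  moreover have "sos_fun 3 2 (\<lambda>z. \<Sum>r<6. (nodal_sum (B r) z)\<^sup>2)" by (intro sos_fun_sum sos_fun_square nodal_sum_hom_fun)
  ultimately show ?thesis by (simp only:)
qed

theorem corollary4p25:
  fixes n d :: nat
  assumes "n \<ge> 1" and "d \<ge> 1"
  shows "(spectrahedral_shadow (forms n (2 * d)) (psd_forms n (2 * d)) \<longrightarrow>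
            psd_forms n (2 * d) = sos_forms n (2 * d)) \<and>
         (psd_forms n (2 * d) = sos_forms n (2 * d) \<longleftrightarrow>
            2 * d = 2 \<or> n \<le> 2 \<or> (n, 2 * d) = (3, 4))"
proof (cases "d = 1 \<or> n \<le> 2 \<or> (n = 3 \<and> d = 2)")
  case True
  have "p \<in> sos_forms n (2 * d)" if "p \<in> psd_forms n (2 * d)" for p
  proof -
    have p: "p \<in> forms n (2 * d)" and nn: "\<And>z. 0 \<le> ev p z"
      using that by (simp_all add: psd_forms_iff)
    have ev: "ev p \<in> hom_fun n (2 * d)" using p by (rule ev_form_hom_fun)
    consider "d = 1" | "n = 1" | "n = 2" | "n = 3" "d = 2" using True assms by linarith
    hence "sos_fun n d (ev p)"
    proof cases
      case 1
      thus ?thesis using quadratic_sos_fun[of "ev p" n] ev nn by (simp del: hom_fun.simps)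
    next
      case 2
      thus ?thesis using hom_fun1_sos_fun[of "ev p" d] ev nn by (simp del: hom_fun.simps)
    next
      case 3
      thus ?thesis using hom_fun2_sos_fun[of "ev p" d] ev nn by (simp del: hom_fun.simps)
    next
      case 4
      thus ?thesis using ternary_quartics_sos[of "ev p"] ev nn by (simp del: hom_fun.simps)
    qed
    thus ?thesis using p by (intro sos_forms_I)
  qed
  hence "psd_forms n (2 * d) = sos_forms n (2 * d)" using sos_subset_psd by blast
  thus ?thesis using True by auto
next
  case False
  hence "(n \<ge> 3 \<and> d \<ge> 3) \<or> (n \<ge> 4 \<and> d \<ge> 2)" using assms by linarith
  \<comment> \<open>Here the implication holds because its hypothesis fails.\<close>
  from non_hilbert[OF this] show ?thesis using False by auto
qed

end
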